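(* Let $M$ be a closed connected smooth $n$-dimensional manifold and let $\xi\in H^1(M;\mathbf R)$ be nonzero. Then $\mathrm{ccat}(M,\xi)\le n-1$.
   Context: Closed 1-forms. A continuous closed 1-form $\omega$ on a topological space $X$ is given by a family of continuous functions $f_U:U\to\mathbf R$, indexed by the members of an open cover of $X$, such that $f_U-f_V$ is locally constant on $U\cap V$ for all $U,V$; two families define the same closed 1-form if their union is again such a family. For a path $\gamma:[0,1]\to X$ set $\int_\gamma\omega=\sum_i\left(f_{U_i}(\gamma(t_{i+1}))-f_{U_i}(\gamma(t_i))\right)$, where $0=t_0<\dots<t_m=1$ and $\gamma([t_i,t_{i+1}])\subset U_i$. Integration over loops defines the class $[\omega]\in H^1(X;\mathbf R)$ represented by $\omega$; on a finite cell complex every class is represented. Definition of $\mathrm{ccat}(X,\xi)$, for $X$ a finite cell complex (e.g. a closed smooth manifold) and $\xi\in H^1(X;\mathbf R)$. Fix a continuous closed 1-form $\omega$ representing $\xi$. For real numbers $N,C$, a subset $A\subset X$ is $N$-movable with respect to $\omega$ with control $C$ if there is a continuous homotopy $h_t:A\to X$, $t\in[0,1]$, such that (1) $h_0$ is the inclusion; (2) $\int_x^{h_1(x)}\omega<-N$ for every $x\in A$; (3) $\int_x^{h_t(x)}\omega\le C$ for every $x\in A$ and $t\in[0,1]$; the integrals are along the path $\tau\mapsto h_\tau(x)$. $\mathrm{ccat}(X,\xi)$ is the minimal integer $k\ge0$ for which there exists $C>0$ such that for every $N>0$ there is an open cover $X=F\cup F_1\cup\dots\cup F_k$ with each inclusion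 $F_j\to X$ null-homotopic and with $F$ $N$-movable with control $C$ with respect to $\omega$. It does not depend on the choice of $\omega$ in the class $\xi$. *)

theory Defs
  imports
    "HOL-Analysis.Analysis"
    "HOL-Homology.Homology"
    "HOL-Library.Extended_Nat"
begin

section \<open>Closed smooth manifolds\<close>

text \<open>\<open>k\<close>-fold continuous differentiability, meant for open sets \<open>S\<close>: all iterated directional
  derivatives of order at most \<open>k\<close> exist as total derivatives and are continuous.\<close>

primrec times_cont_differentiable_on ::
  "nat \<Rightarrow> ('a::real_normed_vector \<Rightarrow> 'b::real_normed_vector) \<Rightarrow> 'a set \<Rightarrow> bool"
where
  "times_cont_differentiable_on 0 f S \<longleftrightarrow> continuous_on S f"
| "times_cont_differentiable_on (Suc k) f S \<longleftrightarrow>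
     (\<forall>x\<in>S. f differentiable (at x)) \<and>
     (\<forall>v. times_cont_differentiable_on k (\<lambda>x. frechet_derivative f (at x) v) S)"

definition smooth_on :: "('a::real_normed_vector \<Rightarrow> 'b::real_normed_vector) \<Rightarrow> 'a set \<Rightarrow> bool"
  where "smooth_on f S \<longleftrightarrow> (\<forall>k. times_cont_differentiable_on k f S)"

text \<open>Charts are pairs of a domain and a map. The dimension of the manifold is that of the model
  space \<open>'e\<close>.\<close>

definition smooth_atlas :: "'a topology \<Rightarrow> ('a set \<times> ('a \<Rightarrow> 'e::euclidean_space)) set \<Rightarrow> bool"
  where "smooth_atlas M \<A> \<longleftrightarrow>
    (\<forall>(U, \<phi>)\<in>\<A>. openin M U \<and> open (\<phi> ` U) \<and>
       homeomorphic_map (subtopology M U) (top_of_set (\<phi> ` U)) \<phi>) \<and>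
    (\<Union>(U, \<phi>)\<in>\<A>. U) = topspace M \<and>
    (\<forall>(U, \<phi>)\<in>\<A>. \<forall>(V, \<psi>)\<in>\<A>. smooth_on (\<psi> \<circ> inv_into U \<phi>) (\<phi> ` (U \<inter> V)))"

definition smooth_manifold :: "'a topology \<Rightarrow> ('a set \<times> ('a \<Rightarrow> 'e::euclidean_space)) set \<Rightarrow> bool"
  where "smooth_manifold M \<A> \<longleftrightarrow>
    Hausdorff_space M \<and> second_countable M \<and> smooth_atlas M \<A>"

text \<open>Charts are onto open subsets of a Euclidean space, so there is no boundary.\<close>

definition closed_smooth_manifold ::
  "'a topology \<Rightarrow> ('a set \<times> ('a \<Rightarrow> 'e::euclidean_space)) set \<Rightarrow> bool"
  where "closed_smooth_manifold M \<A> \<longleftrightarrow> smooth_manifold M \<A> \<and> compact_space M"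


section \<open>Singular cohomology with real coefficients\<close>

text \<open>A real \<open>p\<close>-cochain is given by its values on the singular \<open>p\<close>-simplices and is normalised to
  vanish on everything else. Its linear extension to chains is \<open>cochain_eval\<close>.\<close>

definition cochain_group :: "nat \<Rightarrow> 'a topology \<Rightarrow> (((nat \<Rightarrow> real) \<Rightarrow> 'a) \<Rightarrow> real) monoid"
  where "cochain_group p X =
    \<lparr>carrier = {c. \<forall>\<sigma>. \<not> singular_simplex p X \<sigma> \<longrightarrow> c \<sigma> = 0},
     monoid.mult = (\<lambda>c d \<sigma>. c \<sigma> + d \<sigma>),
     one = (\<lambda>\<sigma>. 0)\<rparr>"

definition cochain_eval :: "(((nat \<Rightarrow> real) \<Rightarrow> 'a) \<Rightarrow> real) \<Rightarrow> 'a chain \<Rightarrow> real"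
  where "cochain_eval c z =
    (\<Sum>\<sigma>\<in>Poly_Mapping.keys z. of_int (Poly_Mapping.lookup z \<sigma>) * c \<sigma>)"

text \<open>The coboundary with values in the \<open>p\<close>-cochains. For \<open>p = 0\<close> it is zero, because
  \<open>chain_boundary 0\<close> is.\<close>

definition coboundary ::
  "nat \<Rightarrow> 'a topology \<Rightarrow> (((nat \<Rightarrow> real) \<Rightarrow> 'a) \<Rightarrow> real) \<Rightarrow> ((nat \<Rightarrow> real) \<Rightarrow> 'a) \<Rightarrow> real"
  where "coboundary p X c \<sigma> =
    (if singular_simplex p X \<sigma> then cochain_eval c (chain_boundary p (frag_of \<sigma>)) else 0)"

definition cocycle_set :: "nat \<Rightarrow> 'a topology \<Rightarrow> (((nat \<Rightarrow> real) \<Rightarrow> 'a) \<Rightarrow> real) set"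
  where "cocycle_set p X = {c \<in> carrier (cochain_group p X). coboundary (Suc p) X c = (\<lambda>\<sigma>. 0)}"

definition coboundary_set :: "nat \<Rightarrow> 'a topology \<Rightarrow> (((nat \<Rightarrow> real) \<Rightarrow> 'a) \<Rightarrow> real) set"
  where "coboundary_set p X = coboundary p X ` carrier (cochain_group (p - 1) X)"

definition real_cohomology_group ::
  "nat \<Rightarrow> 'a topology \<Rightarrow> (((nat \<Rightarrow> real) \<Rightarrow> 'a) \<Rightarrow> real) set monoid"
  where "real_cohomology_group p X =
    subgroup_generated (cochain_group p X) (cocycle_set p X) Mod coboundary_set p X"


section \<open>Continuous closed 1-forms\<close>

text \<open>A continuous closed 1-form is given by a set of pairs \<open>(U, f)\<close>, the values of \<open>f\<close> outside
  \<open>U\<close> being irrelevant. Families whose union is again such a family define the same form; they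
  have the same path integrals, and only these integrals are used below.\<close>

definition closed_one_form :: "'a topology \<Rightarrow> ('a set \<times> ('a \<Rightarrow> real)) set \<Rightarrow> bool"
  where "closed_one_form X \<omega> \<longleftrightarrow>
    (\<forall>(U, f)\<in>\<omega>. openin X U \<and> continuous_map (subtopology X U) euclideanreal f) \<and>
    (\<Union>(U, f)\<in>\<omega>. U) = topspace X \<and>
    (\<forall>(U, f)\<in>\<omega>. \<forall>(V, g)\<in>\<omega>. \<forall>x \<in> U \<inter> V.
       \<exists>W. openin X W \<and> x \<in> W \<and> W \<subseteq> U \<inter> V \<and> (\<forall>y\<in>W. f y - g y = f x - g x))"

definition has_form_integral ::
  "('a set \<times> ('a \<Rightarrow> real)) set \<Rightarrow> (real \<Rightarrow> 'a) \<Rightarrow> real \<Rightarrow> bool"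
  where "has_form_integral \<omega> \<gamma> r \<longleftrightarrow>
    (\<exists>m (t :: nat \<Rightarrow> real) U f.
       t 0 = 0 \<and> t m = 1 \<and> (\<forall>i<m. t i < t (Suc i)) \<and>
       (\<forall>i<m. (U i, f i) \<in> \<omega> \<and> \<gamma> ` {t i..t (Suc i)} \<subseteq> U i) \<and>
       r = (\<Sum>i<m. f i (\<gamma> (t (Suc i))) - f i (\<gamma> (t i))))"

definition form_integral :: "('a set \<times> ('a \<Rightarrow> real)) set \<Rightarrow> (real \<Rightarrow> 'a) \<Rightarrow> real"
  where "form_integral \<omega> \<gamma> = (THE r. has_form_integral \<omega> \<gamma> r)"

text \<open>The second barycentric coordinate identifies the standard 1-simplex with \<open>[0,1]\<close>.\<close>

definition path_simplex :: "(real \<Rightarrow> 'a) \<Rightarrow> (nat \<Rightarrow> real) \<Rightarrow> 'a"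
  where "path_simplex \<gamma> = restrict (\<lambda>x. \<gamma> (x 1)) (standard_simplex 1)"

text \<open>The class \<open>\<xi>\<close> is a coset of cocycles, all of which agree on loops.\<close>

definition form_represents ::
  "'a topology \<Rightarrow> ('a set \<times> ('a \<Rightarrow> real)) set \<Rightarrow> (((nat \<Rightarrow> real) \<Rightarrow> 'a) \<Rightarrow> real) set \<Rightarrow> bool"
  where "form_represents X \<omega> \<xi> \<longleftrightarrow>
    closed_one_form X \<omega> \<and> \<xi> \<in> carrier (real_cohomology_group 1 X) \<and>
    (\<forall>\<gamma>. pathin X \<gamma> \<and> \<gamma> 0 = \<gamma> 1 \<longrightarrow>
       (\<forall>c\<in>\<xi>. c (path_simplex \<gamma>) = form_integral \<omega> \<gamma>))"


section \<open>The controlled category of a cohomology class\<close>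

definition movable ::
  "'a topology \<Rightarrow> ('a set \<times> ('a \<Rightarrow> real)) set \<Rightarrow> real \<Rightarrow> real \<Rightarrow> 'a set \<Rightarrow> bool"
  where "movable X \<omega> N C A \<longleftrightarrow> A \<subseteq> topspace X \<and>
    (\<exists>h :: real \<times> 'a \<Rightarrow> 'a.
       continuous_map (prod_topology (top_of_set {0..1}) (subtopology X A)) X h \<and>
       (\<forall>x\<in>A. h (0, x) = x) \<and>
       (\<forall>x\<in>A. form_integral \<omega> (\<lambda>\<tau>. h (\<tau>, x)) < - N) \<and>
       (\<forall>x\<in>A. \<forall>t\<in>{0..1}. form_integral \<omega> (\<lambda>\<tau>. h (t * \<tau>, x)) \<le> C))"

definition null_homotopic_in :: "'a topology \<Rightarrow> 'a set \<Rightarrow> bool"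
  where "null_homotopic_in X A \<longleftrightarrow> A \<subseteq> topspace X \<and>
    (\<exists>c. homotopic_with (\<lambda>_. True) (subtopology X A) X id (\<lambda>_. c))"

definition ccat_cover ::
  "'a topology \<Rightarrow> ('a set \<times> ('a \<Rightarrow> real)) set \<Rightarrow> real \<Rightarrow> real \<Rightarrow> nat \<Rightarrow> bool"
  where "ccat_cover X \<omega> N C k \<longleftrightarrow>
    (\<exists>F (G :: nat \<Rightarrow> 'a set).
       openin X F \<and> movable X \<omega> N C F \<and>
       (\<forall>j\<in>{1..k}. openin X (G j) \<and> null_homotopic_in X (G j)) \<and>
       topspace X = F \<union> (\<Union>j\<in>{1..k}. G j))"

text \<open>The minimal \<open>k\<close>, or \<open>\<infinity>\<close> if there is none.\<close>

definition ccat_form :: "'a topology \<Rightarrow> ('a set \<times> ('a \<Rightarrow> real)) set \<Rightarrow> enat"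
  where "ccat_form X \<omega> = Inf {enat k |k. \<exists>C>0. \<forall>N>0. ccat_cover X \<omega> N C k}"

definition ccat :: "'a topology \<Rightarrow> (((nat \<Rightarrow> real) \<Rightarrow> 'a) \<Rightarrow> real) set \<Rightarrow> enat"
  where "ccat X \<xi> = ccat_form X (SOME \<omega>. form_represents X \<omega> \<xi>)"

end

theory Submission
  imports Defs
begin

text \<open>Choose \<open>\<omega>\<close> representing \<open>\<xi>\<close> and a loop with negative integral; shortcutting it in a good cover
  by charts gives an embedded closed polygon with negative integral. Pushing along its segments one
  after the other rotates the polygon, and iterating the rotation makes the integral at a chosen
  point of the polygon tend to minus infinity, while all integrals stay below a fixed bound.

  Let \<open>n \<ge> 2\<close>. The polygon has no interior, so \<open>M\<close> minus small neighbourhoods of finitely many points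
  off the polygon can be deformed radially into a finite union \<open>Y\<close> of boundaries of coordinate cubes.
  First the points destined to arrive near these centres are brought there by way of the polygon, and
  so pick up a very negative integral; every other point lands in \<open>Y\<close>. As \<open>Y\<close> has dimension \<open>n - 1\<close>, it is
  covered by \<open>n\<close> families of disjoint small open sets, and each family can be contracted to a point.
  The preimages of \<open>n - 1\<close> families are null-homotopic in \<open>M\<close>. The remaining family is contracted to a
  point of the polygon and then rotated; together with the points of very negative integral it makes up \<open>F\<close>.
  In dimension one the polygon is all of \<open>M\<close>, and rotating it often enough moves \<open>M\<close> itself.\<close>

section \<open>Integration of closed 1-forms\<close>

text \<open>The difficulty is uniformity: the bound \<open>C\<close> must be fixed before
  \<open>N\<close>, while the integrals to be reached, and with them open sets and homotopies,
  depend on \<open>N\<close>. The integrals along iterated rotations are compared with a bounded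
  function on \<open>M\<close>, against which they telescope. The radial deformation is estimated by
  local primitives on fixed cubes, so its bound does not see how small the holes around the centres
  are. Each stage has one constant for all \<open>N\<close>, and is asked for a value so negative
  that the constants of the other stages cannot undo it. For \<open>F\<close> to be open the
  integral has to vary continuously with the point; therefore a homotopy is carried together with a
  continuous primitive along its tracks (\<open>move_by\<close>). To know where the integral is very
  negative, preimages are controlled rather than images: a move serving one centre lets a single
  point arrive there and brings nothing new to the other centres.\<close>

lemma closed_one_form_openin_continuous:
  assumes "closed_one_form X \<omega>" "(U, f) \<in> \<omega>"
  shows "openin X U \<and> continuous_map (subtopology X U) euclideanreal f"
proof -
  have "\<forall>p\<in>\<omega>. openin X (fst p) \<and> continuous_map (subtopology X (fst p)) euclideanreal (snd p)"
    using assms(1) by (simp add: closed_one_form_def case_prod_beta)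
  from bspec[OF this assms(2)] show ?thesis by simp
qed

lemmas closed_one_form_openin = conjunct1[OF closed_one_form_openin_continuous]
  and closed_one_form_continuous = conjunct2[OF closed_one_form_openin_continuous]

lemma closed_one_form_cover:
  assumes "closed_one_form X \<omega>" "x \<in> topspace X"
  obtains U f where "(U, f) \<in> \<omega>" "x \<in> U"
proof -
  have "x \<in> (\<Union>(U, f)\<in>\<omega>. U)"
    using assms by (simp add: closed_one_form_def)
  then show thesis using that by auto
qed

lemma closed_one_form_diff:
  assumes "closed_one_form X \<omega>" "(U, f) \<in> \<omega>" "(V, g) \<in> \<omega>" "x \<in> U" "x \<in> V"
  shows "\<exists>W. openin X W \<and> x \<in> W \<and> W \<subseteq> U \<inter> V \<and> (\<forall>y\<in>W. f y - g y = f x - g x)"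
proof -
  have "\<forall>p\<in>\<omega>. \<forall>q\<in>\<omega>. \<forall>x\<in>fst p \<inter> fst q. \<exists>W. openin X W \<and> x \<in> W \<and> W \<subseteq> fst p \<inter> fst q \<and>
      (\<forall>y\<in>W. snd p y - snd q y = snd p x - snd q x)"
    using assms(1) by (simp add: closed_one_form_def case_prod_beta)
  from bspec[OF bspec[OF bspec[OF this assms(2)] assms(3)], of x] assms(4,5)
  show ?thesis by simp
qed

lemma topspace_subset_form_domains: "closed_one_form X \<omega> \<Longrightarrow> topspace X \<subseteq> \<Union>(fst ` \<omega>)"
  by (auto simp: closed_one_form_def split_beta)

text \<open>Comparing increments near each parameter, for every member of the family defined there,
  avoids partitions altogether. The punctured filter makes the condition empty at isolated
  parameters.\<close>

definition primitive_on ::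
  "('a set \<times> ('a \<Rightarrow> real)) set \<Rightarrow> (real \<Rightarrow> 'a) \<Rightarrow> real set \<Rightarrow> (real \<Rightarrow> real) \<Rightarrow> bool"
  where "primitive_on \<omega> \<gamma> S F \<longleftrightarrow>
    (\<forall>s\<in>S. \<forall>(U, f)\<in>\<omega>. \<gamma> s \<in> U \<longrightarrow>
       (\<forall>\<^sub>F t in at s within S. F t - F s = f (\<gamma> t) - f (\<gamma> s)))"

lemma continuous_map_eventually_in:
  assumes "continuous_map (top_of_set S) X \<gamma>" "openin X W" "s \<in> S" "\<gamma> s \<in> W"
  shows "\<forall>\<^sub>F t in at s within S. \<gamma> t \<in> W"
proof -
  have "openin (top_of_set S) {x \<in> S. \<gamma> x \<in> W}"
    using openin_continuous_map_preimage[OF assms(1,2)] by simp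
  then obtain T where "open T" "{x \<in> S. \<gamma> x \<in> W} = S \<inter> T"
    by (auto simp: openin_open)
  then show ?thesis
    unfolding eventually_at_topological using assms(3,4) by blast
qed

lemma closed_one_form_agree:
  assumes "closed_one_form X \<omega>" "(U, f) \<in> \<omega>" "(V, g) \<in> \<omega>"
    and "continuous_map (top_of_set S) X \<gamma>" "s \<in> S" "\<gamma> s \<in> U" "\<gamma> s \<in> V"
  shows "\<forall>\<^sub>F t in at s within S. f (\<gamma> t) - f (\<gamma> s) = g (\<gamma> t) - g (\<gamma> s)"
proof -
  obtain W where W: "openin X W" "\<gamma> s \<in> W"
      "\<forall>y\<in>W. f y - g y = f (\<gamma> s) - g (\<gamma> s)"
    using closed_one_form_diff[OF assms(1-3,6,7)] by blast
  have "\<forall>\<^sub>F t in at s within S. \<gamma> t \<in> W"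
    by (rule continuous_map_eventually_in[OF assms(4) W(1) assms(5) W(2)])
  then show ?thesis
    by eventually_elim (use W(3) in \<open>force simp: algebra_simps\<close>)
qed

text \<open>One member of the family per parameter suffices: any other one differs from it by a
  locally constant function, and the path stays for a while in a neighbourhood where the difference
  is constant.\<close>

lemma primitive_onI:
  assumes "closed_one_form X \<omega>" "continuous_map (top_of_set S) X \<gamma>"
    and "\<And>s. s \<in> S \<Longrightarrow> \<exists>(U, f)\<in>\<omega>. \<gamma> s \<in> U \<and>
          (\<forall>\<^sub>F t in at s within S. F t - F s = f (\<gamma> t) - f (\<gamma> s))"
  shows "primitive_on \<omega> \<gamma> S F"
  unfolding primitive_on_def
proof (clarify)
  fix s V g assume s: "s \<in> S" "(V, g) \<in> \<omega>" "\<gamma> s \<in> V"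
  obtain U f where f: "(U, f) \<in> \<omega>" "\<gamma> s \<in> U"
    and ev: "\<forall>\<^sub>F t in at s within S. F t - F s = f (\<gamma> t) - f (\<gamma> s)"
    using assms(3)[OF s(1)] by blast
  show "\<forall>\<^sub>F t in at s within S. F t - F s = g (\<gamma> t) - g (\<gamma> s)"
    using ev closed_one_form_agree[OF assms(1) f(1) s(2) assms(2) s(1) f(2) s(3)]
    by eventually_elim simp
qed

lemma primitive_on_local:
  assumes "closed_one_form X \<omega>" "continuous_map (top_of_set S) X \<gamma>" "(U, f) \<in> \<omega>" "\<gamma> ` S \<subseteq> U"
    and "\<And>t. t \<in> S \<Longrightarrow> F t = c + f (\<gamma> t)"
  shows "primitive_on \<omega> \<gamma> S F"
proof (rule primitive_onI[OF assms(1,2)])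
  fix s assume "s \<in> S"
  then have "\<gamma> s \<in> U" "\<forall>\<^sub>F t in at s within S. F t - F s = f (\<gamma> t) - f (\<gamma> s)"
    using assms(4,5) by (auto simp: eventually_at_filter)
  then show "\<exists>(U, f)\<in>\<omega>. \<gamma> s \<in> U \<and> (\<forall>\<^sub>F t in at s within S. F t - F s = f (\<gamma> t) - f (\<gamma> s))"
    using assms(3) by blast
qed

text \<open>Closedness matters at a parameter outside one of the two sets: it is no limit point of
  that set, so the corresponding filter is trivial.\<close>

lemma primitive_on_Un:
  assumes "closed S" "closed T" "primitive_on \<omega> \<gamma> S F" "primitive_on \<omega> \<gamma> T F"
  shows "primitive_on \<omega> \<gamma> (S \<union> T) F"
  unfolding primitive_on_def
proof clarify
  fix s U f assume s: "s \<in> S \<union> T" "(U, f) \<in> \<omega>" "\<gamma> s \<in> U"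
  have *: "\<forall>\<^sub>F t in at s within R. F t - F s = f (\<gamma> t) - f (\<gamma> s)"
    if "closed R" "primitive_on \<omega> \<gamma> R F" for R
  proof (cases "s \<in> R")
    case True
    then show ?thesis using that(2) s unfolding primitive_on_def by blast
  next
    case False
    then have "at s within R = bot"
      using \<open>closed R\<close> closed_limpt trivial_limit_within by metis
    then show ?thesis by simp
  qed
  show "\<forall>\<^sub>F t in at s within (S \<union> T). F t - F s = f (\<gamma> t) - f (\<gamma> s)"
    using * assms by (auto simp: at_within_union eventually_sup)
qed

text \<open>The difference of two primitives is locally constant, hence constant on a connected
  set.\<close>

lemma primitive_on_unique:
  assumes om: "closed_one_form X \<omega>" and "continuous_map (top_of_set S) X \<gamma>" "connected S"
    and "primitive_on \<omega> \<gamma> S F" "primitive_on \<omega> \<gamma> S G" "a \<in> S" "b \<in> S"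
  shows "F b - F a = G b - G a"
proof -
  have "(\<lambda>t. F t - G t) a = (\<lambda>t. F t - G t) b"
  proof (rule connected_local_const[OF assms(3,6,7)], clarify)
    fix s assume s: "s \<in> S"
    then have "\<gamma> s \<in> topspace X"
      using assms(2) by (auto simp: continuous_map_def)
    then obtain U f where "(U, f) \<in> \<omega>" "\<gamma> s \<in> U"
      using closed_one_form_cover[OF om] by blast
    then have "\<forall>\<^sub>F t in at s within S. F t - F s = f (\<gamma> t) - f (\<gamma> s)"
        "\<forall>\<^sub>F t in at s within S. G t - G s = f (\<gamma> t) - f (\<gamma> s)"
      using assms(4,5) s unfolding primitive_on_def by blast+
    then show "\<forall>\<^sub>F t in at s within S. F s - G s = F t - G t"
      by eventually_elim simp
  qed
  then show ?thesis by simp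
qed

lemma primitive_on_subset:
  assumes "primitive_on \<omega> \<gamma> S F" "T \<subseteq> S"
  shows "primitive_on \<omega> \<gamma> T F"
  unfolding primitive_on_def
proof clarify
  fix s U f assume "s \<in> T" "(U, f) \<in> \<omega>" "\<gamma> s \<in> U"
  then have "\<forall>\<^sub>F t in at s within S. F t - F s = f (\<gamma> t) - f (\<gamma> s)"
    using assms unfolding primitive_on_def by blast
  then show "\<forall>\<^sub>F t in at s within T. F t - F s = f (\<gamma> t) - f (\<gamma> s)"
    using filter_leD[OF at_le[OF assms(2)]] by blast
qed

text \<open>On each piece of a partition the local function is a primitive, so its increment is that
  of \<open>F\<close> and the sum telescopes. This makes the integral independent of the
  partition.\<close>

lemma has_form_integral_primitive:
  assumes om: "closed_one_form X \<omega>" and \<gamma>: "pathin X \<gamma>"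
    and F: "primitive_on \<omega> \<gamma> {0..1} F" and r: "has_form_integral \<omega> \<gamma> r"
  shows "r = F 1 - F 0"
proof -
  obtain m t U f where t: "t 0 = 0" "t m = 1" "\<forall>i<m. t i < t (Suc i)"
    and U: "\<forall>i<m. (U i, f i) \<in> \<omega> \<and> \<gamma> ` {t i..t (Suc i)} \<subseteq> U i"
    and r: "r = (\<Sum>i<m. f i (\<gamma> (t (Suc i))) - f i (\<gamma> (t i)))"
    using r unfolding has_form_integral_def by blast
  have mono: "t i \<le> t j" if "i \<le> j" "j \<le> m" for i j
    using that
  proof (induction rule: dec_induct)
    case (step n)
    then show ?case using t(3)[rule_format, of n] by simp
  qed simp
  have "F (t (Suc i)) - F (t i) = f i (\<gamma> (t (Suc i))) - f i (\<gamma> (t i))" if i: "i < m" for i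
  proof -
    have sub: "{t i..t (Suc i)} \<subseteq> {0..1}"
      using mono[of 0 i] mono[of "Suc i" m] t(1,2) i by auto
    have c: "continuous_map (top_of_set {t i..t (Suc i)}) X \<gamma>"
      using \<gamma> sub unfolding pathin_def by (rule continuous_map_from_subtopology_mono)
    have "primitive_on \<omega> \<gamma> {t i..t (Suc i)} (\<lambda>t. 0 + f i (\<gamma> t))"
      by (rule primitive_on_local[OF om c]) (use U i in auto)
    from primitive_on_unique[OF om c _ primitive_on_subset[OF F sub] this, of "t i" "t (Suc i)"]
    show ?thesis using t(3) i by (simp add: less_imp_le)
  qed
  then have "r = (\<Sum>i<m. F (t (Suc i)) - F (t i))"
    using r by simp
  then show ?thesis
    using sum_lessThan_telescope[of "\<lambda>i. F (t i)" m] t by simp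
qed

text \<open>A Lebesgue number allows pieces of equal length, which spares the bookkeeping of
  partition points. The cover is arbitrary because the argument serves both for the domains of a
  form and for a cover by charts.\<close>

lemma path_partition:
  assumes \<gamma>: "pathin X \<gamma>" and op: "\<And>U. U \<in> \<U> \<Longrightarrow> openin X U" and cov: "topspace X \<subseteq> \<Union>\<U>"
  obtains m :: nat where "0 < m" "\<And>i. i < m \<Longrightarrow> \<exists>U\<in>\<U>. \<gamma> ` {real i / m..real (Suc i) / m} \<subseteq> U"
proof -
  define \<C> where "\<C> = {T. open T \<and> (\<exists>U\<in>\<U>. \<gamma> ` (T \<inter> {0..1}) \<subseteq> U)}"
  have sub: "{0..1} \<subseteq> \<Union>\<C>"
  proof
    fix s :: real assume s: "s \<in> {0..1}"
    then have "\<gamma> s \<in> topspace X"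
      using \<gamma> by (auto simp: pathin_def continuous_map_def)
    then obtain U where U: "U \<in> \<U>" "\<gamma> s \<in> U" using cov by blast
    have "openin (top_of_set {0..1}) {x \<in> {0..1}. \<gamma> x \<in> U}"
      using openin_continuous_map_preimage[OF \<gamma>[unfolded pathin_def] op[OF U(1)]] by simp
    then obtain T where "open T" "{x \<in> {0..1}. \<gamma> x \<in> U} = {0..1} \<inter> T"
      by (auto simp: openin_open)
    then have "T \<in> \<C>" "s \<in> T" using U s unfolding \<C>_def by blast+
    then show "s \<in> \<Union>\<C>" by blast
  qed
  have ne: "\<C> \<noteq> {}"
  proof
    assume "\<C> = {}"
    then have "(0::real) \<in> \<Union>{}" using sub by auto
    then show False by simp
  qed
  have opC: "\<And>B. B \<in> \<C> \<Longrightarrow> open B" unfolding \<C>_def by simp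
  obtain \<delta> where "0 < \<delta>" and \<delta>: "\<And>T. T \<subseteq> {0..1} \<Longrightarrow> diameter T < \<delta> \<Longrightarrow> \<exists>B\<in>\<C>. T \<subseteq> B"
    using Lebesgue_number_lemma[OF compact_Icc ne sub opC] by blast
  obtain k where k: "inverse (real (Suc k)) < \<delta>"
    using reals_Archimedean[OF \<open>0 < \<delta>\<close>] by blast
  define m where "m = Suc k"
  have m: "0 < m" "1 / real m < \<delta>" using k unfolding m_def by (auto simp: inverse_eq_divide)
  have "\<exists>U\<in>\<U>. \<gamma> ` {real i / m..real (Suc i) / m} \<subseteq> U" if "i < m" for i
  proof -
    have "{real i / m..real (Suc i) / m} \<subseteq> {0..1}"
    proof -
      have "real (Suc i) \<le> m" using that by linarith
      then show ?thesis using m(1) by (auto simp: field_simps)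
    qed
    moreover have "diameter {real i / m..real (Suc i) / m} < \<delta>"
    proof -
      have "real i / m \<le> real (Suc i) / m" by (simp add: divide_right_mono)
      moreover have "real (Suc i) / m - real i / m = 1 / m" by (simp add: diff_divide_distrib[symmetric])
      ultimately show ?thesis using m by (simp add: diameter_closed_interval del: of_nat_Suc)
    qed
    ultimately obtain B where B: "B \<in> \<C>" "{real i / m..real (Suc i) / m} \<subseteq> B"
      using \<delta> by meson
    then obtain U where "U \<in> \<U>" "\<gamma> ` (B \<inter> {0..1}) \<subseteq> U"
      unfolding \<C>_def by blast
    moreover have "{real i / m..real (Suc i) / m} \<subseteq> B \<inter> {0..1}"
      using B \<open>{real i / m..real (Suc i) / m} \<subseteq> {0..1}\<close> by blast
    ultimately show ?thesis by (meson image_mono subset_trans)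
  qed
  then show thesis using that m by blast
qed

lemma has_form_integral_partition:
  assumes "0 < m" "\<And>i. i < m \<Longrightarrow> (U i, f i) \<in> \<omega> \<and> \<gamma> ` {real i / m..real (Suc i) / m} \<subseteq> U i"
  shows "has_form_integral \<omega> \<gamma> (\<Sum>i<m. f i (\<gamma> (real (Suc i) / m)) - f i (\<gamma> (real i / m)))"
proof -
  have "\<forall>i<m. real i / m < real (Suc i) / m"
    using assms(1) by (simp add: divide_strict_right_mono)
  then show ?thesis
    unfolding has_form_integral_def
    using assms by (intro exI[of _ m] exI[of _ "\<lambda>i. real i / m"] exI[of _ U] exI[of _ f] conjI allI impI) simp_all
qed

lemma form_partition:
  assumes om: "closed_one_form X \<omega>" and \<gamma>: "pathin X \<gamma>"
  obtains m :: nat and U f where "0 < m"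
    "\<And>i. i < m \<Longrightarrow> (U i, f i) \<in> \<omega> \<and> \<gamma> ` {real i / m..real (Suc i) / m} \<subseteq> U i"
proof -
  have op: "openin X U" if "U \<in> fst ` \<omega>" for U
    using closed_one_form_openin[OF om] that by auto
  obtain m :: nat where m: "0 < m"
    "\<And>i. i < m \<Longrightarrow> \<exists>U\<in>fst ` \<omega>. \<gamma> ` {real i / m..real (Suc i) / m} \<subseteq> U"
    using path_partition[OF \<gamma> op topspace_subset_form_domains[OF om]] by blast
  then have "\<forall>i. \<exists>p. i < m \<longrightarrow> p \<in> \<omega> \<and> \<gamma> ` {real i / m..real (Suc i) / m} \<subseteq> fst p"
    by (metis imageE)
  then obtain p where "\<And>i. i < m \<Longrightarrow> p i \<in> \<omega> \<and> \<gamma> ` {real i / m..real (Suc i) / m} \<subseteq> fst (p i)"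
    by metis
  then show thesis using that[of m "fst \<circ> p" "snd \<circ> p"] m(1) by auto
qed

lemma primitive_exists:
  assumes om: "closed_one_form X \<omega>" and \<gamma>: "pathin X \<gamma>"
  obtains F where "primitive_on \<omega> \<gamma> {0..1} F"
proof -
  obtain m :: nat and U f where m: "0 < m"
    "\<And>i. i < m \<Longrightarrow> (U i, f i) \<in> \<omega> \<and> \<gamma> ` {real i / m..real (Suc i) / m} \<subseteq> U i"
    using form_partition[OF om \<gamma>] by metis
  have sub: "{real i / m..real (Suc i) / m} \<subseteq> {0..1}" if "i < m" for i
  proof -
    have "real (Suc i) \<le> m" using that by linarith
    then show ?thesis using m(1) by (auto simp: field_simps)
  qed
  have "\<exists>F. primitive_on \<omega> \<gamma> {0..real i / m} F" if "i \<le> m" for i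
    using that
  proof (induction i)
    case 0
    have "\<gamma> 0 \<in> topspace X" using \<gamma> by (auto simp: pathin_def continuous_map_def)
    have "primitive_on \<omega> \<gamma> {0..0} F" for F
      by (auto simp: primitive_on_def eventually_at_filter)
    then show ?case by auto
  next
    case (Suc i)
    then obtain F where F: "primitive_on \<omega> \<gamma> {0..real i / m} F" by auto
    obtain U f where U: "(U, f) \<in> \<omega>" "\<gamma> ` {real i / m..real (Suc i) / m} \<subseteq> U"
      using m(2)[of i] Suc.prems by (meson Suc_le_eq)
    \<comment> \<open>The local function is shifted so that both pieces agree at
      \<open>i / m\<close>; \<open>primitive_on_Un\<close> then joins the two closed
      intervals.\<close>
    define G where "G = (\<lambda>t. if t \<le> real i / m then F t else F (real i / m) + f (\<gamma> t) - f (\<gamma> (real i / m)))"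
    have c: "continuous_map (top_of_set {real i / m..real (Suc i) / m}) X \<gamma>"
      using \<gamma> sub[of i] Suc.prems unfolding pathin_def
      by (metis Suc_le_eq continuous_map_from_subtopology_mono)
    have "primitive_on \<omega> \<gamma> {real i / m..real (Suc i) / m} G"
      by (rule primitive_on_local[OF om c U, where c = "F (real i / m) - f (\<gamma> (real i / m))"])
        (auto simp: G_def)
    moreover have "primitive_on \<omega> \<gamma> {0..real i / m} G"
      unfolding primitive_on_def
    proof clarify
      fix s V g assume "s \<in> {0..real i / m}" "(V, g) \<in> \<omega>" "\<gamma> s \<in> V"
      then have "\<forall>\<^sub>F t in at s within {0..real i / m}. F t - F s = g (\<gamma> t) - g (\<gamma> s)"
        using F unfolding primitive_on_def by blast
      then show "\<forall>\<^sub>F t in at s within {0..real i / m}. G t - G s = g (\<gamma> t) - g (\<gamma> s)"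
        using \<open>s \<in> _\<close> by (auto simp: G_def eventually_at_filter elim: eventually_mono)
    qed
    ultimately have "primitive_on \<omega> \<gamma> ({0..real i / m} \<union> {real i / m..real (Suc i) / m}) G"
      by (intro primitive_on_Un) auto
    moreover have "{0..real i / m} \<union> {real i / m..real (Suc i) / m} = {0..real (Suc i) / m}"
    proof -
      have "0 \<le> real i / m" "real i / m \<le> real (Suc i) / m"
        by (simp_all add: divide_right_mono)
      then show ?thesis by (rule ivl_disj_un_two_touch)
    qed
    ultimately have "primitive_on \<omega> \<gamma> {0..real (Suc i) / m} G"
      by metis
    then show ?case by blast
  qed
  from this[of m] show thesis using that m by auto
qed

lemma form_integral_unique:
  assumes om: "closed_one_form X \<omega>" and \<gamma>: "pathin X \<gamma>" and r: "has_form_integral \<omega> \<gamma> r"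
  shows "form_integral \<omega> \<gamma> = r"
proof -
  obtain F where F: "primitive_on \<omega> \<gamma> {0..1} F"
    using primitive_exists[OF om \<gamma>] .
  show ?thesis
    unfolding form_integral_def
    using has_form_integral_primitive[OF om \<gamma> F] r by (auto intro!: the_equality)
qed

text \<open>From here on integrals are evaluated through primitives; partitions reappear only where
  a cycle of charts is extracted from a loop.\<close>

lemma form_integral_primitive:
  assumes om: "closed_one_form X \<omega>" and \<gamma>: "pathin X \<gamma>" and F: "primitive_on \<omega> \<gamma> {0..1} F"
  shows "form_integral \<omega> \<gamma> = F 1 - F 0"
proof -
  obtain m :: nat and U f where m: "0 < m"
    "\<And>i. i < m \<Longrightarrow> (U i, f i) \<in> \<omega> \<and> \<gamma> ` {real i / m..real (Suc i) / m} \<subseteq> U i"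
    using form_partition[OF om \<gamma>] by metis
  from has_form_integral_partition[OF m]
  obtain r where r: "has_form_integral \<omega> \<gamma> r" by blast
  show ?thesis
    using form_integral_unique[OF om \<gamma> r] has_form_integral_primitive[OF om \<gamma> F r] by simp
qed

section \<open>Charts of a closed manifold\<close>

text \<open>The inverse \<open>\<psi>\<close> is part of the data since maps are built in
  coordinates and carried back. Convexity of \<open>D\<close> makes straight-line homotopies
  available; a ball is not demanded, so that boxes can be used as well.\<close>

definition convex_chart ::
  "'a topology \<Rightarrow> 'a set \<Rightarrow> ('a \<Rightarrow> 'e::euclidean_space) \<Rightarrow> ('e \<Rightarrow> 'a) \<Rightarrow> 'e set \<Rightarrow> bool"
  where "convex_chart M B \<phi> \<psi> D \<longleftrightarrow>
    openin M B \<and> open D \<and> convex D \<and> homeomorphic_maps (subtopology M B) (top_of_set D) \<phi> \<psi>"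

lemma convex_chartD:
  assumes "convex_chart M B \<phi> \<psi> D"
  shows "openin M B" "B \<subseteq> topspace M" "open D" "convex D"
    and "\<And>x. x \<in> B \<Longrightarrow> \<phi> x \<in> D" "\<And>z. z \<in> D \<Longrightarrow> \<psi> z \<in> B"
    and "\<And>x. x \<in> B \<Longrightarrow> \<psi> (\<phi> x) = x" "\<And>z. z \<in> D \<Longrightarrow> \<phi> (\<psi> z) = z"
    and "continuous_map (subtopology M B) euclidean \<phi>" "continuous_map (top_of_set D) M \<psi>"
proof -
  show op: "openin M B" and "open D" "convex D"
    using assms unfolding convex_chart_def by auto
  show B: "B \<subseteq> topspace M" using op by (rule openin_subset)
  have h: "homeomorphic_maps (subtopology M B) (top_of_set D) \<phi> \<psi>"
    using assms unfolding convex_chart_def by auto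
  then have c: "continuous_map (subtopology M B) (top_of_set D) \<phi>"
    "continuous_map (top_of_set D) (subtopology M B) \<psi>"
    and inv: "\<And>x. x \<in> topspace (subtopology M B) \<Longrightarrow> \<psi> (\<phi> x) = x" "\<And>z. z \<in> D \<Longrightarrow> \<phi> (\<psi> z) = z"
    unfolding homeomorphic_maps_def by auto
  have [simp]: "topspace (subtopology M B) = B" using B by auto
  show "continuous_map (subtopology M B) euclidean \<phi>" "continuous_map (top_of_set D) M \<psi>"
    using c by (auto simp: continuous_map_in_subtopology)
  show "\<And>x. x \<in> B \<Longrightarrow> \<phi> x \<in> D" "\<And>z. z \<in> D \<Longrightarrow> \<psi> z \<in> B"
    using continuous_map_funspace[OF c(1)] continuous_map_funspace[OF c(2)] B by (auto simp: Pi_iff)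
  show "\<And>x. x \<in> B \<Longrightarrow> \<psi> (\<phi> x) = x" "\<And>z. z \<in> D \<Longrightarrow> \<phi> (\<psi> z) = z"
    using inv B by auto
qed

lemma convex_chart_openin_preimage:
  assumes "convex_chart M B \<phi> \<psi> D" "open Q"
  shows "openin M {x \<in> B. \<phi> x \<in> Q}"
proof -
  note C = convex_chartD[OF assms(1)]
  have "openin (subtopology M B) {x \<in> topspace (subtopology M B). \<phi> x \<in> Q}"
    using openin_continuous_map_preimage[OF C(9)] assms(2) by auto
  moreover have "topspace (subtopology M B) = B" using C(2) by auto
  ultimately show ?thesis
    using C(1) openin_trans_full by fastforce
qed

lemma convex_chart_open_preimage:
  assumes "convex_chart M B \<phi> \<psi> D" "openin M W"
  shows "open {z \<in> D. \<psi> z \<in> W}"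
proof -
  note C = convex_chartD[OF assms(1)]
  have "openin (top_of_set D) {z \<in> D. \<psi> z \<in> W}"
    using openin_continuous_map_preimage[OF C(10) assms(2)] by auto
  then show ?thesis using C(3) openin_open_eq by blast
qed

lemma convex_chart_compactin:
  assumes "convex_chart M B \<phi> \<psi> D" "compact S" "S \<subseteq> D"
  shows "compactin M (\<psi> ` S)"
proof -
  have "compactin (top_of_set D) S"
    using assms by (simp add: compactin_subtopology)
  then show ?thesis
    using image_compactin convex_chartD(10)[OF assms(1)] by blast
qed

lemma convex_chart_mono:
  assumes "convex_chart M B \<phi> \<psi> D" "D' \<subseteq> D" "open D'" "convex D'"
  shows "convex_chart M (\<psi> ` D') \<phi> \<psi> D'"
proof -
  note C = convex_chartD[OF assms(1)]
  have eq: "\<psi> ` D' = {x \<in> B. \<phi> x \<in> D'}"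
    using C(5-8) assms(2) by force
  have op: "openin M (\<psi> ` D')"
    unfolding eq by (rule convex_chart_openin_preimage[OF assms(1,3)])
  have t: "topspace (subtopology M (\<psi> ` D')) = \<psi> ` D'" "\<psi> ` D' \<subseteq> B"
    using openin_subset[OF op] assms(2) C(6) by auto
  have "continuous_map (subtopology M (\<psi> ` D')) (top_of_set D') \<phi>"
    using continuous_map_from_subtopology_mono[OF C(9) t(2)] t eq
    by (auto simp: continuous_map_in_subtopology)
  moreover have "continuous_map (top_of_set D') (subtopology M (\<psi> ` D')) \<psi>"
    using continuous_map_from_subtopology_mono[OF C(10) assms(2)]
    by (auto simp: continuous_map_in_subtopology)
  ultimately show ?thesis
    unfolding convex_chart_def homeomorphic_maps_def
    using op assms t C(7,8) by (auto simp: subset_iff)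
qed

section \<open>Closed connected manifolds\<close>

locale closed_manifold =
  fixes M :: "'a topology" and \<A> :: "('a set \<times> ('a \<Rightarrow> 'e::euclidean_space)) set"
  assumes closed_manifold: "closed_smooth_manifold M \<A>" and connected: "connected_space M"
begin

lemma compact: "compact_space M" and Hausdorff: "Hausdorff_space M"
  using closed_manifold unfolding closed_smooth_manifold_def smooth_manifold_def by auto

lemma normal: "normal_space M"
  using compact Hausdorff by (simp add: compact_Hausdorff_or_regular_imp_normal_space)

lemma closedin_compactin: "compactin M S \<Longrightarrow> closedin M S"
  using Hausdorff compactin_imp_closedin by blast

lemma compactin_closedin: "closedin M S \<Longrightarrow> compactin M S"
  using closedin_compact_space compact by blast

text \<open>A set that small neighbourhoods never meet only partly is open and has open complement.
  Arguments along chains of charts take this form.\<close>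

lemma connected_spread:
  assumes "R \<subseteq> topspace M" "R \<noteq> {}"
    and spread: "\<And>z. z \<in> topspace M \<Longrightarrow> \<exists>N. openin M N \<and> z \<in> N \<and> (N \<inter> R \<noteq> {} \<longrightarrow> N \<subseteq> R)"
  shows "R = topspace M"
proof (rule ccontr)
  assume ne: "R \<noteq> topspace M"
  obtain N where N: "\<And>z. z \<in> topspace M \<Longrightarrow> openin M (N z) \<and> z \<in> N z \<and> (N z \<inter> R \<noteq> {} \<longrightarrow> N z \<subseteq> R)"
    using spread by metis
  have "R = \<Union>(N ` R)" using N assms(1) by blast
  moreover have "openin M (\<Union>(N ` R))" using N assms(1) by (intro openin_Union) auto
  ultimately have 1: "openin M R" by simp
  have "topspace M - R = \<Union>(N ` (topspace M - R))"
    using N openin_subset by blast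
  moreover have "openin M (\<Union>(N ` (topspace M - R)))" using N by (intro openin_Union) auto
  ultimately have "openin M (topspace M - R)" by simp
  with 1 show False
    using connected assms(1,2) ne unfolding connected_space_def by blast
qed

text \<open>An atlas chart is cut down to the preimage of a ball so small that the inverse maps it
  into \<open>W\<close>.\<close>

lemma chart_exists:
  assumes "openin M W" "x \<in> W"
  shows "\<exists>B (\<phi> :: 'a \<Rightarrow> 'e) \<psi> r. 0 < r \<and> convex_chart M B \<phi> \<psi> (ball (\<phi> x) r) \<and> x \<in> B \<and> B \<subseteq> W"
proof -
  have at: "smooth_atlas M \<A>"
    using closed_manifold unfolding closed_smooth_manifold_def smooth_manifold_def by auto
  have "x \<in> topspace M" using assms openin_subset by blast
  moreover have "(\<Union>p\<in>\<A>. fst p) = topspace M"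
    using at by (simp add: smooth_atlas_def split_beta)
  ultimately have "x \<in> (\<Union>p\<in>\<A>. fst p)" by simp
  then obtain U \<phi> where U: "(U, \<phi>) \<in> \<A>" "x \<in> U"
    by auto
  have "\<forall>p\<in>\<A>. openin M (fst p) \<and> open (snd p ` fst p) \<and>
      homeomorphic_map (subtopology M (fst p)) (top_of_set (snd p ` fst p)) (snd p)"
    using at by (simp add: smooth_atlas_def split_beta)
  from bspec[OF this U(1)] have op: "openin M U" "open (\<phi> ` U)"
    and "homeomorphic_map (subtopology M U) (top_of_set (\<phi> ` U)) \<phi>"
    by auto
  then obtain \<psi> where h: "homeomorphic_maps (subtopology M U) (top_of_set (\<phi> ` U)) \<phi> \<psi>"
    using homeomorphic_map_maps by blast
  have Ut: "topspace (subtopology M U) = U" using openin_subset[OF op(1)] by auto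
  have c: "continuous_map (subtopology M U) (top_of_set (\<phi> ` U)) \<phi>"
    "continuous_map (top_of_set (\<phi> ` U)) (subtopology M U) \<psi>"
    and inv: "\<And>x. x \<in> U \<Longrightarrow> \<psi> (\<phi> x) = x" "\<And>z. z \<in> \<phi> ` U \<Longrightarrow> \<phi> (\<psi> z) = z"
    using h Ut unfolding homeomorphic_maps_def by auto
  have "openin (top_of_set (\<phi> ` U)) {z \<in> \<phi> ` U. \<psi> z \<in> U \<inter> W}"
    using openin_continuous_map_preimage[OF c(2), of "U \<inter> W"] assms(1)
    by (simp add: openin_subtopology_Int2)
  then have "open {z \<in> \<phi> ` U. \<psi> z \<in> U \<inter> W}" using op(2) openin_open_eq by blast
  moreover have "\<phi> x \<in> {z \<in> \<phi> ` U. \<psi> z \<in> U \<inter> W}" using inv U(2) assms(2) by auto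
  ultimately obtain r where r: "0 < r" "ball (\<phi> x) r \<subseteq> {z \<in> \<phi> ` U. \<psi> z \<in> U \<inter> W}"
    using openE by blast
  define B where "B = {y \<in> U. \<phi> y \<in> ball (\<phi> x) r}"
  have "openin (subtopology M U) {y \<in> topspace (subtopology M U). \<phi> y \<in> ball (\<phi> x) r}"
    using openin_continuous_map_preimage[of "subtopology M U" euclidean \<phi> "ball (\<phi> x) r"] c(1)
    by (simp add: continuous_map_in_subtopology)
  then have B: "openin M B"
    unfolding B_def Ut using op(1) openin_trans_full by blast
  have BU: "B \<subseteq> U" unfolding B_def by auto
  have Bt: "topspace (subtopology M B) = B" using openin_subset[OF B] by auto
  have "continuous_map (subtopology M B) (top_of_set (ball (\<phi> x) r)) \<phi>"
    using continuous_map_from_subtopology_mono[of M U euclidean \<phi> B] c(1) BU Bt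
    by (auto simp: continuous_map_in_subtopology B_def)
  moreover have "\<psi> z \<in> B" "z \<in> \<phi> ` U" if "z \<in> ball (\<phi> x) r" for z
    using that r inv unfolding B_def by auto
  then have "continuous_map (top_of_set (ball (\<phi> x) r)) (subtopology M B) \<psi>"
    using continuous_map_from_subtopology_mono[of euclidean "\<phi> ` U" M \<psi> "ball (\<phi> x) r"] c(2) r(2)
    by (auto simp: continuous_map_in_subtopology subset_iff)
  ultimately have "convex_chart M B \<phi> \<psi> (ball (\<phi> x) r)"
    unfolding convex_chart_def homeomorphic_maps_def
    using B inv BU r Bt by (auto simp: subset_iff)
  moreover have "x \<in> B" "B \<subseteq> W"
    using U(2) r inv unfolding B_def by force+
  ultimately show ?thesis using r(1) by blast
qed

end


section \<open>Moves\<close>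

lemma primitive_on_compose:
  assumes F: "primitive_on \<omega> \<gamma> S F" and p: "continuous_on T p" "p ` T \<subseteq> S"
  shows "primitive_on \<omega> (\<lambda>t. \<gamma> (p t)) T (\<lambda>t. F (p t))"
  unfolding primitive_on_def
proof clarify
  fix s U f assume s: "s \<in> T" "(U, f) \<in> \<omega>" "\<gamma> (p s) \<in> U"
  then have "\<forall>\<^sub>F t in at (p s) within S. F t - F (p s) = f (\<gamma> t) - f (\<gamma> (p s))"
    using F p unfolding primitive_on_def by blast
  then obtain Q where Q: "open Q" "p s \<in> Q"
    "\<And>t. t \<in> Q \<Longrightarrow> t \<noteq> p s \<Longrightarrow> t \<in> S \<Longrightarrow> F t - F (p s) = f (\<gamma> t) - f (\<gamma> (p s))"
    unfolding eventually_at_topological by blast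
  obtain R where R: "open R" "s \<in> R" "\<And>t. t \<in> R \<Longrightarrow> t \<in> T \<Longrightarrow> p t \<in> Q"
    using p(1) s(1) Q(1,2) unfolding continuous_on_topological by metis
  show "\<forall>\<^sub>F t in at s within T. F (p t) - F (p s) = f (\<gamma> (p t)) - f (\<gamma> (p s))"
    unfolding eventually_at_topological
  proof (intro exI[of _ R] conjI ballI impI R(1,2))
    \<comment> \<open>The reparametrisation may return to \<open>p s\<close>, a point that the
      punctured filter excludes; there both increments vanish.\<close>
    fix t assume "t \<in> R" "t \<noteq> s" "t \<in> T"
    then show "F (p t) - F (p s) = f (\<gamma> (p t)) - f (\<gamma> (p s))"
      using Q(3)[of "p t"] R(3)[of t] p(2) by (cases "p t = p s") auto
  qed
qed

lemma primitive_on_cong: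
  assumes "primitive_on \<omega> \<gamma> S F" "\<And>t. t \<in> S \<Longrightarrow> \<gamma>' t = \<gamma> t" "\<And>t. t \<in> S \<Longrightarrow> F' t = F t + c"
  shows "primitive_on \<omega> \<gamma>' S F'"
  unfolding primitive_on_def
proof clarify
  fix s U f assume s: "s \<in> S" "(U, f) \<in> \<omega>" "\<gamma>' s \<in> U"
  then have "\<forall>\<^sub>F t in at s within S. F t - F s = f (\<gamma> t) - f (\<gamma> s)"
    using assms unfolding primitive_on_def by fastforce
  then show "\<forall>\<^sub>F t in at s within S. F' t - F' s = f (\<gamma>' t) - f (\<gamma>' s)"
    using assms(2,3) s(1) unfolding eventually_at_filter by (auto elim!: eventually_mono)
qed

text \<open>\<open>move_by M \<omega> g d C\<close>: the map \<open>g\<close> is the end of a homotopy of the identity along which the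
  integral of \<open>\<omega>\<close> depends continuously on the point, ends with the value \<open>d\<close>, and stays below \<open>C\<close>.\<close>

definition move_by ::
  "'a topology \<Rightarrow> ('a set \<times> ('a \<Rightarrow> real)) set \<Rightarrow> ('a \<Rightarrow> 'a) \<Rightarrow> ('a \<Rightarrow> real) \<Rightarrow> real \<Rightarrow> bool"
  where "move_by M \<omega> g d C \<longleftrightarrow>
    (\<exists>h \<Phi>. continuous_map (prod_topology (top_of_set {0..1}) M) M h \<and>
       continuous_map (prod_topology (top_of_set {0..1}) M) euclideanreal \<Phi> \<and>
       (\<forall>x\<in>topspace M. h (0, x) = x) \<and> (\<forall>x\<in>topspace M. \<Phi> (0, x) = 0) \<and>
       (\<forall>x\<in>topspace M. h (1, x) = g x) \<and> (\<forall>x\<in>topspace M. \<Phi> (1, x) = d x) \<and>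
       (\<forall>x\<in>topspace M. primitive_on \<omega> (\<lambda>t. h (t, x)) {0..1} (\<lambda>t. \<Phi> (t, x))) \<and>
       (\<forall>x\<in>topspace M. \<forall>t\<in>{0..1}. \<Phi> (t, x) \<le> C))"

lemma move_byE:
  assumes "move_by M \<omega> g d C"
  obtains h \<Phi> where "continuous_map (prod_topology (top_of_set {0..1}) M) M h"
    "continuous_map (prod_topology (top_of_set {0..1}) M) euclideanreal \<Phi>"
    "\<forall>x\<in>topspace M. h (0, x) = x" "\<forall>x\<in>topspace M. \<Phi> (0, x) = 0"
    "\<forall>x\<in>topspace M. h (1, x) = g x" "\<forall>x\<in>topspace M. \<Phi> (1, x) = d x"
    "\<forall>x\<in>topspace M. primitive_on \<omega> (\<lambda>t. h (t, x)) {0..1} (\<lambda>t. \<Phi> (t, x))"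
    "\<forall>x\<in>topspace M. \<forall>t\<in>{0..1}. \<Phi> (t, x) \<le> C"
  using assms unfolding move_by_def by (elim exE conjE) (rule that; assumption)

lemma continuous_map_at_time:
  assumes "continuous_map (prod_topology (top_of_set {0..1}) M) Y h" "t \<in> {0..1::real}"
  shows "continuous_map M Y (\<lambda>x. h (t, x))"
proof -
  have "continuous_map M (prod_topology (top_of_set {0..1}) M) (\<lambda>x. (t, x))"
    using assms(2) by (auto intro!: continuous_map_pairedI)
  from continuous_map_compose[OF this assms(1)] show ?thesis by (simp add: o_def)
qed

lemma continuous_map_track:
  assumes "continuous_map (prod_topology (top_of_set {0..1::real}) M) Y h" "x \<in> topspace M"
    "continuous_on {0..1} p" "p ` {0..1} \<subseteq> {0..1}"
  shows "pathin Y (\<lambda>t. h (p t, x))"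
proof -
  have "continuous_map (top_of_set {0..1}) (prod_topology (top_of_set {0..1}) M) (\<lambda>t. (p t, x))"
    using assms(2-4) by (intro continuous_map_pairedI) (auto simp: continuous_map_in_subtopology Pi_iff image_subset_iff)
  from continuous_map_compose[OF this assms(1)] show ?thesis by (simp add: o_def pathin_def)
qed

lemma move_by_continuous:
  assumes "move_by M \<omega> g d C"
  shows "continuous_map M M g" "continuous_map M euclideanreal d"
proof -
  obtain h \<Phi> where h: "continuous_map (prod_topology (top_of_set {0..1::real}) M) M h"
    "continuous_map (prod_topology (top_of_set {0..1::real}) M) euclideanreal \<Phi>"
    "\<forall>x\<in>topspace M. h (1, x) = g x" "\<forall>x\<in>topspace M. \<Phi> (1, x) = d x"
    by (rule move_byE[OF assms]) (rule that; assumption)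
  show "continuous_map M M g"
    by (rule continuous_map_eq[OF continuous_map_at_time[OF h(1), of 1]]) (use h(3,4) in auto)
  show "continuous_map M euclideanreal d"
    by (rule continuous_map_eq[OF continuous_map_at_time[OF h(2), of 1]]) (use h(3,4) in auto)
qed

lemma move_by_in:
  assumes "move_by M \<omega> g d C" "x \<in> topspace M"
  shows "g x \<in> topspace M"
  using continuous_map_funspace[OF move_by_continuous(1)[OF assms(1)]] assms(2) by (rule funcset_mem)

lemma move_by_le:
  assumes "move_by M \<omega> g d C" "x \<in> topspace M"
  shows "d x \<le> C" "0 \<le> C"
proof -
  obtain h \<Phi> where \<Phi>: "\<forall>x\<in>topspace M. \<Phi> (0, x) = 0" "\<forall>x\<in>topspace M. \<Phi> (1::real, x) = d x"
    "\<forall>x\<in>topspace M. \<forall>t\<in>{0..1}. \<Phi> (t, x) \<le> C"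
    by (rule move_byE[OF assms(1)]) (rule that; assumption)
  show "d x \<le> C" "0 \<le> C"
    using \<Phi> assms(2) by (metis atLeastAtMost_iff order_refl zero_le_one)+
qed

lemma move_by_mono: "move_by M \<omega> g d C \<Longrightarrow> C \<le> C' \<Longrightarrow> move_by M \<omega> g d C'"
  unfolding move_by_def
  by (elim exE conjE, intro exI conjI, assumption+) (meson order_trans)

lemma move_by_id:
  shows "move_by M \<omega> (\<lambda>x. x) (\<lambda>x. 0) 0"
proof -
  have "continuous_map (prod_topology (top_of_set {0..1::real}) M) M snd"
    by (rule continuous_map_snd)
  then show ?thesis
    unfolding move_by_def
    by (intro exI[of _ snd] exI[of _ "\<lambda>p. 0"]) (simp add: primitive_on_def)
qed

text \<open>The homotopies are run one after the other at double speed. The bound is pointwise, with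
  \<open>d x + C'\<close> instead of \<open>C + C'\<close>: adding constants would let the bound of
  an iterated move grow with the number of iterations.\<close>

lemma move_by_comp:
  assumes g: "move_by M \<omega> g d C" and g': "move_by M \<omega> g' d' C'"
    and E: "C \<le> E" "\<And>x. x \<in> topspace M \<Longrightarrow> d x + C' \<le> E"
  shows "move_by M \<omega> (\<lambda>x. g' (g x)) (\<lambda>x. d x + d' (g x)) E"
proof -
  let ?P = "prod_topology (top_of_set {0..1::real}) M"
  obtain h \<Phi> where c: "continuous_map ?P M h" "continuous_map ?P euclideanreal \<Phi>"
    and h: "\<forall>x\<in>topspace M. h (0, x) = x" "\<forall>x\<in>topspace M. \<Phi> (0, x) = 0"
    "\<forall>x\<in>topspace M. h (1, x) = g x" "\<forall>x\<in>topspace M. \<Phi> (1, x) = d x"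
    "\<forall>x\<in>topspace M. primitive_on \<omega> (\<lambda>t. h (t, x)) {0..1} (\<lambda>t. \<Phi> (t, x))"
    "\<forall>x\<in>topspace M. \<forall>t\<in>{0..1}. \<Phi> (t, x) \<le> C"
    by (rule move_byE[OF g]) (rule that; assumption)
  obtain h' \<Phi>' where c': "continuous_map ?P M h'" "continuous_map ?P euclideanreal \<Phi>'"
    and h': "\<forall>x\<in>topspace M. h' (0, x) = x" "\<forall>x\<in>topspace M. \<Phi>' (0, x) = 0"
    "\<forall>x\<in>topspace M. h' (1, x) = g' x" "\<forall>x\<in>topspace M. \<Phi>' (1, x) = d' x"
    "\<forall>x\<in>topspace M. primitive_on \<omega> (\<lambda>t. h' (t, x)) {0..1} (\<lambda>t. \<Phi>' (t, x))"
    "\<forall>x\<in>topspace M. \<forall>t\<in>{0..1}. \<Phi>' (t, x) \<le> C'"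
    by (rule move_byE[OF g']) (rule that; assumption)
  have gt: "g x \<in> topspace M" if "x \<in> topspace M" for x
    using move_by_in[OF g that] .
  define k where "k = (\<lambda>p. if fst p \<le> 1/2 then h (2 * fst p, snd p) else h' (2 * fst p - 1, g (snd p)))"
  \<comment> \<open>In the second half the integral \<open>d\<close> already collected is added; it
    is the value of \<open>\<Phi>\<close> at time 1.\<close>
  define \<Psi> where "\<Psi> = (\<lambda>p. if fst p \<le> 1/2 then \<Phi> (2 * fst p, snd p) else d (snd p) + \<Phi>' (2 * fst p - 1, g (snd p)))"
  have fst_c: "continuous_map ?P euclideanreal fst"
    using continuous_map_fst[of "top_of_set {0..1::real}" M] by (simp add: continuous_map_in_subtopology)
  have a: "continuous_map (subtopology ?P {x \<in> topspace ?P. fst x \<le> 1/2}) ?P (\<lambda>p. (2 * fst p, snd p))"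
    by (intro continuous_map_pairedI)
      (auto simp: continuous_map_in_subtopology
        intro!: continuous_map_real_mult continuous_map_from_subtopology fst_c continuous_map_snd)
  have b: "continuous_map (subtopology ?P {x \<in> topspace ?P. 1/2 \<le> fst x}) ?P (\<lambda>p. (2 * fst p - 1, g (snd p)))"
    using continuous_map_compose[OF continuous_map_snd[of "top_of_set {0..1::real}" M] move_by_continuous(1)[OF g]]
    by (intro continuous_map_pairedI)
      (auto simp: continuous_map_in_subtopology o_def
        intro!: continuous_map_real_mult continuous_map_diff continuous_map_from_subtopology fst_c)
  have half: "2 * fst p = 1" "fst p * 2 = 1" if "fst p = 1/2" for p :: "real \<times> 'a"
    using that by auto
  have kc: "continuous_map ?P M k"
    unfolding k_def
  proof (rule continuous_map_cases_le)
    show "continuous_map (subtopology ?P {x \<in> topspace ?P. fst x \<le> 1/2}) M (\<lambda>p. h (2 * fst p, snd p))"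
      using continuous_map_compose[OF a c(1)] by (simp add: o_def)
    show "continuous_map (subtopology ?P {x \<in> topspace ?P. 1/2 \<le> fst x}) M (\<lambda>p. h' (2 * fst p - 1, g (snd p)))"
      using continuous_map_compose[OF b c'(1)] by (simp add: o_def)
    show "h (2 * fst p, snd p) = h' (2 * fst p - 1, g (snd p))" if "p \<in> topspace ?P" "fst p = 1/2" for p
      using that h(3) h'(1) gt by (auto simp: half)
  qed (use fst_c in auto)
  have "continuous_map ?P euclideanreal (\<lambda>p. d (snd p))"
    using continuous_map_compose[OF continuous_map_snd[of "top_of_set {0..1::real}" M] move_by_continuous(2)[OF g]]
    by (simp add: o_def)
  then have \<Psi>c: "continuous_map ?P euclideanreal \<Psi>"
    unfolding \<Psi>_def
  proof (intro continuous_map_cases_le)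
    show "continuous_map (subtopology ?P {x \<in> topspace ?P. fst x \<le> 1/2}) euclideanreal (\<lambda>p. \<Phi> (2 * fst p, snd p))"
      using continuous_map_compose[OF a c(2)] by (simp add: o_def)
    assume "continuous_map ?P euclideanreal (\<lambda>p. d (snd p))"
    then show "continuous_map (subtopology ?P {x \<in> topspace ?P. 1/2 \<le> fst x}) euclideanreal
        (\<lambda>p. d (snd p) + \<Phi>' (2 * fst p - 1, g (snd p)))"
      using continuous_map_compose[OF b c'(2)] continuous_map_from_subtopology
      by (intro continuous_map_add) (simp_all add: o_def)
    show "\<Phi> (2 * fst p, snd p) = d (snd p) + \<Phi>' (2 * fst p - 1, g (snd p))"
      if "p \<in> topspace ?P" "fst p = 1/2" for p
      using that h(4) h'(2) gt by (auto simp: half)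
  qed (use fst_c in auto)
  have "primitive_on \<omega> (\<lambda>t. k (t, x)) {0..1} (\<lambda>t. \<Psi> (t, x))" if x: "x \<in> topspace M" for x
  proof -
    have "primitive_on \<omega> (\<lambda>t. h (2 * t, x)) {0..1/2} (\<lambda>t. \<Phi> (2 * t, x))"
      by (rule primitive_on_compose[where p = "\<lambda>t. 2 * t" and S = "{0..1}"])
        (use h x in \<open>auto intro!: continuous_intros\<close>)
    then have 1: "primitive_on \<omega> (\<lambda>t. k (t, x)) {0..1/2} (\<lambda>t. \<Psi> (t, x))"
      by (rule primitive_on_cong[where c = 0]) (auto simp: k_def \<Psi>_def)
    have "primitive_on \<omega> (\<lambda>t. h' (2 * t - 1, g x)) {1/2..1} (\<lambda>t. \<Phi>' (2 * t - 1, g x))"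
      by (rule primitive_on_compose[where p = "\<lambda>t. 2 * t - 1" and S = "{0..1}"])
        (use h' x gt in \<open>auto intro!: continuous_intros\<close>)
    then have 2: "primitive_on \<omega> (\<lambda>t. k (t, x)) {1/2..1} (\<lambda>t. \<Psi> (t, x))"
    proof (rule primitive_on_cong[where c = "d x"])
      fix t :: real assume t: "t \<in> {1/2..1}"
      \<comment> \<open>At time \<open>1/2\<close> the definitions of \<open>k\<close> and
        \<open>\<Psi>\<close> choose the first formula, so the second one has to be checked there
        separately.\<close>
      consider "t = 1/2" | "\<not> t \<le> 1/2" using t by fastforce
      then have "k (t, x) = h' (2 * t - 1, g x) \<and> \<Psi> (t, x) = \<Phi>' (2 * t - 1, g x) + d x"
      proof cases
        case 1
        show ?thesis
          using bspec[OF h(3) x] bspec[OF h(4) x] bspec[OF h'(1) gt[OF x]] bspec[OF h'(2) gt[OF x]]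
          unfolding 1 k_def \<Psi>_def by simp
      qed (simp add: k_def \<Psi>_def)
      then show "k (t, x) = h' (2 * t - 1, g x)" "\<Psi> (t, x) = \<Phi>' (2 * t - 1, g x) + d x"
        by auto
    qed
    have "{0..1} = {0..1/2} \<union> {1/2..1::real}" by auto
    then show ?thesis using primitive_on_Un[OF _ _ 1 2] by simp
  qed
  moreover have "k (0, x) = x \<and> \<Psi> (0, x) = 0 \<and> k (1, x) = g' (g x) \<and> \<Psi> (1, x) = d x + d' (g x)"
    if "x \<in> topspace M" for x
    using bspec[OF h(1) that] bspec[OF h(2) that] bspec[OF h'(3) gt[OF that]] bspec[OF h'(4) gt[OF that]]
    by (simp add: k_def \<Psi>_def)
  moreover have "\<Psi> (t, x) \<le> E" if x: "x \<in> topspace M" and t: "t \<in> {0..1}" for x t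
  proof (cases "t \<le> 1/2")
    case True
    then have "\<Phi> (2 * t, x) \<le> C" using h(6) x t by auto
    then show ?thesis using E(1) True by (simp add: \<Psi>_def)
  next
    case False
    then have "\<Phi>' (2 * t - 1, g x) \<le> C'" using h'(6) gt[OF x] t by auto
    then show ?thesis using E(2)[OF x] False by (simp add: \<Psi>_def)
  qed
  ultimately show ?thesis
    unfolding move_by_def using kc \<Psi>c by (intro exI[of _ k] exI[of _ \<Psi>]) blast
qed

text \<open>Stopping at time \<open>t\<close> is the reparametrisation
  \<open>\<tau> \<mapsto> t * \<tau>\<close>, along which \<open>\<Phi>\<close> stays a primitive;
  both integral conditions are thus read off from \<open>\<Phi>\<close>.\<close>

lemma move_by_movable:
  assumes om: "closed_one_form M \<omega>" and g: "move_by M \<omega> g d C"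
    and A: "A \<subseteq> topspace M" "\<And>x. x \<in> A \<Longrightarrow> d x < - N"
  shows "movable M \<omega> N C A"
proof -
  let ?P = "prod_topology (top_of_set {0..1::real}) M"
  obtain h \<Phi> where c: "continuous_map ?P M h"
    and h: "\<forall>x\<in>topspace M. h (0, x) = x" "\<forall>x\<in>topspace M. \<Phi> (0, x) = 0" "\<forall>x\<in>topspace M. \<Phi> (1, x) = d x"
    "\<forall>x\<in>topspace M. primitive_on \<omega> (\<lambda>t. h (t, x)) {0..1} (\<lambda>t. \<Phi> (t, x))"
    "\<forall>x\<in>topspace M. \<forall>t\<in>{0..1}. \<Phi> (t, x) \<le> C"
    by (rule move_byE[OF g]) (rule that; assumption)
  have int: "form_integral \<omega> (\<lambda>\<tau>. h (t * \<tau>, x)) = \<Phi> (t, x)" if "x \<in> A" "t \<in> {0..1}" for x t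
  proof -
    have p: "continuous_on {0..1} (\<lambda>\<tau>. t * \<tau>)" "(\<lambda>\<tau>. t * \<tau>) ` {0..1} \<subseteq> {0..1}"
      using that(2) by (auto intro!: continuous_intros mult_le_one)
    have "x \<in> topspace M" using that A by auto
    then have "primitive_on \<omega> (\<lambda>\<tau>. h (t * \<tau>, x)) {0..1} (\<lambda>\<tau>. \<Phi> (t * \<tau>, x))"
      using primitive_on_compose[OF _ p] h by blast
    from form_integral_primitive[OF om continuous_map_track[OF c \<open>x \<in> topspace M\<close> p] this]
    show ?thesis using h(2) \<open>x \<in> topspace M\<close> by simp
  qed
  show ?thesis
    unfolding movable_def
  proof (intro conjI exI[of _ h] ballI)
    show "continuous_map (prod_topology (top_of_set {0..1}) (subtopology M A)) M h"
      using continuous_map_from_subtopology[OF c, of "{0..1} \<times> A"]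
      by (simp add: subtopology_Times[symmetric] prod_topology_subtopology(2) subtopology_subtopology)
    fix x assume x: "x \<in> A"
    then have "x \<in> topspace M" using A by auto
    then show "h (0, x) = x" "form_integral \<omega> (\<lambda>\<tau>. h (\<tau>, x)) < - N"
      using h int[OF x, of 1] A(2)[OF x] by auto
    fix t :: real assume t: "t \<in> {0..1}"
    show "form_integral \<omega> (\<lambda>\<tau>. h (t * \<tau>, x)) \<le> C"
      using int[OF x t] h(5) \<open>x \<in> topspace M\<close> t by auto
  qed (rule A)
qed

lemma move_by_null_homotopic:
  assumes g: "move_by M \<omega> g d C" and A: "A \<subseteq> topspace M" "\<And>x. x \<in> A \<Longrightarrow> g x = c"
  shows "null_homotopic_in M A"
proof -
  let ?P = "prod_topology (top_of_set {0..1::real}) M"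
  obtain h :: "real \<times> 'a \<Rightarrow> 'a" where c: "continuous_map ?P M h"
    and h: "\<forall>x\<in>topspace M. h (0, x) = x" "\<forall>x\<in>topspace M. h (1, x) = g x"
    by (rule move_byE[OF g]) (rule that; assumption)
  have "continuous_map (prod_topology (top_of_set {0..1}) (subtopology M A)) M h"
    using continuous_map_from_subtopology[OF c, of "{0..1} \<times> A"]
    by (simp add: subtopology_Times[symmetric] prod_topology_subtopology(2) subtopology_subtopology)
  moreover have "(\<lambda>x. h (0, x)) = (\<lambda>x. if x \<in> topspace M then x else h (0, x))" using h by auto
  ultimately have "homotopic_with (\<lambda>_. True) (subtopology M A) M (\<lambda>x. h (0, x)) (\<lambda>x. h (1, x))"
    unfolding homotopic_with_def by auto
  then have "homotopic_with (\<lambda>_. True) (subtopology M A) M id (\<lambda>_. c)"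
    by (rule homotopic_with_eq) (use h A in auto)
  then show ?thesis
    unfolding null_homotopic_in_def using A by auto
qed


text \<open>The straight line from \<open>z\<close> to \<open>P z\<close> stays in the convex set
  \<open>S\<close>, so each track lies in one domain of the form and \<open>f\<close> itself
  measures the integral: a difference of two values on \<open>S\<close>, whence
  \<open>2 * b\<close>. Off the image of \<open>S\<close> nothing moves, which allows extension by
  the identity.\<close>

lemma move_by_chart:
  assumes om: "closed_one_form M \<omega>" and haus: "Hausdorff_space M"
    and ch: "convex_chart M B \<phi> \<psi> D" and Vf: "(V, f) \<in> \<omega>" "B \<subseteq> V"
    and S: "compact S" "convex S" "S \<subseteq> D"
    and P: "continuous_on D P" "P ` S \<subseteq> S" "\<And>z. z \<in> D \<Longrightarrow> z \<notin> S \<Longrightarrow> P z = z"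
    and b: "0 \<le> b" "\<And>z. z \<in> S \<Longrightarrow> \<bar>f (\<psi> z)\<bar> \<le> b"
  shows "move_by M \<omega> (\<lambda>x. if x \<in> B then \<psi> (P (\<phi> x)) else x)
    (\<lambda>x. if x \<in> B then f (\<psi> (P (\<phi> x))) - f x else 0) (2 * b)"
proof -
  note C = convex_chartD[OF ch]
  let ?I = "top_of_set {0..1::real}"
  let ?P = "prod_topology ?I M"
  define Q where "Q = (\<lambda>t z. (1 - t) *\<^sub>R z + t *\<^sub>R P z)"
  define h where "h = (\<lambda>p. if snd p \<in> B then \<psi> (Q (fst p) (\<phi> (snd p))) else snd p)"
  define \<Phi> where "\<Phi> = (\<lambda>p. if snd p \<in> B then f (h p) - f (snd p) else 0)"
  have QS: "Q t z \<in> S" if "t \<in> {0..1}" "z \<in> S" for t z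
    unfolding Q_def using that S(2) P(2) by (intro convexD) auto
  have Qid: "Q t z = z" if "z \<in> D" "z \<notin> S" for t z
    using P(3)[OF that] by (simp add: Q_def algebra_simps)
  have QD: "Q t z \<in> D" if "t \<in> {0..1}" "z \<in> D" for t z
    using QS[of t z] Qid[of z t] that S(3) by (cases "z \<in> S") auto
  have tB: "topspace (subtopology M B) = B" using C(2) by auto
  have f: "continuous_map (subtopology M B) euclideanreal f"
    using closed_one_form_continuous[OF om Vf(1)] Vf(2) continuous_map_from_subtopology_mono by blast
  have cl: "closedin M (\<psi> ` S)"
    using convex_chart_compactin[OF ch S(1,3)] haus compactin_imp_closedin by blast
  have subB: "subtopology ?P ({0..1} \<times> B) = prod_topology ?I (subtopology M B)"
    by (simp add: subtopology_Times subtopology_subtopology)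
  have Q: "continuous_map (subtopology ?P ({0..1} \<times> B)) (top_of_set D) (\<lambda>p. Q (fst p) (\<phi> (snd p)))"
  proof -
    have "continuous_map (subtopology M B) (top_of_set D) \<phi>"
      using C(5,9) tB by (auto simp: continuous_map_in_subtopology)
    then have 1: "continuous_map (prod_topology ?I (subtopology M B)) (prod_topology ?I (top_of_set D)) (\<lambda>p. (fst p, \<phi> (snd p)))"
      using continuous_map_compose[OF continuous_map_snd[of ?I "subtopology M B"]]
      by (intro continuous_map_pairedI) (auto simp: o_def continuous_map_fst)
    have 2: "prod_topology ?I (top_of_set D) = top_of_set ({0..1} \<times> D)"
      using subtopology_Times[of euclidean euclidean "{0..1::real}" D] by (simp add: euclidean_product_topology)
    have "continuous_on ({0..1} \<times> D) (\<lambda>q. Q (fst q) (snd q))"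
      unfolding Q_def
      by (intro continuous_intros continuous_on_compose2[OF P(1)]) auto
    then have "continuous_map (top_of_set ({0..1} \<times> D)) (top_of_set D) (\<lambda>q. Q (fst q) (snd q))"
      using QD by (auto simp: continuous_map_in_subtopology)
    from continuous_map_compose[OF 1[unfolded 2] this] show ?thesis
      unfolding subB by (simp add: o_def)
  qed
  have hB: "continuous_map (subtopology ?P ({0..1} \<times> B)) M (\<lambda>p. \<psi> (Q (fst p) (\<phi> (snd p))))"
    using continuous_map_compose[OF Q C(10)] by (simp add: o_def)
  \<comment> \<open>The chart and the complement of the compact image of \<open>S\<close> give an
    open cover on whose overlap the formula in coordinates is the identity; a truth value indexes
    the two sets.\<close>
  define T where "T = (\<lambda>j. if j then {0..1::real} \<times> B else {0..1} \<times> (topspace M - \<psi> ` S))"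
  have Top: "openin ?P (T j)" for j
    unfolding T_def using C(1) cl by (auto simp: openin_prod_Times_iff)
  have out: "\<psi> (Q t (\<phi> x)) = x" if "x \<in> B" "x \<notin> \<psi> ` S" for t x
  proof -
    have "\<phi> x \<notin> S" using that C(7)[of x] by force
    then show ?thesis using that(1) Qid[of "\<phi> x" t] C(5,7) by simp
  qed
  have hc: "continuous_map ?P M h"
  proof (rule pasting_lemma[where I = UNIV and T = T and
        f = "\<lambda>j. if j then (\<lambda>p. \<psi> (Q (fst p) (\<phi> (snd p)))) else snd"])
    show "continuous_map (subtopology ?P (T j)) M (if j then (\<lambda>p. \<psi> (Q (fst p) (\<phi> (snd p)))) else snd)" for j
      using hB continuous_map_from_subtopology[OF continuous_map_snd[of ?I M]] by (simp add: T_def)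
    show "(if i then (\<lambda>p. \<psi> (Q (fst p) (\<phi> (snd p)))) else snd) p
        = (if j then (\<lambda>p. \<psi> (Q (fst p) (\<phi> (snd p)))) else snd) p"
      if "p \<in> topspace ?P \<inter> T i \<inter> T j" for i j p
      using that out[of "snd p" "fst p"] by (auto simp: T_def split: if_splits)
    show "\<exists>j. j \<in> UNIV \<and> p \<in> T j \<and> h p = (if j then (\<lambda>p. \<psi> (Q (fst p) (\<phi> (snd p)))) else snd) p"
      if "p \<in> topspace ?P" for p
    proof (cases "snd p \<in> B")
      case True
      then show ?thesis using that by (intro exI[of _ True]) (auto simp: T_def h_def mem_Times_iff)
    next
      case False
      then have "snd p \<notin> \<psi> ` S" using C(6) S(3) by auto
      then show ?thesis using that False by (intro exI[of _ False]) (auto simp: T_def h_def mem_Times_iff)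
    qed
  qed (use Top in auto)
  have \<Phi>c: "continuous_map ?P euclideanreal \<Phi>"
  proof (rule pasting_lemma[where I = UNIV and T = T and
        f = "\<lambda>j. if j then (\<lambda>p. f (\<psi> (Q (fst p) (\<phi> (snd p)))) - f (snd p)) else (\<lambda>p. 0)"])
    have "continuous_map (subtopology ?P ({0..1} \<times> B)) (subtopology M B) (\<lambda>p. \<psi> (Q (fst p) (\<phi> (snd p))))"
      using hB QD C(5,6) unfolding subB by (auto simp: continuous_map_in_subtopology tB)
    from continuous_map_compose[OF this f]
      continuous_map_compose[OF continuous_map_snd[of ?I "subtopology M B"] f]
    have "continuous_map (subtopology ?P ({0..1} \<times> B)) euclideanreal (\<lambda>p. f (\<psi> (Q (fst p) (\<phi> (snd p)))) - f (snd p))"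
      unfolding subB by (intro continuous_map_diff) (simp_all add: o_def)
    then show "continuous_map (subtopology ?P (T j)) euclideanreal
        (if j then (\<lambda>p. f (\<psi> (Q (fst p) (\<phi> (snd p)))) - f (snd p)) else (\<lambda>p. 0))" for j
      by (simp add: T_def)
    show "(if i then (\<lambda>p. f (\<psi> (Q (fst p) (\<phi> (snd p)))) - f (snd p)) else (\<lambda>p. 0)) p
        = (if j then (\<lambda>p. f (\<psi> (Q (fst p) (\<phi> (snd p)))) - f (snd p)) else (\<lambda>p. 0)) p"
      if "p \<in> topspace ?P \<inter> T i \<inter> T j" for i j p
      using that out[of "snd p" "fst p"] by (auto simp: T_def split: if_splits)
    show "\<exists>j. j \<in> UNIV \<and> p \<in> T j \<and>
        \<Phi> p = (if j then (\<lambda>p. f (\<psi> (Q (fst p) (\<phi> (snd p)))) - f (snd p)) else (\<lambda>p. 0)) p"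
      if "p \<in> topspace ?P" for p
    proof (cases "snd p \<in> B")
      case True
      then show ?thesis using that by (intro exI[of _ True]) (auto simp: T_def h_def \<Phi>_def mem_Times_iff)
    next
      case False
      then have "snd p \<notin> \<psi> ` S" using C(6) S(3) by auto
      then show ?thesis using that False by (intro exI[of _ False]) (auto simp: T_def \<Phi>_def mem_Times_iff)
    qed
  qed (use Top in auto)
  have prim: "primitive_on \<omega> (\<lambda>t. h (t, x)) {0..1} (\<lambda>t. \<Phi> (t, x))" if x: "x \<in> topspace M" for x
  proof (cases "x \<in> B")
    case True
    have "pathin M (\<lambda>t. h (t, x))"
      by (rule continuous_map_track[OF hc x]) auto
    moreover have "(\<lambda>t. h (t, x)) ` {0..1} \<subseteq> V"
      using True Vf(2) QD C(5,6) by (force simp: h_def)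
    ultimately show ?thesis
      using True by (intro primitive_on_local[OF om _ Vf(1), where c = "- f x"]) (auto simp: \<Phi>_def pathin_def)
  next
    case False
    then show ?thesis by (simp add: primitive_on_def h_def \<Phi>_def)
  qed
  have bound: "\<Phi> (t, x) \<le> 2 * b" if t: "t \<in> {0..1}" for t x
  proof (cases "x \<in> B \<and> \<phi> x \<in> S")
    case True
    then have "\<bar>f x\<bar> \<le> b" "\<bar>f (\<psi> (Q t (\<phi> x)))\<bar> \<le> b"
      using b(2)[of "\<phi> x"] C(7)[of x] b(2)[OF QS[OF t]] by auto
    then show ?thesis using True by (simp add: \<Phi>_def h_def abs_le_iff)
  next
    case False
    then show ?thesis using b(1) Qid[of "\<phi> x" t] C(5,7) by (auto simp: \<Phi>_def h_def)
  qed
  have Q01: "Q 0 z = z" "Q 1 z = P z" for z by (simp_all add: Q_def)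
  show ?thesis
    unfolding move_by_def
    by (rule exI[of _ h], rule exI[of _ \<Phi>]) (use hc \<Phi>c prim bound C(7) in \<open>auto simp: h_def \<Phi>_def Q01\<close>)
qed

section \<open>Covering dimension\<close>

text \<open>Ostrand's form of covering dimension: arbitrarily fine covers by \<open>m\<close> families of disjoint sets.\<close>

definition colorable :: "nat \<Rightarrow> 'a topology \<Rightarrow> 'a set \<Rightarrow> bool"
  where "colorable m X Y \<longleftrightarrow>
    (\<forall>\<U>. (\<forall>U\<in>\<U>. openin X U) \<and> topspace X \<subseteq> \<Union>\<U> \<longrightarrow>
      (\<exists>\<V> :: nat \<Rightarrow> 'a set set.
        (\<forall>i<m. finite (\<V> i) \<and> pairwise disjnt (\<V> i) \<and> (\<forall>V\<in>\<V> i. openin X V \<and> (\<exists>U\<in>\<U>. V \<subseteq> U))) \<and>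
        Y \<subseteq> (\<Union>i<m. \<Union>(\<V> i))))"

lemma colorableE:
  assumes "colorable m X Y" "\<And>U. U \<in> \<U> \<Longrightarrow> openin X U" "topspace X \<subseteq> \<Union>\<U>"
  obtains \<V> :: "nat \<Rightarrow> 'a set set" where "\<And>i. i < m \<Longrightarrow> finite (\<V> i)"
    "\<And>i. i < m \<Longrightarrow> pairwise disjnt (\<V> i)" "\<And>i V. i < m \<Longrightarrow> V \<in> \<V> i \<Longrightarrow> openin X V"
    "\<And>i V. i < m \<Longrightarrow> V \<in> \<V> i \<Longrightarrow> \<exists>U\<in>\<U>. V \<subseteq> U" "Y \<subseteq> (\<Union>i<m. \<Union>(\<V> i))"
proof -
  have "(\<forall>U\<in>\<U>. openin X U) \<and> topspace X \<subseteq> \<Union>\<U>" using assms(2,3) by blast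
  then obtain \<V> :: "nat \<Rightarrow> 'a set set"
    where "\<forall>i<m. finite (\<V> i) \<and> pairwise disjnt (\<V> i) \<and> (\<forall>V\<in>\<V> i. openin X V \<and> (\<exists>U\<in>\<U>. V \<subseteq> U))"
      "Y \<subseteq> (\<Union>i<m. \<Union>(\<V> i))"
    using assms(1) unfolding colorable_def by metis
  then show thesis using that[of \<V>] by simp
qed

lemma colorable_subset:
  assumes "colorable m X Y" "Y' \<subseteq> Y"
  shows "colorable m X Y'"
  using assms(1) unfolding colorable_def
  by (elim all_forward imp_forward ex_forward conj_forward asm_rl) (rule subset_trans[OF assms(2)])

lemma colorable_empty: "colorable m X {}"
  unfolding colorable_def by (auto intro!: exI[of _ "\<lambda>_. {}"])

lemma regular_space_closure_of:
  assumes "regular_space X" "openin X W" "x \<in> W"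
  obtains Q where "openin X Q" "x \<in> Q" "X closure_of Q \<subseteq> W"
proof -
  have "closedin X (topspace X - W)" "x \<in> topspace X - (topspace X - W)"
    using assms openin_subset by blast+
  then obtain Q where "openin X Q" "x \<in> Q" "disjnt (topspace X - W) (X closure_of Q)"
    using assms(1) unfolding regular_space by blast
  then show thesis
    using that[of Q] closure_of_subset_topspace[of X Q] by (auto simp: disjnt_iff)
qed

text \<open>Only finitely many of the sets \<open>v V\<close> are non-empty, the others being unions
  over the empty set. Indexing by all sets \<open>V\<close> lets the closure condition be used
  without checking membership in the cover.\<close>

lemma shrink_finite_cover:
  assumes X: "compact_space X" "Hausdorff_space X" and Y: "closedin X Y"
    and \<V>: "\<And>V. V \<in> \<V> \<Longrightarrow> openin X V" "Y \<subseteq> \<Union>\<V>"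
  obtains v where "\<And>V. openin X (v V)" "\<And>V. X closure_of (v V) \<subseteq> V" "Y \<subseteq> (\<Union>V\<in>\<V>. v V)"
proof -
  have reg: "regular_space X" using X by (simp add: compact_Hausdorff_imp_regular_space)
  have "\<exists>V Q. V \<in> \<V> \<and> openin X Q \<and> y \<in> Q \<and> X closure_of Q \<subseteq> V" if y: "y \<in> Y" for y
  proof -
    obtain V where V: "V \<in> \<V>" "y \<in> V" using y \<V>(2) by blast
    obtain Q where "openin X Q" "y \<in> Q" "X closure_of Q \<subseteq> V"
      using regular_space_closure_of[OF reg \<V>(1)[OF V(1)] V(2)] .
    then show ?thesis using V(1) by blast
  qed
  then obtain V Q where VQ: "\<And>y. y \<in> Y \<Longrightarrow> V y \<in> \<V> \<and> openin X (Q y) \<and> y \<in> Q y \<and> X closure_of (Q y) \<subseteq> V y"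
    by metis
  have "compactin X Y" using X(1) Y closedin_compact_space by blast
  then obtain \<F> where \<F>: "finite \<F>" "\<F> \<subseteq> Q ` Y" "Y \<subseteq> \<Union>\<F>"
    using VQ unfolding compactin_def by (metis (no_types, lifting) UN_I image_iff subsetI)
  then obtain F where F: "finite F" "F \<subseteq> Y" "\<F> = Q ` F"
    by (meson finite_subset_image)
  define v where "v = (\<lambda>W. \<Union>(Q ` {y \<in> F. V y = W}))"
  show thesis
  proof
    show "openin X (v W)" for W
      unfolding v_def using VQ F(2) by (intro openin_Union) auto
    have "finite (Q ` {y \<in> F. V y = W})" for W using F(1) by simp
    then show "X closure_of (v W) \<subseteq> W" for W
      unfolding v_def using VQ F(2) by (fastforce simp: closure_of_Union)
    show "Y \<subseteq> (\<Union>V\<in>\<V>. v V)"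
    proof
      fix y assume "y \<in> Y"
      then obtain z where "z \<in> F" "y \<in> Q z" using \<F>(3) F(3) by blast
      then have "y \<in> v (V z)" "V z \<in> \<V>" unfolding v_def using VQ F(2) by blast+
      then show "y \<in> (\<Union>V\<in>\<V>. v V)" by blast
    qed
  qed
qed

text \<open>After shrinking a coloured cover of \<open>Y1\<close>, the cover of \<open>Y2\<close> is
  taken so fine that each of its sets meeting a shrunken set lies in the original one. Each shrunken
  set then absorbs the sets of its own colour that meet it and stays inside the original set, so
  disjointness survives.\<close>

lemma colorable_Un:
  assumes X: "compact_space X" "Hausdorff_space X" and Y: "closedin X Y1"
    and c1: "colorable m X Y1" and c2: "colorable m X Y2"
  shows "colorable m X (Y1 \<union> Y2)"
  unfolding colorable_def
proof clarify
  fix \<U> assume \<U>: "\<forall>U\<in>\<U>. openin X U" "topspace X \<subseteq> \<Union>\<U>"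
  obtain \<V> :: "nat \<Rightarrow> 'a set set" where V: "\<And>i. i < m \<Longrightarrow> finite (\<V> i)"
    "\<And>i. i < m \<Longrightarrow> pairwise disjnt (\<V> i)" "\<And>i V. i < m \<Longrightarrow> V \<in> \<V> i \<Longrightarrow> openin X V"
    "\<And>i V. i < m \<Longrightarrow> V \<in> \<V> i \<Longrightarrow> \<exists>U\<in>\<U>. V \<subseteq> U" "Y1 \<subseteq> (\<Union>i<m. \<Union>(\<V> i))"
    by (rule colorableE[OF c1 \<U>(1)[rule_format] \<U>(2)]) (assumption | rule that; assumption)+
  define \<W> where "\<W> = (\<Union>i<m. \<V> i)"
  have W: "finite \<W>" "\<And>V. V \<in> \<W> \<Longrightarrow> openin X V"
    unfolding \<W>_def using V(1,3) by auto
  have WY: "Y1 \<subseteq> \<Union>\<W>"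
    unfolding \<W>_def using V(5) by blast
  obtain v where v: "\<And>V. openin X (v V)" "\<And>V. X closure_of (v V) \<subseteq> V" "Y1 \<subseteq> (\<Union>V\<in>\<W>. v V)"
    using shrink_finite_cover[OF X Y W(2) WY] by blast
  have vV: "v V \<subseteq> V" for V
    using v(2)[of V] closure_of_subset[OF openin_subset[OF v(1)[of V]]] by blast
  define \<O> where "\<O> = {Q. openin X Q \<and> (\<exists>U\<in>\<U>. Q \<subseteq> U) \<and> (\<forall>V\<in>\<W>. Q \<subseteq> V \<or> Q \<inter> v V = {})}"
  have "topspace X \<subseteq> \<Union>\<O>"
  proof
    fix y assume y: "y \<in> topspace X"
    then obtain U where U: "U \<in> \<U>" "y \<in> U" using \<U>(2) by blast
    \<comment> \<open>One condition for each of finitely many \<open>V\<close>: to lie inside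
      \<open>V\<close> if \<open>y\<close> does, and otherwise to avoid the closure of
      \<open>v V\<close>, which is contained in \<open>V\<close>.\<close>
    define R where "R = (\<lambda>V. if y \<in> V then V else topspace X - X closure_of (v V))"
    define Q where "Q = \<Inter>(insert U (R ` \<W>))"
    have "openin X (R V)" if "V \<in> \<W>" for V
      unfolding R_def using W(2)[OF that] by (auto intro: openin_diff)
    then have "openin X Q"
      unfolding Q_def using W(1) U \<U>(1) by (intro openin_Inter) auto
    moreover have "y \<in> R V" for V
      unfolding R_def using y v(2)[of V] by auto
    then have "y \<in> Q" unfolding Q_def using U by auto
    moreover have "Q \<subseteq> V \<or> Q \<inter> v V = {}" if "V \<in> \<W>" for V
    proof -
      have "Q \<subseteq> R V" unfolding Q_def using that by auto
      then show ?thesis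
        using closure_of_subset[OF openin_subset[OF v(1)[of V]]] unfolding R_def by (auto split: if_splits)
    qed
    moreover have "\<exists>U\<in>\<U>. Q \<subseteq> U" using U(1) unfolding Q_def by (intro bexI[of _ U]) auto
    ultimately have "Q \<in> \<O>" unfolding \<O>_def by simp
    then show "y \<in> \<Union>\<O>" using \<open>y \<in> Q\<close> by (rule UnionI)
  qed
  note cov = this
  have opn: "\<And>Q. Q \<in> \<O> \<Longrightarrow> openin X Q" unfolding \<O>_def by blast
  obtain \<Z> :: "nat \<Rightarrow> 'a set set" where Z: "\<And>i. i < m \<Longrightarrow> finite (\<Z> i)"
    "\<And>i. i < m \<Longrightarrow> pairwise disjnt (\<Z> i)" "\<And>i V. i < m \<Longrightarrow> V \<in> \<Z> i \<Longrightarrow> openin X V"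
    "\<And>i V. i < m \<Longrightarrow> V \<in> \<Z> i \<Longrightarrow> \<exists>U\<in>\<O>. V \<subseteq> U" "Y2 \<subseteq> (\<Union>i<m. \<Union>(\<Z> i))"
    by (rule colorableE[OF c2 opn cov]) (assumption | rule that; assumption)+
  have Zv: "Q \<subseteq> V \<or> Q \<inter> v V = {}" if "i < m" "Q \<in> \<Z> i" "V \<in> \<V> i" for i Q V
  proof -
    have "V \<in> \<W>" using that unfolding \<W>_def by blast
    then show ?thesis using Z(4)[OF that(1,2)] unfolding \<O>_def by blast
  qed
  define e where "e = (\<lambda>i V. v V \<union> \<Union>{Q \<in> \<Z> i. Q \<inter> v V \<noteq> {}})"
  have eV: "e i V \<subseteq> V" if "i < m" "V \<in> \<V> i" for i V
    unfolding e_def using Zv[OF that(1) _ that(2)] vV[of V] by blast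
  \<comment> \<open>The sets that meet no shrunken set of their colour are kept unchanged.\<close>
  define r where "r = (\<lambda>i. {Q \<in> \<Z> i. \<forall>V\<in>\<V> i. Q \<inter> v V = {}})"
  define \<T> where "\<T> = (\<lambda>i. e i ` \<V> i \<union> r i)"
  have er: "disjnt (e i V) Q" if "i < m" "V \<in> \<V> i" "Q \<in> r i" for i V Q
  proof -
    have "Q \<inter> v V = {}" "Q \<in> \<Z> i" using that unfolding r_def by auto
    moreover have "Q \<inter> P = {}" if "P \<in> \<Z> i" "P \<inter> v V \<noteq> {}" for P
      using Z(2)[OF \<open>i < m\<close>] that \<open>Q \<inter> v V = {}\<close> \<open>Q \<in> \<Z> i\<close> unfolding pairwise_def disjnt_def by blast
    ultimately show ?thesis unfolding e_def disjnt_def by blast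
  qed
  show "\<exists>\<V>. (\<forall>i<m. finite (\<V> i) \<and> pairwise disjnt (\<V> i) \<and> (\<forall>V\<in>\<V> i. openin X V \<and> (\<exists>U\<in>\<U>. V \<subseteq> U))) \<and>
      Y1 \<union> Y2 \<subseteq> (\<Union>i<m. \<Union>(\<V> i))"
  proof (intro exI[of _ \<T>] conjI allI impI ballI)
    fix i assume i: "i < m"
    have er: "\<And>Q V. V \<in> \<V> i \<Longrightarrow> Q \<in> r i \<Longrightarrow> disjnt (e i V) Q" using er[OF i] .
    show "finite (\<T> i)" unfolding \<T>_def r_def using V(1)[OF i] Z(1)[OF i] by simp
    show "pairwise disjnt (\<T> i)"
    proof (rule pairwiseI)
      fix A B assume AB: "A \<in> \<T> i" "B \<in> \<T> i" "A \<noteq> B"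
      have 1: "disjnt (e i P) (e i Q)" if "P \<in> \<V> i" "Q \<in> \<V> i" "e i P \<noteq> e i Q" for P Q
      proof -
        have "disjnt P Q" using pairwiseD[OF V(2)[OF i] that(1,2)] that(3) by metis
        then show ?thesis
          using eV[OF i that(1)] eV[OF i that(2)] disjnt_subset1 disjnt_subset2 by metis
      qed
      have 2: "disjnt P Q" if "P \<in> r i" "Q \<in> r i" "P \<noteq> Q" for P Q
        using pairwiseD[OF Z(2)[OF i], of P Q] that unfolding r_def by simp
      consider (ee) P Q where "P \<in> \<V> i" "A = e i P" "Q \<in> \<V> i" "B = e i Q"
        | (er) P where "P \<in> \<V> i" "A = e i P" "B \<in> r i"
        | (re) Q where "A \<in> r i" "Q \<in> \<V> i" "B = e i Q"
        | (rr) "A \<in> r i" "B \<in> r i"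
        using AB(1,2) unfolding \<T>_def by blast
      then show "disjnt A B"
      proof cases
        case ee
        then show ?thesis using 1[of P Q] AB(3) by simp
      next
        case er
        then show ?thesis using \<open>\<And>Q V. V \<in> \<V> i \<Longrightarrow> Q \<in> r i \<Longrightarrow> disjnt (e i V) Q\<close> by simp
      next
        case re
        then show ?thesis
          using \<open>\<And>Q V. V \<in> \<V> i \<Longrightarrow> Q \<in> r i \<Longrightarrow> disjnt (e i V) Q\<close> disjnt_sym by metis
      next
        case rr
        then show ?thesis using 2 AB(3) by simp
      qed
    qed
    fix A assume A: "A \<in> \<T> i"
    show "openin X A"
      using A v(1) Z(3)[OF i] unfolding \<T>_def e_def r_def by (auto intro!: openin_Un openin_Union)
    show "\<exists>U\<in>\<U>. A \<subseteq> U"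
    proof (cases "A \<in> r i")
      case True
      then obtain Q where "Q \<in> \<O>" "A \<subseteq> Q" using Z(4)[OF i] unfolding r_def by blast
      then show ?thesis unfolding \<O>_def by blast
    next
      case False
      then obtain V where "V \<in> \<V> i" "A = e i V" using A unfolding \<T>_def by blast
      then show ?thesis using V(4)[OF i, of V] eV[OF i, of V] by (meson subset_trans)
    qed
  next
    show "Y1 \<union> Y2 \<subseteq> (\<Union>i<m. \<Union>(\<T> i))"
    proof
      fix y assume "y \<in> Y1 \<union> Y2"
      then consider "y \<in> Y1" | "y \<in> Y2" by blast
      then show "y \<in> (\<Union>i<m. \<Union>(\<T> i))"
      proof cases
        case 1
        then have "y \<in> (\<Union>V\<in>\<W>. v V)" by (rule subsetD[OF v(3)])
        then obtain V i where "i < m" "V \<in> \<V> i" "y \<in> v V" unfolding \<W>_def by auto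
        then have "y \<in> e i V" "e i V \<in> \<T> i" unfolding e_def \<T>_def by auto
        then show ?thesis using \<open>i < m\<close> by blast
      next
        case 2
        then have "y \<in> (\<Union>i<m. \<Union>(\<Z> i))" by (rule subsetD[OF Z(5)])
        then obtain Q i where Q: "i < m" "Q \<in> \<Z> i" "y \<in> Q" by auto
        have "\<exists>A\<in>\<T> i. y \<in> A"
        proof (cases "Q \<in> r i")
          case True
          then show ?thesis unfolding \<T>_def using Q by blast
        next
          case False
          then obtain V where "V \<in> \<V> i" "Q \<inter> v V \<noteq> {}" using Q unfolding r_def by blast
          then have "y \<in> e i V" "e i V \<in> \<T> i" unfolding e_def \<T>_def using Q by auto
          then show ?thesis by blast
        qed
        then show ?thesis using Q(1) by blast
      qed
    qed
  qed
qed

lemma colorable_UN: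
  assumes X: "compact_space X" "Hausdorff_space X" and "finite I"
    and "\<And>i. i \<in> I \<Longrightarrow> closedin X (Y i)" "\<And>i. i \<in> I \<Longrightarrow> colorable m X (Y i)"
  shows "colorable m X (\<Union>i\<in>I. Y i)"
  using assms(3-)
  by (induction I rule: finite_induct) (simp_all add: colorable_empty colorable_Un[OF X])

text \<open>This is the step of small inductive dimension. Finitely many small neighbourhoods whose
  boundaries need only \<open>m\<close> colours cover \<open>Y\<close>; each of them, diminished by
  the closures of its predecessors, becomes disjoint from the others, and only boundary points are
  lost. So one further colour is enough.\<close>

lemma colorable_Suc:
  assumes X: "compact_space X" "Hausdorff_space X" and Y: "closedin X Y"
    and small: "\<And>y W. y \<in> Y \<Longrightarrow> openin X W \<Longrightarrow> y \<in> W \<Longrightarrow>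
      \<exists>Q. openin X Q \<and> y \<in> Q \<and> Q \<subseteq> W \<and> colorable m X (Y \<inter> (X closure_of Q - Q))"
  shows "colorable (Suc m) X Y"
  unfolding colorable_def
proof clarify
  fix \<U> assume \<U>: "\<forall>U\<in>\<U>. openin X U" "topspace X \<subseteq> \<Union>\<U>"
  have "\<exists>Q. openin X Q \<and> y \<in> Q \<and> (\<exists>U\<in>\<U>. Q \<subseteq> U) \<and> colorable m X (Y \<inter> (X closure_of Q - Q))"
    if y: "y \<in> Y" for y
  proof -
    obtain U where "U \<in> \<U>" "y \<in> U" using y \<U>(2) closedin_subset[OF Y] by blast
    then show ?thesis using small[OF y, of U] \<U>(1) by blast
  qed
  then obtain Q where Q: "\<And>y. y \<in> Y \<Longrightarrow> openin X (Q y)" "\<And>y. y \<in> Y \<Longrightarrow> y \<in> Q y"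
    "\<And>y. y \<in> Y \<Longrightarrow> \<exists>U\<in>\<U>. Q y \<subseteq> U" "\<And>y. y \<in> Y \<Longrightarrow> colorable m X (Y \<inter> (X closure_of (Q y) - Q y))"
    by metis
  have "compactin X Y" using X(1) Y closedin_compact_space by blast
  then obtain \<F> where \<F>: "finite \<F>" "\<F> \<subseteq> Q ` Y" "Y \<subseteq> \<Union>\<F>"
    using Q(1,2) unfolding compactin_def by (metis (no_types, lifting) UN_I image_iff subsetI)
  then obtain F where F: "finite F" "F \<subseteq> Y" "\<F> = Q ` F"
    by (meson finite_subset_image)
  define k where "k = card F"
  obtain e where e: "bij_betw e {..<k} F"
    using ex_bij_betw_nat_finite[OF F(1)] unfolding k_def by (auto simp: atLeast0LessThan)
  define P where "P = (\<lambda>i. Q (e i))"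
  have eY: "e i \<in> Y" if "i < k" for i using e that F(2) by (auto simp: bij_betw_def)
  have YP: "Y \<subseteq> (\<Union>i<k. P i)"
    using \<F>(3) F(3) e unfolding P_def bij_betw_def by force
  have op: "openin X (P i)" if "i < k" for i unfolding P_def using Q(1)[OF eY[OF that]] .
  define Z where "Z = (\<Union>i<k. Y \<inter> (X closure_of (P i) - P i))"
  have "colorable m X Z"
    unfolding Z_def
  proof (rule colorable_UN[OF X])
    fix i assume "i \<in> {..<k}"
    then have "i < k" by simp
    then show "closedin X (Y \<inter> (X closure_of P i - P i))"
      using Y op by (intro closedin_Int closedin_diff) auto
    show "colorable m X (Y \<inter> (X closure_of P i - P i))"
      unfolding P_def using Q(4)[OF eY[OF \<open>i < k\<close>]] .
  qed simp
  note cZ = this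
  obtain \<V> :: "nat \<Rightarrow> 'a set set" where V: "\<And>i. i < m \<Longrightarrow> finite (\<V> i)"
    "\<And>i. i < m \<Longrightarrow> pairwise disjnt (\<V> i)" "\<And>i V. i < m \<Longrightarrow> V \<in> \<V> i \<Longrightarrow> openin X V"
    "\<And>i V. i < m \<Longrightarrow> V \<in> \<V> i \<Longrightarrow> \<exists>U\<in>\<U>. V \<subseteq> U" "Z \<subseteq> (\<Union>i<m. \<Union>(\<V> i))"
    by (rule colorableE[OF cZ \<U>(1)[rule_format] \<U>(2)]) (assumption | rule that; assumption)+
  \<comment> \<open>Closures, not the sets themselves, are removed to keep \<open>d i\<close> open;
    what is lost of \<open>Y\<close> lies on a boundary and hence in \<open>Z\<close>.\<close>
  define d where "d = (\<lambda>i. P i - (\<Union>l<i. X closure_of (P l)))"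
  define \<T> where "\<T> = (\<lambda>i. if i < m then \<V> i else d ` {..<k})"
  have PP: "P i \<subseteq> X closure_of (P i)" if "i < k" for i
    using closure_of_subset[OF openin_subset[OF op[OF that]]] .
  have dd: "disjnt (d i) (d j)" if "i < j" "j < k" for i j
    using that PP[of i] unfolding d_def disjnt_def by fastforce
  show "\<exists>\<V>. (\<forall>i<Suc m. finite (\<V> i) \<and> pairwise disjnt (\<V> i) \<and> (\<forall>V\<in>\<V> i. openin X V \<and> (\<exists>U\<in>\<U>. V \<subseteq> U))) \<and>
      Y \<subseteq> (\<Union>i<Suc m. \<Union>(\<V> i))"
  proof (intro exI[of _ \<T>] conjI allI impI ballI)
    fix i assume "i < Suc m"
    show "finite (\<T> i)" unfolding \<T>_def using V(1) by simp
    show "pairwise disjnt (\<T> i)"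
    proof (cases "i < m")
      case False
      have "pairwise disjnt (d ` {..<k})"
      proof (rule pairwiseI)
        fix A B assume "A \<in> d ` {..<k}" "B \<in> d ` {..<k}" "A \<noteq> B"
        then obtain a b where "A = d a" "B = d b" "a < k" "b < k" "a \<noteq> b" by blast
        then show "disjnt A B" using dd[of a b] dd[of b a] disjnt_sym by (cases "a < b") auto
      qed
      then show ?thesis using False by (simp add: \<T>_def)
    qed (simp add: \<T>_def V(2))
    fix A assume A: "A \<in> \<T> i"
    show "openin X A"
    proof (cases "i < m")
      case True then show ?thesis using A V(3) by (simp add: \<T>_def)
    next
      case False
      then obtain a where "a < k" "A = d a" using A by (auto simp: \<T>_def)
      then show ?thesis unfolding d_def using op by (auto intro!: openin_diff closedin_Union)
    qed
    show "\<exists>U\<in>\<U>. A \<subseteq> U"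
    proof (cases "i < m")
      case True then show ?thesis using A V(4) by (simp add: \<T>_def)
    next
      case False
      then obtain a where "a < k" "A = d a" using A by (auto simp: \<T>_def)
      then show ?thesis using Q(3)[OF eY[OF \<open>a < k\<close>]] unfolding d_def P_def by blast
    qed
  next
    show "Y \<subseteq> (\<Union>i<Suc m. \<Union>(\<T> i))"
    proof
      fix y assume y: "y \<in> Y"
      show "y \<in> (\<Union>i<Suc m. \<Union>(\<T> i))"
      proof (cases "y \<in> Z")
        case True
        then obtain i V where "i < m" "V \<in> \<V> i" "y \<in> V" using V(5) by blast
        then show ?thesis unfolding \<T>_def by (intro UN_I[of i]) auto
      next
        case False
        \<comment> \<open>For the first index whose closure contains \<open>y\<close>, being off all
          boundaries puts \<open>y\<close> into \<open>P j\<close> itself, and no earlier closure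
          contains it.\<close>
        define j where "j = (LEAST i. i < k \<and> y \<in> X closure_of (P i))"
        have "\<exists>i. i < k \<and> y \<in> X closure_of (P i)" using YP y PP by blast
        from LeastI_ex[OF this] have j: "j < k" "y \<in> X closure_of (P j)" unfolding j_def by auto
        have "y \<in> P j" using False j y unfolding Z_def by blast
        moreover have "y \<notin> X closure_of (P l)" if "l < j" for l
          using not_less_Least[of l "\<lambda>i. i < k \<and> y \<in> X closure_of (P i)"] that j(1) unfolding j_def by auto
        ultimately have "y \<in> d j" unfolding d_def by blast
        then show ?thesis using j(1) unfolding \<T>_def by (intro UN_I[of m]) auto
      qed
    qed
  qed
qed

text \<open>A small box is centred at a point of \<open>K\<close>. In the directions of
  \<open>J\<close> all of \<open>K\<close> has the coordinates of that centre, so \<open>K\<close>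
  meets the boundary of the box only in faces orthogonal to other directions, and on such a face one
  coordinate more is fixed. The number of colours is one more than the number of free
  coordinates.\<close>

lemma colorable_chart_slice:
  fixes \<phi> :: "'a \<Rightarrow> 'e::euclidean_space"
  assumes X: "compact_space M" "Hausdorff_space M" and ch: "convex_chart M B \<phi> \<psi> D"
    and "compact K" "K \<subseteq> D" "J \<subseteq> Basis" "\<And>z b. z \<in> K \<Longrightarrow> b \<in> J \<Longrightarrow> z \<bullet> b = a b"
  shows "colorable (Suc (DIM('e) - card J)) M (\<psi> ` K)"
  using assms(4-)
proof (induction "DIM('e) - card J" arbitrary: J K a)
  \<comment> \<open>Both cases of the induction share this step; for \<open>J = Basis\<close> there
    is no face to treat and the hypothesis on faces is vacuous.\<close>
  have step: "colorable (Suc m) M (\<psi> ` K)"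
    if K: "compact K" "K \<subseteq> D" and J: "J \<subseteq> Basis" "\<And>z b. z \<in> K \<Longrightarrow> b \<in> J \<Longrightarrow> z \<bullet> b = a b"
      and face: "\<And>b c L. b \<in> Basis - J \<Longrightarrow> compact L \<Longrightarrow> L \<subseteq> K \<Longrightarrow> (\<And>z. z \<in> L \<Longrightarrow> z \<bullet> b = c) \<Longrightarrow>
          colorable m M (\<psi> ` L)"
    for m K J and a :: "'e \<Rightarrow> real"
  proof (rule colorable_Suc[OF X])
    show "closedin M (\<psi> ` K)"
      using convex_chart_compactin[OF ch K] X(2) compactin_imp_closedin by blast
    fix y W assume y: "y \<in> \<psi> ` K" "openin M W" "y \<in> W"
    then obtain z0 where z0: "z0 \<in> K" "y = \<psi> z0" by blast
    have "open {z \<in> D. \<psi> z \<in> W}" "z0 \<in> {z \<in> D. \<psi> z \<in> W}"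
      using convex_chart_open_preimage[OF ch y(2)] z0 K y by auto
    then obtain \<epsilon> where \<epsilon>: "0 < \<epsilon>" "ball z0 \<epsilon> \<subseteq> {z \<in> D. \<psi> z \<in> W}"
      using openE by blast
    \<comment> \<open>The norm is at most the sum of the absolute coordinates, so a box of this
      half-width lies in the ball of radius \<open>\<epsilon>\<close>; the factor 2 makes the
      inequality strict.\<close>
    define r where "r = \<epsilon> / (2 * DIM('e))"
    have r: "0 < r" unfolding r_def using \<epsilon>(1) by simp
    define I where "I = {z. \<forall>b\<in>Basis. \<bar>z \<bullet> b - z0 \<bullet> b\<bar> < r}"
    define I' where "I' = {z. \<forall>b\<in>Basis. \<bar>z \<bullet> b - z0 \<bullet> b\<bar> \<le> r}"
    have I: "I = box (z0 - r *\<^sub>R One) (z0 + r *\<^sub>R One)"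
      unfolding I_def by (auto simp: mem_box algebra_simps abs_less_iff)
    have I': "I' = cbox (z0 - r *\<^sub>R One) (z0 + r *\<^sub>R One)"
      unfolding I'_def by (auto simp: mem_box algebra_simps abs_le_iff)
    have sub: "I' \<subseteq> {z \<in> D. \<psi> z \<in> W}"
    proof
      fix z assume "z \<in> I'"
      then have z: "\<bar>(z - z0) \<bullet> b\<bar> \<le> r" if "b \<in> Basis" for b
        using that unfolding I'_def by (simp add: inner_diff_left)
      have "norm (z - z0) \<le> (\<Sum>b\<in>Basis. \<bar>(z - z0) \<bullet> b\<bar>)"
        by (rule norm_le_l1)
      also have "\<dots> \<le> (\<Sum>b\<in>(Basis :: 'e set). r)"
        by (rule sum_mono) (rule z)
      also have "\<dots> < \<epsilon>" unfolding r_def using \<epsilon>(1) by simp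
      finally show "z \<in> {z \<in> D. \<psi> z \<in> W}" using \<epsilon>(2) by (auto simp: dist_norm norm_minus_commute)
    qed
    have II': "I \<subseteq> I'" unfolding I_def I'_def by fastforce
    have "convex_chart M (\<psi> ` I) \<phi> \<psi> I"
      using convex_chart_mono[OF ch, of I] sub II' unfolding I by (auto simp: open_box)
    then have op: "openin M (\<psi> ` I)" by (rule convex_chartD(1))
    have "compact I'" "I' \<subseteq> D" using sub unfolding I' by auto
    then have "closedin M (\<psi> ` I')"
      using convex_chart_compactin[OF ch, of I'] X(2) compactin_imp_closedin by blast
    then have cl: "M closure_of (\<psi> ` I) \<subseteq> \<psi> ` I'"
      using closure_of_minimal[of "\<psi> ` I" "\<psi> ` I'"] II' by (simp add: image_mono)
    define L where "L = (\<lambda>(b, s). {z \<in> K. z \<in> I' \<and> z \<bullet> b = z0 \<bullet> b + s})"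
    have L: "compact (L p)" "L p \<subseteq> K" for p
    proof -
      have "L p = K \<inter> I' \<inter> {z. fst p \<bullet> z = z0 \<bullet> fst p + snd p}"
        unfolding L_def by (auto simp: inner_commute split: prod.splits)
      then show "compact (L p)" unfolding I' using K(1)
        by (metis closed_cbox closed_hyperplane compact_Int_closed)
      show "L p \<subseteq> K" unfolding L_def by (auto split: prod.splits)
    qed
    have "\<psi> ` K \<inter> (M closure_of (\<psi> ` I) - \<psi> ` I) \<subseteq> (\<Union>p\<in>(Basis - J) \<times> {r, -r}. \<psi> ` L p)"
    proof
      fix x assume x: "x \<in> \<psi> ` K \<inter> (M closure_of (\<psi> ` I) - \<psi> ` I)"
      then obtain z z' where z: "z \<in> K" "x = \<psi> z" "z' \<in> I'" "x = \<psi> z'" using cl by blast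
      have "z \<in> D" "z' \<in> D" using z sub K(2) by blast+
      then have "z = z'" using z(2,4) convex_chartD(8)[OF ch] by metis
      then have "z \<in> I'" "z \<notin> I" using z x by auto
      then obtain b where b: "b \<in> Basis" "\<bar>z \<bullet> b - z0 \<bullet> b\<bar> = r"
        unfolding I_def I'_def by (auto simp: not_less intro: antisym)
      have "b \<notin> J"
      proof
        assume "b \<in> J"
        then have "z \<bullet> b = z0 \<bullet> b" using J(2) z(1) z0(1) by metis
        then show False using b(2) r by simp
      qed
      moreover define s where "s = z \<bullet> b - z0 \<bullet> b"
      moreover have "s \<in> {r, -r}" "z \<bullet> b = z0 \<bullet> b + s"
        using b(2) unfolding s_def by (auto simp: abs_if split: if_splits)
      ultimately show "x \<in> (\<Union>p\<in>(Basis - J) \<times> {r, -r}. \<psi> ` L p)"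
        using b(1) z(1,2) \<open>z \<in> I'\<close> unfolding L_def by (intro UN_I[of "(b, s)"]) auto
    qed
    moreover have "colorable m M (\<Union>p\<in>(Basis - J) \<times> {r, -r}. \<psi> ` L p)"
    proof (rule colorable_UN[OF X])
      fix p assume p: "p \<in> (Basis - J) \<times> {r, -r}"
      show "closedin M (\<psi> ` L p)"
        using convex_chart_compactin[OF ch L(1)[of p]] L(2)[of p] K(2) X(2) compactin_imp_closedin by blast
      show "colorable m M (\<psi> ` L p)"
        by (rule face[of "fst p" _ "z0 \<bullet> fst p + snd p"]) (use p L in \<open>auto simp: L_def split: prod.splits\<close>)
    qed simp
    ultimately have "colorable m M (\<psi> ` K \<inter> (M closure_of (\<psi> ` I) - \<psi> ` I))"
      by (metis colorable_subset)
    moreover have "y \<in> \<psi> ` I" unfolding I_def using z0 r by auto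
    ultimately show "\<exists>Q. openin M Q \<and> y \<in> Q \<and> Q \<subseteq> W \<and> colorable m M (\<psi> ` K \<inter> (M closure_of Q - Q))"
      using op sub II' by blast
  qed
  {
    case 0
    have "card J = DIM('e)" using 0 card_mono[of Basis J] by simp
    then have J: "J = Basis" using card_subset_eq[OF finite_Basis 0(4)] by simp
    have "colorable (Suc 0) M (\<psi> ` K)"
      by (rule step[OF 0(2-5)]) (simp_all add: J)
    then show ?case using 0(1) by simp
  next
    case (Suc n)
    have "colorable (Suc (Suc n)) M (\<psi> ` K)"
    proof (rule step[of K J a])
      fix b c L assume b: "b \<in> Basis - J" and L: "compact L" "L \<subseteq> K" "\<And>z. z \<in> L \<Longrightarrow> z \<bullet> b = c"
      have "finite J" using Suc.prems(3) finite_subset finite_Basis by blast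
      then have "n = DIM('e) - card (insert b J)" using Suc.hyps(2) b by simp
      have val: "z \<bullet> b' = (a(b := c)) b'" if "z \<in> L" "b' \<in> insert b J" for z b'
        using that L(2,3) Suc.prems(4)[of z b'] by (cases "b' = b") auto
      have sub: "L \<subseteq> D" "insert b J \<subseteq> Basis" using L(2) b Suc.prems(2,3) by blast+
      show "colorable (Suc n) M (\<psi> ` L)"
        using Suc.hyps(1)[OF \<open>n = _\<close> L(1) sub val] \<open>n = _\<close> by simp
    qed (use Suc.prems in auto)
    then show ?case using Suc.hyps(2) by simp
  }
qed

text \<open>A sphere of \<open>infnorm\<close> is the boundary of a cube, contained in
  \<open>2 * DIM('e)\<close> coordinate hyperplanes; on each of them one coordinate is fixed, which
  saves one colour.\<close>

lemma colorable_cube_boundary: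
  fixes \<phi> :: "'a \<Rightarrow> 'e::euclidean_space"
  assumes X: "compact_space M" "Hausdorff_space M" and ch: "convex_chart M B \<phi> \<psi> D"
    and K: "compact K" "K \<subseteq> D" and r: "\<And>z. z \<in> K \<Longrightarrow> infnorm (z - c) = r"
  shows "colorable DIM('e) M (\<psi> ` K)"
proof -
  define L where "L = (\<lambda>(b, s). {z \<in> K. z \<bullet> b = c \<bullet> b + s})"
  have L: "compact (L p)" "L p \<subseteq> K" for p
  proof -
    have "L p = K \<inter> {z. fst p \<bullet> z = c \<bullet> fst p + snd p}"
      unfolding L_def by (auto simp: inner_commute split: prod.splits)
    then show "compact (L p)" using K(1) by (metis closed_hyperplane compact_Int_closed)
    show "L p \<subseteq> K" unfolding L_def by (auto split: prod.splits)
  qed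
  have "\<psi> ` K \<subseteq> (\<Union>p\<in>Basis \<times> {r, -r}. \<psi> ` L p)"
  proof
    fix x assume "x \<in> \<psi> ` K"
    then obtain z where z: "z \<in> K" "x = \<psi> z" by blast
    have "infnorm (z - c) \<in> (\<lambda>i. \<bar>(z - c) \<bullet> i\<bar>) ` Basis"
      unfolding infnorm_Max by (rule Max_in) auto
    then obtain b where b: "b \<in> Basis" "\<bar>(z - c) \<bullet> b\<bar> = r" using r[OF z(1)] by auto
    define s where "s = z \<bullet> b - c \<bullet> b"
    have "s \<in> {r, -r}" "z \<bullet> b = c \<bullet> b + s"
      using b(2) unfolding s_def by (auto simp: inner_diff_left abs_if split: if_splits)
    then show "x \<in> (\<Union>p\<in>Basis \<times> {r, -r}. \<psi> ` L p)"
      using b(1) z unfolding L_def by (intro UN_I[of "(b, s)"]) auto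
  qed
  moreover have "colorable DIM('e) M (\<Union>p\<in>Basis \<times> {r, -r}. \<psi> ` L p)"
  proof (rule colorable_UN[OF X])
    fix p :: "'e \<times> real" assume p: "p \<in> Basis \<times> {r, -r}"
    show "closedin M (\<psi> ` L p)"
      using convex_chart_compactin[OF ch L(1)[of p]] L(2)[of p] K(2) X(2) compactin_imp_closedin by blast
    have "colorable (Suc (DIM('e) - card {fst p})) M (\<psi> ` L p)"
      by (rule colorable_chart_slice[OF X ch L(1), where a = "\<lambda>b. c \<bullet> b + snd p"])
        (use p L K in \<open>auto simp: L_def split: prod.splits\<close>)
    then show "colorable DIM('e) M (\<psi> ` L p)" by simp
  qed simp
  ultimately show ?thesis by (metis colorable_subset)
qed

section \<open>Pushing along segments\<close>

text \<open>The affine coordinate of the orthogonal projection to the line through \<open>x\<close>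
  and \<open>y\<close>, with \<open>x\<close> at 0 and \<open>y\<close> at 1.\<close>

definition proj_coord :: "'e::euclidean_space \<Rightarrow> 'e \<Rightarrow> 'e \<Rightarrow> real"
  where "proj_coord x y z = ((z - x) \<bullet> (y - x)) / ((y - x) \<bullet> (y - x))"

lemma proj_coord_add:
  assumes "x \<noteq> y"
  shows "proj_coord x y (z + a *\<^sub>R (y - x)) = proj_coord x y z + a"
proof -
  have "(y - x) \<bullet> (y - x) \<noteq> 0" using assms by simp
  moreover have "(z + a *\<^sub>R (y - x) - x) \<bullet> (y - x) = (z - x) \<bullet> (y - x) + a * ((y - x) \<bullet> (y - x))"
    by (simp add: inner_diff_left inner_add_left)
  ultimately show ?thesis
    unfolding proj_coord_def by (metis add_divide_distrib nonzero_mult_div_cancel_right)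
qed

lemma proj_coord_segment:
  assumes "x \<noteq> y" "0 \<le> u" "u \<le> 1"
  shows "proj_coord x y ((1 - u) *\<^sub>R x + u *\<^sub>R y) = u"
proof -
  have "(1 - u) *\<^sub>R x + u *\<^sub>R y = x + u *\<^sub>R (y - x)" by (simp add: algebra_simps)
  moreover have "proj_coord x y x = 0" by (simp add: proj_coord_def)
  ultimately show ?thesis using proj_coord_add[OF assms(1), of x u] by simp
qed

lemma proj_coord_ends: "x \<noteq> y \<Longrightarrow> proj_coord x y x = 0" "x \<noteq> y \<Longrightarrow> proj_coord x y y = 1"
  by (simp_all add: proj_coord_def)

lemma continuous_on_proj_coord: "continuous_on A (proj_coord x y)"
  unfolding proj_coord_def divide_inverse by (intro continuous_intros)

text \<open>Points near the segment are shifted in the direction \<open>y - x\<close>, by a length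
  that is cut off with the distance from the line and with the coordinate along it. The profile is
  chosen such that no shift is backward and that only \<open>x\<close> is shifted to
  \<open>y\<close>.\<close>

lemma segment_push:
  fixes x y :: "'e::euclidean_space"
  assumes xy: "x \<noteq> y" and Q: "open Q" "closed_segment x y \<subseteq> Q"
  obtains S P where "compact S" "convex S" "closed_segment x y \<subseteq> S" "S \<subseteq> Q"
    "continuous_on UNIV P" "P ` S \<subseteq> S" "\<And>z. z \<notin> S \<Longrightarrow> P z = z"
    "P x = y" "\<And>z. P z = y \<Longrightarrow> z = x"
    "\<And>z. P z \<noteq> z \<Longrightarrow> proj_coord x y z < proj_coord x y (P z)"
    "\<And>z. z \<in> closed_segment x y \<Longrightarrow> P z \<noteq> z"
proof -
  define v where "v = y - x"
  have v: "v \<noteq> 0" using xy unfolding v_def by simp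
  let ?\<sigma> = "proj_coord x y"
  define w where "w = (\<lambda>z. z - x - ?\<sigma> z *\<^sub>R v)"
  obtain \<delta> where \<delta>: "0 < \<delta>" "{z. infdist z (closed_segment x y) \<le> \<delta>} \<subseteq> Q"
    using compact_in_open_separated[of "closed_segment x y" Q] Q by auto
  \<comment> \<open>A point of \<open>S\<close> is off the segment by at most
    \<open>\<epsilon> * norm v\<close> along the line and \<open>\<epsilon>\<close> across it, in
    total by at most \<open>\<delta>\<close>.\<close>
  define \<epsilon> where "\<epsilon> = \<delta> / (1 + norm v)"
  have "0 < 1 + norm v" by (simp add: add_pos_nonneg)
  then have \<epsilon>: "0 < \<epsilon>" "\<epsilon> * (1 + norm v) = \<delta>"
    unfolding \<epsilon>_def using \<delta>(1) by simp_all
  define \<mu> where "\<mu> = (\<lambda>z. max 0 (1 - norm (w z) / \<epsilon>))"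
  \<comment> \<open>A tent with value 1 at 0 and zeros at \<open>- \<epsilon>\<close> and
    \<open>1 + \<epsilon>\<close>. On its two slopes \<open>s + m s - 1\<close> is a positive
    multiple of \<open>s\<close>, and \<open>m 1\<close> is positive; so only the coordinate 0 is
    moved to 1.\<close>
  define m where "m = (\<lambda>s::real. max 0 (min (1 + s / \<epsilon>) (1 - s / (1 + \<epsilon>))))"
  define P where "P = (\<lambda>z. z + (\<mu> z * m (?\<sigma> z)) *\<^sub>R v)"
  define S where "S = {z. - \<epsilon> \<le> ?\<sigma> z \<and> ?\<sigma> z \<le> 1 + \<epsilon> \<and> norm (w z) \<le> \<epsilon>}"
  have \<sigma>_add: "?\<sigma> (z + a *\<^sub>R v) = ?\<sigma> z + a" for z a
    unfolding v_def by (rule proj_coord_add[OF xy])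
  have w_add: "w (z + a *\<^sub>R v) = w z" for z a
    unfolding w_def \<sigma>_add by (simp add: algebra_simps)
  have \<sigma>P: "?\<sigma> (P z) = ?\<sigma> z + \<mu> z * m (?\<sigma> z)" and wP: "w (P z) = w z" for z
    unfolding P_def by (simp_all add: \<sigma>_add w_add)
  have zw: "z = x + ?\<sigma> z *\<^sub>R v + w z" for z unfolding w_def by simp
  have \<mu>: "0 \<le> \<mu> z" "\<mu> z \<le> 1" for z unfolding \<mu>_def using \<epsilon>(1) by auto
  have m: "0 \<le> m s" for s unfolding m_def by simp
  have mS: "s + m s \<le> 1 + \<epsilon>" if "- \<epsilon> \<le> s" "s \<le> 1 + \<epsilon>" for s
  proof -
    have "s + (1 - s / (1 + \<epsilon>)) \<le> 1 + \<epsilon>"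
    proof -
      define u where "u = s / (1 + \<epsilon>)"
      have u: "u \<le> 1" "s = u * (1 + \<epsilon>)" using \<epsilon>(1) \<open>s \<le> 1 + \<epsilon>\<close> unfolding u_def by simp_all
      have "u * \<epsilon> \<le> 1 * \<epsilon>" using u(1) \<epsilon>(1) by (intro mult_right_mono) auto
      moreover have "s = u + u * \<epsilon>" unfolding u(2) by (simp add: algebra_simps)
      ultimately show ?thesis unfolding u_def[symmetric] by linarith
    qed
    moreover have "s + (1 + s / \<epsilon>) \<le> 1 + \<epsilon>" if "s < 0"
    proof -
      have "s / \<epsilon> < 0" using \<epsilon>(1) that by (rule divide_neg_pos[rotated])
      then show ?thesis using that \<epsilon>(1) by linarith
    qed
    ultimately show ?thesis unfolding m_def using that \<epsilon>(1) by (cases "0 \<le> s") auto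
  qed
  have \<sigma>c: "continuous_on UNIV ?\<sigma>" by (rule continuous_on_proj_coord)
  have wc: "continuous_on UNIV w" unfolding w_def by (intro continuous_intros \<sigma>c)
  have "continuous_on UNIV P"
    unfolding P_def \<mu>_def m_def using \<epsilon>(1) by (intro continuous_intros \<sigma>c wc) auto
  moreover have "P z = z" if "z \<notin> S" for z
  proof -
    have "m (?\<sigma> z) = 0 \<or> \<mu> z = 0"
    proof -
      consider "?\<sigma> z < - \<epsilon>" | "?\<sigma> z > 1 + \<epsilon>" | "norm (w z) > \<epsilon>"
        using \<open>z \<notin> S\<close> unfolding S_def by (auto simp: not_le)
      then show ?thesis
      proof cases
        case 1
        then have "?\<sigma> z / \<epsilon> < - 1" using \<epsilon>(1) by (simp add: divide_less_eq)
        then show ?thesis unfolding m_def by simp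
      next
        case 2
        then have "?\<sigma> z / (1 + \<epsilon>) > 1" using \<epsilon>(1) by (simp add: less_divide_eq)
        then show ?thesis unfolding m_def by simp
      next
        case 3
        then have "norm (w z) / \<epsilon> > 1" using \<epsilon>(1) by (simp add: less_divide_eq)
        then show ?thesis unfolding \<mu>_def by simp
      qed
    qed
    then show ?thesis unfolding P_def by auto
  qed
  moreover have "P ` S \<subseteq> S"
  proof
    fix p assume "p \<in> P ` S"
    then obtain z where z: "z \<in> S" "p = P z" by blast
    have "0 \<le> \<mu> z * m (?\<sigma> z)" "\<mu> z * m (?\<sigma> z) \<le> m (?\<sigma> z)"
      using \<mu>[of z] m[of "?\<sigma> z"] by (auto simp: mult_left_le_one_le)
    then show "p \<in> S"
      using z(1) mS[of "?\<sigma> z"] unfolding z(2) S_def by (auto simp: \<sigma>P wP)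
  qed
  moreover have "P x = y"
    unfolding P_def \<mu>_def m_def w_def using xy by (simp add: proj_coord_ends v_def)
  moreover have "z = x" if "P z = y" for z
  proof -
    have "w y = 0" unfolding w_def using xy by (simp add: proj_coord_ends v_def)
    then have wz: "w z = 0" using wP[of z] that by simp
    then have "\<mu> z = 1" unfolding \<mu>_def by simp
    then have eq: "?\<sigma> z + m (?\<sigma> z) = 1" using \<sigma>P[of z] that xy by (simp add: proj_coord_ends)
    have "?\<sigma> z = 0"
    proof (rule ccontr)
      assume nz: "?\<sigma> z \<noteq> 0"
      have "m (?\<sigma> z) = 0 \<or> m (?\<sigma> z) = 1 + ?\<sigma> z / \<epsilon> \<or> m (?\<sigma> z) = 1 - ?\<sigma> z / (1 + \<epsilon>)"
        unfolding m_def by (auto simp: max_def min_def)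
      then consider "m (?\<sigma> z) = 0" | "m (?\<sigma> z) = 1 + ?\<sigma> z / \<epsilon>" | "m (?\<sigma> z) = 1 - ?\<sigma> z / (1 + \<epsilon>)"
        by blast
      then show False
      proof cases
        case 1
        then have "?\<sigma> z = 1" using eq by simp
        then show False using 1 \<epsilon>(1) unfolding m_def by (simp add: max_def min_def field_simps split: if_splits)
      next
        case 2
        then have "?\<sigma> z * (1 + 1 / \<epsilon>) = 0" using eq by (simp add: algebra_simps)
        moreover have "1 + 1 / \<epsilon> > 0" using \<epsilon>(1) by (simp add: add_pos_pos)
        ultimately show False using nz by simp
      next
        case 3
        then have "?\<sigma> z * (1 - 1 / (1 + \<epsilon>)) = 0" using eq by (simp add: algebra_simps)
        moreover have "1 - 1 / (1 + \<epsilon>) > 0" using \<epsilon>(1) by simp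
        ultimately show False using nz by simp
      qed
    qed
    then show "z = x" using zw[of z] wz by simp
  qed
  moreover have "?\<sigma> z < ?\<sigma> (P z)" if "P z \<noteq> z" for z
  proof -
    have "\<mu> z * m (?\<sigma> z) \<noteq> 0" using that unfolding P_def by auto
    then show ?thesis using \<sigma>P[of z] \<mu>(1)[of z] m[of "?\<sigma> z"] by (simp add: less_le)
  qed
  moreover have seg: "0 \<le> ?\<sigma> z \<and> ?\<sigma> z \<le> 1 \<and> w z = 0" if "z \<in> closed_segment x y" for z
  proof -
    obtain u where u: "z = (1 - u) *\<^sub>R x + u *\<^sub>R y" "0 \<le> u" "u \<le> 1"
      using \<open>z \<in> closed_segment x y\<close> unfolding closed_segment_def by blast
    then have su: "?\<sigma> z = u" using proj_coord_segment[OF xy] by simp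
    have "w z = z - x - u *\<^sub>R v" unfolding w_def su ..
    also have "\<dots> = 0" unfolding u(1) v_def by (simp add: algebra_simps)
    finally show ?thesis using u(2,3) su by simp
  qed
  moreover have "P z \<noteq> z" if "z \<in> closed_segment x y" for z
  proof -
    have s: "0 \<le> ?\<sigma> z" "?\<sigma> z \<le> 1" "w z = 0" using seg[OF that] by auto
    have "?\<sigma> z / (1 + \<epsilon>) < 1" using s \<epsilon>(1) by simp
    moreover have "0 \<le> ?\<sigma> z / \<epsilon>" using s \<epsilon>(1) by simp
    ultimately have "0 < m (?\<sigma> z)" unfolding m_def by simp
    moreover have "\<mu> z = 1" unfolding \<mu>_def s(3) by simp
    ultimately show ?thesis unfolding P_def using v by simp
  qed
  moreover have "closed_segment x y \<subseteq> S"
    unfolding S_def using seg \<epsilon>(1) by fastforce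
  moreover have "convex S"
  proof (rule convexI)
    fix a b u t assume ab: "a \<in> S" "b \<in> S" and ut: "0 \<le> u" "0 \<le> t" "u + t = (1::real)"
    have t: "t = 1 - u" using ut by simp
    have "u *\<^sub>R a + t *\<^sub>R b - x = u *\<^sub>R (a - x) + t *\<^sub>R (b - x)"
      unfolding t by (simp add: algebra_simps)
    then have \<sigma>: "?\<sigma> (u *\<^sub>R a + t *\<^sub>R b) = u * ?\<sigma> a + t * ?\<sigma> b"
      unfolding proj_coord_def by (simp add: inner_add_left add_divide_distrib)
    have w: "w (u *\<^sub>R a + t *\<^sub>R b) = u *\<^sub>R w a + t *\<^sub>R w b"
      unfolding w_def \<sigma> unfolding t by (simp add: algebra_simps)
    have "norm (w (u *\<^sub>R a + t *\<^sub>R b)) \<le> u * norm (w a) + t * norm (w b)"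
      unfolding w using ut norm_triangle_ineq[of "u *\<^sub>R w a" "t *\<^sub>R w b"] by simp
    also have "\<dots> \<le> \<epsilon>"
      by (rule convex_bound_le) (use ab ut in \<open>auto simp: S_def\<close>)
    finally have 1: "norm (w (u *\<^sub>R a + t *\<^sub>R b)) \<le> \<epsilon>" .
    have 2: "u * ?\<sigma> a + t * ?\<sigma> b \<le> 1 + \<epsilon>"
      by (rule convex_bound_le) (use ab ut in \<open>auto simp: S_def\<close>)
    have "u * (- ?\<sigma> a) + t * (- ?\<sigma> b) \<le> \<epsilon>"
      by (rule convex_bound_le) (use ab ut in \<open>auto simp: S_def\<close>)
    then show "u *\<^sub>R a + t *\<^sub>R b \<in> S"
      using 1 2 \<sigma> unfolding S_def by simp
  qed
  moreover have "S \<subseteq> Q"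
  proof
    fix z assume z: "z \<in> S"
    \<comment> \<open>The coordinate is clamped to the segment, which changes it by at most
      \<open>\<epsilon>\<close>.\<close>
    define c where "c = max 0 (min 1 (?\<sigma> z))"
    have c: "0 \<le> c" "c \<le> 1" "\<bar>?\<sigma> z - c\<bar> \<le> \<epsilon>"
      using z \<epsilon>(1) unfolding c_def S_def by auto
    have "x + c *\<^sub>R v \<in> closed_segment x y"
      unfolding closed_segment_def using c(1,2) by (auto simp: v_def algebra_simps intro!: exI[of _ c])
    then have "infdist z (closed_segment x y) \<le> dist z (x + c *\<^sub>R v)" by (rule infdist_le)
    also have "\<dots> = norm ((?\<sigma> z - c) *\<^sub>R v + w z)"
      unfolding dist_norm w_def by (simp add: algebra_simps)
    also have "\<dots> \<le> \<bar>?\<sigma> z - c\<bar> * norm v + norm (w z)"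
      using norm_triangle_ineq[of "(?\<sigma> z - c) *\<^sub>R v" "w z"] by simp
    also have "\<dots> \<le> \<epsilon> * norm v + \<epsilon>"
      using c(3) z unfolding S_def by (intro add_mono mult_right_mono) auto
    also have "\<dots> = \<delta>" using \<epsilon>(2) by (simp add: algebra_simps)
    finally show "z \<in> Q" using \<delta>(2) by blast
  qed
  moreover have "compact S"
  proof (rule compact_eq_bounded_closed[THEN iffD2, OF conjI])
    show "closed S"
      unfolding S_def Collect_conj_eq
      by (intro closed_Int closed_Collect_le continuous_intros \<sigma>c wc)
    have "norm z \<le> norm x + (1 + \<epsilon>) * norm v + \<epsilon>" if z: "z \<in> S" for z
    proof -
      have "norm z \<le> norm (x + ?\<sigma> z *\<^sub>R v) + norm (w z)"
        by (subst zw[of z]) (rule norm_triangle_ineq)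
      also have "\<dots> \<le> (norm x + \<bar>?\<sigma> z\<bar> * norm v) + norm (w z)"
        using norm_triangle_ineq[of x "?\<sigma> z *\<^sub>R v"] by simp
      also have "\<dots> \<le> (norm x + (1 + \<epsilon>) * norm v) + \<epsilon>"
        using z \<epsilon>(1) unfolding S_def by (intro add_mono mult_right_mono) auto
      finally show ?thesis .
    qed
    then show "bounded S" unfolding bounded_iff by blast
  qed
  ultimately show thesis using that[of S P] by blast
qed

section \<open>Moves inside charts\<close>

locale manifold_form = closed_manifold M \<A>
  for M :: "'a topology" and \<A> :: "('a set \<times> ('a \<Rightarrow> 'e::euclidean_space)) set" +
  fixes \<omega> :: "('a set \<times> ('a \<Rightarrow> real)) set"
  assumes form: "closed_one_form M \<omega>" and nonempty: "topspace M \<noteq> {}"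
begin

text \<open>The domain lies in a single member of the form, so \<open>f\<close> is a primitive on
  the whole chart and a move inside it has an explicit integral.\<close>

definition form_chart :: "'a set \<Rightarrow> ('a \<Rightarrow> 'e) \<Rightarrow> ('e \<Rightarrow> 'a) \<Rightarrow> 'e set \<Rightarrow> ('a \<Rightarrow> real) \<Rightarrow> bool"
  where "form_chart B \<phi> \<psi> D f \<longleftrightarrow> convex_chart M B \<phi> \<psi> D \<and> (\<exists>V. (V, f) \<in> \<omega> \<and> B \<subseteq> V)"

lemma form_chart_convex: "form_chart B \<phi> \<psi> D f \<Longrightarrow> convex_chart M B \<phi> \<psi> D"
  by (simp add: form_chart_def)

lemmas form_chartD = convex_chartD[OF form_chart_convex]

lemma form_chart_exists:
  assumes "openin M W" "x \<in> W"
  shows "\<exists>B \<phi> \<psi> r f. 0 < r \<and> form_chart B \<phi> \<psi> (ball (\<phi> x) r) f \<and> x \<in> B \<and> B \<subseteq> W"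
proof -
  obtain V f where V: "(V, f) \<in> \<omega>" "x \<in> V"
    using closed_one_form_cover[OF form] openin_subset[OF assms(1)] assms(2) by blast
  have "openin M (W \<inter> V)" using assms(1) closed_one_form_openin[OF form V(1)] by blast
  from chart_exists[OF this, of x] V assms(2) show ?thesis
    unfolding form_chart_def by blast
qed

lemma form_chart_continuous:
  assumes "form_chart B \<phi> \<psi> D f"
  shows "continuous_map (subtopology M B) euclideanreal f"
  using assms closed_one_form_continuous[OF form] continuous_map_from_subtopology_mono
  unfolding form_chart_def by blast

lemma form_chart_bounded:
  assumes "form_chart B \<phi> \<psi> D f" "compact S" "S \<subseteq> D"
  obtains b where "0 \<le> b" "\<And>z. z \<in> S \<Longrightarrow> \<bar>f (\<psi> z)\<bar> \<le> b"
proof -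
  have "compactin M (\<psi> ` S)"
    using convex_chart_compactin[OF form_chart_convex[OF assms(1)] assms(2,3)] .
  moreover have "\<psi> ` S \<subseteq> B" using form_chartD(6)[OF assms(1)] assms(3) by blast
  ultimately have "compactin (subtopology M B) (\<psi> ` S)" by (simp add: compactin_subtopology)
  then have "compactin euclideanreal (f ` \<psi> ` S)"
    using image_compactin form_chart_continuous[OF assms(1)] by blast
  then have "bounded (f ` \<psi> ` S)" using compact_imp_bounded by simp
  then obtain b where "\<forall>x\<in>f ` \<psi> ` S. \<bar>x\<bar> \<le> b" unfolding bounded_iff by auto
  then show thesis using that[of "\<bar>b\<bar>"] by fastforce
qed

lemma form_chart_move:
  assumes "form_chart B \<phi> \<psi> D f" "compact S" "convex S" "S \<subseteq> D" "continuous_on D P" "P ` S \<subseteq> S"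
    "\<And>z. z \<in> D \<Longrightarrow> z \<notin> S \<Longrightarrow> P z = z" "0 \<le> b" "\<And>z. z \<in> S \<Longrightarrow> \<bar>f (\<psi> z)\<bar> \<le> b"
  shows "move_by M \<omega> (\<lambda>x. if x \<in> B then \<psi> (P (\<phi> x)) else x)
    (\<lambda>x. if x \<in> B then f (\<psi> (P (\<phi> x))) - f x else 0) (2 * b)"
proof -
  obtain V where "(V, f) \<in> \<omega>" "B \<subseteq> V" using assms(1) unfolding form_chart_def by blast
  from move_by_chart[OF form Hausdorff form_chart_convex[OF assms(1)] this assms(2-)]
  show ?thesis .
qed

lemma move_comp:
  assumes "move_by M \<omega> g d C" "move_by M \<omega> g' d' C'"
  shows "move_by M \<omega> (\<lambda>x. g' (g x)) (\<lambda>x. d x + d' (g x)) (C + C')"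
proof (rule move_by_comp[OF assms])
  obtain x where "x \<in> topspace M" using nonempty by blast
  then show "C \<le> C + C'" using move_by_le(2)[OF assms(2)] by simp
qed (use move_by_le(1)[OF assms(1)] in simp)

text \<open>The clauses serve different purposes: uniqueness of the preimage of \<open>y\<close>
  controls what arrives at a chosen point, growth of the coordinate makes the push comparable with a
  function that steps down along the segment, and \<open>d z = f (g z) - f z\<close> turns integrals
  into differences of values.\<close>

lemma push_move:
  assumes ch: "form_chart B \<phi> \<psi> D f" and xy: "x \<in> B" "y \<in> B" "x \<noteq> y"
    and W: "openin M W" "\<psi> ` closed_segment (\<phi> x) (\<phi> y) \<subseteq> W"
  shows "\<exists>S g d C. compact S \<and> S \<subseteq> D \<and> closed_segment (\<phi> x) (\<phi> y) \<subseteq> S \<and> \<psi> ` S \<subseteq> W \<and>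
    move_by M \<omega> g d C \<and> (\<forall>z\<in>topspace M - \<psi> ` S. g z = z \<and> d z = 0) \<and>
    (\<forall>z\<in>\<psi> ` S. g z \<in> \<psi> ` S \<and> d z = f (g z) - f z) \<and>
    g x = y \<and> (\<forall>z\<in>topspace M. g z = y \<longrightarrow> z = x) \<and>
    (\<forall>z\<in>\<psi> ` S. g z \<noteq> z \<longrightarrow> proj_coord (\<phi> x) (\<phi> y) (\<phi> z) < proj_coord (\<phi> x) (\<phi> y) (\<phi> (g z))) \<and>
    (\<forall>z\<in>\<psi> ` closed_segment (\<phi> x) (\<phi> y). g z \<noteq> z)"
proof -
  note C = form_chartD[OF ch]
  have ne: "\<phi> x \<noteq> \<phi> y" using xy C(7) by metis
  have seg: "closed_segment (\<phi> x) (\<phi> y) \<subseteq> D"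
    using C(4,5) xy by (simp add: closed_segment_subset)
  have "open {z \<in> D. \<psi> z \<in> W}"
    using convex_chart_open_preimage[OF form_chart_convex[OF ch] W(1)] .
  note opn = this
  have sub: "closed_segment (\<phi> x) (\<phi> y) \<subseteq> {z \<in> D. \<psi> z \<in> W}" using seg W(2) by blast
  obtain S P where S: "compact S" "convex S" "closed_segment (\<phi> x) (\<phi> y) \<subseteq> S" "S \<subseteq> {z \<in> D. \<psi> z \<in> W}"
    and P: "continuous_on UNIV P" "P ` S \<subseteq> S" "\<And>z. z \<notin> S \<Longrightarrow> P z = z"
    "P (\<phi> x) = \<phi> y" "\<And>z. P z = \<phi> y \<Longrightarrow> z = \<phi> x"
    "\<And>z. P z \<noteq> z \<Longrightarrow> proj_coord (\<phi> x) (\<phi> y) z < proj_coord (\<phi> x) (\<phi> y) (P z)"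
    "\<And>z. z \<in> closed_segment (\<phi> x) (\<phi> y) \<Longrightarrow> P z \<noteq> z"
    by (rule segment_push[OF ne opn sub]) (rule that; assumption)
  have SD: "S \<subseteq> D" using S(4) by blast
  obtain b where b: "0 \<le> b" "\<And>z. z \<in> S \<Longrightarrow> \<bar>f (\<psi> z)\<bar> \<le> b"
    by (rule form_chart_bounded[OF ch S(1) SD]) (rule that; assumption)
  define g where "g = (\<lambda>x. if x \<in> B then \<psi> (P (\<phi> x)) else x)"
  define d where "d = (\<lambda>x. if x \<in> B then f (\<psi> (P (\<phi> x))) - f x else 0)"
  have mv: "move_by M \<omega> g d (2 * b)"
    unfolding g_def d_def
    by (rule form_chart_move[OF ch S(1,2) SD _ P(2) P(3) b]) (use P(1) continuous_on_subset in blast)+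
  have PD: "P z \<in> D" if "z \<in> D" for z
    using P(2) P(3)[of z] SD that by (cases "z \<in> S") auto
  have out: "g z = z \<and> d z = 0" if "z \<notin> \<psi> ` S" for z
  proof (cases "z \<in> B")
    case True
    then have "\<phi> z \<notin> S" using that C(7)[OF True] by force
    then show ?thesis using P(3) True C(7) by (simp add: g_def d_def)
  qed (simp add: g_def d_def)
  have inS: "g z \<in> \<psi> ` S \<and> d z = f (g z) - f z" if "z \<in> \<psi> ` S" for z
  proof -
    obtain u where u: "u \<in> S" "z = \<psi> u" using \<open>z \<in> \<psi> ` S\<close> by blast
    then have "z \<in> B" "\<phi> z = u" using SD C(6,8) by auto
    then show ?thesis using u P(2) by (auto simp: g_def d_def)
  qed
  have \<phi>g: "\<phi> (g z) = P (\<phi> z)" if "z \<in> B" for z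
    using that C(5,8) PD by (simp add: g_def)
  show ?thesis
  proof (intro exI[of _ S] exI[of _ g] exI[of _ d] exI[of _ "2 * b"] conjI ballI impI)
    show "compact S" "S \<subseteq> D" "closed_segment (\<phi> x) (\<phi> y) \<subseteq> S" "move_by M \<omega> g d (2 * b)"
      using S(1,3) SD mv by auto
    show "\<psi> ` S \<subseteq> W" using S(4) by blast
    show "g z = z" "d z = 0" if "z \<in> topspace M - \<psi> ` S" for z using out that by blast+
    show "g z \<in> \<psi> ` S" "d z = f (g z) - f z" if "z \<in> \<psi> ` S" for z using inS[OF that] by auto
    show "g x = y" using xy P(4) C(7) by (simp add: g_def)
    show "z = x" if "g z = y" for z
    proof (cases "z \<in> B")
      case True
      then have "P (\<phi> z) = \<phi> y" using \<phi>g that by metis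
      then have "\<phi> z = \<phi> x" by (rule P(5))
      then show ?thesis using C(7) True xy(1) by metis
    qed (use that xy(2) in \<open>auto simp: g_def\<close>)
    show "proj_coord (\<phi> x) (\<phi> y) (\<phi> z) < proj_coord (\<phi> x) (\<phi> y) (\<phi> (g z))"
      if "z \<in> \<psi> ` S" "g z \<noteq> z" for z
    proof -
      have "z \<in> B" using that(1) SD C(6) by auto
      then have "P (\<phi> z) \<noteq> \<phi> z" using that(2) C(7) by (auto simp: g_def)
      then show ?thesis using P(6) \<phi>g[OF \<open>z \<in> B\<close>] by simp
    qed
    show "g z \<noteq> z" if "z \<in> \<psi> ` closed_segment (\<phi> x) (\<phi> y)" for z
    proof -
      obtain u where u: "u \<in> closed_segment (\<phi> x) (\<phi> y)" "z = \<psi> u"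
        using \<open>z \<in> \<psi> ` closed_segment (\<phi> x) (\<phi> y)\<close> by blast
      then have "z \<in> B" "\<phi> z = u" using seg C(6,8) by auto
      then show ?thesis using P(7)[OF u(1)] \<phi>g by metis
    qed
  qed
qed

text \<open>A Urysohn function, 1 on \<open>K\<close> and 0 off \<open>V\<close>, is the time for
  which a point moves straight towards \<open>c\<close>. \<open>V\<close> need not be convex: the
  motion takes place in the convex set \<open>S\<close>, and only the points of \<open>V\<close>
  move.\<close>

lemma collapse_piece:
  assumes ch: "form_chart B \<phi> \<psi> D f" and S: "compact S" "convex S" "S \<subseteq> D"
    and V: "openin M V" "V \<subseteq> \<psi> ` S" and K: "closedin M K" "K \<subseteq> V" and c: "c \<in> V"
  shows "\<exists>g d C. move_by M \<omega> g d C \<and> (\<forall>x\<in>K. g x = c) \<and> (\<forall>x\<in>topspace M - V. g x = x)"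
proof -
  note C = form_chartD[OF ch]
  have "closedin M (topspace M - V)" "disjnt (topspace M - V) K"
    using V(1) K(2) by (auto simp: disjnt_def)
  then obtain l where L: "continuous_map M (top_of_set {0..1::real}) l"
    "l ` (topspace M - V) \<subseteq> {0}" "l ` K \<subseteq> {1}"
    using Urysohn_lemma[OF normal _ K(1), of "topspace M - V" 0 1] by auto
  have l01: "l x \<in> {0..1}" if "x \<in> topspace M" for x
    using L(1) that continuous_map_funspace[OF L(1)] by auto
  define P where "P = (\<lambda>z. (1 - l (\<psi> z)) *\<^sub>R z + l (\<psi> z) *\<^sub>R \<phi> c)"
  obtain b where b: "0 \<le> b" "\<And>z. z \<in> S \<Longrightarrow> \<bar>f (\<psi> z)\<bar> \<le> b"
    by (rule form_chart_bounded[OF ch S(1,3)]) (rule that; assumption)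
  have VB: "V \<subseteq> B" using V(2) S(3) C(6) by blast
  have cS: "\<phi> c \<in> S" using c V(2) S(3) C(8) by force
  have "continuous_map (top_of_set D) euclideanreal (\<lambda>z. l (\<psi> z))"
    using continuous_map_compose[OF C(10), of euclideanreal l] L(1)
    by (simp add: o_def continuous_map_in_subtopology)
  then have cont: "continuous_on D (\<lambda>z. l (\<psi> z))" by simp
  have PS: "P ` S \<subseteq> S"
  proof
    fix p assume "p \<in> P ` S"
    then obtain z where z: "z \<in> S" "p = P z" by blast
    have "l (\<psi> z) \<in> {0..1}" using l01 C(2,6) S(3) z(1) by blast
    then show "p \<in> S" unfolding z(2) P_def using S(2) z(1) cS by (intro convexD) auto
  qed
  have Pid: "P z = z" if "z \<in> D" "\<psi> z \<notin> V" for z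
  proof -
    have "l (\<psi> z) = 0" using L(2) that C(2,6) by blast
    then show ?thesis by (simp add: P_def)
  qed
  have Pid': "P z = z" if "z \<in> D" "z \<notin> S" for z
  proof (rule Pid[OF that(1)])
    show "\<psi> z \<notin> V"
    proof
      assume "\<psi> z \<in> V"
      then obtain u where "u \<in> S" "\<psi> z = \<psi> u" using V(2) by blast
      then show False using that S(3) C(8) by (metis subsetD)
    qed
  qed
  define g where "g = (\<lambda>x. if x \<in> B then \<psi> (P (\<phi> x)) else x)"
  have "continuous_on D P" unfolding P_def by (intro continuous_intros cont)
  from form_chart_move[OF ch S this PS Pid' b]
  have "move_by M \<omega> g (\<lambda>x. if x \<in> B then f (\<psi> (P (\<phi> x))) - f x else 0) (2 * b)"
    unfolding g_def .
  moreover have "g x = c" if "x \<in> K" for x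
  proof -
    have "x \<in> B" "l x = 1" using that K(2) VB L(3) by auto
    then show ?thesis using C(7) c VB by (auto simp: g_def P_def)
  qed
  moreover have "g x = x" if "x \<notin> V" for x
    using that Pid[of "\<phi> x"] C(5,7) by (auto simp: g_def)
  ultimately show ?thesis by blast
qed


section \<open>Transporting and merging points\<close>

text \<open>The second clause prescribes preimages: only \<open>x\<close> arrives at \<open>y\<close>, and the points of \<open>Z\<close> are
  reached from nowhere else.\<close>

definition carries :: "'a set \<Rightarrow> 'a \<Rightarrow> 'a \<Rightarrow> bool"
  where "carries Z x y \<longleftrightarrow>
    (\<exists>g d C. move_by M \<omega> g d C \<and> g x = y \<and> (\<forall>z\<in>topspace M. g z = y \<longrightarrow> z = x) \<and>
      (\<forall>p\<in>Z. \<forall>z\<in>topspace M. g z = p \<longrightarrow> z = p))"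

lemma carries_refl: "carries Z x x"
  unfolding carries_def using move_by_id[of M \<omega>]
  by (intro exI[of _ "\<lambda>x. x"] exI[of _ "\<lambda>x. 0"] exI[of _ 0]) simp

lemma carries_trans:
  assumes "carries Z x y" "carries Z y z"
  shows "carries Z x z"
proof -
  obtain g d C where g: "move_by M \<omega> g d C" "g x = y" "\<forall>z\<in>topspace M. g z = y \<longrightarrow> z = x"
    "\<forall>p\<in>Z. \<forall>z\<in>topspace M. g z = p \<longrightarrow> z = p"
    using assms(1) unfolding carries_def by auto
  obtain g' d' C' where g': "move_by M \<omega> g' d' C'" "g' y = z" "\<forall>u\<in>topspace M. g' u = z \<longrightarrow> u = y"
    "\<forall>p\<in>Z. \<forall>z\<in>topspace M. g' z = p \<longrightarrow> z = p"
    using assms(2) unfolding carries_def by auto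
  have "\<forall>u\<in>topspace M. g' (g u) = z \<longrightarrow> u = x"
    using g(3) g'(3) move_by_in[OF g(1)] by blast
  moreover have "\<forall>p\<in>Z. \<forall>z\<in>topspace M. g' (g z) = p \<longrightarrow> z = p"
    using g(4) g'(4) move_by_in[OF g(1)] by blast
  ultimately show ?thesis
    unfolding carries_def using move_comp[OF g(1) g'(1)] g(2) g'(2) by blast
qed

text \<open>The push along the segment from \<open>x\<close> to \<open>y\<close> moves points only
  within the chart, which contains no point of \<open>Z\<close>; so nothing arrives at
  \<open>Z\<close> from elsewhere.\<close>

lemma carries_chart:
  assumes "form_chart B \<phi> \<psi> D f" "B \<inter> Z = {}" "x \<in> B" "y \<in> B"
  shows "carries Z x y"
proof (cases "x = y")
  case False
  note C = form_chartD[OF assms(1)]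
  have "closed_segment (\<phi> x) (\<phi> y) \<subseteq> D"
    using C(4,5) assms by (simp add: closed_segment_subset)
  then have "\<psi> ` closed_segment (\<phi> x) (\<phi> y) \<subseteq> B" using C(6) by blast
  from push_move[OF assms(1,3,4) False C(1) this]
  obtain S g d C' where g: "\<psi> ` S \<subseteq> B" "move_by M \<omega> g d C'" "g x = y"
    "\<forall>z\<in>topspace M - \<psi> ` S. g z = z \<and> d z = 0" "\<forall>z\<in>\<psi> ` S. g z \<in> \<psi> ` S \<and> d z = f (g z) - f z"
    "\<forall>z\<in>topspace M. g z = y \<longrightarrow> z = x"
    by (elim exE conjE) (rule that; assumption)
  have "z = p" if "p \<in> Z" "z \<in> topspace M" "g z = p" for p z
  proof (cases "z \<in> \<psi> ` S")
    case True
    then have "g z \<in> B" using g(1,5) by auto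
    then show ?thesis using that assms(2) by auto
  next
    case False
    then show ?thesis using g(4) that by auto
  qed
  then show ?thesis
    unfolding carries_def using g(2,3,6)
    by (intro exI[of _ g] exI[of _ d] exI[of _ C'] conjI) auto
qed (simp add: carries_refl)

lemma open_infinite:
  assumes "openin M W" "W \<noteq> {}"
  shows "infinite W"
proof -
  obtain x where "x \<in> W" using assms(2) by blast
  then obtain B \<phi> \<psi> r f where B: "0 < r" "form_chart B \<phi> \<psi> (ball (\<phi> x) r) f" "B \<subseteq> W"
    using form_chart_exists[OF assms(1)] by blast
  note C = form_chartD[OF B(2)]
  have "inj_on \<psi> (ball (\<phi> x) r)" using C(8) by (metis inj_onI)
  moreover have "infinite (ball (\<phi> x) r)" using B(1) uncountable_ball countable_finite by blast
  ultimately have "infinite (\<psi> ` ball (\<phi> x) r)" using finite_imageD by blast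
  moreover have "\<psi> ` ball (\<phi> x) r \<subseteq> W" using C(6) B(3) by blast
  ultimately show ?thesis using finite_subset by blast
qed

text \<open>In dimension at least two a finite set does not separate a chart, so the points
  reachable from \<open>x\<close> in the complement of \<open>Z\<close> fill, up to
  \<open>Z\<close>, each chart that they meet; connectedness of \<open>M\<close> does the
  rest.\<close>

lemma carries_all:
  assumes dim: "2 \<le> DIM('e)" and Z: "finite Z" "Z \<subseteq> topspace M"
    and x: "x \<in> topspace M - Z" and y: "y \<in> topspace M - Z"
  shows "carries Z x y"
proof -
  define R where "R = {u \<in> topspace M - Z. carries Z x u}"
  have clZ: "closedin M Z" using Z Hausdorff by (simp add: closedin_Hausdorff_finite)
  have 1: "\<exists>N. openin M N \<and> z \<in> N \<and> N \<subseteq> topspace M - Z \<and> (N \<inter> R \<noteq> {} \<longrightarrow> N \<subseteq> R)"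
    if z: "z \<in> topspace M - Z" for z
  proof -
    have "openin M (topspace M - Z)" using clZ by blast
    from form_chart_exists[OF this z] obtain B \<phi> \<psi> r f
      where B: "form_chart B \<phi> \<psi> (ball (\<phi> z) r) f" "z \<in> B" "B \<subseteq> topspace M - Z" by blast
    have "B \<inter> Z = {}" using B(3) by blast
    then have "N \<in> R" if "u \<in> B \<inter> R" "N \<in> B" for u N
      using carries_chart[OF B(1), of Z u N] carries_trans that B(3) unfolding R_def by blast
    then show ?thesis using form_chartD(1)[OF B(1)] B(2,3) by (intro exI[of _ B]) blast
  qed
  then obtain N where N: "\<And>z. z \<in> topspace M - Z \<Longrightarrow>
      openin M (N z) \<and> z \<in> N z \<and> N z \<subseteq> topspace M - Z \<and> (N z \<inter> R \<noteq> {} \<longrightarrow> N z \<subseteq> R)"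
    by metis
  have Rs: "R \<subseteq> topspace M - Z" unfolding R_def by blast
  have "R = \<Union>(N ` R)" using N Rs by blast
  moreover have "openin M (\<Union>(N ` R))" using N Rs by (intro openin_Union) auto
  ultimately have opR: "openin M R" by simp
  have "topspace M - Z - R = \<Union>(N ` (topspace M - Z - R))" using N by blast
  moreover have "openin M (\<Union>(N ` (topspace M - Z - R)))" using N by (intro openin_Union) auto
  ultimately have opR': "openin M (topspace M - Z - R)" by simp
  \<comment> \<open>Both \<open>R\<close> and its complement in \<open>topspace M - Z\<close> are
    open, and the connected set \<open>B - Z\<close> cannot meet both.\<close>
  have 2: "B - Z \<subseteq> R" if B: "form_chart B \<phi> \<psi> D f" "(B - Z) \<inter> R \<noteq> {}" for B \<phi> \<psi> D f
  proof -
    note C = form_chartD[OF B(1)]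
    have "connected (D - \<phi> ` (Z \<inter> B))"
      using connected_open_delete_finite[OF C(3) convex_connected[OF C(4)] dim, of "\<phi> ` (Z \<inter> B)"] Z(1) by simp
    then have "connectedin (top_of_set D) (D - \<phi> ` (Z \<inter> B))"
      by (simp add: connectedin_subtopology)
    then have "connectedin M (\<psi> ` (D - \<phi> ` (Z \<inter> B)))"
      using connectedin_continuous_map_image C(10) by blast
    moreover have "\<psi> ` (D - \<phi> ` (Z \<inter> B)) = B - Z"
    proof
      show "B - Z \<subseteq> \<psi> ` (D - \<phi> ` (Z \<inter> B))"
      proof
        fix u assume u: "u \<in> B - Z"
        then have "\<phi> u \<notin> \<phi> ` (Z \<inter> B)" using C(7) by (metis DiffE IntE image_iff)
        then show "u \<in> \<psi> ` (D - \<phi> ` (Z \<inter> B))" using u C(5,7) by (intro image_eqI[of _ _ "\<phi> u"]) auto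
      qed
      show "\<psi> ` (D - \<phi> ` (Z \<inter> B)) \<subseteq> B - Z"
        using C(6,8) by force
    qed
    ultimately have "connectedin M (B - Z)" by simp
    then have nex: "\<not> (\<exists>E1 E2. openin M E1 \<and> openin M E2 \<and> B - Z \<subseteq> E1 \<union> E2 \<and> E1 \<inter> E2 \<inter> (B - Z) = {} \<and>
        E1 \<inter> (B - Z) \<noteq> {} \<and> E2 \<inter> (B - Z) \<noteq> {})"
      unfolding connectedin by blast
    show ?thesis
    proof (rule ccontr)
      assume "\<not> B - Z \<subseteq> R"
      then have "(topspace M - Z - R) \<inter> (B - Z) \<noteq> {}" "R \<inter> (B - Z) \<noteq> {}" using C(2) B(2) by blast+
      moreover have "B - Z \<subseteq> R \<union> (topspace M - Z - R)" using C(2) by blast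
      moreover have "R \<inter> (topspace M - Z - R) \<inter> (B - Z) = {}" by blast
      ultimately show False using nex opR opR' by blast
    qed
  qed
  \<comment> \<open>Points of \<open>Z\<close> are not reachable themselves, so the spreading is
    done with whole charts. Two overlapping charts share infinitely many points, hence one outside
    \<open>Z\<close>.\<close>
  define R' where "R' = {z \<in> topspace M. \<exists>B \<phi> \<psi> D f. form_chart B \<phi> \<psi> D f \<and> z \<in> B \<and> (B - Z) \<inter> R \<noteq> {}}"
  have "R' = topspace M"
  proof (rule connected_spread)
    show "R' \<subseteq> topspace M" unfolding R'_def by blast
    have "x \<in> R" unfolding R_def using x carries_refl by blast
    moreover obtain B \<phi> \<psi> r f where "form_chart B \<phi> \<psi> (ball (\<phi> x) r) f" "x \<in> B"
      using form_chart_exists[of "topspace M" x] x by blast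
    ultimately have "x \<in> R'" unfolding R'_def using x by blast
    then show "R' \<noteq> {}" by blast
    fix z assume "z \<in> topspace M"
    then obtain N \<phi> \<psi> r f where N: "form_chart N \<phi> \<psi> (ball (\<phi> z) r) f" "z \<in> N"
      using form_chart_exists[of "topspace M" z] by blast
    have "N \<subseteq> R'" if ne: "N \<inter> R' \<noteq> {}"
    proof -
      obtain u where u: "u \<in> N" "u \<in> R'" using ne by blast
      then obtain B \<phi>' \<psi>' D' f' where B: "form_chart B \<phi>' \<psi>' D' f'" "u \<in> B" "(B - Z) \<inter> R \<noteq> {}"
        unfolding R'_def by blast
      have "openin M (N \<inter> B)" using form_chartD(1)[OF N(1)] form_chartD(1)[OF B(1)] by blast
      then have "infinite (N \<inter> B)" using open_infinite u(1) B(2) by blast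
      then have "\<not> N \<inter> B \<subseteq> Z" using Z(1) finite_subset by blast
      then have "(N - Z) \<inter> R \<noteq> {}" using 2[OF B(1,3)] by blast
      then show ?thesis unfolding R'_def using N(1) form_chartD(2)[OF N(1)] by blast
    qed
    then show "\<exists>N. openin M N \<and> z \<in> N \<and> (N \<inter> R' \<noteq> {} \<longrightarrow> N \<subseteq> R')"
      using form_chartD(1)[OF N(1)] N(2) by blast
  qed
  then have "y \<in> R'" using y by blast
  then obtain B \<phi> \<psi> D f where "form_chart B \<phi> \<psi> D f" "y \<in> B" "(B - Z) \<inter> R \<noteq> {}"
    unfolding R'_def by blast
  then have "y \<in> R" using 2 y by blast
  then show ?thesis unfolding R_def by blast
qed

text \<open>The point \<open>a\<close> may move as well; the two points only have to end together.
  Near a point \<open>z\<close> other than \<open>a\<close>, a whole neighbourhood is first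
  collapsed to one point that can be merged with \<open>a\<close>; the collapse fixes
  \<open>a\<close> because it happens in a chart avoiding \<open>a\<close>.\<close>

lemma merge_two_points:
  assumes a: "a \<in> topspace M" and y: "y \<in> topspace M"
  shows "\<exists>g d C. move_by M \<omega> g d C \<and> g y = g a"
proof -
  define X where "X = {y \<in> topspace M. \<exists>g d C. move_by M \<omega> g d C \<and> g y = g a}"
  have aX: "a \<in> X" unfolding X_def using a move_by_id[of M \<omega>] by blast
  have "X = topspace M"
  proof (rule connected_spread)
    show "X \<subseteq> topspace M" "X \<noteq> {}" using aX unfolding X_def by blast+
    fix z assume z: "z \<in> topspace M"
    define W where "W = (if z = a then topspace M else topspace M - {a})"
    have "closedin M {a}" using a Hausdorff by (simp add: closedin_Hausdorff_singleton)
    then have W: "openin M W" "z \<in> W" unfolding W_def using z by auto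
    then obtain B \<phi> \<psi> r f where B: "0 < r" "form_chart B \<phi> \<psi> (ball (\<phi> z) r) f" "z \<in> B" "B \<subseteq> W"
      using form_chart_exists[OF W] by blast
    note C = form_chartD[OF B(2)] and ch = form_chart_convex[OF B(2)]
    define V where "V = \<psi> ` ball (\<phi> z) (r/2)"
    define N where "N = \<psi> ` ball (\<phi> z) (r/4)"
    define K where "K = \<psi> ` cball (\<phi> z) (r/4)"
    have sub: "ball (\<phi> z) (r/4) \<subseteq> cball (\<phi> z) (r/4)" "cball (\<phi> z) (r/4) \<subseteq> ball (\<phi> z) (r/2)"
      "ball (\<phi> z) (r/2) \<subseteq> cball (\<phi> z) (r/2)" "cball (\<phi> z) (r/2) \<subseteq> ball (\<phi> z) r"
      using B(1) by (simp_all add: cball_subset_ball_iff ball_subset_cball)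
    have "ball (\<phi> z) (r/2) \<subseteq> ball (\<phi> z) r" "ball (\<phi> z) (r/4) \<subseteq> ball (\<phi> z) r" using sub by blast+
    then have "openin M V" "openin M N"
      unfolding V_def N_def using convex_chartD(1)[OF convex_chart_mono[OF ch]] by auto
    have "closedin M K"
    proof -
      have "cball (\<phi> z) (r/4) \<subseteq> ball (\<phi> z) r" using sub by blast
      from closedin_compactin[OF convex_chart_compactin[OF ch compact_cball this]]
      show ?thesis unfolding K_def .
    qed
    have NKV: "N \<subseteq> K" "K \<subseteq> V" "V \<subseteq> \<psi> ` cball (\<phi> z) (r/2)" "V \<subseteq> B"
      unfolding N_def K_def V_def using sub C(6) by blast+
    have col: "\<exists>g d C. move_by M \<omega> g d C \<and> (\<forall>x\<in>K. g x = c) \<and> (\<forall>x\<in>topspace M - V. g x = x)"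
      if "c \<in> V" for c
      by (rule collapse_piece[OF B(2) compact_cball convex_cball sub(4) \<open>openin M V\<close> NKV(3) \<open>closedin M K\<close> NKV(2) that])
    have Nt: "N \<subseteq> topspace M" using \<open>openin M N\<close> openin_subset by blast
    have zN: "z \<in> N" unfolding N_def using B(1,3) C(7) by (intro image_eqI[of _ _ "\<phi> z"]) auto
    have "N \<subseteq> X" if "N \<inter> X \<noteq> {}"
    proof (cases "z = a")
      case True
      have "a \<in> K" using zN NKV(1) True by blast
      then obtain g d C' where g: "move_by M \<omega> g d C'" "\<forall>x\<in>K. g x = a"
        using col[of a] NKV(2) by blast
      show ?thesis
      proof
        fix u assume u: "u \<in> N"
        then have "g u = g a" using g(2) NKV(1) \<open>a \<in> K\<close> by auto
        then show "u \<in> X" unfolding X_def using Nt u g(1) by blast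
      qed
    next
      case False
      have "a \<notin> V" using NKV(4) B(4) False unfolding W_def by auto
      obtain y' g d C where y': "y' \<in> N" "move_by M \<omega> g d C" "g y' = g a"
        using \<open>N \<inter> X \<noteq> {}\<close> unfolding X_def by blast
      have "y' \<in> V" using y'(1) NKV by blast
      from col[OF this] obtain k d' C' where k: "move_by M \<omega> k d' C'" "\<forall>x\<in>K. k x = y'"
        "\<forall>x\<in>topspace M - V. k x = x" by blast
      have "g (k u) = g (k a)" if "u \<in> N" for u
        using k(2,3) that NKV(1) y'(3) a \<open>a \<notin> V\<close> by auto
      with move_comp[OF k(1) y'(2)] have "\<exists>g d C. move_by M \<omega> g d C \<and> g u = g a" if "u \<in> N" for u
        using that by blast
      then show ?thesis unfolding X_def using Nt by blast
    qed
    then show "\<exists>N. openin M N \<and> z \<in> N \<and> (N \<inter> X \<noteq> {} \<longrightarrow> N \<subseteq> X)"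
      using \<open>openin M N\<close> zN by blast
  qed
  then show ?thesis using y unfolding X_def by blast
qed

lemma merge_finite:
  assumes "finite F" "F \<subseteq> topspace M"
  shows "\<exists>g d C. \<exists>a\<in>topspace M. move_by M \<omega> g d C \<and> (\<forall>x\<in>F. g x = a)"
  using assms
proof (induction F rule: finite_induct)
  case empty
  then show ?case using nonempty move_by_id[of M \<omega>] by blast
next
  case (insert x F)
  then obtain g d C a where g: "a \<in> topspace M" "move_by M \<omega> g d C" "\<forall>x\<in>F. g x = a" by blast
  have gx: "g x \<in> topspace M" using move_by_in[OF g(2)] insert.prems by blast
  then obtain g' d' C' where g': "move_by M \<omega> g' d' C'" "g' (g x) = g' a"
    using merge_two_points[OF g(1)] by blast
  have "\<forall>u\<in>insert x F. g' (g u) = g' a" using g(3) g'(2) by simp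
  then show ?case using move_comp[OF g(2) g'(1)] move_by_in[OF g'(1) g(1)] by blast
qed

text \<open>This is the situation in which \<open>collapse_piece\<close> applies; it is inherited by
  open subsets.\<close>

definition small_open :: "'a set \<Rightarrow> bool"
  where "small_open V \<longleftrightarrow> openin M V \<and>
    (\<exists>B \<phi> \<psi> D f S. form_chart B \<phi> \<psi> D f \<and> compact S \<and> convex S \<and> S \<subseteq> D \<and> V \<subseteq> \<psi> ` S)"

lemma small_open_subset: "small_open V \<Longrightarrow> openin M W \<Longrightarrow> W \<subseteq> V \<Longrightarrow> small_open W"
  unfolding small_open_def
  by (elim conjE exE, intro conjI exI) (assumption | erule (1) subset_trans)+

lemma small_open_exists:
  assumes "x \<in> topspace M"
  shows "\<exists>V. small_open V \<and> x \<in> V"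
proof -
  obtain B \<phi> \<psi> r f where B: "0 < r" "form_chart B \<phi> \<psi> (ball (\<phi> x) r) f" "x \<in> B"
    using form_chart_exists[of "topspace M" x] assms by blast
  have sub: "ball (\<phi> x) (r/2) \<subseteq> ball (\<phi> x) r" "cball (\<phi> x) (r/2) \<subseteq> ball (\<phi> x) r"
    using B(1) by (simp_all add: cball_subset_ball_iff subset_ball)
  have "openin M (\<psi> ` ball (\<phi> x) (r/2))"
    using convex_chartD(1)[OF convex_chart_mono[OF form_chart_convex[OF B(2)] sub(1)]] by auto
  moreover have "\<psi> ` ball (\<phi> x) (r/2) \<subseteq> \<psi> ` cball (\<phi> x) (r/2)" using ball_subset_cball by blast
  ultimately have "small_open (\<psi> ` ball (\<phi> x) (r/2))"
    unfolding small_open_def using B(2) sub(2)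
    by (intro conjI exI[of _ B] exI[of _ \<phi>] exI[of _ \<psi>] exI[of _ "ball (\<phi> x) r"] exI[of _ f]
        exI[of _ "cball (\<phi> x) (r/2)"]) (simp_all only: compact_cball convex_cball)
  moreover have "x \<in> \<psi> ` ball (\<phi> x) (r/2)"
  proof -
    have "\<phi> x \<in> ball (\<phi> x) (r/2)" using B(1) by simp
    then have "\<psi> (\<phi> x) \<in> \<psi> ` ball (\<phi> x) (r/2)" by (rule imageI)
    then show ?thesis using form_chartD(7)[OF B(2,3)] by simp
  qed
  ultimately show ?thesis by blast
qed

text \<open>Each set is collapsed within a chart while only points of its own \<open>V\<close> move,
  so the collapses do not disturb one another; the finitely many centres that remain are then
  merged.\<close>

lemma collapse_family:
  assumes fin: "finite \<V>" and disj: "pairwise disjnt \<V>" and sm: "\<And>V. V \<in> \<V> \<Longrightarrow> small_open V"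
    and v: "\<And>V. openin M (v V)" "\<And>V. M closure_of (v V) \<subseteq> V"
  shows "\<exists>g d C. \<exists>a\<in>topspace M. move_by M \<omega> g d C \<and> (\<forall>V\<in>\<V>. \<forall>x\<in>v V. g x = a)"
proof -
  have vK: "v V \<subseteq> M closure_of (v V)" for V using closure_of_subset[OF openin_subset[OF v(1)]] .
  \<comment> \<open>Recording that the centre lies in \<open>V\<close> guarantees that later
    collapses, which move only points of sets disjoint from \<open>V\<close>, leave it in
    place.\<close>
  have "\<exists>g d C. move_by M \<omega> g d C \<and> (\<forall>V\<in>\<W>. \<exists>c\<in>V. \<forall>x\<in>v V. g x = c \<or> v V = {}) \<and>
      (\<forall>V\<in>\<V> - \<W>. \<forall>x\<in>V. g x = x)" if "finite \<W>" "\<W> \<subseteq> {V \<in> \<V>. v V \<noteq> {}}" for \<W>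
    using that
  proof (induction \<W> rule: finite_induct)
    case empty
    then show ?case using move_by_id[of M \<omega>]
      by (intro exI[of _ "\<lambda>x. x"] exI[of _ "\<lambda>x. 0"] exI[of _ 0]) simp
  next
    case (insert W \<W>)
    then obtain g d C where g: "move_by M \<omega> g d C" "\<forall>V\<in>\<W>. \<exists>c\<in>V. \<forall>x\<in>v V. g x = c \<or> v V = {}"
      "\<forall>V\<in>\<V> - \<W>. \<forall>x\<in>V. g x = x" by auto
    have W: "W \<in> \<V>" "v W \<noteq> {}" using insert.prems by auto
    then obtain c where c: "c \<in> v W" by blast
    obtain B \<phi> \<psi> D f S where S: "form_chart B \<phi> \<psi> D f" "compact S" "convex S" "S \<subseteq> D" "W \<subseteq> \<psi> ` S"
      and opW: "openin M W"
      using sm[OF W(1)] unfolding small_open_def by blast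
    have cW: "c \<in> W" using c vK v(2) by blast
    from collapse_piece[OF S(1-4) opW S(5) _ v(2) cW]
    obtain k d' C' where k: "move_by M \<omega> k d' C'" "\<forall>x\<in>M closure_of (v W). k x = c"
      "\<forall>x\<in>topspace M - W. k x = x" by auto
    have disjW: "V \<inter> W = {}" if "V \<in> \<V>" "V \<noteq> W" for V
      using pairwiseD[OF disj that(1) W(1) that(2)] by (simp add: disjnt_def)
    have subt: "V \<subseteq> topspace M" if "V \<in> \<V>" for V
      using sm[OF that] openin_subset unfolding small_open_def by blast
    have "\<exists>c\<in>V. \<forall>x\<in>v V. k (g x) = c \<or> v V = {}" if V: "V \<in> insert W \<W>" for V
    proof (cases "V = W")
      case True
      have "k (g x) = c" if "x \<in> v W" for x
      proof -
        have "g x = x" using g(3) W(1) insert.hyps(2) that vK v(2) by blast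
        then show ?thesis using k(2) that vK by auto
      qed
      then show ?thesis using True cW by blast
    next
      case False
      then have "V \<in> \<W>" using V by blast
      then obtain c' where c': "c' \<in> V" "\<forall>x\<in>v V. g x = c' \<or> v V = {}" using g(2) by blast
      have "V \<in> \<V>" using \<open>V \<in> \<W>\<close> insert.prems by blast
      then have "k c' = c'" using k(3) disjW[OF _ False] c'(1) subt by blast
      then show ?thesis using c' by (metis)
    qed
    moreover have "k (g x) = x" if "V \<in> \<V> - insert W \<W>" "x \<in> V" for V x
    proof -
      have "g x = x" using g(3) that by blast
      moreover have "x \<notin> W" using disjW[of V] that by blast
      ultimately show ?thesis using k(3) subt that by auto
    qed
    ultimately show ?case using move_comp[OF g(1) k(1)] by blast
  qed
  from this[of "{V \<in> \<V>. v V \<noteq> {}}"] fin obtain g d C where g: "move_by M \<omega> g d C"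
    and c: "\<forall>V\<in>{V \<in> \<V>. v V \<noteq> {}}. \<exists>c\<in>V. \<forall>x\<in>v V. g x = c \<or> v V = {}" by auto
  then obtain c where c: "\<And>V. V \<in> \<V> \<Longrightarrow> v V \<noteq> {} \<Longrightarrow> c V \<in> V \<and> (\<forall>x\<in>v V. g x = c V)"
    by (metis (mono_tags, lifting) mem_Collect_eq)
  define F where "F = c ` {V \<in> \<V>. v V \<noteq> {}}"
  have "V \<subseteq> topspace M" if "V \<in> \<V>" for V
    using sm[OF that] openin_subset unfolding small_open_def by blast
  then have "finite F" "F \<subseteq> topspace M" unfolding F_def using fin c by auto
  from merge_finite[OF this] obtain g' d' C' a where g': "a \<in> topspace M" "move_by M \<omega> g' d' C'" "\<forall>x\<in>F. g' x = a"
    by blast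
  have "g' (g x) = a" if "V \<in> \<V>" "x \<in> v V" for V x
  proof -
    have "v V \<noteq> {}" using that(2) by blast
    then have "g x = c V" "c V \<in> F" using c[OF that(1)] that unfolding F_def by auto
    then show ?thesis using g'(3) by simp
  qed
  then show ?thesis using move_comp[OF g g'(2)] g'(1) by blast
qed

end

section \<open>Necklaces of charts\<close>

text \<open>A chart, its inverse, its coordinate domain and a local primitive are bundled, so that
  chains of charts become lists and cycles can be compared by length.\<close>

datatype ('a, 'e) bead = Bead (dom: "'a set") (fwd: "'a \<Rightarrow> 'e") (bwd: "'e \<Rightarrow> 'a") (ran: "'e set")
  (prim: "'a \<Rightarrow> real")

hide_const (open) dom ran

abbreviation "bdom \<equiv> bead.dom"
abbreviation "bran \<equiv> bead.ran"

text \<open>For a closed walk the first vertex is appended at the end. The weights will be the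
  transition constants between local primitives, so this is the period of a Cech cocycle.\<close>

fun path_weight :: "('b \<Rightarrow> 'b \<Rightarrow> real) \<Rightarrow> 'b list \<Rightarrow> real"
  where
    "path_weight w (a # b # r) = w a b + path_weight w (b # r)"
  | "path_weight w r = 0"

lemma path_weight_append: "path_weight w (xs @ a # ys) = path_weight w (xs @ [a]) + path_weight w (a # ys)"
proof (induction xs)
  case (Cons x xs)
  then show ?case by (cases xs) auto
qed simp

lemma path_weight_sum: "path_weight w xs = (\<Sum>i<length xs - 1. w (xs ! i) (xs ! Suc i))"
proof (induction w xs rule: path_weight.induct)
  case (1 w a b r)
  then show ?case by (simp add: sum.lessThan_Suc_shift del: sum.lessThan_Suc)
qed auto

lemma successively_append_Cons:
  "successively P (xs @ a # ys) \<longleftrightarrow> successively P (xs @ [a]) \<and> successively P (a # ys)"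
proof (induction xs)
  case (Cons x xs)
  then show ?case by (cases xs) auto
qed simp

lemma sum_Suc_mod:
  fixes u :: "nat \<Rightarrow> real"
  assumes "0 < m"
  shows "(\<Sum>i<m. u (Suc i mod m)) = (\<Sum>i<m. u i)"
proof -
  obtain k where k: "m = Suc k" using assms gr0_implies_Suc by blast
  have "(\<Sum>i<Suc k. u (Suc i mod Suc k)) = (\<Sum>i<k. u (Suc i mod Suc k)) + u 0" by simp
  also have "(\<Sum>i<k. u (Suc i mod Suc k)) = (\<Sum>i<k. u (Suc i))"
    by (rule sum.cong) auto
  also have "(\<Sum>i<k. u (Suc i)) + u 0 = (\<Sum>i<Suc k. u i)"
    by (simp add: sum.lessThan_Suc_shift del: sum.lessThan_Suc)
  finally show ?thesis using k by simp
qed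

context manifold_form begin

abbreviation chart_bead :: "('a, 'e) bead \<Rightarrow> bool"
  where "chart_bead c \<equiv> form_chart (bdom c) (fwd c) (bwd c) (bran c) (prim c)"

text \<open>Two points of a chart are joined by a coordinate segment inside it, and \<open>f\<close>
  and \<open>g\<close> both give primitives along this path.\<close>

lemma form_chart_diff_const:
  assumes ch: "form_chart B \<phi> \<psi> D f" and V: "(V, g) \<in> \<omega>" "B \<subseteq> V" and xy: "x \<in> B" "y \<in> B"
  shows "f x - g x = f y - g y"
proof -
  note C = form_chartD[OF ch]
  obtain U where U: "(U, f) \<in> \<omega>" "B \<subseteq> U" using ch unfolding form_chart_def by blast
  define \<gamma> where "\<gamma> = (\<lambda>t. \<psi> ((1 - t) *\<^sub>R \<phi> x + t *\<^sub>R \<phi> y))"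
  have D: "(1 - t) *\<^sub>R \<phi> x + t *\<^sub>R \<phi> y \<in> D" if "t \<in> {0..1}" for t
    using C(4,5) xy that by (intro convexD) auto
  have "continuous_map (top_of_set {0..1::real}) (top_of_set D) (\<lambda>t. (1 - t) *\<^sub>R \<phi> x + t *\<^sub>R \<phi> y)"
    using D by (auto simp: continuous_map_in_subtopology intro!: continuous_intros)
  from continuous_map_compose[OF this C(10)]
  have cont: "continuous_map (top_of_set {0..1}) M \<gamma>" by (simp add: o_def \<gamma>_def)
  have im: "\<gamma> ` {0..1} \<subseteq> B" unfolding \<gamma>_def using D C(6) by auto
  have "primitive_on \<omega> \<gamma> {0..1} (\<lambda>t. f (\<gamma> t))" "primitive_on \<omega> \<gamma> {0..1} (\<lambda>t. g (\<gamma> t))"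
    using primitive_on_local[OF form cont U(1), of "\<lambda>t. f (\<gamma> t)" 0]
      primitive_on_local[OF form cont V(1), of "\<lambda>t. g (\<gamma> t)" 0] im U(2) V(2) by auto
  from primitive_on_unique[OF form cont _ this, of 0 1]
  have "f (\<gamma> 1) - f (\<gamma> 0) = g (\<gamma> 1) - g (\<gamma> 0)" by simp
  moreover have "\<gamma> 0 = x" "\<gamma> 1 = y" unfolding \<gamma>_def using C(7) xy by auto
  ultimately show ?thesis by simp
qed

text \<open>Two charts may overlap in a disconnected set, on which their primitives could differ by
  several constants. To exclude this, charts are taken so small that one meeting the shrunken set
  \<open>v V\<close> lies in \<open>V\<close>; overlapping charts then lie in a common
  \<open>V\<close> and are both compared with the one function \<open>g\<close> given there.\<close>

lemma good_beads:
  obtains \<P> :: "('a, 'e) bead set" where "\<And>c. c \<in> \<P> \<Longrightarrow> chart_bead c" "topspace M \<subseteq> \<Union>(bdom ` \<P>)"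
    "\<And>c c' x y. c \<in> \<P> \<Longrightarrow> c' \<in> \<P> \<Longrightarrow> x \<in> bdom c \<inter> bdom c' \<Longrightarrow> y \<in> bdom c \<inter> bdom c' \<Longrightarrow>
      prim c x - prim c' x = prim c y - prim c' y"
proof -
  have op: "openin M V" if "V \<in> fst ` \<omega>" for V using closed_one_form_openin[OF form] that by auto
  obtain v where v: "\<And>V. openin M (v V)" "\<And>V. M closure_of (v V) \<subseteq> V" "topspace M \<subseteq> (\<Union>V\<in>fst ` \<omega>. v V)"
    by (rule shrink_finite_cover[OF compact Hausdorff closedin_topspace op topspace_subset_form_domains[OF form]])
      (assumption | rule that; assumption)+
  have "compactin M (topspace M)" using compact by (simp add: compact_space_def)
  then obtain \<F> where F: "finite \<F>" "\<F> \<subseteq> v ` fst ` \<omega>" "topspace M \<subseteq> \<Union>\<F>"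
    using v(1,3) unfolding compactin_def by (metis (no_types, lifting) imageE)
  then obtain \<V> where \<V>: "finite \<V>" "\<V> \<subseteq> fst ` \<omega>" "\<F> = v ` \<V>" by (meson finite_subset_image)
  have vV: "v V \<subseteq> M closure_of (v V)" for V using closure_of_subset[OF openin_subset[OF v(1)]] .
  define \<P> where "\<P> = {c :: ('a, 'e) bead. chart_bead c \<and> (\<forall>V\<in>\<V>. bdom c \<subseteq> V \<or> bdom c \<inter> v V = {})}"
  show thesis
  proof
    show "chart_bead c" if "c \<in> \<P>" for c using that unfolding \<P>_def by blast
    show "topspace M \<subseteq> \<Union>(bdom ` \<P>)"
    proof
      fix x assume x: "x \<in> topspace M"
      define R where "R = (\<lambda>V. if x \<in> V then V else topspace M - M closure_of (v V))"
      define W where "W = \<Inter>(insert (topspace M) (R ` \<V>))"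
      have "openin M (R V)" if "V \<in> \<V>" for V
      proof -
        have "openin M V" using op \<V>(2) that by blast
        then show ?thesis unfolding R_def by (auto intro!: openin_diff)
      qed
      then have opW: "openin M W" unfolding W_def using \<V>(1) by (intro openin_Inter) auto
      have "x \<in> R V" for V unfolding R_def using x v(2)[of V] by auto
      then have xW: "x \<in> W" unfolding W_def using x by auto
      obtain B \<phi> \<psi> r f where B: "form_chart B \<phi> \<psi> (ball (\<phi> x) r) f" "x \<in> B" "B \<subseteq> W"
        using form_chart_exists[OF opW xW] by blast
      have "B \<subseteq> V \<or> B \<inter> v V = {}" if "V \<in> \<V>" for V
      proof -
        have "B \<subseteq> R V" using B(3) that unfolding W_def by auto
        then show ?thesis using vV[of V] unfolding R_def by (auto split: if_splits)
      qed
      then have "Bead B \<phi> \<psi> (ball (\<phi> x) r) f \<in> \<P>" unfolding \<P>_def using B(1) by simp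
      moreover have "x \<in> bdom (Bead B \<phi> \<psi> (ball (\<phi> x) r) f)" using B(2) by simp
      ultimately show "x \<in> \<Union>(bdom ` \<P>)" by blast
    qed
    fix c c' x y
    assume c: "c \<in> \<P>" "c' \<in> \<P>" and xy: "x \<in> bdom c \<inter> bdom c'" "y \<in> bdom c \<inter> bdom c'"
    have chb: "chart_bead c" "chart_bead c'" using c unfolding \<P>_def by auto
    have "x \<in> topspace M" using xy(1) form_chartD(2)[OF chb(1)] by blast
    then obtain V where V: "V \<in> \<V>" "x \<in> v V" using F(3) \<V>(3) by blast
    have sub: "bdom c \<subseteq> V" "bdom c' \<subseteq> V" using c V xy(1) unfolding \<P>_def by blast+
    obtain g where g: "(V, g) \<in> \<omega>" using V(1) \<V>(2) by auto
    have "prim c x - g x = prim c y - g y" "prim c' x - g x = prim c' y - g y"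
      using form_chart_diff_const[OF chb(1) g sub(1)] form_chart_diff_const[OF chb(2) g sub(2)] xy by auto
    then show "prim c x - prim c' x = prim c y - prim c' y" by linarith
  qed
qed

text \<open>The edge is straight in the coordinates of its own chart only; the index of its end is
  cyclic.\<close>

definition bead_seg :: "(nat \<Rightarrow> ('a, 'e) bead) \<Rightarrow> (nat \<Rightarrow> 'a) \<Rightarrow> nat \<Rightarrow> nat \<Rightarrow> 'a set"
  where "bead_seg b q m i = bwd (b i) ` closed_segment (fwd (b i) (q i)) (fwd (b i) (q (Suc i mod m)))"

text \<open>A cyclic chain of charts, consecutive ones meeting, together with an embedded closed polygon
  having one chart segment per chart; the integral of the form along the polygon is negative.\<close>

definition necklace :: "nat \<Rightarrow> (nat \<Rightarrow> ('a, 'e) bead) \<Rightarrow> (nat \<Rightarrow> 'a) \<Rightarrow> bool"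
  where "necklace m b q \<longleftrightarrow> 3 \<le> m \<and>
    (\<forall>i<m. chart_bead (b i) \<and> q i \<in> bdom (b i) \<and> q (Suc i mod m) \<in> bdom (b i) \<and> q i \<noteq> q (Suc i mod m)) \<and>
    (\<forall>i<m. \<forall>j<m. j \<noteq> i \<and> j \<noteq> Suc i mod m \<and> i \<noteq> Suc j mod m \<longrightarrow> bdom (b i) \<inter> bdom (b j) = {}) \<and>
    (\<forall>i<m. bead_seg b q m i \<inter> bead_seg b q m (Suc i mod m) = {q (Suc i mod m)}) \<and>
    (\<forall>i<m. \<forall>x\<in>bdom (b i) \<inter> bdom (b (Suc i mod m)). \<forall>y\<in>bdom (b i) \<inter> bdom (b (Suc i mod m)).
       prim (b i) x - prim (b (Suc i mod m)) x = prim (b i) y - prim (b (Suc i mod m)) y) \<and>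
    (\<Sum>i<m. prim (b i) (q (Suc i mod m)) - prim (b (Suc i mod m)) (q (Suc i mod m))) < 0"

text \<open>A negative cycle of charts of least length has no chord: a chord would split it into two shorter
  cycles, the integrals along which add up, so that one of them would be negative.\<close>

lemma minimal_cycle:
  assumes \<gamma>: "pathin M \<gamma>" "\<gamma> 0 = \<gamma> 1" "form_integral \<omega> \<gamma> < 0"
  obtains m b where "3 \<le> m" "\<forall>i<m. chart_bead (b i)"
    "\<forall>i<m. bdom (b i) \<inter> bdom (b (Suc i mod m)) \<noteq> {}"
    "\<forall>i<m. bdom (b i) \<inter> bdom (b (Suc i mod m)) \<inter> bdom (b (Suc (Suc i mod m) mod m)) = {}"
    "\<forall>i j. i < m \<longrightarrow> j < m \<longrightarrow> j \<noteq> i \<longrightarrow> j \<noteq> Suc i mod m \<longrightarrow> i \<noteq> Suc j mod m \<longrightarrow> bdom (b i) \<inter> bdom (b j) = {}"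
    "\<forall>i x y. i < m \<longrightarrow> x \<in> bdom (b i) \<inter> bdom (b (Suc i mod m)) \<longrightarrow> y \<in> bdom (b i) \<inter> bdom (b (Suc i mod m)) \<longrightarrow>
       prim (b i) x - prim (b (Suc i mod m)) x = prim (b i) y - prim (b (Suc i mod m)) y"
    "\<forall>q. (\<forall>i<m. q (Suc i mod m) \<in> bdom (b i) \<inter> bdom (b (Suc i mod m))) \<longrightarrow>
      (\<Sum>i<m. prim (b i) (q (Suc i mod m)) - prim (b (Suc i mod m)) (q (Suc i mod m))) < 0"
proof -
  obtain \<P> :: "('a, 'e) bead set" where P: "\<And>c. c \<in> \<P> \<Longrightarrow> chart_bead c" "topspace M \<subseteq> \<Union>(bdom ` \<P>)"
    and H: "\<And>c c' x y. c \<in> \<P> \<Longrightarrow> c' \<in> \<P> \<Longrightarrow> x \<in> bdom c \<inter> bdom c' \<Longrightarrow> y \<in> bdom c \<inter> bdom c' \<Longrightarrow>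
      prim c x - prim c' x = prim c y - prim c' y"
    by (rule good_beads) (rule that; assumption)
  \<comment> \<open>The transition constant of two charts. Any point of the overlap gives the same
    value, so an arbitrary choice is harmless.\<close>
  define w where "w = (\<lambda>(c :: ('a, 'e) bead) (c' :: ('a, 'e) bead). prim c (SOME z. z \<in> bdom c \<inter> bdom c') - prim c' (SOME z. z \<in> bdom c \<inter> bdom c'))"
  have w: "w c c' = prim c x - prim c' x" if "c \<in> \<P>" "c' \<in> \<P>" "x \<in> bdom c \<inter> bdom c'" for c c' x
    unfolding w_def by (rule H[OF that(1,2) _ that(3)]) (rule someI[of "\<lambda>z. z \<in> bdom c \<inter> bdom c'", OF that(3)])
  let ?L = "\<lambda>c c' :: ('a, 'e) bead. bdom c \<inter> bdom c' \<noteq> {}"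
  define cyc where "cyc = (\<lambda>l. l \<noteq> [] \<and> set l \<subseteq> \<P> \<and> successively ?L (l @ [hd l]) \<and> path_weight w (l @ [hd l]) < 0)"
  have ex: "\<exists>l. cyc l"
  proof -
    have "openin M U" if "U \<in> bdom ` \<P>" for U using form_chartD(1)[OF P(1)] that by auto
    from path_partition[OF \<gamma>(1) this P(2)] obtain m :: nat where m: "0 < m"
      "\<And>i. i < m \<Longrightarrow> \<exists>U\<in>bdom ` \<P>. \<gamma> ` {real i / m..real (Suc i) / m} \<subseteq> U" by metis
    then have "\<forall>i. \<exists>c. i < m \<longrightarrow> c \<in> \<P> \<and> \<gamma> ` {real i / m..real (Suc i) / m} \<subseteq> bdom c" by (metis imageE)
    then obtain c where c: "\<And>i. i < m \<Longrightarrow> c i \<in> \<P>" "\<And>i. i < m \<Longrightarrow> \<gamma> ` {real i / m..real (Suc i) / m} \<subseteq> bdom (c i)"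
      by metis
    have "\<exists>V. (V, prim (c i)) \<in> \<omega> \<and> bdom (c i) \<subseteq> V" if "i < m" for i
      using P(1)[OF c(1)[OF that]] unfolding form_chart_def by blast
    then obtain V where V: "\<And>i. i < m \<Longrightarrow> (V i, prim (c i)) \<in> \<omega> \<and> bdom (c i) \<subseteq> V i" by metis
    have "has_form_integral \<omega> \<gamma> (\<Sum>i<m. prim (c i) (\<gamma> (real (Suc i) / m)) - prim (c i) (\<gamma> (real i / m)))"
      by (rule has_form_integral_partition[OF m(1), of V]) (use V c(2) in blast)
    then have neg: "(\<Sum>i<m. prim (c i) (\<gamma> (real (Suc i) / m)) - prim (c i) (\<gamma> (real i / m))) < 0"
      using form_integral_unique[OF form \<gamma>(1)] \<gamma>(3) by simp
    have ends: "\<gamma> (real i / m) \<in> bdom (c i)" "\<gamma> (real (Suc i) / m) \<in> bdom (c i)" if "i < m" for i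
    proof -
      have "real i / m \<le> real (Suc i) / m" by (simp add: divide_right_mono)
      then show "\<gamma> (real i / m) \<in> bdom (c i)" "\<gamma> (real (Suc i) / m) \<in> bdom (c i)" using c(2)[OF that] by auto
    qed
    have wrap: "\<gamma> (real (Suc i) / m) = \<gamma> (real (Suc i mod m) / m)" if "i < m" for i
      using that \<gamma>(2) m(1) by (cases "Suc i = m") auto
    have meet: "\<gamma> (real (Suc i) / m) \<in> bdom (c i) \<inter> bdom (c (Suc i mod m))" if "i < m" for i
      using ends[OF that] ends(1)[of "Suc i mod m"] wrap[OF that] m(1) by auto
    define l where "l = map c [0..<m]"
    have nth: "(l @ [hd l]) ! i = c i" "(l @ [hd l]) ! Suc i = c (Suc i mod m)" if "i < m" for i
    proof -
      show "(l @ [hd l]) ! i = c i" using that by (simp add: l_def nth_append)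
      show "(l @ [hd l]) ! Suc i = c (Suc i mod m)"
        using that m(1) by (cases "Suc i = m") (auto simp: l_def nth_append hd_map)
    qed
    have len: "length (l @ [hd l]) = Suc m" by (simp add: l_def)
    have "path_weight w (l @ [hd l]) = (\<Sum>i<m. w (c i) (c (Suc i mod m)))"
      unfolding path_weight_sum len using nth by (intro sum.cong) auto
    \<comment> \<open>Each transition constant is evaluated at the common partition point.
      Regrouping by charts instead of by points then turns the sum into the integral along
      \<open>\<gamma>\<close>.\<close>
    also have "\<dots> = (\<Sum>i<m. prim (c i) (\<gamma> (real (Suc i) / m)) - prim (c (Suc i mod m)) (\<gamma> (real (Suc i mod m) / m)))"
    proof (rule sum.cong)
      fix i assume "i \<in> {..<m}"
      then have i: "i < m" by simp
      have "Suc i mod m < m" using m(1) by simp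
      from w[OF c(1)[OF i] c(1)[OF this] meet[OF i]]
      show "w (c i) (c (Suc i mod m)) = prim (c i) (\<gamma> (real (Suc i) / m)) - prim (c (Suc i mod m)) (\<gamma> (real (Suc i mod m) / m))"
        using wrap[OF i] by simp
    qed simp
    also have "\<dots> = (\<Sum>i<m. prim (c i) (\<gamma> (real (Suc i) / m)) - prim (c i) (\<gamma> (real i / m)))"
      unfolding sum_subtractf using sum_Suc_mod[OF m(1), of "\<lambda>i. prim (c i) (\<gamma> (real i / m))"] by simp
    finally have "path_weight w (l @ [hd l]) < 0" using neg by simp
    moreover have "successively ?L (l @ [hd l])"
      unfolding successively_conv_nth len using nth meet by (auto simp: less_Suc_eq_le Suc_le_eq)
    moreover have "l \<noteq> []" "set l \<subseteq> \<P>" using m(1) c(1) by (auto simp: l_def)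
    ultimately show ?thesis unfolding cyc_def by blast
  qed
  define l where "l = arg_min length cyc"
  have l: "cyc l" unfolding l_def using ex arg_min_natI by metis
  have lmin: "length l \<le> length l'" if "cyc l'" for l'
    unfolding l_def by (rule arg_min_nat_le) (rule that)
  define m where "m = length l"
  define b where "b = (\<lambda>i. l ! i)"
  have m0: "0 < m" using l unfolding cyc_def m_def by simp
  have bP: "b i \<in> \<P>" if "i < m" for i
    using l that unfolding cyc_def m_def b_def by auto
  have nth: "(l @ [hd l]) ! i = b i" "(l @ [hd l]) ! Suc i = b (Suc i mod m)" if "i < m" for i
  proof -
    show "(l @ [hd l]) ! i = b i" using that by (simp add: b_def m_def nth_append)
    show "(l @ [hd l]) ! Suc i = b (Suc i mod m)"
      using that m0 by (cases "Suc i = m") (auto simp: b_def m_def nth_append hd_conv_nth)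
  qed
  have len: "length (l @ [hd l]) = Suc m" by (simp add: m_def)
  have meet: "bdom (b i) \<inter> bdom (b (Suc i mod m)) \<noteq> {}" if "i < m" for i
  proof -
    have "successively ?L (l @ [hd l])" using l unfolding cyc_def by blast
    then have "?L ((l @ [hd l]) ! i) ((l @ [hd l]) ! Suc i)"
      unfolding successively_conv_nth len using that by simp
    then show ?thesis using nth[OF that] by simp
  qed
  have W: "(\<Sum>i<m. w (b i) (b (Suc i mod m))) < 0"
  proof -
    have "path_weight w (l @ [hd l]) = (\<Sum>i<m. w (b i) (b (Suc i mod m)))"
      unfolding path_weight_sum len using nth by (intro sum.cong) auto
    then show ?thesis using l unfolding cyc_def by simp
  qed
  have mlt: "Suc i mod m < m" for i using m0 by simp
  have w': "w (b i) (b (Suc i mod m)) = prim (b i) x - prim (b (Suc i mod m)) x"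
    if "i < m" "x \<in> bdom (b i) \<inter> bdom (b (Suc i mod m))" for i x
    by (rule w[OF bP[OF that(1)] bP[OF mlt] that(2)])
  \<comment> \<open>A chart has transition constant 0 with itself, and two charts have opposite
    constants in the two orders; so shorter cycles have weight 0.\<close>
  have m3: "3 \<le> m"
  proof (rule ccontr)
    assume "\<not> 3 \<le> m"
    then consider "m = 1" | "m = 2" using m0 by linarith
    then show False
    proof cases
      case 1
      obtain z where "z \<in> bdom (b 0) \<inter> bdom (b 0)" using meet[of 0] 1 by auto
      then have "w (b 0) (b 0) = 0" using w'[of 0 z] 1 by simp
      then show False using W 1 by simp
    next
      case 2
      obtain z where "z \<in> bdom (b 0) \<inter> bdom (b 1)" using meet[of 0] 2 by auto
      then have "w (b 0) (b 1) + w (b 1) (b 0) = 0"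
        using w'[of 0 z] w'[of 1 z] 2 by (auto simp: numeral_2_eq_2)
      then show False using W 2 by (simp add: numeral_2_eq_2)
    qed
  qed
  have chord: "bdom (b i) \<inter> bdom (b j) = {}" if ij: "Suc i < j" "j < m" "\<not> (i = 0 \<and> j = m - 1)" for i j
  proof (rule ccontr)
    assume "bdom (b i) \<inter> bdom (b j) \<noteq> {}"
    then obtain z where z: "z \<in> bdom (b i)" "z \<in> bdom (b j)" by blast
    define A where "A = take i l"
    define Q where "Q = take (j - Suc i) (drop (Suc i) l)"
    define E where "E = drop (Suc j) l"
    have "l = A @ b i # drop (Suc i) l"
      unfolding A_def b_def using ij m_def by (intro id_take_nth_drop) simp
    moreover have "drop (Suc i) l = Q @ b j # E"
    proof -
      have "j - Suc i < length (drop (Suc i) l)" using ij unfolding m_def by simp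
      from id_take_nth_drop[OF this] show ?thesis
        using ij unfolding Q_def E_def b_def m_def by simp
    qed
    ultimately have dec: "l = A @ b i # Q @ b j # E" by simp
    have lenA: "length A = i" "length Q = j - Suc i" "length E = m - Suc j"
      using ij unfolding A_def Q_def E_def m_def by auto
    \<comment> \<open>The chord between \<open>b i\<close> and \<open>b j\<close> closes the inner
      part of the cycle (\<open>l1\<close>) and shortcuts the outer part
      (\<open>l2\<close>).\<close>
    define l1 where "l1 = b i # Q @ [b j]"
    define l2 where "l2 = A @ b i # b j # E"
    have hd: "hd l2 = hd l" unfolding l2_def by (subst dec) (cases A, auto)
    have "path_weight w (l @ [hd l]) = path_weight w (A @ [b i]) + path_weight w (b i # Q @ [b j]) + path_weight w (b j # E @ [hd l])"
      using path_weight_append[of w A "b i" "Q @ b j # E @ [hd l]"]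
        path_weight_append[of w "b i # Q" "b j" "E @ [hd l]"] by (subst dec) simp
    moreover have "path_weight w (l1 @ [hd l1]) = path_weight w (b i # Q @ [b j]) + w (b j) (b i)"
      using path_weight_append[of w "b i # Q" "b j" "[b i]"] unfolding l1_def by simp
    moreover have "path_weight w (l2 @ [hd l2]) = path_weight w (A @ [b i]) + w (b i) (b j) + path_weight w (b j # E @ [hd l])"
      using path_weight_append[of w A "b i" "b j # E @ [hd l]"] unfolding hd by (simp add: l2_def)
    \<comment> \<open>The chord is traversed once in each direction, so its two contributions
      cancel.\<close>
    moreover have "w (b j) (b i) = - w (b i) (b j)"
      using w[OF bP bP, of i j z] w[OF bP bP, of j i z] z ij by simp
    ultimately have "path_weight w (l1 @ [hd l1]) + path_weight w (l2 @ [hd l2]) = path_weight w (l @ [hd l])"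
      by simp
    then have "path_weight w (l1 @ [hd l1]) < 0 \<or> path_weight w (l2 @ [hd l2]) < 0"
      using l unfolding cyc_def by linarith
    moreover have "successively ?L (l @ [hd l])" using l unfolding cyc_def by blast
    then have s: "successively ?L (A @ [b i])" "successively ?L (b i # Q @ [b j])" "successively ?L (b j # E @ [hd l])"
      using successively_append_Cons[of ?L A "b i" "Q @ b j # E @ [hd l]"]
        successively_append_Cons[of ?L "b i # Q" "b j" "E @ [hd l]"] dec
      by (metis append.assoc append_Cons)+
    have "successively ?L (l1 @ [hd l1])"
      using successively_append_Cons[of ?L "b i # Q" "b j" "[b i]"] s(2) z unfolding l1_def by auto
    moreover have "successively ?L (l2 @ [hd l2])"
      using successively_append_Cons[of ?L A "b i" "b j # E @ [hd l]"] s(1,3) z unfolding hd by (auto simp: l2_def)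
    moreover have "set l1 \<subseteq> \<P>" "set l2 \<subseteq> \<P>"
    proof -
      have "set l \<subseteq> \<P>" using l unfolding cyc_def by blast
      moreover have "set l = set A \<union> {b i} \<union> set Q \<union> {b j} \<union> set E" by (subst dec) auto
      ultimately show "set l1 \<subseteq> \<P>" "set l2 \<subseteq> \<P>" unfolding l1_def l2_def by auto
    qed
    moreover have "l1 \<noteq> []" "l2 \<noteq> []" unfolding l1_def l2_def by auto
    ultimately have "cyc l1 \<or> cyc l2" unfolding cyc_def by blast
    moreover have "length l1 < m" "length l2 < m"
    proof -
      \<comment> \<open>For \<open>i = 0\<close> this needs \<open>j \<noteq> m - 1\<close>: the
        first and the last chart are neighbours in the cycle and give no chord.\<close>
      have "j - i + 1 < m" using ij by (cases "i = 0") linarith+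
      moreover have "length l1 = j - i + 1" "length l2 = i + 1 + (m - j)"
        unfolding l1_def l2_def using lenA ij by auto
      ultimately show "length l1 < m" "length l2 < m" using ij by linarith+
    qed
    ultimately show False using lmin unfolding m_def by (meson not_le)
  qed
  have disj: "bdom (b i) \<inter> bdom (b j) = {}"
    if ij: "i < m" "j < m" "j \<noteq> i" "j \<noteq> Suc i mod m" "i \<noteq> Suc j mod m" for i j
  proof (cases "i < j")
    case True
    have "Suc i < j" using True ij(2,4) by (metis Suc_lessI mod_less)
    moreover have "\<not> (i = 0 \<and> j = m - 1)" using ij(5) m0 by auto
    ultimately show ?thesis using chord ij(2) by blast
  next
    case False
    then have "Suc j < i" using ij(1,3,5) by (metis Suc_lessI mod_less nat_neq_iff)
    moreover have "\<not> (j = 0 \<and> i = m - 1)" using ij(4) m0 by auto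
    ultimately show ?thesis using chord[of j i] ij(1) by blast
  qed
  show thesis
  proof (rule that[OF m3]; intro allI impI)
    show "chart_bead (b i)" if "i < m" for i using P(1) bP that by blast
    show "bdom (b i) \<inter> bdom (b (Suc i mod m)) \<noteq> {}" if "i < m" for i using meet that .
    show "bdom (b i) \<inter> bdom (b j) = {}" if "i < m" "j < m" "j \<noteq> i" "j \<noteq> Suc i mod m" "i \<noteq> Suc j mod m" for i j
      using disj that .
    show "prim (b i) x - prim (b (Suc i mod m)) x = prim (b i) y - prim (b (Suc i mod m)) y"
      if "i < m" "x \<in> bdom (b i) \<inter> bdom (b (Suc i mod m))" "y \<in> bdom (b i) \<inter> bdom (b (Suc i mod m))" for i x y
      using w'[OF that(1,2)] w'[OF that(1,3)] by simp
    show "(\<Sum>i<m. prim (b i) (q (Suc i mod m)) - prim (b (Suc i mod m)) (q (Suc i mod m))) < 0"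
      if "\<forall>i<m. q (Suc i mod m) \<in> bdom (b i) \<inter> bdom (b (Suc i mod m))" for q
    proof -
      have "(\<Sum>i<m. prim (b i) (q (Suc i mod m)) - prim (b (Suc i mod m)) (q (Suc i mod m)))
          = (\<Sum>i<m. w (b i) (b (Suc i mod m)))"
      proof (rule sum.cong)
        fix i assume "i \<in> {..<m}"
        then have "i < m" by simp
        from w'[OF this that[rule_format, OF this]]
        show "prim (b i) (q (Suc i mod m)) - prim (b (Suc i mod m)) (q (Suc i mod m)) = w (b i) (b (Suc i mod m))"
          by simp
      qed simp
      then show ?thesis using W by simp
    qed
    show "bdom (b i) \<inter> bdom (b (Suc i mod m)) \<inter> bdom (b (Suc (Suc i mod m) mod m)) = {}" if i: "i < m" for i
    proof (cases "m = 3")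
      case False
      \<comment> \<open>Here the first and the third of the charts are not neighbours, hence
        disjoint.\<close>
      then have m4: "4 \<le> m" using m3 by simp
      have "bdom (b i) \<inter> bdom (b (Suc (Suc i mod m) mod m)) = {}"
      proof (rule disj[OF i mlt])
        have "Suc (Suc i mod m) mod m = (i + 2) mod m" by (simp add: mod_Suc_eq)
        moreover have "Suc (Suc (Suc i mod m) mod m) mod m = (i + 3) mod m"
          by (simp add: mod_Suc_eq numeral_3_eq_3)
        moreover have "(i + 2) mod m \<noteq> i" "(i + 2) mod m \<noteq> (i + 1) mod m" "i \<noteq> (i + 3) mod m"
          using i m4 by (auto simp: mod_if)
        ultimately show "Suc (Suc i mod m) mod m \<noteq> i" "Suc (Suc i mod m) mod m \<noteq> Suc i mod m"
          "i \<noteq> Suc (Suc (Suc i mod m) mod m) mod m" by auto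
      qed
      then show ?thesis by blast
    next
      case True
      show ?thesis
      proof (rule ccontr)
        assume "\<not> ?thesis"
        then obtain z where "z \<in> bdom (b i) \<inter> bdom (b (Suc i mod m)) \<inter> bdom (b (Suc (Suc i mod m) mod m))" by blast
        moreover have "i = 0 \<or> i = 1 \<or> i = 2" using i True by linarith
        ultimately have "z \<in> bdom (b 0)" "z \<in> bdom (b 1)" "z \<in> bdom (b 2)"
          unfolding True by (auto simp: numeral_2_eq_2)
        \<comment> \<open>At a common point of all three charts the transition constants telescope
          to 0, contrary to the negative weight of the cycle.\<close>
        then have "w (b 0) (b 1) + w (b 1) (b 2) + w (b 2) (b 0) = 0"
          using w'[of 0 z] w'[of 1 z] w'[of 2 z] True by (auto simp: numeral_2_eq_2)
        moreover have "(\<Sum>i<3. u i) = u 0 + u 1 + u 2" for u :: "nat \<Rightarrow> real"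
          by (simp add: eval_nat_numeral)
        then have "(\<Sum>i<m. w (b i) (b (Suc i mod m))) = w (b 0) (b 1) + w (b 1) (b 2) + w (b 2) (b 0)"
          unfolding True by (simp add: numeral_2_eq_2)
        ultimately show False using W by simp
      qed
    qed
  qed
qed

text \<open>Consecutive edges may meet more than once. Going along edge \<open>k\<close>, the first
  point on the next edge is made the new vertex: this cuts off the rest of edge \<open>k\<close> and
  the beginning of the next one, so edges only shrink and earlier corrections persist. Edges that
  are not consecutive lie in disjoint charts.\<close>

lemma necklace_exists:
  assumes \<gamma>: "pathin M \<gamma>" "\<gamma> 0 = \<gamma> 1" "form_integral \<omega> \<gamma> < 0"
  obtains m b q where "necklace m b q"
proof -
  obtain m b where m3: "3 \<le> m" and ch': "\<forall>i<m. chart_bead (b i)"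
    and meet': "\<forall>i<m. bdom (b i) \<inter> bdom (b (Suc i mod m)) \<noteq> {}"
    and triple': "\<forall>i<m. bdom (b i) \<inter> bdom (b (Suc i mod m)) \<inter> bdom (b (Suc (Suc i mod m) mod m)) = {}"
    and disj': "\<forall>i j. i < m \<longrightarrow> j < m \<longrightarrow> j \<noteq> i \<longrightarrow> j \<noteq> Suc i mod m \<longrightarrow> i \<noteq> Suc j mod m \<longrightarrow> bdom (b i) \<inter> bdom (b j) = {}"
    and const': "\<forall>i x y. i < m \<longrightarrow> x \<in> bdom (b i) \<inter> bdom (b (Suc i mod m)) \<longrightarrow> y \<in> bdom (b i) \<inter> bdom (b (Suc i mod m)) \<longrightarrow>
       prim (b i) x - prim (b (Suc i mod m)) x = prim (b i) y - prim (b (Suc i mod m)) y"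
    and neg': "\<forall>q. (\<forall>i<m. q (Suc i mod m) \<in> bdom (b i) \<inter> bdom (b (Suc i mod m))) \<longrightarrow>
      (\<Sum>i<m. prim (b i) (q (Suc i mod m)) - prim (b (Suc i mod m)) (q (Suc i mod m))) < 0"
    by (rule minimal_cycle[OF \<gamma>]) (rule that; assumption)
  note ch = ch'[rule_format] and meet = meet'[rule_format] and triple = triple'[rule_format] and disj = disj'[rule_format] and const = const'[rule_format] and neg = neg'[rule_format]
  have m0: "0 < m" using m3 by simp
  let ?n = "\<lambda>i. Suc i mod m"
  have nlt: "?n i < m" for i using m0 by simp
  have n_inj: "i = j" if "?n i = ?n j" "i < m" "j < m" for i j
    using that by (auto simp: mod_Suc split: if_splits)
  have n_neq: "?n i \<noteq> i" "?n (?n i) \<noteq> i" if "i < m" for i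
    using that m3 by (auto simp: mod_Suc split: if_splits)
  have pv: "\<exists>i<m. ?n i = j" if "j < m" for j
    using that m0 by (cases j) (auto intro: exI[of _ "m - 1"] exI[of _ "j - 1"])
  note C = form_chartD[OF ch]
  let ?seg = "\<lambda>q. bead_seg b q m"
  define In where "In = (\<lambda>q. \<forall>i<m. q i \<in> bdom (b i) \<and> q (?n i) \<in> bdom (b i))"
  have ends: "q i \<in> ?seg q i" "q (?n i) \<in> ?seg q i" if "In q" "i < m" for q i
    using that C(7)[OF that(2)] unfolding In_def bead_seg_def by (metis ends_in_segment imageI)+
  have "\<exists>q. In q \<and> (\<forall>i<k. ?seg q i \<inter> ?seg q (?n i) = {q (?n i)})" if "k \<le> m" for k
    using that
  proof (induction k)
    case 0
    have "\<exists>z. \<forall>i<m. ?n i = j \<longrightarrow> z \<in> bdom (b i) \<inter> bdom (b j)" if "j < m" for j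
    proof -
      obtain i where i: "i < m" "?n i = j" using pv[OF \<open>j < m\<close>] by blast
      then obtain z where "z \<in> bdom (b i) \<inter> bdom (b j)" using meet[OF i(1)] by auto
      then show ?thesis using n_inj i by blast
    qed
    then obtain q where q: "\<And>j i. j < m \<Longrightarrow> i < m \<Longrightarrow> ?n i = j \<Longrightarrow> q j \<in> bdom (b i) \<inter> bdom (b j)" by metis
    have "In q"
      unfolding In_def using q pv nlt by (metis IntD1 IntD2)
    then show ?case by auto
  next
    case (Suc k)
    then obtain q where q: "In q" "\<forall>i<k. ?seg q i \<inter> ?seg q (?n i) = {q (?n i)}" by auto
    have k: "k < m" using Suc.prems by simp
    define n where "n = ?n k"
    have n: "n < m" "n \<noteq> k" "?n n \<noteq> k" "?n n \<noteq> n" unfolding n_def using nlt n_neq k by auto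
    define a where "a = fwd (b k) (q k)"
    define c where "c = fwd (b k) (q n)"
    define p where "p = (\<lambda>u. (1 - u) *\<^sub>R a + u *\<^sub>R c)"
    have qk: "q k \<in> bdom (b k)" "q n \<in> bdom (b k)" "q n \<in> bdom (b n)" "q (?n n) \<in> bdom (b n)"
      using q(1) k n(1) unfolding In_def n_def by auto
    have ac: "a \<in> bran (b k)" "c \<in> bran (b k)" unfolding a_def c_def using C(5)[OF k] qk by auto
    have pD: "p u \<in> bran (b k)" if "u \<in> {0..1}" for u
      unfolding p_def using C(4)[OF k] ac that by (intro convexD) auto
    have segn: "closedin M (?seg q n)"
    proof -
      have "closed_segment (fwd (b n) (q n)) (fwd (b n) (q (?n n))) \<subseteq> bran (b n)"
        using C(4,5)[OF n(1)] qk(3,4) by (simp add: closed_segment_subset)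
      from closedin_compactin[OF convex_chart_compactin[OF form_chart_convex[OF ch[OF n(1)]] compact_segment this]]
      show ?thesis unfolding bead_seg_def .
    qed
    \<comment> \<open>The parameters at which edge \<open>k\<close> is on the next edge; its end, at
      parameter 1, is one of them, and compactness provides a first one.\<close>
    define T where "T = {u \<in> {0..1}. bwd (b k) (p u) \<in> ?seg q n}"
    have "continuous_map (top_of_set {0..1::real}) (top_of_set (bran (b k))) p"
      using pD unfolding p_def by (auto simp: continuous_map_in_subtopology intro!: continuous_intros)
    from continuous_map_compose[OF this C(10)[OF k]]
    have "continuous_map (top_of_set {0..1}) M (\<lambda>u. bwd (b k) (p u))" by (simp add: o_def)
    from closedin_continuous_map_preimage[OF this segn]
    have "closedin (top_of_set {0..1}) T" unfolding T_def by simp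
    then have "compact T" using closedin_compact compact_Icc by blast
    have "p 1 = c" "p 0 = a" unfolding p_def by simp_all
    then have "1 \<in> T"
      unfolding T_def using C(7)[OF k qk(2)] ends(1)[OF q(1) n(1)] by (simp add: c_def)
    then obtain u where u: "u \<in> T" "\<And>s. s \<in> T \<Longrightarrow> u \<le> s"
      using compact_attains_inf[OF \<open>compact T\<close>] by blast
    have u01: "u \<in> {0..1}" using u(1) unfolding T_def by blast
    define z where "z = bwd (b k) (p u)"
    have z: "z \<in> ?seg q n" "z \<in> bdom (b k)" "fwd (b k) z = p u"
      using u(1) C(6,8)[OF k] pD[OF u01] unfolding T_def z_def by auto
    obtain y where y: "y \<in> closed_segment (fwd (b n) (q n)) (fwd (b n) (q (?n n)))" "z = bwd (b n) y"
      using z(1) unfolding bead_seg_def by blast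
    have yD: "y \<in> bran (b n)"
      using y(1) C(4,5)[OF n(1)] qk(3,4) closed_segment_subset by blast
    have zn: "z \<in> bdom (b n)" "fwd (b n) z = y" using y(2) C(6,8)[OF n(1)] yD by auto
    define q' where "q' = q(n := z)"
    have q'k: "q' k = q k" "q' n = z" "q' (?n n) = q (?n n)" unfolding q'_def using n by auto
    have q'o: "q' (?n i) = q (?n i)" if "i < m" "i \<noteq> k" for i
      unfolding q'_def n_def using n_inj[OF _ that(1) k] that(2) by auto
    have "In q'"
      unfolding In_def
    proof (intro allI impI)
      fix i assume i: "i < m"
      have "q' i \<in> bdom (b i)"
        using q(1) i zn unfolding In_def q'_def by auto
      moreover have "q' (?n i) \<in> bdom (b i)"
      proof (cases "i = k")
        case True
        then show ?thesis using z(2) q'k(2) unfolding n_def by simp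
      next
        case False
        then show ?thesis using q'o[OF i False] q(1) i unfolding In_def by simp
      qed
      ultimately show "q' i \<in> bdom (b i) \<and> q' (?n i) \<in> bdom (b i)" by blast
    qed
    have segk: "?seg q' k = bwd (b k) ` closed_segment a (p u)"
      unfolding bead_seg_def using q'k(1,2) z(3) by (simp add: a_def n_def)
    \<comment> \<open>As new edges lie in old ones, an intersection already corrected cannot gain
      points; the common vertex keeps it non-empty.\<close>
    have sub: "?seg q' i \<subseteq> ?seg q i" if i: "i < m" for i
    proof -
      consider "i = k" | "i = n" | "i \<noteq> k" "i \<noteq> n" by blast
      then show ?thesis
      proof cases
        case 1
        have "p u \<in> closed_segment a c"
          unfolding p_def closed_segment_def using u01 by auto
        then have "closed_segment a (p u) \<subseteq> closed_segment a c"
          by (simp add: subset_closed_segment)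
        then show ?thesis unfolding 1 segk unfolding bead_seg_def a_def c_def n_def by (rule image_mono)
      next
        case 2
        have "closed_segment y (fwd (b n) (q (?n n))) \<subseteq> closed_segment (fwd (b n) (q n)) (fwd (b n) (q (?n n)))"
          using y(1) by (simp add: subset_closed_segment)
        then show ?thesis unfolding 2 bead_seg_def q'k(2,3) zn(2) by (rule image_mono)
      next
        case 3
        then have "q' i = q i" unfolding q'_def by simp
        then show ?thesis unfolding bead_seg_def using q'o[OF i 3(1)] by simp
      qed
    qed
    have "?seg q' i \<inter> ?seg q' (?n i) = {q' (?n i)}" if "i < Suc k" for i
    proof -
      have i: "i < m" using that k by simp
      have e: "q' (?n i) \<in> ?seg q' i \<inter> ?seg q' (?n i)"
        using ends[OF \<open>In q'\<close> i] ends(1)[OF \<open>In q'\<close> nlt] by blast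
      have "\<exists>x. ?seg q' i \<inter> ?seg q' (?n i) \<subseteq> {x}"
      proof (cases "i = k")
        case False
        then have "?seg q i \<inter> ?seg q (?n i) = {q (?n i)}" using q(2) that by simp
        then show ?thesis using sub[OF i] sub[OF nlt] by blast
      next
        case True
        have "x = z" if x: "x \<in> ?seg q' k" "x \<in> ?seg q n" for x
        proof -
          obtain s where s: "0 \<le> s" "s \<le> 1" "x = bwd (b k) ((1 - s) *\<^sub>R a + s *\<^sub>R p u)"
            using x(1) unfolding segk closed_segment_def by blast
          have eq: "(1 - s) *\<^sub>R a + s *\<^sub>R p u = p (s * u)" unfolding p_def by (simp add: algebra_simps)
          have "s * u \<in> T"
            unfolding T_def using s x(2) u01 eq by (auto simp: mult_le_one)
          then have "u \<le> s * u" by (rule u(2))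
          moreover have "s * u \<le> u" using s u01 by (simp add: mult_left_le_one_le)
          ultimately have "s * u = u" by (rule antisym[rotated])
          then show ?thesis unfolding z_def s(3) eq by (simp only:)
        qed
        moreover have "?seg q' (?n i) \<subseteq> ?seg q n" unfolding True using sub[OF nlt] unfolding n_def .
        ultimately show ?thesis unfolding True by (intro exI[of _ z]) blast
      qed
      then show ?thesis using e by blast
    qed
    then show ?case using \<open>In q'\<close> by blast
  qed
  from this[of m] obtain q where q: "In q" "\<forall>i<m. ?seg q i \<inter> ?seg q (?n i) = {q (?n i)}" by auto
  have qq: "q (?n i) \<in> bdom (b i) \<inter> bdom (b (?n i))" if "i < m" for i
    using q(1) that nlt unfolding In_def by blast
  have "q i \<noteq> q (?n i)" if i: "i < m" for i
  proof
    assume eq: "q i = q (?n i)"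
    \<comment> \<open>A degenerate edge would put its vertex into three consecutive charts.\<close>
    obtain j where j: "j < m" "?n j = i" using pv[OF i] by blast
    have "q i \<in> bdom (b j) \<inter> bdom (b i)" using qq[OF j(1)] j(2) by simp
    moreover have "q i \<in> bdom (b (?n i))" using qq[OF i] eq by simp
    ultimately show False using triple[OF j(1)] j(2) by blast
  qed
  note nondeg = this
  have "necklace m b q"
    unfolding necklace_def
  proof (intro conjI allI impI ballI)
    show "chart_bead (b i)" "q i \<noteq> q (?n i)" if "i < m" for i using ch nondeg that by auto
    show "q i \<in> bdom (b i)" "q (?n i) \<in> bdom (b i)" if "i < m" for i
      using q(1) that unfolding In_def by auto
    show "bdom (b i) \<inter> bdom (b j) = {}" if "i < m" "j < m" "j \<noteq> i \<and> j \<noteq> ?n i \<and> i \<noteq> ?n j" for i j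
      using disj[OF that(1,2)] that(3) by blast
    show "?seg q i \<inter> ?seg q (?n i) = {q (?n i)}" if "i < m" for i using q(2) that by blast
    show "prim (b i) x - prim (b (?n i)) x = prim (b i) y - prim (b (?n i)) y"
      if "i < m" "x \<in> bdom (b i) \<inter> bdom (b (?n i))" "y \<in> bdom (b i) \<inter> bdom (b (?n i))" for i x y
      by (rule const[OF that])
    show "(\<Sum>i<m. prim (b i) (q (?n i)) - prim (b (?n i)) (q (?n i))) < 0"
      by (rule neg[OF qq])
  qed (rule m3)
  then show thesis using that by blast
qed

end

section \<open>Rotation around a necklace\<close>

context manifold_form begin

definition bead_coord :: "(nat \<Rightarrow> ('a, 'e) bead) \<Rightarrow> (nat \<Rightarrow> 'a) \<Rightarrow> nat \<Rightarrow> nat \<Rightarrow> 'a \<Rightarrow> real"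
  where "bead_coord b q m i z = proj_coord (fwd (b i) (q i)) (fwd (b i) (q (Suc i mod m))) (fwd (b i) z)"

lemma necklaceD:
  assumes "necklace m b q"
  shows "3 \<le> m" "\<And>i. i < m \<Longrightarrow> chart_bead (b i)" "\<And>i. i < m \<Longrightarrow> q i \<in> bdom (b i)"
    "\<And>i. i < m \<Longrightarrow> q (Suc i mod m) \<in> bdom (b i)" "\<And>i. i < m \<Longrightarrow> q i \<noteq> q (Suc i mod m)"
    "\<And>i j. i < m \<Longrightarrow> j < m \<Longrightarrow> j \<noteq> i \<Longrightarrow> j \<noteq> Suc i mod m \<Longrightarrow> i \<noteq> Suc j mod m \<Longrightarrow> bdom (b i) \<inter> bdom (b j) = {}"
    "\<And>i. i < m \<Longrightarrow> bead_seg b q m i \<inter> bead_seg b q m (Suc i mod m) = {q (Suc i mod m)}"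
    "\<And>i x y. i < m \<Longrightarrow> x \<in> bdom (b i) \<inter> bdom (b (Suc i mod m)) \<Longrightarrow> y \<in> bdom (b i) \<inter> bdom (b (Suc i mod m)) \<Longrightarrow>
       prim (b i) x - prim (b (Suc i mod m)) x = prim (b i) y - prim (b (Suc i mod m)) y"
    "(\<Sum>i<m. prim (b i) (q (Suc i mod m)) - prim (b (Suc i mod m)) (q (Suc i mod m))) < 0"
proof -
  have *: "3 \<le> m"
    "\<forall>i<m. chart_bead (b i) \<and> q i \<in> bdom (b i) \<and> q (Suc i mod m) \<in> bdom (b i) \<and> q i \<noteq> q (Suc i mod m)"
    "\<forall>i<m. \<forall>j<m. j \<noteq> i \<and> j \<noteq> Suc i mod m \<and> i \<noteq> Suc j mod m \<longrightarrow> bdom (b i) \<inter> bdom (b j) = {}"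
    "\<forall>i<m. bead_seg b q m i \<inter> bead_seg b q m (Suc i mod m) = {q (Suc i mod m)}"
    "\<forall>i<m. \<forall>x\<in>bdom (b i) \<inter> bdom (b (Suc i mod m)). \<forall>y\<in>bdom (b i) \<inter> bdom (b (Suc i mod m)).
       prim (b i) x - prim (b (Suc i mod m)) x = prim (b i) y - prim (b (Suc i mod m)) y"
    "(\<Sum>i<m. prim (b i) (q (Suc i mod m)) - prim (b (Suc i mod m)) (q (Suc i mod m))) < 0"
  proof -
    note A = assms[unfolded necklace_def]
    show "3 \<le> m" by (rule conjunct1[OF A])
    note A = conjunct2[OF A]
    show "\<forall>i<m. chart_bead (b i) \<and> q i \<in> bdom (b i) \<and> q (Suc i mod m) \<in> bdom (b i) \<and> q i \<noteq> q (Suc i mod m)"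
      by (rule conjunct1[OF A])
    note A = conjunct2[OF A]
    show "\<forall>i<m. \<forall>j<m. j \<noteq> i \<and> j \<noteq> Suc i mod m \<and> i \<noteq> Suc j mod m \<longrightarrow> bdom (b i) \<inter> bdom (b j) = {}"
      by (rule conjunct1[OF A])
    note A = conjunct2[OF A]
    show "\<forall>i<m. bead_seg b q m i \<inter> bead_seg b q m (Suc i mod m) = {q (Suc i mod m)}"
      by (rule conjunct1[OF A])
    note A = conjunct2[OF A]
    show "\<forall>i<m. \<forall>x\<in>bdom (b i) \<inter> bdom (b (Suc i mod m)). \<forall>y\<in>bdom (b i) \<inter> bdom (b (Suc i mod m)).
       prim (b i) x - prim (b (Suc i mod m)) x = prim (b i) y - prim (b (Suc i mod m)) y"
      by (rule conjunct1[OF A])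
    show "(\<Sum>i<m. prim (b i) (q (Suc i mod m)) - prim (b (Suc i mod m)) (q (Suc i mod m))) < 0"
      by (rule conjunct2[OF A])
  qed
  show "3 \<le> m" "(\<Sum>i<m. prim (b i) (q (Suc i mod m)) - prim (b (Suc i mod m)) (q (Suc i mod m))) < 0"
    using *(1,6) .
  show "\<And>i. i < m \<Longrightarrow> chart_bead (b i)" "\<And>i. i < m \<Longrightarrow> q i \<in> bdom (b i)"
    "\<And>i. i < m \<Longrightarrow> q (Suc i mod m) \<in> bdom (b i)" "\<And>i. i < m \<Longrightarrow> q i \<noteq> q (Suc i mod m)"
    using *(2) by blast+
  show "\<And>i j. i < m \<Longrightarrow> j < m \<Longrightarrow> j \<noteq> i \<Longrightarrow> j \<noteq> Suc i mod m \<Longrightarrow> i \<noteq> Suc j mod m \<Longrightarrow> bdom (b i) \<inter> bdom (b j) = {}"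
    using *(3) by simp
  show "\<And>i. i < m \<Longrightarrow> bead_seg b q m i \<inter> bead_seg b q m (Suc i mod m) = {q (Suc i mod m)}"
    using *(4) by simp
  show "\<And>i x y. i < m \<Longrightarrow> x \<in> bdom (b i) \<inter> bdom (b (Suc i mod m)) \<Longrightarrow> y \<in> bdom (b i) \<inter> bdom (b (Suc i mod m)) \<Longrightarrow>
       prim (b i) x - prim (b (Suc i mod m)) x = prim (b i) y - prim (b (Suc i mod m)) y"
    using *(5) by blast
qed

lemma bead_seg_facts:
  assumes N: "necklace m b q" and i: "i < m"
  shows "bead_seg b q m i \<subseteq> bdom (b i)" "closedin M (bead_seg b q m i)"
    "q i \<in> bead_seg b q m i" "q (Suc i mod m) \<in> bead_seg b q m i"
    "\<And>z. z \<in> bead_seg b q m i \<Longrightarrow> 0 \<le> bead_coord b q m i z \<and> bead_coord b q m i z \<le> 1"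
    "bead_coord b q m i (q i) = 0" "bead_coord b q m i (q (Suc i mod m)) = 1"
    "\<And>z. z \<in> bead_seg b q m i \<Longrightarrow> bead_coord b q m i z = 0 \<Longrightarrow> z = q i"
    "\<And>z. z \<in> bead_seg b q m i \<Longrightarrow> bead_coord b q m i z = 1 \<Longrightarrow> z = q (Suc i mod m)"
proof -
  note C = form_chartD[OF necklaceD(2)[OF N i]] and q = necklaceD(3-5)[OF N i]
  let ?x = "fwd (b i) (q i)" and ?y = "fwd (b i) (q (Suc i mod m))"
  have D: "closed_segment ?x ?y \<subseteq> bran (b i)"
    using C(4,5) q by (simp add: closed_segment_subset)
  have ne: "?x \<noteq> ?y" using C(7)[OF q(1)] C(7)[OF q(2)] q(3) by metis
  show "bead_seg b q m i \<subseteq> bdom (b i)" unfolding bead_seg_def using D C(6) by blast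
  show "closedin M (bead_seg b q m i)"
    unfolding bead_seg_def
    by (rule closedin_compactin[OF convex_chart_compactin[OF form_chart_convex[OF necklaceD(2)[OF N i]] compact_segment D]])
  show "q i \<in> bead_seg b q m i" "q (Suc i mod m) \<in> bead_seg b q m i"
    unfolding bead_seg_def using C(7)[OF q(1)] C(7)[OF q(2)] by (metis ends_in_segment imageI)+
  show "bead_coord b q m i (q i) = 0" "bead_coord b q m i (q (Suc i mod m)) = 1"
    unfolding bead_coord_def using proj_coord_ends[OF ne] by auto
  have *: "\<exists>u. 0 \<le> u \<and> u \<le> 1 \<and> bead_coord b q m i z = u \<and> z = bwd (b i) ((1 - u) *\<^sub>R ?x + u *\<^sub>R ?y)"
    if "z \<in> bead_seg b q m i" for z
  proof -
    obtain u where u: "0 \<le> u" "u \<le> 1" "z = bwd (b i) ((1 - u) *\<^sub>R ?x + u *\<^sub>R ?y)"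
      using \<open>z \<in> bead_seg b q m i\<close> unfolding bead_seg_def closed_segment_def by blast
    have "(1 - u) *\<^sub>R ?x + u *\<^sub>R ?y \<in> bran (b i)"
      using D u(1,2) unfolding closed_segment_def by blast
    then have "bead_coord b q m i z = u"
      unfolding bead_coord_def u(3) using C(8) proj_coord_segment[OF ne u(1,2)] by simp
    then show ?thesis using u by blast
  qed
  show "0 \<le> bead_coord b q m i z \<and> bead_coord b q m i z \<le> 1" if "z \<in> bead_seg b q m i" for z
    using *[OF that] by blast
  show "z = q i" if "z \<in> bead_seg b q m i" "bead_coord b q m i z = 0" for z
    using *[OF that(1)] that(2) C(7)[OF q(1)] by auto
  show "z = q (Suc i mod m)" if "z \<in> bead_seg b q m i" "bead_coord b q m i z = 1" for z
    using *[OF that(1)] that(2) C(7)[OF q(2)] by auto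
qed

lemma bead_coord_openin:
  assumes N: "necklace m b q" and i: "i < m" and "open A"
  shows "openin M {z \<in> bdom (b i). bead_coord b q m i z \<in> A}"
proof -
  have "open (proj_coord (fwd (b i) (q i)) (fwd (b i) (q (Suc i mod m))) -` A)"
    using continuous_on_proj_coord assms(3) by (rule open_vimage[rotated])
  from convex_chart_openin_preimage[OF form_chart_convex[OF necklaceD(2)[OF N i]] this]
  show ?thesis unfolding bead_coord_def by simp
qed

lemma normal_separation:
  assumes "closedin M S" "closedin M T" "disjnt S T"
  shows "\<exists>U V. openin M U \<and> openin M V \<and> S \<subseteq> U \<and> T \<subseteq> V \<and> disjnt U V"
  using normal[unfolded normal_space_def, rule_format, of S T] assms by simp

lemma Suc_mod_facts:
  assumes "3 \<le> m"
  shows "\<And>i. Suc i mod m < m" "\<And>i j. Suc i mod m = Suc j mod m \<Longrightarrow> i < m \<Longrightarrow> j < m \<Longrightarrow> i = j"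
    "\<And>j. j < m \<Longrightarrow> \<exists>i<m. Suc i mod m = j"
proof -
  show "\<And>i. Suc i mod m < m" using assms by simp
  show "i = j" if "Suc i mod m = Suc j mod m" "i < m" "j < m" for i j
    using that by (auto simp: mod_Suc split: if_splits)
  show "\<exists>i<m. Suc i mod m = j" if "j < m" for j
    using that assms by (cases j) (auto intro: exI[of _ "m - 1"] exI[of _ "j - 1"])
qed

text \<open>Consecutive edges meet only in a vertex, the end of one and the start of the other. By
  normality the supports of the pushes can be made so thin that a point in two consecutive ones is
  past the middle of the first edge and before the middle of the second. A function stepping down at
  the midpoints is then consistent on the overlaps.\<close>

lemma necklace_tubes:
  assumes N: "necklace m b q" and W: "\<And>i. i < m \<Longrightarrow> openin M (W i)" "\<And>i. i < m \<Longrightarrow> bead_seg b q m i \<subseteq> W i"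
  obtains S g d C where "\<forall>i<m. compact (S i) \<and> S i \<subseteq> bran (b i) \<and> bead_seg b q m i \<subseteq> bwd (b i) ` S i \<and>
      bwd (b i) ` S i \<subseteq> W i \<and> move_by M \<omega> (g i) (d i) (C i)"
    "\<forall>i<m. \<forall>z\<in>topspace M - bwd (b i) ` S i. g i z = z \<and> d i z = 0"
    "\<forall>i<m. \<forall>z\<in>bwd (b i) ` S i. g i z \<in> bwd (b i) ` S i \<and> d i z = prim (b i) (g i z) - prim (b i) z"
    "\<forall>i<m. g i (q i) = q (Suc i mod m) \<and> (\<forall>z\<in>topspace M. g i z = q (Suc i mod m) \<longrightarrow> z = q i)"
    "\<forall>i<m. \<forall>z\<in>bwd (b i) ` S i. g i z \<noteq> z \<longrightarrow> bead_coord b q m i z < bead_coord b q m i (g i z)"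
    "\<forall>i<m. \<forall>z\<in>bead_seg b q m i. g i z \<noteq> z"
    "\<forall>i<m. \<forall>z\<in>bwd (b i) ` S i \<inter> bwd (b (Suc i mod m)) ` S (Suc i mod m).
      1/2 < bead_coord b q m i z \<and> bead_coord b q m (Suc i mod m) z < 1/2"
proof -
  let ?n = "\<lambda>i. Suc i mod m"
  let ?seg = "bead_seg b q m" and ?c = "bead_coord b q m"
  note F = bead_seg_facts[OF N]
  note nx = Suc_mod_facts[OF necklaceD(1)[OF N]]
  \<comment> \<open>The first separation keeps the initial half of edge \<open>i\<close> away from
    the next edge, the second keeps edge \<open>i\<close> away from the final half of the next
    edge.\<close>
  have sep: "\<exists>X Y X' Y'. openin M X \<and> openin M Y \<and> openin M X' \<and> openin M Y' \<and> X \<inter> Y = {} \<and> X' \<inter> Y' = {} \<and>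
      {z \<in> ?seg i. ?c i z \<le> 1/2} \<subseteq> X \<and> ?seg (?n i) \<subseteq> Y \<and> ?seg i \<subseteq> X' \<and> {z \<in> ?seg (?n i). 1/2 \<le> ?c (?n i) z} \<subseteq> Y'"
    if i: "i < m" for i
  proof -
    have eq1: "{z \<in> ?seg i. ?c i z \<le> 1/2} = ?seg i - {z \<in> bdom (b i). ?c i z \<in> {1/2<..}}"
      using F(1)[OF i] by auto
    have 1: "closedin M {z \<in> ?seg i. ?c i z \<le> 1/2}"
      unfolding eq1 using F(2)[OF i] bead_coord_openin[OF N i open_greaterThan] by (rule closedin_diff)
    have eq2: "{z \<in> ?seg (?n i). 1/2 \<le> ?c (?n i) z} = ?seg (?n i) - {z \<in> bdom (b (?n i)). ?c (?n i) z \<in> {..<1/2}}"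
      using F(1)[OF nx(1)] by auto
    have 2: "closedin M {z \<in> ?seg (?n i). 1/2 \<le> ?c (?n i) z}"
      unfolding eq2 using F(2)[OF nx(1)] bead_coord_openin[OF N nx(1) open_lessThan] by (rule closedin_diff)
    have int: "?seg i \<inter> ?seg (?n i) = {q (?n i)}" by (rule necklaceD(7)[OF N i])
    have d1: "disjnt {z \<in> ?seg i. ?c i z \<le> 1/2} (?seg (?n i))"
    proof -
      have False if "z \<in> ?seg i" "?c i z \<le> 1/2" "z \<in> ?seg (?n i)" for z
      proof -
        have "z = q (?n i)" using int that by blast
        then show False using F(7)[OF i] that(2) by simp
      qed
      then show ?thesis unfolding disjnt_iff by blast
    qed
    have d2: "disjnt (?seg i) {z \<in> ?seg (?n i). 1/2 \<le> ?c (?n i) z}"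
    proof -
      have False if "z \<in> ?seg i" "1/2 \<le> ?c (?n i) z" "z \<in> ?seg (?n i)" for z
      proof -
        have "z = q (?n i)" using int that by blast
        then show False using F(6)[OF nx(1)] that(2) by simp
      qed
      then show ?thesis unfolding disjnt_iff by blast
    qed
    obtain X Y where "openin M X" "openin M Y" "{z \<in> ?seg i. ?c i z \<le> 1/2} \<subseteq> X" "?seg (?n i) \<subseteq> Y" "disjnt X Y"
      using normal_separation[OF 1 F(2)[OF nx(1)] d1] by blast
    moreover obtain X' Y' where "openin M X'" "openin M Y'" "?seg i \<subseteq> X'" "{z \<in> ?seg (?n i). 1/2 \<le> ?c (?n i) z} \<subseteq> Y'" "disjnt X' Y'"
      using normal_separation[OF F(2)[OF i] 2 d2] by blast
    ultimately show ?thesis unfolding disjnt_def by (intro exI conjI) assumption+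
  qed
  define sp where "sp = (\<lambda>i X Y X' Y'. openin M X \<and> openin M Y \<and> openin M X' \<and> openin M Y' \<and> X \<inter> Y = {} \<and> X' \<inter> Y' = {} \<and>
      {z \<in> ?seg i. ?c i z \<le> 1/2} \<subseteq> X \<and> ?seg (?n i) \<subseteq> Y \<and> ?seg i \<subseteq> X' \<and> {z \<in> ?seg (?n i). 1/2 \<le> ?c (?n i) z} \<subseteq> Y')"
  have "\<exists>X Y X' Y'. sp i X Y X' Y'" if "i < m" for i
    unfolding sp_def by (rule sep[OF that])
  then obtain X Y X' Y' where "\<And>i. i < m \<Longrightarrow> sp i (X i) (Y i) (X' i) (Y' i)" by metis
  then have XY: "\<forall>i<m. openin M (X i) \<and> openin M (Y i) \<and> openin M (X' i) \<and> openin M (Y' i) \<and>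
      X i \<inter> Y i = {} \<and> X' i \<inter> Y' i = {} \<and> {z \<in> ?seg i. ?c i z \<le> 1/2} \<subseteq> X i \<and> ?seg (?n i) \<subseteq> Y i \<and> ?seg i \<subseteq> X' i \<and>
      {z \<in> ?seg (?n i). 1/2 \<le> ?c (?n i) z} \<subseteq> Y' i"
    unfolding sp_def by simp
  have step: "\<exists>S g d C. compact S \<and> S \<subseteq> bran (b i) \<and> ?seg i \<subseteq> bwd (b i) ` S \<and> bwd (b i) ` S \<subseteq> W i \<and>
      move_by M \<omega> g d C \<and> (\<forall>z\<in>topspace M - bwd (b i) ` S. g z = z \<and> d z = 0) \<and>
      (\<forall>z\<in>bwd (b i) ` S. g z \<in> bwd (b i) ` S \<and> d z = prim (b i) (g z) - prim (b i) z) \<and>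
      g (q i) = q (?n i) \<and> (\<forall>z\<in>topspace M. g z = q (?n i) \<longrightarrow> z = q i) \<and>
      (\<forall>z\<in>bwd (b i) ` S. g z \<noteq> z \<longrightarrow> ?c i z < ?c i (g z)) \<and> (\<forall>z\<in>?seg i. g z \<noteq> z) \<and>
      (\<forall>z\<in>bwd (b i) ` S. (?c i z \<le> 1/2 \<longrightarrow> z \<in> X i) \<and> z \<in> X' i \<and>
         (\<forall>j<m. ?n j = i \<longrightarrow> z \<in> Y j \<and> (1/2 \<le> ?c i z \<longrightarrow> z \<in> Y' j)))"
    if i: "i < m" for i
  proof -
    obtain j where j: "j < m" "?n j = i" using nx(3)[OF i] by blast
    have ju: "j' = j" if "j' < m" "?n j' = i" for j' using nx(2)[of j' j] that j by simp
    \<comment> \<open>Edge \<open>i\<close> takes part in two separations, as the earlier edge in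
      the one with index \<open>i\<close> and as the later edge in the one of its predecessor
      \<open>j\<close>; \<open>Q\<close> collects all conditions.\<close>
    define Q where "Q = W i \<inter> (X i \<union> {z \<in> bdom (b i). ?c i z \<in> {1/2<..}}) \<inter> X' i \<inter> Y j \<inter>
        (Y' j \<union> {z \<in> bdom (b i). ?c i z \<in> {..<1/2}})"
    have Q: "openin M Q"
    proof -
      have "openin M (X i)" "openin M (X' i)" "openin M (Y j)" "openin M (Y' j)"
        using XY i j(1) by simp_all
      then show ?thesis
        unfolding Q_def
        by (intro openin_Int openin_Un W(1)[OF i] bead_coord_openin[OF N i open_greaterThan]
            bead_coord_openin[OF N i open_lessThan])
    qed
    have sQ: "?seg i \<subseteq> Q"
    proof
      fix z assume z: "z \<in> ?seg i"
      have "z \<in> bdom (b i)" using F(1)[OF i] z by blast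
      moreover have "z \<in> W i" "z \<in> X' i" "z \<in> Y j" using W(2)[OF i] XY i j z by blast+
      moreover have "z \<in> X i" if "?c i z \<le> 1/2" using XY i z that by blast
      moreover have "z \<in> Y' j" if "1/2 \<le> ?c i z" using XY j z that by blast
      ultimately show "z \<in> Q" unfolding Q_def by (auto simp: not_le)
    qed
    from push_move[OF necklaceD(2)[OF N i] necklaceD(3)[OF N i] necklaceD(4)[OF N i] necklaceD(5)[OF N i] Q
        sQ[unfolded bead_seg_def]]
    obtain S g d C where S: "compact S" "S \<subseteq> bran (b i)"
      "closed_segment (fwd (b i) (q i)) (fwd (b i) (q (?n i))) \<subseteq> S" "bwd (b i) ` S \<subseteq> Q" "move_by M \<omega> g d C"
      "\<forall>z\<in>topspace M - bwd (b i) ` S. g z = z \<and> d z = 0"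
      "\<forall>z\<in>bwd (b i) ` S. g z \<in> bwd (b i) ` S \<and> d z = prim (b i) (g z) - prim (b i) z"
      "g (q i) = q (?n i)" "\<forall>z\<in>topspace M. g z = q (?n i) \<longrightarrow> z = q i"
      "\<forall>z\<in>bwd (b i) ` S. g z \<noteq> z \<longrightarrow>
        proj_coord (fwd (b i) (q i)) (fwd (b i) (q (?n i))) (fwd (b i) z)
        < proj_coord (fwd (b i) (q i)) (fwd (b i) (q (?n i))) (fwd (b i) (g z))"
      "\<forall>z\<in>bwd (b i) ` closed_segment (fwd (b i) (q i)) (fwd (b i) (q (?n i))). g z \<noteq> z"
      by (elim exE conjE) (rule that; assumption)
    have "\<forall>z\<in>bwd (b i) ` S. g z \<noteq> z \<longrightarrow> ?c i z < ?c i (g z)" unfolding bead_coord_def by (rule S(10))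
    moreover have "\<forall>z\<in>?seg i. g z \<noteq> z" unfolding bead_seg_def by (rule S(11))
    moreover have "?seg i \<subseteq> bwd (b i) ` S" unfolding bead_seg_def using S(3) by (rule image_mono)
    moreover have "bwd (b i) ` S \<subseteq> W i" using S(4) unfolding Q_def by blast
    moreover have "\<forall>z\<in>bwd (b i) ` S. (?c i z \<le> 1/2 \<longrightarrow> z \<in> X i) \<and> z \<in> X' i \<and>
         (\<forall>j<m. ?n j = i \<longrightarrow> z \<in> Y j \<and> (1/2 \<le> ?c i z \<longrightarrow> z \<in> Y' j))"
    proof (intro ballI conjI impI allI)
      fix z assume "z \<in> bwd (b i) ` S"
      then have z: "z \<in> Q" using S(4) by blast
      show "z \<in> X' i" using z unfolding Q_def by blast
      show "z \<in> X i" if "?c i z \<le> 1/2" using z that unfolding Q_def by auto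
      fix j' assume "j' < m" "?n j' = i"
      then have [simp]: "j' = j" by (rule ju)
      show "z \<in> Y j'" using z unfolding Q_def by simp
      show "z \<in> Y' j'" if "1/2 \<le> ?c i z" using z that unfolding Q_def by auto
    qed
    ultimately show ?thesis using S(1,2,5-9) by (intro exI conjI) assumption+
  qed
  define tube where "tube = (\<lambda>i S g d C. compact S \<and> S \<subseteq> bran (b i) \<and> ?seg i \<subseteq> bwd (b i) ` S \<and> bwd (b i) ` S \<subseteq> W i \<and>
      move_by M \<omega> g d C \<and> (\<forall>z\<in>topspace M - bwd (b i) ` S. g z = z \<and> d z = 0) \<and>
      (\<forall>z\<in>bwd (b i) ` S. g z \<in> bwd (b i) ` S \<and> d z = prim (b i) (g z) - prim (b i) z) \<and>
      g (q i) = q (?n i) \<and> (\<forall>z\<in>topspace M. g z = q (?n i) \<longrightarrow> z = q i) \<and>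
      (\<forall>z\<in>bwd (b i) ` S. g z \<noteq> z \<longrightarrow> ?c i z < ?c i (g z)) \<and> (\<forall>z\<in>?seg i. g z \<noteq> z) \<and>
      (\<forall>z\<in>bwd (b i) ` S. (?c i z \<le> 1/2 \<longrightarrow> z \<in> X i) \<and> z \<in> X' i \<and>
         (\<forall>j<m. ?n j = i \<longrightarrow> z \<in> Y j \<and> (1/2 \<le> ?c i z \<longrightarrow> z \<in> Y' j))))"
  have "\<exists>S g d C. tube i S g d C" if "i < m" for i
    unfolding tube_def by (rule step[OF that])
  then obtain S g d C where tube: "\<And>i. i < m \<Longrightarrow> tube i (S i) (g i) (d i) (C i)" by metis
  note tube = tube[unfolded tube_def]
  have inQ: "\<forall>z\<in>bwd (b i) ` S i. (?c i z \<le> 1/2 \<longrightarrow> z \<in> X i) \<and> z \<in> X' i \<and>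
         (\<forall>j<m. ?n j = i \<longrightarrow> z \<in> Y j \<and> (1/2 \<le> ?c i z \<longrightarrow> z \<in> Y' j))" if "i < m" for i
    using tube[OF that] by (elim conjE) assumption
  show thesis
  proof (rule that[of S g d C]; intro allI impI)
    fix i assume i: "i < m"
    note t = tube[OF i]
    show "compact (S i) \<and> S i \<subseteq> bran (b i) \<and> ?seg i \<subseteq> bwd (b i) ` S i \<and>
        bwd (b i) ` S i \<subseteq> W i \<and> move_by M \<omega> (g i) (d i) (C i)"
      using t by (elim conjE, intro conjI) assumption+
    show "\<forall>z\<in>topspace M - bwd (b i) ` S i. g i z = z \<and> d i z = 0"
      using t by (elim conjE) assumption
    show "\<forall>z\<in>bwd (b i) ` S i. g i z \<in> bwd (b i) ` S i \<and> d i z = prim (b i) (g i z) - prim (b i) z"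
      using t by (elim conjE) assumption
    show "g i (q i) = q (?n i) \<and> (\<forall>z\<in>topspace M. g i z = q (?n i) \<longrightarrow> z = q i)"
      using t by (elim conjE, intro conjI) assumption+
    show "\<forall>z\<in>bwd (b i) ` S i. g i z \<noteq> z \<longrightarrow> ?c i z < ?c i (g i z)"
      using t by (elim conjE) assumption
    show "\<forall>z\<in>?seg i. g i z \<noteq> z"
      using t by (elim conjE) assumption
    show "\<forall>z\<in>bwd (b i) ` S i \<inter> bwd (b (?n i)) ` S (?n i). 1/2 < ?c i z \<and> ?c (?n i) z < 1/2"
    proof (intro ballI conjI)
      fix z assume z: "z \<in> bwd (b i) ` S i \<inter> bwd (b (?n i)) ` S (?n i)"
      have 1: "?c i z \<le> 1/2 \<longrightarrow> z \<in> X i" "z \<in> X' i"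
        using bspec[OF inQ[OF i], of z] z by simp_all
      have 2: "z \<in> Y i" "1/2 \<le> ?c (?n i) z \<longrightarrow> z \<in> Y' i"
        using bspec[OF inQ[OF nx(1)], of z i] z i by simp_all
      have 3: "X i \<inter> Y i = {}" "X' i \<inter> Y' i = {}" using XY i by simp_all
      show "1/2 < ?c i z" using 1(1) 2(1) 3(1) by (meson disjoint_iff not_le)
      show "?c (?n i) z < 1/2" using 1(2) 2(2) 3(2) by (meson disjoint_iff not_le)
    qed
  qed
qed

text \<open>The bound \<open>C + 2 * G\<close> does not depend on \<open>k\<close>, because the integrals along the iterates telescope.\<close>

lemma iterate_move:
  fixes \<gamma> :: "'a \<Rightarrow> real" and \<eta> G :: real
  assumes R: "move_by M \<omega> R D C" and G: "\<And>x. x \<in> topspace M \<Longrightarrow> \<bar>\<gamma> x\<bar> \<le> G" and "0 \<le> \<eta>"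
    and D: "\<And>x. x \<in> topspace M \<Longrightarrow> D x \<le> \<gamma> x - \<gamma> (R x) - \<eta>"
  shows "\<exists>E. move_by M \<omega> (R ^^ k) E (C + 2 * G) \<and>
    (\<forall>x\<in>topspace M. E x \<le> \<gamma> x - \<gamma> ((R ^^ k) x) - k * \<eta> \<and> (R x = x \<longrightarrow> E x = k * D x))"
proof (induction k)
  case 0
  obtain x where x: "x \<in> topspace M" using nonempty by blast
  have "0 \<le> C" "0 \<le> G" using move_by_le(2)[OF R x] G[OF x] by auto
  then have "move_by M \<omega> (\<lambda>x. x) (\<lambda>x. 0) (C + 2 * G)" by (intro move_by_mono[OF move_by_id]) simp
  then show ?case by (intro exI[of _ "\<lambda>x. 0"]) (simp add: id_def)
next
  case (Suc k)
  then obtain E :: "'a \<Rightarrow> real" where E: "move_by M \<omega> (R ^^ k) E (C + 2 * G)"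
    "\<forall>x\<in>topspace M. E x \<le> \<gamma> x - \<gamma> ((R ^^ k) x) - k * \<eta> \<and> (R x = x \<longrightarrow> E x = k * D x)" by blast
  have Rk: "(R ^^ k) x \<in> topspace M" if "x \<in> topspace M" for x using move_by_in[OF E(1) that] .
  have "move_by M \<omega> (\<lambda>x. R ((R ^^ k) x)) (\<lambda>x. E x + D ((R ^^ k) x)) (C + 2 * G)"
  proof (rule move_by_comp[OF E(1) R order_refl])
    fix x assume x: "x \<in> topspace M"
    have "E x \<le> \<gamma> x - \<gamma> ((R ^^ k) x)" using E(2) x \<open>0 \<le> \<eta>\<close> by (smt (verit) mult_nonneg_nonneg of_nat_0_le_iff)
    then show "E x + C \<le> C + 2 * G" using G[OF x] G[OF Rk[OF x]] by linarith
  qed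
  moreover have "E x + D ((R ^^ k) x) \<le> \<gamma> x - \<gamma> ((R ^^ Suc k) x) - Suc k * \<eta>" if x: "x \<in> topspace M" for x
  proof -
    have "E x \<le> \<gamma> x - \<gamma> ((R ^^ k) x) - k * \<eta>" using E(2) x by blast
    moreover have "D ((R ^^ k) x) \<le> \<gamma> ((R ^^ k) x) - \<gamma> (R ((R ^^ k) x)) - \<eta>" by (rule D[OF Rk[OF x]])
    ultimately show ?thesis by (simp add: algebra_simps)
  qed
  moreover have "E x + D ((R ^^ k) x) = Suc k * D x" if "x \<in> topspace M" "R x = x" for x
  proof -
    have "(R ^^ k) x = x" using that(2) by (induction k) auto
    then show ?thesis using E(2) that by (simp add: algebra_simps)
  qed
  ultimately show ?case
    by (intro exI[of _ "\<lambda>x. E x + D ((R ^^ k) x)"]) (auto simp: o_def)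
qed

text \<open>Each push changes the integral by a difference of local primitives, and these do not fit
  together around the polygon: the discrepancy is \<open>w < 0\<close>. It is spread over
  \<open>m\<close> equal steps down, one at each midpoint. As pushes never move backward, a step can
  only help: the integral of a push is at most the decrease of a bounded function
  \<open>\<gamma>\<close>. At \<open>q 0\<close>, on the other hand, a full turn contributes exactly
  \<open>w\<close>.\<close>

lemma necklace_rotation:
  assumes N: "necklace m b q" and P: "finite P" "P \<subseteq> topspace M" "\<And>i. i < m \<Longrightarrow> P \<inter> bead_seg b q m i = {}"
  shows "\<exists>C. \<forall>K. \<exists>g d. move_by M \<omega> g d C \<and> g (q 0) = q 0 \<and> d (q 0) < - K \<and>
    (\<forall>z\<in>topspace M. g z = q 0 \<longrightarrow> z = q 0) \<and> (\<forall>p\<in>P. \<forall>z\<in>topspace M. g z = p \<longrightarrow> z = p)"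
proof -
  let ?n = "\<lambda>i. Suc i mod m"
  let ?seg = "bead_seg b q m" and ?c = "bead_coord b q m"
  note F = bead_seg_facts[OF N]
  note nx = Suc_mod_facts[OF necklaceD(1)[OF N]]
  have m0: "0 < m" using necklaceD(1)[OF N] by simp
  have "closedin M P" using P(1,2) Hausdorff by (simp add: closedin_Hausdorff_finite)
  then have W: "openin M (topspace M - P)" by blast
  have sW: "?seg i \<subseteq> topspace M - P" if "i < m" for i
    using F(2)[OF that] P(3)[OF that] closedin_subset by blast
  obtain S g d C where S: "\<forall>i<m. compact (S i) \<and> S i \<subseteq> bran (b i) \<and> ?seg i \<subseteq> bwd (b i) ` S i \<and>
      bwd (b i) ` S i \<subseteq> topspace M - P \<and> move_by M \<omega> (g i) (d i) (C i)"
    and out: "\<forall>i<m. \<forall>z\<in>topspace M - bwd (b i) ` S i. g i z = z \<and> d i z = 0"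
    and ins: "\<forall>i<m. \<forall>z\<in>bwd (b i) ` S i. g i z \<in> bwd (b i) ` S i \<and> d i z = prim (b i) (g i z) - prim (b i) z"
    and gq: "\<forall>i<m. g i (q i) = q (?n i) \<and> (\<forall>z\<in>topspace M. g i z = q (?n i) \<longrightarrow> z = q i)"
    and mono: "\<forall>i<m. \<forall>z\<in>bwd (b i) ` S i. g i z \<noteq> z \<longrightarrow> ?c i z < ?c i (g i z)"
    and adj: "\<forall>i<m. \<forall>z\<in>bwd (b i) ` S i \<inter> bwd (b (?n i)) ` S (?n i). 1/2 < ?c i z \<and> ?c (?n i) z < 1/2"
    by (rule necklace_tubes[OF N W sW]) (assumption | rule that; assumption)+
  define T where "T = (\<lambda>i. bwd (b i) ` S i)"
  have TB: "T i \<subseteq> bdom (b i)" if "i < m" for i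
    unfolding T_def using S that form_chartD(6)[OF necklaceD(2)[OF N that]] by blast
  define w where "w = (\<Sum>i<m. prim (b i) (q (?n i)) - prim (b (?n i)) (q (?n i)))"
  have w: "w < 0" unfolding w_def by (rule necklaceD(9)[OF N])
  \<comment> \<open>The recursion \<open>e (Suc i) = e i + w / m\<close> minus the transition
    constant is what makes \<open>\<gamma>\<close> agree on the overlap of consecutive
    tubes.\<close>
  define e where "e = (\<lambda>i. \<Sum>j<i. w / m - (prim (b j) (q (?n j)) - prim (b (?n j)) (q (?n j))))"
  have en: "e (?n i) = e i + w / m - (prim (b i) (q (?n i)) - prim (b (?n i)) (q (?n i)))" if "i < m" for i
  proof (cases "Suc i = m")
    case False
    then show ?thesis using that by (simp add: e_def)
  next
    case True
    \<comment> \<open>Closing up: the \<open>m\<close> steps add up to \<open>w\<close>, and so do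
      the transition constants, so the recursion returns to \<open>e 0 = 0\<close>.\<close>
    have "e (Suc i) = (\<Sum>j<m. w / m) - (\<Sum>j<m. prim (b j) (q (?n j)) - prim (b (?n j)) (q (?n j)))"
      unfolding e_def True by (rule sum_subtractf)
    also have "\<dots> = m * (w / m) - w" by (simp only: w_def[symmetric] sum_constant card_lessThan of_nat_id)
    finally have "e (Suc i) = m * (w / m) - w" .
    then have "e (Suc i) = e (?n i)" using m0 True by (simp add: e_def)
    then show ?thesis by (simp add: e_def)
  qed
  \<comment> \<open>The step at the midpoint; on an overlap of tubes, edge \<open>i\<close> is past
    its midpoint and the next edge before its own.\<close>
  define h where "h = (\<lambda>i z. if ?c i z \<le> 1/2 then e i else e i + w / m)"
  have cons: "h i z - prim (b i) z = h (?n i) z - prim (b (?n i)) z" if "i < m" "z \<in> T i" "z \<in> T (?n i)" for i z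
  proof -
    have "1/2 < ?c i z" "?c (?n i) z < 1/2" using adj that unfolding T_def by blast+
    moreover have "prim (b i) z - prim (b (?n i)) z = prim (b i) (q (?n i)) - prim (b (?n i)) (q (?n i))"
      by (rule necklaceD(8)[OF N that(1)])
        (use that TB nx(1) necklaceD(3,4)[OF N] in blast)+
    ultimately show ?thesis using en[OF that(1)] unfolding h_def by simp
  qed
  have cons': "h i z - prim (b i) z = h j z - prim (b j) z" if "i < m" "j < m" "z \<in> T i" "z \<in> T j" for i j z
  proof -
    consider "i = j" | "j = ?n i" | "i = ?n j"
      using necklaceD(6)[OF N \<open>i < m\<close> \<open>j < m\<close>] TB[OF \<open>i < m\<close>] TB[OF \<open>j < m\<close>] \<open>z \<in> T i\<close> \<open>z \<in> T j\<close> by blast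
    then show ?thesis using cons that by cases auto
  qed
  \<comment> \<open>Independent of the chosen tube by \<open>cons'\<close>; it is bounded but jumps
    at the midpoints. Off the tubes no push moves anything, so the value 0 there is
    harmless.\<close>
  define \<gamma> where "\<gamma> = (\<lambda>z. if \<exists>i<m. z \<in> T i then h (SOME i. i < m \<and> z \<in> T i) z - prim (b (SOME i. i < m \<and> z \<in> T i)) z else 0)"
  have \<gamma>: "\<gamma> z = h i z - prim (b i) z" if "i < m" "z \<in> T i" for i z
  proof -
    have ex: "\<exists>i. i < m \<and> z \<in> T i" using that by blast
    have "(SOME i. i < m \<and> z \<in> T i) < m" "z \<in> T (SOME i. i < m \<and> z \<in> T i)"
      using someI_ex[OF ex] by auto
    then show ?thesis unfolding \<gamma>_def using cons'[OF _ that(1) _ that(2)] ex by auto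
  qed
  have "\<exists>B\<ge>0. \<forall>z\<in>T i. \<bar>prim (b i) z\<bar> \<le> B" if "i < m" for i
  proof -
    have "compact (S i)" "S i \<subseteq> bran (b i)" using S that by auto
    then obtain B where "0 \<le> B" "\<And>z. z \<in> S i \<Longrightarrow> \<bar>prim (b i) (bwd (b i) z)\<bar> \<le> B"
      by (rule form_chart_bounded[OF necklaceD(2)[OF N \<open>i < m\<close>]]) (rule that; assumption)
    then show ?thesis unfolding T_def by (intro exI[of _ B]) auto
  qed
  then obtain B where B: "\<And>i. i < m \<Longrightarrow> 0 \<le> B i" "\<And>i z. i < m \<Longrightarrow> z \<in> T i \<Longrightarrow> \<bar>prim (b i) z\<bar> \<le> B i" by metis
  define G where "G = (\<Sum>i<m. \<bar>e i\<bar> + \<bar>w / m\<bar> + B i)"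
  have Gi: "\<bar>e i\<bar> + \<bar>w / m\<bar> + B i \<le> G" if "i < m" for i
    unfolding G_def by (rule member_le_sum) (use that B(1) in auto)
  have "0 \<le> G" unfolding G_def using B(1) by (intro sum_nonneg) simp
  have G: "\<bar>\<gamma> z\<bar> \<le> G" for z
  proof (cases "\<exists>i<m. z \<in> T i")
    case True
    then obtain i where i: "i < m" "z \<in> T i" by blast
    have "\<bar>h i z\<bar> \<le> \<bar>e i\<bar> + \<bar>w / m\<bar>"
      unfolding h_def using abs_triangle_ineq[of "e i" "w / m"] by simp
    then show ?thesis using \<gamma>[OF i] B(2)[OF i] Gi[OF i(1)] by linarith
  next
    case False
    then have "\<gamma> z = 0" unfolding \<gamma>_def by (rule if_not_P)
    then show ?thesis using \<open>0 \<le> G\<close> by simp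
  qed
  have dle: "d i z \<le> \<gamma> z - \<gamma> (g i z)" if i: "i < m" and z: "z \<in> topspace M" for i z
  proof (cases "z \<in> T i")
    case True
    then have gz: "g i z \<in> T i" "d i z = prim (b i) (g i z) - prim (b i) z" using ins i unfolding T_def by auto
    have "?c i z \<le> ?c i (g i z)" using mono i True unfolding T_def by (cases "g i z = z") (auto simp: less_imp_le)
    \<comment> \<open>The push goes forward along the edge and may cross the midpoint, where
      \<open>h\<close> steps down.\<close>
    then have "h i (g i z) \<le> h i z" unfolding h_def using w m0 by (auto simp: divide_nonpos_pos)
    then show ?thesis using \<gamma>[OF i True] \<gamma>[OF i gz(1)] gz(2) by linarith
  next
    case False
    then show ?thesis using out i z unfolding T_def by simp
  qed
  have segT: "?seg i \<subseteq> T i" if "i < m" for i using S that unfolding T_def by blast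
  have dq: "d i (q i) = \<gamma> (q i) - \<gamma> (q (?n i)) + w / m" if i: "i < m" for i
  proof -
    have "q i \<in> T i" "q (?n i) \<in> T i" using segT[OF i] F(3,4)[OF i] by auto
    moreover have "h i (q i) = e i" "h i (q (?n i)) = e i + w / m" unfolding h_def using F(6,7)[OF i] by simp_all
    moreover have "d i (q i) = prim (b i) (q (?n i)) - prim (b i) (q i)"
      using ins gq i \<open>q i \<in> T i\<close> unfolding T_def by auto
    ultimately show ?thesis using \<gamma>[OF i] by simp
  qed
  \<comment> \<open>\<open>R\<close> performs the first \<open>k\<close> pushes. The value of
    \<open>D (q 0)\<close> is exact because \<open>q 0\<close> is carried from vertex to vertex and
    passes one step down on each edge.\<close>
  have "\<exists>R D C. move_by M \<omega> R D C \<and> (\<forall>x\<in>topspace M. D x \<le> \<gamma> x - \<gamma> (R x)) \<and> R (q 0) = q (k mod m) \<and>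
      D (q 0) = \<gamma> (q 0) - \<gamma> (q (k mod m)) + k * (w / m) \<and> (\<forall>x\<in>topspace M. R x = q (k mod m) \<longrightarrow> x = q 0) \<and>
      (\<forall>p\<in>P. \<forall>x\<in>topspace M. R x = p \<longrightarrow> x = p)" if "k \<le> m" for k
    using that
  proof (induction k)
    case 0
    show ?case using move_by_id[of M \<omega>] m0
      by (intro exI[of _ "\<lambda>x. x"] exI[of _ "\<lambda>x. 0"] exI[of _ 0]) simp
  next
    case (Suc k)
    then have k: "k < m" by simp
    then obtain R D C' where R: "move_by M \<omega> R D C'" "\<forall>x\<in>topspace M. D x \<le> \<gamma> x - \<gamma> (R x)" "R (q 0) = q k"
      "D (q 0) = \<gamma> (q 0) - \<gamma> (q k) + k * (w / m)" "\<forall>x\<in>topspace M. R x = q k \<longrightarrow> x = q 0"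
      "\<forall>p\<in>P. \<forall>x\<in>topspace M. R x = p \<longrightarrow> x = p" using Suc by auto
    have g: "move_by M \<omega> (g k) (d k) (C k)" using S k by blast
    have Rt: "R x \<in> topspace M" if "x \<in> topspace M" for x using move_by_in[OF R(1) that] .
    have gP: "z = p" if p: "p \<in> P" and z: "z \<in> topspace M" "g k z = p" for p z
    proof (cases "z \<in> T k")
      case True
      then have "g k z \<in> T k" using ins k unfolding T_def by blast
      then show ?thesis using S k p z(2) unfolding T_def by blast
    next
      case False
      then show ?thesis using out k z unfolding T_def by auto
    qed
    have "move_by M \<omega> (\<lambda>x. g k (R x)) (\<lambda>x. D x + d k (R x)) (C' + C k)" by (rule move_comp[OF R(1) g])
    moreover have "D x + d k (R x) \<le> \<gamma> x - \<gamma> (g k (R x))" if "x \<in> topspace M" for x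
      using R(2) dle[OF k Rt[OF that]] that by fastforce
    moreover have "g k (R (q 0)) = q (?n k)" using R(3) gq k by simp
    moreover have "D (q 0) + d k (R (q 0)) = \<gamma> (q 0) - \<gamma> (q (?n k)) + Suc k * (w / m)"
      using R(3,4) dq[OF k] by (simp add: algebra_simps add_divide_distrib)
    moreover have "x = q 0" if "x \<in> topspace M" "g k (R x) = q (?n k)" for x
    proof -
      have "R x = q k" using gq k Rt[OF that(1)] that(2) by blast
      then show ?thesis using R(5) that(1) by blast
    qed
    moreover have "x = p" if "p \<in> P" "x \<in> topspace M" "g k (R x) = p" for p x
      using gP[OF that(1) Rt[OF that(2)] that(3)] R(6) that by blast
    ultimately show ?case
      by (intro exI[of _ "\<lambda>x. g k (R x)"] exI[of _ "\<lambda>x. D x + d k (R x)"] exI[of _ "C' + C k"]) blast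
  qed
  from this[of m] obtain R D C' where R: "move_by M \<omega> R D C'" "\<forall>x\<in>topspace M. D x \<le> \<gamma> x - \<gamma> (R x)" "R (q 0) = q 0"
      "D (q 0) = w" "\<forall>x\<in>topspace M. R x = q 0 \<longrightarrow> x = q 0" "\<forall>p\<in>P. \<forall>x\<in>topspace M. R x = p \<longrightarrow> x = p"
    using m0 by auto
  have q0: "q 0 \<in> topspace M" using necklaceD(3)[OF N m0] form_chartD(2)[OF necklaceD(2)[OF N m0]] by blast
  show ?thesis
  proof (intro exI[of _ "C' + 2 * G"] allI)
    fix K :: real
    obtain k :: nat where k: "K / (- w) < k" using reals_Archimedean2 by blast
    \<comment> \<open>At a general point a turn is only known to gain at least 0, hence the factor
      0; the gain \<open>k * w\<close> is available at the fixed point \<open>q 0\<close>.\<close>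
    have "\<exists>E. move_by M \<omega> (R ^^ k) E (C' + 2 * G) \<and>
      (\<forall>x\<in>topspace M. E x \<le> \<gamma> x - \<gamma> ((R ^^ k) x) - real k * 0 \<and> (R x = x \<longrightarrow> E x = k * D x))"
      by (rule iterate_move[OF R(1)]) (use G R(2) in auto)
    then obtain E where E: "move_by M \<omega> (R ^^ k) E (C' + 2 * G)" "\<forall>x\<in>topspace M. R x = x \<longrightarrow> E x = k * D x" by blast
    have "E (q 0) = k * w" using E(2) q0 R(3,4) by simp
    moreover have "k * w < - K" using k w by (simp add: field_simps)
    moreover have "(R ^^ k) (q 0) = q 0" using R(3) by (induction k) auto
    \<comment> \<open>A point whose only possible preimage under \<open>R\<close> is itself keeps
      this property under iteration; it is applied to \<open>q 0\<close> and to the points of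
      \<open>P\<close>.\<close>
    moreover have pre: "z = u" if "z \<in> topspace M" "(R ^^ j) z = u" "\<forall>x\<in>topspace M. R x = u \<longrightarrow> x = u" for z u j
      using that(2)
    proof (induction j)
      case (Suc j)
      have "\<exists>E. move_by M \<omega> (R ^^ j) E (C' + 2 * G) \<and>
        (\<forall>x\<in>topspace M. E x \<le> \<gamma> x - \<gamma> ((R ^^ j) x) - real j * 0 \<and> (R x = x \<longrightarrow> E x = j * D x))"
        by (rule iterate_move[OF R(1)]) (use G R(2) in auto)
      then obtain E' where "move_by M \<omega> (R ^^ j) E' (C' + 2 * G)" by blast
      from move_by_in[OF this that(1)] have "(R ^^ j) z \<in> topspace M" .
      then have "(R ^^ j) z = u" using Suc.prems that(3) by simp
      then show ?case by (rule Suc.IH)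
    qed simp
    ultimately show "\<exists>g d. move_by M \<omega> g d (C' + 2 * G) \<and> g (q 0) = q 0 \<and> d (q 0) < - K \<and>
      (\<forall>z\<in>topspace M. g z = q 0 \<longrightarrow> z = q 0) \<and> (\<forall>p\<in>P. \<forall>z\<in>topspace M. g z = p \<longrightarrow> z = p)"
      using E(1) R(5,6) by (intro exI[of _ "R ^^ k"] exI[of _ E]) auto
  qed
qed

end

section \<open>Radial deformation onto a set of codimension one\<close>

context manifold_form begin

lemma compact_infnorm_ball:
  fixes c :: "'e"
  shows "compact {z. infnorm (z - c) \<le> r}" "convex {z. infnorm (z - c) \<le> r}" "compact {z. infnorm (z - c) = r}"
proof -
  have cont: "continuous_on UNIV (\<lambda>z. infnorm (z - c))"
    by (intro continuous_intros)
  have "norm z \<le> norm c + sqrt DIM('e) * r" if "infnorm (z - c) \<le> r" for z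
  proof -
    have "norm z \<le> norm c + norm (z - c)" using norm_triangle_ineq[of c "z - c"] by simp
    moreover have "norm (z - c) \<le> sqrt DIM('e) * infnorm (z - c)" by (rule norm_le_infnorm)
    moreover have "sqrt DIM('e) * infnorm (z - c) \<le> sqrt DIM('e) * r" using that by (intro mult_left_mono) auto
    ultimately show ?thesis by linarith
  qed
  then have "bounded {z. infnorm (z - c) \<le> r}" unfolding bounded_iff by blast
  moreover have "closed {z. infnorm (z - c) \<le> r}" by (intro closed_Collect_le cont continuous_intros)
  ultimately show 1: "compact {z. infnorm (z - c) \<le> r}" by (simp add: compact_eq_bounded_closed)
  have "closed {z. infnorm (z - c) = r}" by (intro closed_Collect_eq cont continuous_intros)
  moreover have "{z. infnorm (z - c) = r} = {z. infnorm (z - c) \<le> r} \<inter> {z. infnorm (z - c) = r}" by auto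
  ultimately show "compact {z. infnorm (z - c) = r}" using 1 compact_Int_closed by metis
  show "convex {z. infnorm (z - c) \<le> r}"
  proof (rule convexI)
    fix x y u v assume xy: "x \<in> {z. infnorm (z - c) \<le> r}" "y \<in> {z. infnorm (z - c) \<le> r}"
      and uv: "0 \<le> u" "0 \<le> v" "u + v = (1::real)"
    have v: "v = 1 - u" using uv by simp
    have "u *\<^sub>R x + v *\<^sub>R y - c = u *\<^sub>R (x - c) + v *\<^sub>R (y - c)" unfolding v by (simp add: algebra_simps)
    then have "infnorm (u *\<^sub>R x + v *\<^sub>R y - c) \<le> infnorm (u *\<^sub>R (x - c)) + infnorm (v *\<^sub>R (y - c))"
      by (metis infnorm_triangle)
    also have "\<dots> = u * infnorm (x - c) + v * infnorm (y - c)" using uv by (simp add: infnorm_mul)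
    also have "\<dots> \<le> r" by (rule convex_bound_le) (use xy uv in auto)
    finally show "u *\<^sub>R x + v *\<^sub>R y \<in> {z. infnorm (z - c) \<le> r}" by simp
  qed
qed

lemma infnorm_ball_subset:
  fixes c x :: "'e"
  assumes "infnorm (x - c) \<le> s" "sqrt DIM('e) * (r + s) < \<epsilon>"
  shows "{z. infnorm (z - c) \<le> r} \<subseteq> ball x \<epsilon>"
proof
  fix z assume "z \<in> {z. infnorm (z - c) \<le> r}"
  then have "infnorm (z - x) \<le> r + s"
    using infnorm_triangle[of "z - c" "c - x"] assms(1) by (simp add: infnorm_sub[of c x])
  then have "sqrt DIM('e) * infnorm (z - x) \<le> sqrt DIM('e) * (r + s)" by (intro mult_left_mono) auto
  then have "norm (z - x) < \<epsilon>" using norm_le_infnorm[of "z - x"] assms(2) by linarith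
  then show "z \<in> ball x \<epsilon>" by (simp add: dist_norm norm_minus_commute)
qed

text \<open>The factor \<open>t\<close> carries the shell between \<open>\<delta> * r\<close> and
  \<open>r\<close> to the boundary of the cube and stretches the inner cube linearly. Tracks stay in
  the cube, so the bound \<open>2 * b\<close> does not depend on \<open>\<delta>\<close>, which will
  shrink with the hole around the centre. Cubes are preferred to balls because each of their faces
  has a constant coordinate.\<close>

lemma radial_move:
  assumes ch: "form_chart B \<phi> \<psi> D f" and r: "0 < r" "{z. infnorm (z - c) \<le> r} \<subseteq> D"
    and b: "0 \<le> b" "\<And>z. infnorm (z - c) \<le> r \<Longrightarrow> \<bar>f (\<psi> z)\<bar> \<le> b" and \<delta>: "0 < \<delta>" "\<delta> < 1"
  shows "\<exists>g d. move_by M \<omega> g d (2 * b) \<and>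
    (\<forall>y\<in>topspace M - \<psi> ` {z. infnorm (z - c) \<le> r}. g y = y) \<and>
    (\<forall>z. \<delta> * r \<le> infnorm (z - c) \<and> infnorm (z - c) \<le> r \<longrightarrow> g (\<psi> z) \<in> \<psi> ` {z. infnorm (z - c) = r})"
proof -
  note C = form_chartD[OF ch]
  define t where "t = (\<lambda>z. max 1 (r / max (infnorm (z - c)) (\<delta> * r)))"
  define P where "P = (\<lambda>z. c + t z *\<^sub>R (z - c))"
  let ?S = "{z. infnorm (z - c) \<le> r}"
  have dr: "0 < \<delta> * r" "\<delta> * r < r" using \<delta> r by auto
  have in0: "0 \<le> infnorm (z - c)" for z by (rule infnorm_pos_le)
  have Pn: "infnorm (P z - c) = t z * infnorm (z - c)" for z
    unfolding P_def t_def by (simp add: infnorm_mul)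
  have tb: "t z * infnorm (z - c) = r" if "\<delta> * r \<le> infnorm (z - c)" "infnorm (z - c) \<le> r" for z
  proof -
    have "0 < infnorm (z - c)" using that dr by linarith
    moreover have "t z = r / infnorm (z - c)"
      unfolding t_def using that \<open>0 < infnorm (z - c)\<close> by (simp add: max_absorb1 max_absorb2)
    ultimately show ?thesis by simp
  qed
  have PS: "P ` ?S \<subseteq> ?S"
  proof
    fix y assume "y \<in> P ` ?S"
    then obtain z where z: "infnorm (z - c) \<le> r" "y = P z" by blast
    have "t z * infnorm (z - c) \<le> r"
    proof (cases "\<delta> * r \<le> infnorm (z - c)")
      case True
      then show ?thesis using tb z(1) by simp
    next
      case False
      have "r / (\<delta> * r) = 1 / \<delta>" using r by simp
      then have "t z = 1 / \<delta>" unfolding t_def using False \<delta> by (simp add: max_absorb2)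
      moreover have "1 / \<delta> * infnorm (z - c) \<le> 1 / \<delta> * (\<delta> * r)"
        using False \<delta> by (intro mult_left_mono) auto
      ultimately show ?thesis using \<delta> by simp
    qed
    then show "y \<in> ?S" using z(2) Pn by simp
  qed
  have Pid: "P z = z" if "z \<notin> ?S" for z
  proof -
    have "r < infnorm (z - c)" using that by simp
    then have "t z = 1" unfolding t_def using dr by (simp add: max_absorb1 divide_le_eq)
    then show ?thesis by (simp add: P_def)
  qed
  have "max (infnorm (z - c)) (\<delta> * r) \<noteq> 0" for z using dr(1) by simp
  then have "continuous_on D P"
    unfolding P_def t_def by (intro continuous_intros) auto
  from form_chart_move[OF ch compact_infnorm_ball(1,2) r(2) this PS Pid b(1)] b(2)
  have mv: "move_by M \<omega> (\<lambda>x. if x \<in> B then \<psi> (P (\<phi> x)) else x)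
    (\<lambda>x. if x \<in> B then f (\<psi> (P (\<phi> x))) - f x else 0) (2 * b)" by simp
  show ?thesis
  proof (intro exI conjI ballI allI impI)
    show "move_by M \<omega> (\<lambda>x. if x \<in> B then \<psi> (P (\<phi> x)) else x)
      (\<lambda>x. if x \<in> B then f (\<psi> (P (\<phi> x))) - f x else 0) (2 * b)" by (rule mv)
    fix y assume y: "y \<in> topspace M - \<psi> ` ?S"
    have "\<psi> (P (\<phi> y)) = y" if "y \<in> B"
    proof -
      have "\<phi> y \<notin> ?S" using y C(7)[OF that] by (metis DiffE imageI)
      then show ?thesis using Pid C(7)[OF that] by simp
    qed
    then show "(if y \<in> B then \<psi> (P (\<phi> y)) else y) = y" by simp
  next
    fix z assume z: "\<delta> * r \<le> infnorm (z - c) \<and> infnorm (z - c) \<le> r"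
    then have "z \<in> D" using r(2) by blast
    then have "\<psi> z \<in> B" "\<phi> (\<psi> z) = z" using C(6,8) by auto
    moreover have "P z \<in> {z. infnorm (z - c) = r}" using Pn tb z by simp
    ultimately show "(if \<psi> z \<in> B then \<psi> (P (\<phi> (\<psi> z))) else \<psi> z) \<in> \<psi> ` {z. infnorm (z - c) = r}"
      by simp
  qed
qed

text \<open>Finitely many cubes with centres off \<open>K\<close> are treated one after the other. A
  point that has reached \<open>Y\<close> never leaves it: the hole left around a centre avoids
  \<open>Y\<close>, so a point of \<open>Y\<close> in a further cube is pushed to the boundary of
  that cube. The constant is a sum over the cubes, fixed before \<open>E\<close> and hence before
  the size of the holes.\<close>

lemma radial_deformation:
  assumes K: "\<And>W. openin M W \<Longrightarrow> W \<noteq> {} \<Longrightarrow> \<not> W \<subseteq> K"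
  obtains P Y C where "finite P" "P \<subseteq> topspace M - K" "closedin M Y" "colorable DIM('e) M Y"
    "\<forall>E. openin M E \<longrightarrow> P \<subseteq> E \<longrightarrow> (\<exists>g d. move_by M \<omega> g d C \<and> (\<forall>x\<in>topspace M - E. g x \<in> Y))"
proof -
  define N where "N = sqrt DIM('e)"
  have N: "1 \<le> N" unfolding N_def by (simp add: DIM_positive Suc_leI)
  define ok where "ok = (\<lambda>x (c :: ('a, 'e) bead) p R. chart_bead c \<and> p \<in> bdom c - K \<and> 0 < R \<and>
      {z. infnorm (z - fwd c p) \<le> R} \<subseteq> bran c \<and> x \<in> bdom c \<and> infnorm (fwd c x - fwd c p) < R / 2)"
  have "\<exists>c p R. ok x c p R" if x: "x \<in> topspace M" for x
  proof -
    obtain B \<phi> \<psi> r f where B: "0 < r" "form_chart B \<phi> \<psi> (ball (\<phi> x) r) f" "x \<in> B"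
      using form_chart_exists[of "topspace M" x] x by blast
    note C = form_chartD[OF B(2)]
    \<comment> \<open>A cube of half-width \<open>R\<close> whose centre is within
      \<open>R / 2\<close> of \<open>\<phi> x\<close> has to fit into the ball of radius
      \<open>r\<close>; \<open>N\<close> compares the two norms.\<close>
    define R where "R = r / (4 * N)"
    have R: "0 < R" "N * R = r / 4" unfolding R_def using B(1) N by auto
    have W: "openin M {y \<in> B. \<phi> y \<in> ball (\<phi> x) (R / 2)}"
      by (rule convex_chart_openin_preimage[OF form_chart_convex[OF B(2)] open_ball])
    moreover have "x \<in> {y \<in> B. \<phi> y \<in> ball (\<phi> x) (R / 2)}" using B(3) R(1) by simp
    ultimately obtain p where p: "p \<in> B" "\<phi> p \<in> ball (\<phi> x) (R / 2)" "p \<notin> K"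
      using K[OF W] by blast
    have i: "infnorm (\<phi> x - \<phi> p) < R / 2"
      using p(2) infnorm_le_norm[of "\<phi> x - \<phi> p"] by (simp add: dist_norm)
    have "N * (R + R / 2) < r" using R(2) B(1) by (simp add: algebra_simps)
    from infnorm_ball_subset[of "\<phi> x" "\<phi> p" "R / 2" R r] this i
    have "{z. infnorm (z - \<phi> p) \<le> R} \<subseteq> ball (\<phi> x) r" unfolding N_def by simp
    then have "ok x (Bead B \<phi> \<psi> (ball (\<phi> x) r) f) p R"
      unfolding ok_def using B(2,3) p R(1) i by simp
    then show ?thesis by blast
  qed
  then obtain c p R where okx: "\<And>x. x \<in> topspace M \<Longrightarrow> ok x (c x) (p x) (R x)" by metis
  define Q where "Q = (\<lambda>x. {y \<in> bdom (c x). fwd (c x) y \<in> {z. infnorm (z - fwd (c x) (p x)) < R x / 2}})"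
  have opi: "open {z :: 'e. infnorm (z - a) < s}" for a s by (intro open_Collect_less continuous_intros)
  have Q: "openin M (Q x)" "x \<in> Q x" if "x \<in> topspace M" for x
  proof -
    have "chart_bead (c x)" using okx[OF that] unfolding ok_def by blast
    from convex_chart_openin_preimage[OF form_chart_convex[OF this] opi]
    show "openin M (Q x)" unfolding Q_def .
    show "x \<in> Q x" unfolding Q_def using okx[OF that] unfolding ok_def by simp
  qed
  have "compactin M (topspace M)" using compact by (simp add: compact_space_def)
  moreover have "topspace M \<subseteq> \<Union>(Q ` topspace M)" using Q(2) by blast
  ultimately obtain \<F> where F: "finite \<F>" "\<F> \<subseteq> Q ` topspace M" "topspace M \<subseteq> \<Union>\<F>"
    using Q(1) unfolding compactin_def by (metis (no_types, lifting) imageE)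
  then obtain I where I: "finite I" "I \<subseteq> topspace M" "\<F> = Q ` I" by (meson finite_subset_image)
  have ch: "chart_bead (c x)" and px: "p x \<in> bdom (c x) - K" and R0: "0 < R x"
    and cube: "{z. infnorm (z - fwd (c x) (p x)) \<le> R x} \<subseteq> bran (c x)" if "x \<in> I" for x
    using okx[of x] that I(2) unfolding ok_def by auto
  define P where "P = p ` I"
  \<comment> \<open>The radius avoids finitely many values so that no centre lies on the boundary of
    any of the cubes. Being larger than \<open>R x / 2\<close>, it keeps \<open>M\<close>
    covered.\<close>
  have "\<exists>r. R x / 2 < r \<and> r < R x \<and> (\<forall>l\<in>I. r \<noteq> infnorm (fwd (c x) (p l) - fwd (c x) (p x)))" if "x \<in> I" for x
  proof -
    have "infinite {R x / 2<..<R x}" using R0[OF that] by simp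
    moreover have "finite ((\<lambda>l. infnorm (fwd (c x) (p l) - fwd (c x) (p x))) ` I)" using I(1) by simp
    ultimately have "\<not> {R x / 2<..<R x} \<subseteq> (\<lambda>l. infnorm (fwd (c x) (p l) - fwd (c x) (p x))) ` I"
      using finite_subset by blast
    then obtain r where "r \<in> {R x / 2<..<R x}" "r \<notin> (\<lambda>l. infnorm (fwd (c x) (p l) - fwd (c x) (p x))) ` I" by blast
    then show ?thesis by (intro exI[of _ r]) auto
  qed
  then obtain r where r: "\<And>x. x \<in> I \<Longrightarrow> R x / 2 < r x \<and> r x < R x \<and>
      (\<forall>l\<in>I. r x \<noteq> infnorm (fwd (c x) (p l) - fwd (c x) (p x)))" by metis
  have r0: "0 < r x" if "x \<in> I" for x using r[OF that] R0[OF that] by linarith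
  define S where "S = (\<lambda>x. bwd (c x) ` {z. infnorm (z - fwd (c x) (p x)) \<le> r x})"
  define \<Sigma> where "\<Sigma> = (\<lambda>x. bwd (c x) ` {z. infnorm (z - fwd (c x) (p x)) = r x})"
  define Y where "Y = (\<Union>x\<in>I. \<Sigma> x)"
  have cube': "{z. infnorm (z - fwd (c x) (p x)) \<le> r x} \<subseteq> bran (c x)" if "x \<in> I" for x
    using cube[OF that] r[OF that] by fastforce
  have cubeb: "{z. infnorm (z - fwd (c x) (p x)) = r x} \<subseteq> bran (c x)" if "x \<in> I" for x
    using cube'[OF that] by auto
  have clS: "closedin M (\<Sigma> x)" if "x \<in> I" for x
    unfolding \<Sigma>_def
    by (rule closedin_compactin[OF convex_chart_compactin[OF form_chart_convex[OF ch[OF that]] compact_infnorm_ball(3) cubeb[OF that]]])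
  have clY: "closedin M Y" unfolding Y_def using I(1) clS by (intro closedin_Union) auto
  have colY: "colorable DIM('e) M Y"
    unfolding Y_def
  proof (rule colorable_UN[OF compact Hausdorff I(1) clS])
    fix x assume "x \<in> I"
    show "colorable DIM('e) M (\<Sigma> x)"
      unfolding \<Sigma>_def
      by (rule colorable_cube_boundary[OF compact Hausdorff form_chart_convex[OF ch[OF \<open>x \<in> I\<close>]] compact_infnorm_ball(3) cubeb[OF \<open>x \<in> I\<close>]])
        simp
  qed
  have PY: "p l \<notin> Y" if "l \<in> I" for l
  proof
    assume "p l \<in> Y"
    then obtain x z where x: "x \<in> I" "infnorm (z - fwd (c x) (p x)) = r x" "p l = bwd (c x) z"
      unfolding Y_def \<Sigma>_def by blast
    then have "fwd (c x) (p l) = z" using form_chartD(8)[OF ch[OF x(1)], of z] cubeb[OF x(1)] by auto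
    then show False using r[OF x(1)] x(2) that by auto
  qed
  have "\<exists>b\<ge>0. \<forall>z. infnorm (z - fwd (c x) (p x)) \<le> r x \<longrightarrow> \<bar>prim (c x) (bwd (c x) z)\<bar> \<le> b" if "x \<in> I" for x
  proof -
    obtain b where "0 \<le> b" "\<And>z. z \<in> {z. infnorm (z - fwd (c x) (p x)) \<le> r x} \<Longrightarrow> \<bar>prim (c x) (bwd (c x) z)\<bar> \<le> b"
      by (rule form_chart_bounded[OF ch[OF \<open>x \<in> I\<close>] compact_infnorm_ball(1) cube'[OF \<open>x \<in> I\<close>]]) (rule that; assumption)
    then show ?thesis by blast
  qed
  then obtain b where b: "\<And>x. x \<in> I \<Longrightarrow> 0 \<le> b x"
    "\<And>x z. x \<in> I \<Longrightarrow> infnorm (z - fwd (c x) (p x)) \<le> r x \<Longrightarrow> \<bar>prim (c x) (bwd (c x) z)\<bar> \<le> b x" by metis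
  have main: "\<exists>g d. move_by M \<omega> g d (\<Sum>x\<in>I. 2 * b x) \<and> (\<forall>x\<in>topspace M - E. g x \<in> Y)"
    if E: "openin M E" "P \<subseteq> E" for E
  proof -
    have EY: "openin M (E - Y)" using E(1) clY by (rule openin_diff)
    have el: "\<exists>g d. move_by M \<omega> g d (2 * b x) \<and> (\<forall>y\<in>topspace M - S x. g y = y) \<and>
        (\<forall>y\<in>S x. y \<in> Y \<or> y \<notin> E \<longrightarrow> g y \<in> Y)" if x: "x \<in> I" for x
    proof -
      let ?\<psi> = "bwd (c x)" and ?p = "fwd (c x) (p x)"
      note C = form_chartD[OF ch[OF x]]
      have "open {z \<in> bran (c x). ?\<psi> z \<in> E - Y}"
        by (rule convex_chart_open_preimage[OF form_chart_convex[OF ch[OF x]] EY])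
      moreover have "?p \<in> {z \<in> bran (c x). ?\<psi> z \<in> E - Y}"
        using px[OF x] C(5,7) E(2) PY[OF x] x unfolding P_def by auto
      ultimately obtain \<epsilon> where \<epsilon>: "0 < \<epsilon>" "ball ?p \<epsilon> \<subseteq> {z \<in> bran (c x). ?\<psi> z \<in> E - Y}"
        using openE by blast
      \<comment> \<open>So small that the inner cube lies in \<open>E - Y\<close>; a point of the
        cube that is in \<open>Y\<close> or outside \<open>E\<close> is therefore in the
        shell.\<close>
      define \<delta> where "\<delta> = min (1/2) (\<epsilon> / (2 * N * r x))"
      have \<delta>: "0 < \<delta>" "\<delta> < 1" unfolding \<delta>_def using \<epsilon>(1) N r0[OF x] by auto
      have "\<delta> * (N * r x) \<le> \<epsilon> / (2 * N * r x) * (N * r x)"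
        unfolding \<delta>_def using N r0[OF x] by (intro mult_right_mono) auto
      also have "\<dots> = \<epsilon> / 2" using N r0[OF x] by (simp add: field_simps)
      finally have "N * (\<delta> * r x + 0) < \<epsilon>" using \<epsilon>(1) by (simp add: algebra_simps)
      then have sm: "{z. infnorm (z - ?p) \<le> \<delta> * r x} \<subseteq> ball ?p \<epsilon>"
        using infnorm_ball_subset[of ?p ?p 0 "\<delta> * r x" \<epsilon>] unfolding N_def by (simp add: infnorm_0)
      obtain g d where g: "move_by M \<omega> g d (2 * b x)"
        "\<forall>y\<in>topspace M - ?\<psi> ` {z. infnorm (z - ?p) \<le> r x}. g y = y"
        "\<forall>z. \<delta> * r x \<le> infnorm (z - ?p) \<and> infnorm (z - ?p) \<le> r x \<longrightarrow> g (?\<psi> z) \<in> ?\<psi> ` {z. infnorm (z - ?p) = r x}"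
        using radial_move[OF ch[OF x] r0[OF x] cube'[OF x] b(1)[OF x] b(2)[OF x] \<delta>] by blast
      have "g y \<in> Y" if y: "y \<in> S x" "y \<in> Y \<or> y \<notin> E" for y
      proof -
        obtain z where z: "infnorm (z - ?p) \<le> r x" "y = ?\<psi> z" using y(1) unfolding S_def by blast
        have "\<delta> * r x \<le> infnorm (z - ?p)"
        proof (rule ccontr)
          assume "\<not> ?thesis"
          then have "infnorm (z - ?p) \<le> \<delta> * r x" by simp
          then have "z \<in> ball ?p \<epsilon>" using subsetD[OF sm] by blast
          then have "?\<psi> z \<in> E - Y" using \<epsilon>(2) by blast
          then show False using y(2) z(2) by blast
        qed
        then have "g y \<in> \<Sigma> x" using g(3) z unfolding \<Sigma>_def by blast
        then show ?thesis unfolding Y_def using x by blast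
      qed
      then show ?thesis using g(1,2) unfolding S_def by blast
    qed
    \<comment> \<open>A point outside \<open>E\<close> has either reached \<open>Y\<close> by now,
      or it is where it started and in none of the cubes treated so far.\<close>
    have "\<exists>g d. move_by M \<omega> g d (\<Sum>x\<in>J. 2 * b x) \<and>
        (\<forall>y\<in>topspace M - E. g y \<in> Y \<or> (g y = y \<and> y \<notin> (\<Union>x\<in>J. S x)))" if "finite J" "J \<subseteq> I" for J
      using that
    proof (induction J rule: finite_induct)
      case empty
      then show ?case using move_by_id[of M \<omega>] by (intro exI[of _ "\<lambda>x. x"] exI[of _ "\<lambda>x. 0"]) simp
    next
      case (insert x J)
      then obtain g d where g: "move_by M \<omega> g d (\<Sum>x\<in>J. 2 * b x)"
        "\<forall>y\<in>topspace M - E. g y \<in> Y \<or> (g y = y \<and> y \<notin> (\<Union>x\<in>J. S x))" by auto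
      have "x \<in> I" using insert.prems by blast
      from el[OF this] obtain g' d' where g': "move_by M \<omega> g' d' (2 * b x)" "\<forall>y\<in>topspace M - S x. g' y = y"
        "\<forall>y\<in>S x. y \<in> Y \<or> y \<notin> E \<longrightarrow> g' y \<in> Y" by blast
      have "g' (g y) \<in> Y \<or> (g' (g y) = y \<and> y \<notin> (\<Union>x\<in>insert x J. S x))" if y: "y \<in> topspace M - E" for y
      proof -
        have gy: "g y \<in> topspace M" using move_by_in[OF g(1)] y by blast
        consider "g y \<in> Y" | "g y = y" "y \<notin> (\<Union>x\<in>J. S x)" using g(2) y by blast
        then show ?thesis
        proof cases
          case 1
          then show ?thesis using g'(2,3) gy by (cases "g y \<in> S x") auto
        next
          case 2
          then show ?thesis using g'(2,3) gy y by (cases "y \<in> S x") auto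
        qed
      qed
      moreover have "move_by M \<omega> (\<lambda>y. g' (g y)) (\<lambda>y. d y + d' (g y)) (\<Sum>x\<in>insert x J. 2 * b x)"
        using move_comp[OF g(1) g'(1)] insert.hyps by (simp add: add.commute)
      ultimately show ?case by blast
    qed
    from this[OF I(1) order_refl] obtain g d where g: "move_by M \<omega> g d (\<Sum>x\<in>I. 2 * b x)"
      "\<forall>y\<in>topspace M - E. g y \<in> Y \<or> (g y = y \<and> y \<notin> (\<Union>x\<in>I. S x))" by blast
    have "y \<in> (\<Union>x\<in>I. S x)" if "y \<in> topspace M" for y
    proof -
      obtain x where x: "x \<in> I" "y \<in> Q x" using F(3) I(3) \<open>y \<in> topspace M\<close> by blast
      then have "y \<in> bdom (c x)" "infnorm (fwd (c x) y - fwd (c x) (p x)) \<le> r x"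
        unfolding Q_def using r[OF x(1)] by auto
      then have "y \<in> S x"
        unfolding S_def using form_chartD(7)[OF ch[OF x(1)], of y]
        by (intro image_eqI[of _ _ "fwd (c x) y"]) auto
      then show ?thesis using x(1) by blast
    qed
    then show ?thesis using g by blast
  qed
  show thesis
  proof (rule that)
    show "finite P" unfolding P_def using I(1) by simp
    show "P \<subseteq> topspace M - K" unfolding P_def using px form_chartD(2)[OF ch] by blast
    show "\<forall>E. openin M E \<longrightarrow> P \<subseteq> E \<longrightarrow> (\<exists>g d. move_by M \<omega> g d (\<Sum>x\<in>I. 2 * b x) \<and> (\<forall>x\<in>topspace M - E. g x \<in> Y))"
      using main by blast
  qed (rule clY colY)+
qed

end

section \<open>The controlled cover in dimension at least two\<close>

context manifold_form begin

text \<open>Removing the edges one after the other leaves a non-empty open set each time, since a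
  segment has no interior in dimension at least two.\<close>

lemma necklace_no_interior:
  assumes N: "necklace m b q" and dim: "2 \<le> DIM('e)" and W: "openin M W" "W \<noteq> {}"
  shows "\<not> W \<subseteq> (\<Union>i<m. bead_seg b q m i)"
proof -
  have "\<exists>W'. openin M W' \<and> W' \<noteq> {} \<and> W' \<subseteq> W \<and> W' \<inter> (\<Union>i<k. bead_seg b q m i) = {}" if "k \<le> m" for k
    using that
  proof (induction k)
    case 0
    show ?case using W by (intro exI[of _ W]) simp
  next
    case (Suc k)
    then obtain W' where W': "openin M W'" "W' \<noteq> {}" "W' \<subseteq> W" "W' \<inter> (\<Union>i<k. bead_seg b q m i) = {}" by auto
    have k: "k < m" using Suc.prems by simp
    note sg = bead_seg_facts[OF N k] and C = form_chartD[OF necklaceD(2)[OF N k]]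
    have "W' - bead_seg b q m k \<noteq> {}"
    proof
      assume "W' - bead_seg b q m k = {}"
      then have sub: "W' \<subseteq> bead_seg b q m k" by blast
      let ?Q = "{z \<in> bran (b k). bwd (b k) z \<in> W'}"
      let ?L = "closed_segment (fwd (b k) (q k)) (fwd (b k) (q (Suc k mod m)))"
      have L: "?L \<subseteq> bran (b k)"
        using C(4,5) necklaceD(3,4)[OF N k] by (simp add: closed_segment_subset)
      have "open ?Q" by (rule convex_chart_open_preimage[OF form_chart_convex[OF necklaceD(2)[OF N k]] W'(1)])
      moreover have "?Q \<subseteq> ?L"
      proof
        fix z assume z: "z \<in> ?Q"
        then obtain w where "w \<in> ?L" "bwd (b k) z = bwd (b k) w" using sub unfolding bead_seg_def by blast
        then show "z \<in> ?L" using z L C(8) by (metis (no_types, lifting) mem_Collect_eq subsetD)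
      qed
      ultimately have "?Q \<subseteq> interior ?L" by (rule interior_maximal[rotated])
      then have "?Q = {}" using interior_closed_segment_ge2[OF dim] by blast
      moreover obtain x where "x \<in> W'" using W'(2) by blast
      then have "x \<in> bdom (b k)" using sub sg(1) by blast
      then have "fwd (b k) x \<in> ?Q" using C(5,7) \<open>x \<in> W'\<close> by simp
      ultimately show False by blast
    qed
    moreover have "openin M (W' - bead_seg b q m k)" using W'(1) sg(2) by (rule openin_diff)
    moreover have "(W' - bead_seg b q m k) \<inter> (\<Union>i<Suc k. bead_seg b q m i) = {}"
      unfolding lessThan_Suc UN_insert using W'(4) by blast
    ultimately show ?case using W'(3) by (intro exI[of _ "W' - bead_seg b q m k"]) auto
  qed
  from this[OF order_refl] show ?thesis by blast
qed

text \<open>The rotation makes the integral at \<open>q 0\<close> as negative as desired, then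
  \<open>q 0\<close> is carried to \<open>p\<close> and nothing else arrives there. That points
  ending near \<open>p\<close> do as well follows later by continuity. The clause on
  \<open>P - {p}\<close> allows the centres to be treated in turn.\<close>

lemma star_move_point:
  assumes N: "necklace m b q" and dim: "2 \<le> DIM('e)"
    and P: "finite P" "P \<subseteq> topspace M - (\<Union>i<m. bead_seg b q m i)" "p \<in> P"
  shows "\<exists>C. \<forall>N. \<exists>g d. move_by M \<omega> g d C \<and> (\<forall>x\<in>topspace M. g x = p \<longrightarrow> d x < - N) \<and>
    (\<forall>p'\<in>P - {p}. \<forall>x\<in>topspace M. g x = p' \<longrightarrow> x = p')"
proof -
  have m: "0 < m" using necklaceD(1)[OF N] by simp
  have q0: "q 0 \<in> bead_seg b q m 0" "q 0 \<in> topspace M"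
    using bead_seg_facts(3)[OF N m] necklaceD(3)[OF N m] form_chartD(2)[OF necklaceD(2)[OF N m]] by auto
  have "q 0 \<notin> P" using P(2) q0(1) m by auto
  then have "carries (P - {p}) (q 0) p"
    using P q0(2) by (intro carries_all[OF dim]) auto
  then obtain g2 d2 C2 where g2: "move_by M \<omega> g2 d2 C2" "g2 (q 0) = p"
    "\<And>z. z \<in> topspace M \<Longrightarrow> g2 z = p \<Longrightarrow> z = q 0"
    "\<And>p' z. p' \<in> P - {p} \<Longrightarrow> z \<in> topspace M \<Longrightarrow> g2 z = p' \<Longrightarrow> z = p'"
    unfolding carries_def by blast
  have "\<exists>C. \<forall>K. \<exists>g d. move_by M \<omega> g d C \<and> g (q 0) = q 0 \<and> d (q 0) < - K \<and>
    (\<forall>z\<in>topspace M. g z = q 0 \<longrightarrow> z = q 0) \<and> (\<forall>p\<in>P. \<forall>z\<in>topspace M. g z = p \<longrightarrow> z = p)"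
    by (rule necklace_rotation[OF N P(1)]) (use P(2) in auto)
  then obtain C1 where C1: "\<forall>K. \<exists>g d. move_by M \<omega> g d C1 \<and> g (q 0) = q 0 \<and> d (q 0) < - K \<and>
    (\<forall>z\<in>topspace M. g z = q 0 \<longrightarrow> z = q 0) \<and> (\<forall>p\<in>P. \<forall>z\<in>topspace M. g z = p \<longrightarrow> z = p)" by (elim exE)
  show ?thesis
  proof (intro exI[of _ "C1 + C2"] allI)
    fix N :: real
    obtain g1 d1 where g1: "move_by M \<omega> g1 d1 C1" "g1 (q 0) = q 0" "d1 (q 0) < - (N + C2)"
      "\<forall>z\<in>topspace M. g1 z = q 0 \<longrightarrow> z = q 0" "\<forall>p\<in>P. \<forall>z\<in>topspace M. g1 z = p \<longrightarrow> z = p"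
      using C1[rule_format, of "N + C2"] by (elim exE conjE) (rule that; assumption)
    have "d1 x + d2 (g1 x) < - N" if x: "x \<in> topspace M" "g2 (g1 x) = p" for x
    proof -
      have gx: "g1 x \<in> topspace M" using move_by_in[OF g1(1) x(1)] .
      have "g1 x = q 0" using g2(3)[OF gx x(2)] .
      then have "x = q 0" using g1(4) x(1) by blast
      then show ?thesis using g1(2,3) move_by_le(1)[OF g2(1) q0(2)] by simp
    qed
    moreover have "x = p'" if "p' \<in> P - {p}" "x \<in> topspace M" "g2 (g1 x) = p'" for p' x
      using g2(4)[OF that(1) move_by_in[OF g1(1) that(2)] that(3)] g1(5) that(1,2) by blast
    ultimately show "\<exists>g d. move_by M \<omega> g d (C1 + C2) \<and> (\<forall>x\<in>topspace M. g x = p \<longrightarrow> d x < - N) \<and>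
        (\<forall>p'\<in>P - {p}. \<forall>x\<in>topspace M. g x = p' \<longrightarrow> x = p')"
      using move_comp[OF g1(1) g2(1)]
      by (intro exI[of _ "\<lambda>x. g2 (g1 x)"] exI[of _ "\<lambda>x. d1 x + d2 (g1 x)"]) blast
  qed
qed

text \<open>The demands on the two moves are raised by each other's constant. A point ending at
  \<open>p\<close> collects enough in the last move; one ending in \<open>A\<close> was there before
  that move, which brings nothing new to the other centres.\<close>

lemma star_move:
  assumes N: "necklace m b q" and dim: "2 \<le> DIM('e)"
    and P: "finite P" "P \<subseteq> topspace M - (\<Union>i<m. bead_seg b q m i)"
  shows "\<exists>C. \<forall>N. \<exists>g d. move_by M \<omega> g d C \<and> (\<forall>x\<in>topspace M. g x \<in> P \<longrightarrow> d x < - N)"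
proof -
  have "\<exists>C. \<forall>N. \<exists>g d. move_by M \<omega> g d C \<and> (\<forall>x\<in>topspace M. g x \<in> A \<longrightarrow> d x < - N) \<and>
      (\<forall>p\<in>P - A. \<forall>x\<in>topspace M. g x = p \<longrightarrow> x = p)" if "finite A" "A \<subseteq> P" for A
    using that
  proof (induction A rule: finite_induct)
    case empty
    show ?case using move_by_id[of M \<omega>] by (intro exI[of _ 0] allI exI[of _ "\<lambda>x. x"] exI[of _ "\<lambda>x. 0"]) simp
  next
    case (insert p A)
    then have pP: "p \<in> P" and AP: "A \<subseteq> P" by auto
    obtain C1 where C1: "\<forall>N. \<exists>g d. move_by M \<omega> g d C1 \<and> (\<forall>x\<in>topspace M. g x \<in> A \<longrightarrow> d x < - N) \<and>
      (\<forall>p\<in>P - A. \<forall>x\<in>topspace M. g x = p \<longrightarrow> x = p)" using insert.IH[OF AP] by (elim exE)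
    obtain C2 where C2: "\<forall>N. \<exists>g d. move_by M \<omega> g d C2 \<and> (\<forall>x\<in>topspace M. g x = p \<longrightarrow> d x < - N) \<and>
      (\<forall>p'\<in>P - {p}. \<forall>x\<in>topspace M. g x = p' \<longrightarrow> x = p')"
      using star_move_point[OF N dim P pP] by (elim exE)
    show ?case
    proof (intro exI[of _ "C1 + C2"] allI)
      fix N :: real
      obtain g1 d1 where g1: "move_by M \<omega> g1 d1 C1" "\<forall>x\<in>topspace M. g1 x \<in> A \<longrightarrow> d1 x < - (N + C2)"
        "\<forall>p\<in>P - A. \<forall>x\<in>topspace M. g1 x = p \<longrightarrow> x = p"
        using C1[rule_format, of "N + C2"] by (elim exE conjE) (rule that; assumption)
      obtain g2 d2 where g2: "move_by M \<omega> g2 d2 C2" "\<forall>x\<in>topspace M. g2 x = p \<longrightarrow> d2 x < - (N + C1)"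
        "\<forall>p'\<in>P - {p}. \<forall>x\<in>topspace M. g2 x = p' \<longrightarrow> x = p'"
        using C2[rule_format, of "N + C1"] by (elim exE conjE) (rule that; assumption)
      have "d1 x + d2 (g1 x) < - N" if x: "x \<in> topspace M" "g2 (g1 x) \<in> insert p A" for x
      proof -
        have gx: "g1 x \<in> topspace M" using move_by_in[OF g1(1) x(1)] .
        have le: "d1 x \<le> C1" "d2 (g1 x) \<le> C2"
          using move_by_le(1)[OF g1(1) x(1)] move_by_le(1)[OF g2(1) gx] .
        show ?thesis
        proof (cases "g2 (g1 x) = p")
          case True
          then show ?thesis using g2(2) gx le(1) by fastforce
        next
          case False
          then have "g2 (g1 x) \<in> A" using x(2) by blast
          then have "g1 x = g2 (g1 x)" using g2(3) gx AP False by blast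
          then have "g1 x \<in> A" using \<open>g2 (g1 x) \<in> A\<close> by simp
          then show ?thesis using g1(2) x(1) le(2) by fastforce
        qed
      qed
      moreover have "x = p'" if "p' \<in> P - insert p A" "x \<in> topspace M" "g2 (g1 x) = p'" for p' x
      proof -
        have "g1 x = p'" using g2(3) move_by_in[OF g1(1) that(2)] that(1,3) by blast
        then show ?thesis using g1(3) that(1,2) by blast
      qed
      ultimately show "\<exists>g d. move_by M \<omega> g d (C1 + C2) \<and>
          (\<forall>x\<in>topspace M. g x \<in> insert p A \<longrightarrow> d x < - N) \<and>
          (\<forall>p'\<in>P - insert p A. \<forall>x\<in>topspace M. g x = p' \<longrightarrow> x = p')"
        using move_comp[OF g1(1) g2(1)]
        by (intro exI[of _ "\<lambda>x. g2 (g1 x)"] exI[of _ "\<lambda>x. d1 x + d2 (g1 x)"]) blast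
    qed
  qed
  from this[OF P(1) order_refl] obtain C where
    C: "\<forall>N. \<exists>g d. move_by M \<omega> g d C \<and> (\<forall>x\<in>topspace M. g x \<in> P \<longrightarrow> d x < - N) \<and>
      (\<forall>p\<in>P - P. \<forall>x\<in>topspace M. g x = p \<longrightarrow> x = p)" by (elim exE)
  show ?thesis
  proof (intro exI[of _ C] allI)
    fix N
    obtain g d where "move_by M \<omega> g d C" "\<forall>x\<in>topspace M. g x \<in> P \<longrightarrow> d x < - N"
      using C[rule_format, of N] by (elim exE conjE) (rule that; assumption)
    then show "\<exists>g d. move_by M \<omega> g d C \<and> (\<forall>x\<in>topspace M. g x \<in> P \<longrightarrow> d x < - N)" by blast
  qed
qed

text \<open>The centres, \<open>Y\<close>, its colouring, the collapses \<open>\<kappa>\<close> and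
  all constants are chosen before \<open>N\<close>; only \<open>gs\<close>, \<open>gr\<close> and
  \<open>go\<close> depend on it. Colour 0 is the one that joins \<open>F\<close>.\<close>

lemma ccat_cover_ge2:
  assumes N: "necklace m b q" and dim: "2 \<le> DIM('e)"
  shows "\<exists>C>0. \<forall>N>0. ccat_cover M \<omega> N C (DIM('e) - 1)"
proof -
  have m: "0 < m" using necklaceD(1)[OF N] by simp
  have q0: "q 0 \<in> topspace M"
    using necklaceD(3)[OF N m] form_chartD(2)[OF necklaceD(2)[OF N m]] by auto
  obtain P Y Cr where PY: "finite P" "P \<subseteq> topspace M - (\<Union>i<m. bead_seg b q m i)" "closedin M Y"
    "colorable DIM('e) M Y" "\<forall>E. openin M E \<longrightarrow> P \<subseteq> E \<longrightarrow>
      (\<exists>g d. move_by M \<omega> g d Cr \<and> (\<forall>x\<in>topspace M - E. g x \<in> Y))"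
    by (rule radial_deformation[of "\<Union>i<m. bead_seg b q m i"])
      ((rule necklace_no_interior[OF N dim]; assumption), (rule that; assumption))
  obtain Cs where Cs: "\<forall>N. \<exists>g d. move_by M \<omega> g d Cs \<and> (\<forall>x\<in>topspace M. g x \<in> P \<longrightarrow> d x < - N)"
    using star_move[OF N dim PY(1,2)] by (elim exE)
  have so: "openin M U" if "U \<in> {V. small_open V}" for U using that unfolding small_open_def by simp
  have "topspace M \<subseteq> \<Union>{V. small_open V}" using small_open_exists by blast
  from colorableE[OF PY(4) so this] obtain \<V> :: "nat \<Rightarrow> 'a set set" where
    V: "\<And>i. i < DIM('e) \<Longrightarrow> finite (\<V> i)" "\<And>i. i < DIM('e) \<Longrightarrow> pairwise disjnt (\<V> i)"
    "\<And>i V. i < DIM('e) \<Longrightarrow> V \<in> \<V> i \<Longrightarrow> openin M V"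
    "\<And>i V. i < DIM('e) \<Longrightarrow> V \<in> \<V> i \<Longrightarrow> \<exists>U\<in>{V. small_open V}. V \<subseteq> U" "Y \<subseteq> (\<Union>i<DIM('e). \<Union>(\<V> i))"
    by blast
  have "Y \<subseteq> \<Union>(\<Union>i<DIM('e). \<V> i)" using V(5) by blast
  moreover have "openin M V" if "V \<in> (\<Union>i<DIM('e). \<V> i)" for V using that V(3) by blast
  ultimately obtain v where v: "\<And>V. openin M (v V)" "\<And>V. M closure_of (v V) \<subseteq> V"
    "Y \<subseteq> (\<Union>V\<in>(\<Union>i<DIM('e). \<V> i). v V)"
    using shrink_finite_cover[OF compact Hausdorff PY(3), of "\<Union>i<DIM('e). \<V> i"] by blast
  have "\<exists>g d C a. a \<in> topspace M \<and> move_by M \<omega> g d C \<and> (\<forall>x\<in>(\<Union>V\<in>\<V> i. v V). g x = a)" if i: "i < DIM('e)" for i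
  proof -
    have "small_open V" if "V \<in> \<V> i" for V
      using V(4)[OF i that] small_open_subset[OF _ V(3)[OF i that]] by blast
    from collapse_family[OF V(1)[OF i] V(2)[OF i] this v(1,2)] show ?thesis by blast
  qed
  then obtain \<kappa> d\<kappa> C\<kappa> a where \<kappa>: "\<And>i. i < DIM('e) \<Longrightarrow> a i \<in> topspace M \<and> move_by M \<omega> (\<kappa> i) (d\<kappa> i) (C\<kappa> i) \<and>
      (\<forall>x\<in>(\<Union>V\<in>\<V> i. v V). \<kappa> i x = a i)" by metis
  have n0: "0 < DIM('e)" using dim by simp
  have \<kappa>0: "move_by M \<omega> (\<kappa> 0) (d\<kappa> 0) (C\<kappa> 0)" "a 0 \<in> topspace M" using \<kappa>[OF n0] by simp_all
  \<comment> \<open>The point to which colour 0 collapses is brought to the fixed point of the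
    rotation.\<close>
  have "carries {} (a 0) (q 0)" using q0 \<kappa>0(2) by (intro carries_all[OF dim]) auto
  then obtain g\<tau> d\<tau> C\<tau> where \<tau>: "move_by M \<omega> g\<tau> d\<tau> C\<tau>" "g\<tau> (a 0) = q 0"
    unfolding carries_def by blast
  obtain Co where Co: "\<forall>K. \<exists>g d. move_by M \<omega> g d Co \<and> g (q 0) = q 0 \<and> d (q 0) < - K \<and>
    (\<forall>z\<in>topspace M. g z = q 0 \<longrightarrow> z = q 0) \<and> (\<forall>p\<in>{}. \<forall>z\<in>topspace M. g z = p \<longrightarrow> z = p)"
    using necklace_rotation[OF N, of "{}"] by auto
  define C where "C = Cs + Cr + C\<kappa> 0 + C\<tau> + Co"
  show ?thesis
  \<comment> \<open>The constants are non-negative, being bounds of moves; adding 1 makes the sum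
    positive.\<close>
  proof (intro exI[of _ "C + 1"] conjI allI impI)
    obtain gs ds where "move_by M \<omega> gs ds Cs" using Cs by blast
    moreover obtain gr dr where "move_by M \<omega> gr dr Cr"
      using PY(2,5) openin_topspace by blast
    moreover obtain go dO where "move_by M \<omega> go dO Co" using Co by blast
    ultimately show "0 < C + 1"
      unfolding C_def using move_by_le(2)[OF _ q0] \<kappa>0(1) \<tau>(1) by (smt (verit))
    fix N :: real assume "0 < N"
    \<comment> \<open>The most that the moves after \<open>gs\<close> can add to the
      integral.\<close>
    define B where "B = Cr + C\<kappa> 0 + C\<tau> + Co"
    obtain gs ds where gs: "move_by M \<omega> gs ds Cs" "\<forall>x\<in>topspace M. gs x \<in> P \<longrightarrow> ds x < - (N + B)"
      using Cs by blast
    define Far where "Far = {x \<in> topspace M. ds x \<in> {..< - (N + B)}}"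
    have Far: "openin M Far"
      unfolding Far_def by (rule openin_continuous_map_preimage[OF move_by_continuous(2)[OF gs(1)]]) simp
    \<comment> \<open>A point is in \<open>E\<close> if all points arriving at it under
      \<open>gs\<close> are in \<open>Far\<close>. The image of the compact complement of
      \<open>Far\<close> is closed, so \<open>E\<close> is an open neighbourhood of the
      centres.\<close>
    define E where "E = topspace M - gs ` (topspace M - Far)"
    have "compactin M (gs ` (topspace M - Far))"
      using move_by_continuous(1)[OF gs(1)] Far
      by (intro image_compactin[of M] compactin_closedin) (auto intro: closedin_diff)
    then have E: "openin M E" unfolding E_def using closedin_compactin by blast
    have "P \<subseteq> E" unfolding E_def Far_def using PY(2) gs(2) by auto
    then obtain gr dr where gr: "move_by M \<omega> gr dr Cr" "\<forall>x\<in>topspace M - E. gr x \<in> Y"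
      using PY(5) E by blast
    \<comment> \<open>The demand makes up for the constants of all preceding moves.\<close>
    obtain go dO where go: "move_by M \<omega> go dO Co" "go (q 0) = q 0" "dO (q 0) < - (N + Cs + Cr + C\<kappa> 0 + C\<tau>)"
      using Co[rule_format, of "N + Cs + Cr + C\<kappa> 0 + C\<tau>"] by (elim exE conjE) (rule that; assumption)
    define G where "G = (\<lambda>x. gr (gs x))"
    define dG where "dG = (\<lambda>x. ds x + dr (gs x))"
    have G: "move_by M \<omega> G dG (Cs + Cr)" unfolding G_def dG_def by (rule move_comp[OF gs(1) gr(1)])
    define A where "A = (\<lambda>j. {x \<in> topspace M. G x \<in> (\<Union>V\<in>\<V> j. v V)})"
    have A: "openin M (A j)" for j
      unfolding A_def using v(1) by (intro openin_continuous_map_preimage[OF move_by_continuous(1)[OF G]]) auto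
    \<comment> \<open>One homotopy has to serve both for \<open>Far\<close> and for
      \<open>A 0\<close>: on \<open>Far\<close> the later moves cannot undo \<open>ds\<close>, on
      \<open>A 0\<close> the final rotation outweighs the earlier ones.\<close>
    have move: "move_by M \<omega> (\<lambda>x. go (g\<tau> (\<kappa> 0 (G x))))
        (\<lambda>x. dG x + d\<kappa> 0 (G x) + d\<tau> (\<kappa> 0 (G x)) + dO (g\<tau> (\<kappa> 0 (G x)))) C"
      unfolding C_def by (rule move_comp[OF move_comp[OF move_comp[OF G \<kappa>0(1)] \<tau>(1)] go(1)])
    have neg: "dG x + d\<kappa> 0 (G x) + d\<tau> (\<kappa> 0 (G x)) + dO (g\<tau> (\<kappa> 0 (G x))) < - N" if "x \<in> Far \<union> A 0" for x
    proof -
      have x: "x \<in> topspace M" using that unfolding Far_def A_def by auto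
      have i1: "gs x \<in> topspace M" using move_by_in[OF gs(1) x] .
      have i2: "G x \<in> topspace M" using move_by_in[OF G x] .
      have i3: "\<kappa> 0 (G x) \<in> topspace M" using move_by_in[OF \<kappa>0(1) i2] .
      have i4: "g\<tau> (\<kappa> 0 (G x)) \<in> topspace M" using move_by_in[OF \<tau>(1) i3] .
      note le = move_by_le(1)[OF gs(1) x] move_by_le(1)[OF gr(1) i1] move_by_le(1)[OF \<kappa>0(1) i2]
        move_by_le(1)[OF \<tau>(1) i3] move_by_le(1)[OF go(1) i4]
      show ?thesis
      proof (cases "x \<in> Far")
        case True
        then have "ds x < - (N + B)" unfolding Far_def by simp
        then show ?thesis using le unfolding dG_def B_def by linarith
      next
        case False
        then have "G x \<in> (\<Union>V\<in>\<V> 0. v V)" using that unfolding A_def by blast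
        then have "\<kappa> 0 (G x) = a 0" using \<kappa>[OF n0] by blast
        then have "g\<tau> (\<kappa> 0 (G x)) = q 0" using \<tau>(2) by simp
        then show ?thesis using le go(3) unfolding dG_def by simp
      qed
    qed
    have "Far \<union> A 0 \<subseteq> topspace M" unfolding Far_def A_def by auto
    then have mov: "movable M \<omega> N (C + 1) (Far \<union> A 0)"
      by (intro move_by_movable[OF form move_by_mono[OF move]] neg) simp_all
    have nul: "null_homotopic_in M (A j)" if "j < DIM('e)" for j
    proof (rule move_by_null_homotopic)
      show "move_by M \<omega> (\<lambda>x. \<kappa> j (G x)) (\<lambda>x. dG x + d\<kappa> j (G x)) (Cs + Cr + C\<kappa> j)"
        using \<kappa>[OF that] by (intro move_comp[OF G]) simp
      show "A j \<subseteq> topspace M" unfolding A_def by auto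
      show "\<kappa> j (G x) = a j" if "x \<in> A j" for x using that \<kappa>[OF \<open>j < DIM('e)\<close>] unfolding A_def by blast
    qed
    have cov: "x \<in> (Far \<union> A 0) \<union> (\<Union>j\<in>{1..DIM('e) - 1}. A j)" if x: "x \<in> topspace M" for x
    proof (cases "x \<in> Far")
      case False
      \<comment> \<open>A point outside \<open>Far\<close> lands outside \<open>E\<close>, where
        \<open>gr\<close> deforms into \<open>Y\<close>.\<close>
      then have "gs x \<in> topspace M - E" using move_by_in[OF gs(1) x] x unfolding E_def by blast
      then have "G x \<in> Y" unfolding G_def using gr(2) by blast
      then obtain i where i: "i < DIM('e)" "G x \<in> (\<Union>V\<in>\<V> i. v V)" using v(3) by blast
      then have "x \<in> A i" using x unfolding A_def by blast
      then show ?thesis using i(1) by (cases "i = 0") (force simp: Suc_le_eq)+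
    qed simp
    have "A j \<subseteq> topspace M" for j unfolding A_def by auto
    then have "topspace M = (Far \<union> A 0) \<union> (\<Union>j\<in>{1..DIM('e) - 1}. A j)"
      using cov \<open>Far \<union> A 0 \<subseteq> topspace M\<close> by blast
    moreover have "\<forall>j\<in>{1..DIM('e) - 1}. openin M (A j) \<and> null_homotopic_in M (A j)"
    proof
      fix j assume "j \<in> {1..DIM('e) - 1}"
      then have "j < DIM('e)" using dim unfolding atLeastAtMost_iff by arith
      then show "openin M (A j) \<and> null_homotopic_in M (A j)" using A nul by blast
    qed
    ultimately show "ccat_cover M \<omega> N (C + 1) (DIM('e) - 1)"
      unfolding ccat_cover_def using mov openin_Un[OF Far A[of 0]]
      by (intro exI[of _ "Far \<union> A 0"] exI[of _ A]) blast
  qed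
qed

end

section \<open>The circle case\<close>

lemma continuous_map_pieces:
  assumes "\<And>J :: nat. continuous_map (top_of_set {real J..real J + 1}) Y h"
  shows "continuous_map (top_of_set {0..real J}) Y h"
proof (induction J)
  case 0
  have "continuous_map (top_of_set {0..1}) Y h" using assms[of 0] by simp
  then have "continuous_map (subtopology (top_of_set {0..1}) {0..0}) Y h" by (rule continuous_map_from_subtopology)
  moreover have "{0..1} \<inter> {0..0} = {0..0::real}" by auto
  ultimately show ?case by (simp add: subtopology_subtopology)
next
  case (Suc J)
  let ?X = "top_of_set {0..real (Suc J)}"
  have X: "topspace ?X = {0..real (Suc J)}" by simp
  have 1: "subtopology ?X {x \<in> topspace ?X. x \<le> real J} = top_of_set {0..real J}"
    unfolding subtopology_subtopology by (rule arg_cong[of _ _ "subtopology euclidean"]) auto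
  have 2: "subtopology ?X {x \<in> topspace ?X. real J \<le> x} = top_of_set {real J..real J + 1}"
    unfolding subtopology_subtopology by (rule arg_cong[of _ _ "subtopology euclidean"]) auto
  have "continuous_map ?X Y (\<lambda>x. if x \<le> real J then h x else h x)"
  proof (rule continuous_map_cases_le)
    show "continuous_map ?X euclideanreal (\<lambda>x. x)" by (simp add: continuous_map_subtopology_eu)
    show "continuous_map (subtopology ?X {x \<in> topspace ?X. x \<le> real J}) Y h" unfolding 1 by (rule Suc)
    show "continuous_map (subtopology ?X {x \<in> topspace ?X. real J \<le> x}) Y h" unfolding 2 by (rule assms)
  qed auto
  then show ?case by simp
qed

lemma primitive_on_pieces:
  assumes "\<And>J :: nat. primitive_on \<omega> \<gamma> {real J..real J + 1} F"
  shows "primitive_on \<omega> \<gamma> {0..real J} F"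
proof (induction J)
  case 0
  then show ?case using primitive_on_subset[OF assms[of 0], of "{0..real 0}"] by auto
next
  case (Suc J)
  have "{0..real (Suc J)} = {0..real J} \<union> {real J..real J + 1}" by auto
  then show ?case using primitive_on_Un[OF _ _ Suc assms[of J]] by simp
qed

context manifold_form begin

text \<open>The parameter runs over all non-negative reals with period \<open>m\<close>, so that a
  full turn may start at any point and simply continue past the first vertex.\<close>

definition bead_loop :: "(nat \<Rightarrow> ('a, 'e) bead) \<Rightarrow> (nat \<Rightarrow> 'a) \<Rightarrow> nat \<Rightarrow> real \<Rightarrow> 'a"
  where "bead_loop b q m s = (let i = nat \<lfloor>s\<rfloor> mod m in
    bwd (b i) ((1 - frac s) *\<^sub>R fwd (b i) (q i) + frac s *\<^sub>R fwd (b i) (q (Suc i mod m))))"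

text \<open>The integral of the form along the polygon from its start to the parameter \<open>s\<close>.\<close>

definition loop_prim :: "(nat \<Rightarrow> ('a, 'e) bead) \<Rightarrow> (nat \<Rightarrow> 'a) \<Rightarrow> nat \<Rightarrow> real \<Rightarrow> real"
  where "loop_prim b q m s =
    (\<Sum>l<nat \<lfloor>s\<rfloor>. prim (b (l mod m)) (q (Suc l mod m)) - prim (b (l mod m)) (q (l mod m))) +
    (prim (b (nat \<lfloor>s\<rfloor> mod m)) (bead_loop b q m s) - prim (b (nat \<lfloor>s\<rfloor> mod m)) (q (nat \<lfloor>s\<rfloor> mod m)))"

section \<open>The polygon as a periodic path\<close>

context
  fixes m b q
  assumes N: "necklace m b q"
begin

lemma index_less: "j mod m < m"
  using necklaceD(1)[OF N] by simp

text \<open>At \<open>t = 1\<close> the integer part has already passed to the next edge, so the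
  formulas of two consecutive edges must be seen to agree at their common vertex. Afterwards closed
  unit intervals can be used.\<close>

lemma bead_loop_piece:
  assumes t: "0 \<le> t" "t \<le> 1"
  shows "bead_loop b q m (real J + t) = bwd (b (J mod m))
      ((1 - t) *\<^sub>R fwd (b (J mod m)) (q (J mod m)) + t *\<^sub>R fwd (b (J mod m)) (q (Suc J mod m)))"
    (is ?r)
    and "loop_prim b q m (real J + t) =
      (\<Sum>l<J. prim (b (l mod m)) (q (Suc l mod m)) - prim (b (l mod m)) (q (l mod m))) +
      (prim (b (J mod m)) (bead_loop b q m (real J + t)) - prim (b (J mod m)) (q (J mod m)))" (is ?p)
proof -
  note nD = necklaceD[OF N]
  have "?r \<and> ?p"
  proof (cases "t = 1")
    case False
    then have t1: "t < 1" using t by simp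
    then have fl: "\<lfloor>real J + t\<rfloor> = int J" using t by (simp add: floor_eq_iff)
    then have "frac (real J + t) = t" unfolding frac_def by simp
    then show ?thesis using fl by (simp add: bead_loop_def loop_prim_def Let_def mod_Suc_eq)
  next
    case True
    have fl: "\<lfloor>real J + t\<rfloor> = int (Suc J)" using True by simp
    then have fr: "frac (real J + t) = 0" unfolding frac_def using True by simp
    have lt: "Suc J mod m < m" "J mod m < m" by (rule index_less)+
    have "bead_loop b q m (real J + t) = bwd (b (Suc J mod m)) (fwd (b (Suc J mod m)) (q (Suc J mod m)))"
      unfolding bead_loop_def fr fl Let_def nat_int by simp
    then have r: "bead_loop b q m (real J + t) = q (Suc J mod m)"
      using form_chartD(7)[OF nD(2)[OF lt(1)] nD(3)[OF lt(1)]] by simp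
    have "q (Suc J mod m) \<in> bdom (b (J mod m))" using nD(4)[OF lt(2)] by (simp add: mod_Suc_eq)
    from form_chartD(7)[OF nD(2)[OF lt(2)] this] r
    have ?r using True by simp
    moreover have ?p unfolding loop_prim_def fl nat_int r by simp
    ultimately show ?thesis by blast
  qed
  then show ?r ?p by blast+
qed

lemma bead_loop_piece_in:
  assumes t: "0 \<le> t" "t \<le> 1"
  shows "bead_loop b q m (real J + t) \<in> bead_seg b q m (J mod m)"
  unfolding bead_loop_piece(1)[OF t] bead_seg_def mod_Suc_eq using t
  by (intro imageI) (auto simp: in_segment intro!: exI[of _ t])

lemma bead_loop_coord:
  assumes "0 \<le> s"
  shows "bead_loop b q m s \<in> bead_seg b q m (nat \<lfloor>s\<rfloor> mod m)"
    "bead_coord b q m (nat \<lfloor>s\<rfloor> mod m) (bead_loop b q m s) = frac s"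
proof -
  let ?J = "nat \<lfloor>s\<rfloor>"
  have s: "s = real ?J + frac s" using assms by (simp add: frac_def)
  have fr: "0 \<le> frac s" "frac s \<le> 1" using frac_lt_1[of s] by (simp_all add: less_imp_le)
  show "bead_loop b q m s \<in> bead_seg b q m (?J mod m)" using bead_loop_piece_in[OF fr, of ?J] s by simp
  let ?i = "?J mod m"
  note nD = necklaceD[OF N] and lt = index_less[of ?J]
  note C = form_chartD[OF nD(2)[OF lt]]
  let ?x = "fwd (b ?i) (q ?i)" and ?y = "fwd (b ?i) (q (Suc ?i mod m))"
  have xy: "?x \<in> bran (b ?i)" "?y \<in> bran (b ?i)" using C(5) nD(3,4)[OF lt] by auto
  have "?x \<noteq> ?y" using C(7) nD(3,4,5)[OF lt] by metis
  have "(1 - frac s) *\<^sub>R ?x + frac s *\<^sub>R ?y \<in> bran (b ?i)"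
    using convexD[OF C(4) xy, of "1 - frac s" "frac s"] fr by simp
  then have "fwd (b ?i) (bead_loop b q m s) = (1 - frac s) *\<^sub>R ?x + frac s *\<^sub>R ?y"
    unfolding bead_loop_def Let_def using C(8) by simp
  then show "bead_coord b q m ?i (bead_loop b q m s) = frac s"
    unfolding bead_coord_def using proj_coord_segment[OF \<open>?x \<noteq> ?y\<close> fr] by simp
qed

text \<open>Coinciding points lie on the same edge: consecutive edges share only a vertex, which the
  parametrisation counts to the later one, and other edges are disjoint. Equal coordinates then make
  \<open>s - s'\<close> an integer divisible by \<open>m\<close>.\<close>

lemma bead_loop_inj:
  assumes s: "0 \<le> s" "0 \<le> s'" "bead_loop b q m s = bead_loop b q m s'" "\<bar>s - s'\<bar> < real m"
  shows "s = s'"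
proof -
  let ?i = "nat \<lfloor>s\<rfloor> mod m" and ?j = "nat \<lfloor>s'\<rfloor> mod m"
  note nD = necklaceD[OF N]
  have lt: "?i < m" "?j < m" by (rule index_less)+
  note r = bead_loop_coord[OF s(1)] and r' = bead_loop_coord[OF s(2)]
  have no: False
    if "0 \<le> s" "0 \<le> s'" "bead_loop b q m s = bead_loop b q m s'" "nat \<lfloor>s'\<rfloor> mod m = Suc (nat \<lfloor>s\<rfloor> mod m) mod m" for s s'
  proof -
    let ?i = "nat \<lfloor>s\<rfloor> mod m"
    have i: "?i < m" by (rule index_less)
    have "bead_loop b q m s \<in> bead_seg b q m ?i \<inter> bead_seg b q m (Suc ?i mod m)"
      using bead_loop_coord(1)[OF that(1)] bead_loop_coord(1)[OF that(2)] that(3,4) by simp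
    then have "bead_loop b q m s = q (Suc ?i mod m)" using nD(7)[OF i] by blast
    then have "frac s = 1" using bead_loop_coord(2)[OF that(1)] bead_seg_facts(7)[OF N i] by simp
    then show False using frac_lt_1[of s] by simp
  qed
  have "?i = ?j"
  proof (rule ccontr)
    assume ne: "?i \<noteq> ?j"
    have "?j \<noteq> Suc ?i mod m" using no[OF s(1,2,3)] by blast
    moreover have "?i \<noteq> Suc ?j mod m" using no[OF s(2,1) s(3)[symmetric]] by blast
    ultimately have "bdom (b ?i) \<inter> bdom (b ?j) = {}" using nD(6)[OF lt] ne by metis
    then show False
      using r(1) r'(1) s(3) bead_seg_facts(1)[OF N lt(1)] bead_seg_facts(1)[OF N lt(2)] by auto
  qed
  then have fr: "frac s = frac s'" using r(2) r'(2) s(3) by simp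
  have "s - s' = real_of_int (\<lfloor>s\<rfloor> - \<lfloor>s'\<rfloor>)" using fr unfolding frac_def by simp
  moreover have "int m dvd \<lfloor>s\<rfloor> - \<lfloor>s'\<rfloor>"
  proof -
    have "int (nat \<lfloor>s\<rfloor>) mod int m = int (nat \<lfloor>s'\<rfloor>) mod int m" using \<open>?i = ?j\<close> by (metis zmod_int)
    then have "\<lfloor>s\<rfloor> mod int m = \<lfloor>s'\<rfloor> mod int m" using s(1,2) by simp
    then show ?thesis by (simp add: mod_eq_dvd_iff)
  qed
  moreover have "\<bar>\<lfloor>s\<rfloor> - \<lfloor>s'\<rfloor>\<bar> < int m" using s(4) \<open>s - s' = _\<close> by linarith
  ultimately show ?thesis using zdvd_imp_le[of "int m" "\<bar>\<lfloor>s\<rfloor> - \<lfloor>s'\<rfloor>\<bar>"] by fastforce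
qed

lemma bead_loop_continuous: "continuous_map (top_of_set {0..real J}) M (bead_loop b q m)"
proof (rule continuous_map_pieces)
  fix J :: nat
  let ?i = "J mod m"
  note nD = necklaceD[OF N] and lt = index_less[of J]
  note C = form_chartD[OF nD(2)[OF lt]]
  let ?x = "fwd (b ?i) (q ?i)" and ?y = "fwd (b ?i) (q (Suc J mod m))"
  let ?l = "\<lambda>s. (1 - (s - real J)) *\<^sub>R ?x + (s - real J) *\<^sub>R ?y"
  have xy: "?x \<in> bran (b ?i)" "?y \<in> bran (b ?i)" using C(5) nD(3,4)[OF lt] by (auto simp: mod_Suc_eq)
  have "?l ` {real J..real J + 1} \<subseteq> bran (b ?i)"
  proof
    fix z assume "z \<in> ?l ` {real J..real J + 1}"
    then obtain s where "z = ?l s" "0 \<le> s - real J" "s - real J \<le> 1" by auto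
    then show "z \<in> bran (b ?i)" using convexD[OF C(4) xy, of "1 - (s - real J)" "s - real J"] by simp
  qed
  then have "continuous_map (top_of_set {real J..real J + 1}) (top_of_set (bran (b ?i))) ?l"
    by (auto simp: continuous_map_in_subtopology intro!: continuous_intros)
  from continuous_map_compose[OF this C(10)]
  have "continuous_map (top_of_set {real J..real J + 1}) M (bwd (b ?i) \<circ> ?l)" .
  then show "continuous_map (top_of_set {real J..real J + 1}) M (bead_loop b q m)"
  proof (rule continuous_map_eq)
    fix s assume "s \<in> topspace (top_of_set {real J..real J + 1})"
    then have "0 \<le> s - real J" "s - real J \<le> 1" by auto
    from bead_loop_piece(1)[OF this, of J] show "(bwd (b ?i) \<circ> ?l) s = bead_loop b q m s" by simp
  qed
qed

lemma bead_loop_primitive: "primitive_on \<omega> (bead_loop b q m) {0..real J} (loop_prim b q m)"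
proof (rule primitive_on_pieces)
  fix J :: nat
  note nD = necklaceD[OF N] and lt = index_less[of J]
  obtain V where V: "(V, prim (b (J mod m))) \<in> \<omega>" "bdom (b (J mod m)) \<subseteq> V"
    using nD(2)[OF lt] unfolding form_chart_def by blast
  have sub: "{real J..real J + 1} \<subseteq> {0..real (Suc J)}" by auto
  have pc: "0 \<le> s - real J" "s - real J \<le> 1" if "s \<in> {real J..real J + 1}" for s using that by auto
  have "bead_loop b q m ` {real J..real J + 1} \<subseteq> V"
  proof
    fix z assume "z \<in> bead_loop b q m ` {real J..real J + 1}"
    then obtain s where s: "s \<in> {real J..real J + 1}" "z = bead_loop b q m s" by blast
    then have "z \<in> bead_seg b q m (J mod m)" using bead_loop_piece_in[OF pc[OF s(1)], of J] by simp
    then show "z \<in> V" using bead_seg_facts(1)[OF N lt] V(2) by blast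
  qed
  moreover have "continuous_map (top_of_set {real J..real J + 1}) M (bead_loop b q m)"
    using continuous_map_from_subtopology_mono[OF bead_loop_continuous sub] .
  moreover have "loop_prim b q m s =
      ((\<Sum>l<J. prim (b (l mod m)) (q (Suc l mod m)) - prim (b (l mod m)) (q (l mod m))) -
       prim (b (J mod m)) (q (J mod m))) + prim (b (J mod m)) (bead_loop b q m s)"
    if "s \<in> {real J..real J + 1}" for s
    using bead_loop_piece(2)[OF pc[OF that], of J] by simp
  ultimately show "primitive_on \<omega> (bead_loop b q m) {real J..real J + 1} (loop_prim b q m)"
    by (intro primitive_on_local[OF form _ V(1)])
qed

lemma loop_prim_continuous: "continuous_on {0..real J} (loop_prim b q m)"
proof -
  have "continuous_map (top_of_set {0..real J}) euclideanreal (loop_prim b q m)"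
  proof (rule continuous_map_pieces)
    fix J :: nat
    note nD = necklaceD[OF N] and lt = index_less[of J]
    have sub: "{real J..real J + 1} \<subseteq> {0..real (Suc J)}" by auto
    have pc: "0 \<le> s - real J" "s - real J \<le> 1" if "s \<in> {real J..real J + 1}" for s using that by auto
    have "bead_loop b q m s \<in> bdom (b (J mod m))" if "s \<in> {real J..real J + 1}" for s
      using bead_loop_piece_in[OF pc[OF that], of J] bead_seg_facts(1)[OF N lt] by auto
    then have "continuous_map (top_of_set {real J..real J + 1}) (subtopology M (bdom (b (J mod m)))) (bead_loop b q m)"
      using continuous_map_from_subtopology_mono[OF bead_loop_continuous sub]
      by (auto simp: continuous_map_in_subtopology)
    from continuous_map_compose[OF this form_chart_continuous[OF nD(2)[OF lt]]]
    have "continuous_on {real J..real J + 1} (\<lambda>s. prim (b (J mod m)) (bead_loop b q m s))"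
      by (simp add: o_def)
    then have "continuous_on {real J..real J + 1} (\<lambda>s.
      (\<Sum>l<J. prim (b (l mod m)) (q (Suc l mod m)) - prim (b (l mod m)) (q (l mod m))) +
      (prim (b (J mod m)) (bead_loop b q m s) - prim (b (J mod m)) (q (J mod m))))"
      by (intro continuous_intros)
    then have "continuous_on {real J..real J + 1} (loop_prim b q m)"
    proof (rule continuous_on_eq)
      fix s assume "s \<in> {real J..real J + 1}"
      from bead_loop_piece(2)[OF pc[OF this], of J]
      show "(\<Sum>l<J. prim (b (l mod m)) (q (Suc l mod m)) - prim (b (l mod m)) (q (l mod m))) +
        (prim (b (J mod m)) (bead_loop b q m s) - prim (b (J mod m)) (q (J mod m))) = loop_prim b q m s"
        by simp
    qed
    then show "continuous_map (top_of_set {real J..real J + 1}) euclideanreal (loop_prim b q m)"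
      by simp
  qed
  then show ?thesis by simp
qed

text \<open>After a cyclic shift of their second terms the increments along the edges add up to the
  sum of the transition constants, which is negative by \<open>necklace\<close>.\<close>

lemma bead_loop_period:
  fixes s :: real
  assumes "0 \<le> s"
  shows "bead_loop b q m (s + real m) = bead_loop b q m s"
    and "loop_prim b q m (s + real m) = loop_prim b q m s + loop_prim b q m m - loop_prim b q m 0"
    and "loop_prim b q m m < loop_prim b q m 0"
proof -
  note nD = necklaceD[OF N]
  let ?w = "\<lambda>l. prim (b (l mod m)) (q (Suc l mod m)) - prim (b (l mod m)) (q (l mod m))"
  have m: "0 < m" using nD(1) by simp
  have fl: "\<lfloor>s + m\<rfloor> = \<lfloor>s\<rfloor> + int m" using floor_add_int[of s "int m"] by simp
  have fr: "frac (s + real m) = frac s" unfolding frac_def fl by simp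
  have nf: "nat \<lfloor>s + m\<rfloor> = nat \<lfloor>s\<rfloor> + m" unfolding fl using assms by (simp add: nat_add_distrib)
  show r: "bead_loop b q m (s + real m) = bead_loop b q m s" unfolding bead_loop_def nf fr by simp
  have per: "(\<Sum>l<J + m. ?w l) = (\<Sum>l<J. ?w l) + (\<Sum>l<m. ?w l)" for J
  proof (induction J)
    case (Suc J)
    have "Suc (J + m) mod m = Suc J mod m" by (metis add_Suc mod_add_self2)
    then have "?w (J + m) = ?w J" by simp
    then show ?case using Suc by simp
  qed simp
  have q0: "bead_loop b q m 0 = q 0" "bead_loop b q m m = q 0"
    using bead_loop_piece(1)[of 0 0] bead_loop_piece(1)[of 0 m] form_chartD(7)[OF nD(2)[OF m] nD(3)[OF m]] by simp_all
  have p0: "loop_prim b q m 0 = 0" using bead_loop_piece(2)[of 0 0] q0 by simp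
  have pm: "loop_prim b q m m = (\<Sum>l<m. ?w l)" using bead_loop_piece(2)[of 0 m] q0 by simp
  show "loop_prim b q m (s + real m) = loop_prim b q m s + loop_prim b q m m - loop_prim b q m 0"
    unfolding p0 pm unfolding loop_prim_def nf r by (simp add: per)
  have "(\<Sum>l<m. ?w l) = (\<Sum>i<m. prim (b i) (q (Suc i mod m))) - (\<Sum>i<m. prim (b i) (q i))"
    by (simp add: sum_subtractf)
  also have "\<dots> = (\<Sum>i<m. prim (b i) (q (Suc i mod m)) - prim (b (Suc i mod m)) (q (Suc i mod m)))"
    using sum_Suc_mod[OF m, of "\<lambda>i. prim (b i) (q i)"] by (simp add: sum_subtractf)
  finally show "loop_prim b q m m < loop_prim b q m 0" using nD(9) p0 pm by simp
qed

text \<open>In dimension one the polygon is locally an injective path in a line, hence open by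
  invariance of domain; it is also compact, and \<open>M\<close> is connected.\<close>

lemma bead_loop_surj:
  assumes dim: "DIM('e) = 1"
  shows "bead_loop b q m ` {0..real m} = topspace M"
proof (rule connected_spread)
  have m: "3 \<le> real m" using necklaceD(1)[OF N] by simp
  let ?K = "bead_loop b q m ` {0..real m}"
  show sub: "?K \<subseteq> topspace M" using bead_loop_continuous[of m] unfolding continuous_map_def by auto
  show "?K \<noteq> {}" by simp
  have "compactin M ?K"
    using bead_loop_continuous[of m] by (intro image_compactin[of "top_of_set {0..real m}"]) (auto simp: compactin_subtopology)
  then have cl: "closedin M ?K" by (rule closedin_compactin)
  fix x assume x: "x \<in> topspace M"
  show "\<exists>W. openin M W \<and> x \<in> W \<and> (W \<inter> ?K \<noteq> {} \<longrightarrow> W \<subseteq> ?K)"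
  proof (cases "x \<in> ?K")
    case False
    then show ?thesis using cl x by (intro exI[of _ "topspace M - ?K"]) auto
  next
    case True
    then obtain s0 where s0: "0 \<le> s0" "s0 \<le> real m" "x = bead_loop b q m s0" by auto
    \<comment> \<open>Parameter 0 is replaced by \<open>m\<close>, so that parameters on both sides
      of it are available; the loop continues up to \<open>2 * m\<close>.\<close>
    define s where "s = (if s0 = 0 then real m else s0)"
    have s: "0 < s" "s \<le> real m" "bead_loop b q m s = x"
      unfolding s_def using s0 m bead_loop_period(1)[of 0] by auto
    obtain B \<phi> \<psi> r f where B: "0 < r" "form_chart B \<phi> \<psi> (ball (\<phi> x) r) f" "x \<in> B"
      using form_chart_exists[of "topspace M" x] x by blast
    note C = form_chartD[OF B(2)]
    let ?I = "{0..real (2 * m)}"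
    have "openin (top_of_set ?I) {t \<in> topspace (top_of_set ?I). bead_loop b q m t \<in> B}"
      by (rule openin_continuous_map_preimage[OF bead_loop_continuous C(1)])
    then obtain Q where Q: "open Q" "{t \<in> ?I. bead_loop b q m t \<in> B} = ?I \<inter> Q"
      by (auto simp: openin_open)
    have "s \<in> {t \<in> ?I. bead_loop b q m t \<in> B}" using s B(3) m by simp
    then have "s \<in> Q" using Q(2) by blast
    then have "s \<in> Q \<inter> {0<..<real (2 * m)} \<inter> ball s 1" using s m by simp
    moreover have "open (Q \<inter> {0<..<real (2 * m)} \<inter> ball s 1)" using Q(1) by (intro open_Int) auto
    ultimately obtain e where e: "0 < e" "ball s e \<subseteq> Q \<inter> {0<..<real (2 * m)} \<inter> ball s 1" using openE by blast
    have inB: "bead_loop b q m t \<in> B" if "t \<in> ball s e" for t 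
    proof -
      have "t \<in> Q \<inter> {0<..<real (2 * m)} \<inter> ball s 1" by (rule subsetD[OF e(2) that])
      then have "t \<in> ?I \<inter> Q" by simp
      then show ?thesis using Q(2) by blast
    qed
    have "ball s e \<subseteq> ?I"
    proof
      fix t assume "t \<in> ball s e"
      from subsetD[OF e(2) this] show "t \<in> ?I" by simp
    qed
    then have "continuous_map (top_of_set (ball s e)) M (bead_loop b q m)"
      using continuous_map_from_subtopology_mono[OF bead_loop_continuous] by blast
    then have "continuous_map (top_of_set (ball s e)) (subtopology M B) (bead_loop b q m)"
      using inB by (auto simp: continuous_map_in_subtopology)
    from continuous_map_compose[OF this C(9)]
    have ct: "continuous_on (ball s e) (\<lambda>t. \<phi> (bead_loop b q m t))" by (simp add: o_def)
    have "inj_on (\<lambda>t. \<phi> (bead_loop b q m t)) (ball s e)"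
    proof (rule inj_onI)
      fix t t' assume t: "t \<in> ball s e" "t' \<in> ball s e" "\<phi> (bead_loop b q m t) = \<phi> (bead_loop b q m t')"
      then have "bead_loop b q m t = bead_loop b q m t'" using inB C(7) by metis
      moreover have "t \<in> {0<..<real (2 * m)} \<inter> ball s 1" "t' \<in> {0<..<real (2 * m)} \<inter> ball s 1" using t(1,2) e(2) by blast+
      then have "0 \<le> t" "0 \<le> t'" "\<bar>t - t'\<bar> < real m" using m by (auto simp: dist_real_def)
      ultimately show "t = t'" using bead_loop_inj by blast
    qed
    then have op: "open ((\<lambda>t. \<phi> (bead_loop b q m t)) ` ball s e)"
      using dim by (intro invariance_of_domain_gen[OF open_ball ct]) auto
    let ?W = "{y \<in> B. \<phi> y \<in> (\<lambda>t. \<phi> (bead_loop b q m t)) ` ball s e}"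
    have "?W \<subseteq> ?K"
    proof
      fix y assume y: "y \<in> ?W"
      then obtain t where t: "t \<in> ball s e" "\<phi> y = \<phi> (bead_loop b q m t)" by blast
      then have "y = bead_loop b q m t" using y C(7) inB by (metis (no_types, lifting) mem_Collect_eq)
      moreover have "0 < t" "t < 2 * real m" using t(1) e(2) by auto
      moreover have "bead_loop b q m t = bead_loop b q m (t - real m)" if "real m \<le> t"
        using bead_loop_period(1)[of "t - real m"] that by simp
      ultimately show "y \<in> ?K" by (cases "t \<le> real m") (auto intro!: image_eqI[of _ _ "t - real m"])
    qed
    moreover have "openin M ?W" by (rule convex_chart_openin_preimage[OF form_chart_convex[OF B(2)] op])
    moreover have "x \<in> ?W" using B(3) s(3) e(1) by (auto intro!: image_eqI[of _ _ s])
    ultimately show ?thesis by blast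
  qed
qed

text \<open>Every point travels once around the polygon and returns. The starting parameter
  \<open>\<sigma>\<close> jumps at the seam, so continuity is checked after composition with the
  parametrisation, which is a quotient map because it goes from a compact space onto a Hausdorff
  space.\<close>

lemma full_turn:
  assumes dim: "DIM('e) = 1"
  shows "\<exists>C. move_by M \<omega> (\<lambda>x. x) (\<lambda>x. loop_prim b q m m - loop_prim b q m 0) C"
proof -
  let ?\<kappa> = "bead_loop b q m" and ?F = "loop_prim b q m" and ?w = "loop_prim b q m m - loop_prim b q m 0"
  have m: "0 < real m" using necklaceD(1)[OF N] by simp
  have ex: "\<exists>s. 0 \<le> s \<and> s < real m \<and> ?\<kappa> s = x" if x: "x \<in> topspace M" for x
  proof -
    obtain s where s: "0 \<le> s" "s \<le> real m" "?\<kappa> s = x" using bead_loop_surj[OF dim] x by force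
    show ?thesis
    proof (cases "s = real m")
      case True
      then show ?thesis using s m bead_loop_period(1)[of 0] by (intro exI[of _ 0]) simp
    qed (use s in \<open>intro exI[of _ s], simp\<close>)
  qed
  define \<sigma> where "\<sigma> = (\<lambda>x. SOME s. 0 \<le> s \<and> s < real m \<and> ?\<kappa> s = x)"
  have \<sigma>: "0 \<le> \<sigma> x" "\<sigma> x < real m" "?\<kappa> (\<sigma> x) = x" if "x \<in> topspace M" for x
    using someI_ex[OF ex[OF that]] unfolding \<sigma>_def by blast+
  define h where "h = (\<lambda>(t, x). ?\<kappa> (\<sigma> x + t * real m))"
  define \<Phi> where "\<Phi> = (\<lambda>(t, x). ?F (\<sigma> x + t * real m) - ?F (\<sigma> x))"
  let ?J = "{0..1::real}" and ?I = "{0..real m}" and ?I2 = "{0..real (2 * m)}"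
  let ?q = "\<lambda>(t, s). (t, ?\<kappa> s)"
  have in\<kappa>: "?\<kappa> s \<in> topspace M" if "s \<in> ?I" for s using bead_loop_surj[OF dim] that by blast
  \<comment> \<open>The parameter is recovered except at the seam, where \<open>m\<close> becomes 0;
    periodicity removes the difference.\<close>
  have sg: "\<sigma> (?\<kappa> s) = s \<or> s = real m \<and> \<sigma> (?\<kappa> s) = 0" if "s \<in> ?I" for s
  proof (cases "s = real m")
    case True
    have e: "?\<kappa> s = ?\<kappa> 0" using True bead_loop_period(1)[of 0] by simp
    have "\<sigma> (?\<kappa> s) = 0"
      using \<sigma>[OF in\<kappa>[OF that]] e m by (intro bead_loop_inj) auto
    then show ?thesis using True by simp
  next
    case False
    have "\<sigma> (?\<kappa> s) = s"
      using \<sigma>[OF in\<kappa>[OF that]] that False by (intro bead_loop_inj) auto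
    then show ?thesis by simp
  qed
  have hq: "h (t, ?\<kappa> s) = ?\<kappa> (s + t * real m)" and \<Phi>q: "\<Phi> (t, ?\<kappa> s) = ?F (s + t * real m) - ?F s"
    if "t \<in> ?J" "s \<in> ?I" for t s
  proof -
    have "?\<kappa> (real m + t * real m) = ?\<kappa> (t * real m)" "?F (real m + t * real m) - ?F m = ?F (t * real m) - ?F 0"
      using bead_loop_period(1,2)[of "t * real m"] that m by (simp_all add: add.commute)
    then show "h (t, ?\<kappa> s) = ?\<kappa> (s + t * real m)" "\<Phi> (t, ?\<kappa> s) = ?F (s + t * real m) - ?F s"
      unfolding h_def \<Phi>_def using sg[OF that(2)] by auto
  qed
  let ?X = "prod_topology (top_of_set ?J) (top_of_set ?I)" and ?Y = "prod_topology (top_of_set ?J) M"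
  have cq: "continuous_map ?X ?Y ?q"
  proof -
    have "continuous_map ?X M (?\<kappa> \<circ> snd)" by (rule continuous_map_compose[OF continuous_map_snd bead_loop_continuous])
    then have "continuous_map ?X ?Y (\<lambda>p. (fst p, (?\<kappa> \<circ> snd) p))"
      unfolding continuous_map_paired using continuous_map_fst by blast
    then show ?thesis by (simp only: o_def case_prod_unfold)
  qed
  have "quotient_map ?X ?Y ?q"
  proof (rule continuous_imp_quotient_map[OF cq])
    have "compact_space (top_of_set ?J)" "compact_space (top_of_set ?I)"
      by (simp_all add: compact_space_subtopology)
    then show "compact_space ?X" unfolding compact_space_prod_topology by blast
    have "Hausdorff_space (top_of_set ?J)" by (simp add: Hausdorff_space_subtopology)
    then show "Hausdorff_space ?Y" unfolding Hausdorff_space_prod_topology using Hausdorff by blast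
    have "?q ` (?J \<times> ?I) = ?J \<times> ?\<kappa> ` ?I" by auto
    then show "?q ` topspace ?X = topspace ?Y" using bead_loop_surj[OF dim] by simp
  qed
  note quo = continuous_compose_quotient_map[OF this]
  have sm: "s + t * real m \<in> ?I2" if "t \<in> ?J" "s \<in> ?I" for s t
  proof -
    have "t * real m \<le> 1 * real m" using that by (intro mult_right_mono) auto
    moreover have "0 \<le> t * real m" using that by (intro mult_nonneg_nonneg) auto
    ultimately show ?thesis using that unfolding atLeastAtMost_iff of_nat_mult of_nat_numeral by linarith
  qed
  have "continuous_on (?J \<times> ?I) (\<lambda>p. snd p + fst p * real m)" by (intro continuous_intros)
  moreover have "(\<lambda>p. snd p + fst p * real m) \<in> ?J \<times> ?I \<rightarrow> ?I2" using sm by fastforce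
  ultimately have "continuous_map ?X (top_of_set ?I2) (\<lambda>p. snd p + fst p * real m)" by simp
  note lin = this
  have hc: "continuous_map ?Y M h"
  proof (rule quo)
    have "continuous_map ?X M (?\<kappa> \<circ> (\<lambda>p. snd p + fst p * real m))"
      by (rule continuous_map_compose[OF lin bead_loop_continuous])
    then show "continuous_map ?X M (h \<circ> ?q)"
      by (rule continuous_map_eq) (auto simp: hq)
  qed
  have Fc: "continuous_map (top_of_set {0..real J}) euclideanreal ?F" for J
    using loop_prim_continuous[of J] by simp
  have \<Phi>c: "continuous_map ?Y euclideanreal \<Phi>"
  proof (rule quo)
    have "continuous_map ?X euclideanreal (?F \<circ> (\<lambda>p. snd p + fst p * real m))"
      by (rule continuous_map_compose[OF lin Fc])
    moreover have "continuous_map ?X euclideanreal (?F \<circ> snd)" by (rule continuous_map_compose[OF continuous_map_snd Fc])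
    ultimately have "continuous_map ?X euclideanreal
        (\<lambda>p. (?F \<circ> (\<lambda>p. snd p + fst p * real m)) p - (?F \<circ> snd) p)" by (rule continuous_map_diff)
    then show "continuous_map ?X euclideanreal (\<Phi> \<circ> ?q)"
      by (rule continuous_map_eq) (auto simp: \<Phi>q)
  qed
  obtain G where G: "\<And>s. s \<in> ?I2 \<Longrightarrow> \<bar>?F s\<bar> \<le> G"
  proof -
    have "compact (?F ` ?I2)" by (rule compact_continuous_image[OF loop_prim_continuous compact_Icc])
    then have "bounded (?F ` ?I2)" by (rule compact_imp_bounded)
    then obtain G where "\<forall>y\<in>?F ` ?I2. norm y \<le> G" unfolding bounded_iff by blast
    then show thesis using that[of G] by simp
  qed
  have "move_by M \<omega> (\<lambda>x. x) (\<lambda>x. ?w) (2 * G)"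
    unfolding move_by_def
  proof (intro exI[of _ h] exI[of _ \<Phi>] conjI ballI)
    fix x assume x: "x \<in> topspace M"
    note s = \<sigma>[OF x]
    show "h (0, x) = x" "\<Phi> (0, x) = 0" unfolding h_def \<Phi>_def using s by auto
    show "h (1, x) = x" "\<Phi> (1, x) = ?w"
      unfolding h_def \<Phi>_def using s bead_loop_period(1,2)[of "\<sigma> x"] by auto
    have "primitive_on \<omega> (\<lambda>t. ?\<kappa> (\<sigma> x + t * real m)) ?J (\<lambda>t. ?F (\<sigma> x + t * real m))"
      using sm s by (intro primitive_on_compose[OF bead_loop_primitive[of "2 * m"]] continuous_intros) auto
    then show "primitive_on \<omega> (\<lambda>t. h (t, x)) ?J (\<lambda>t. \<Phi> (t, x))"
      by (rule primitive_on_cong[where c = "- ?F (\<sigma> x)"]) (auto simp: h_def \<Phi>_def)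
    fix t assume t: "t \<in> ?J"
    have "\<sigma> x \<in> ?I" using s by simp
    then show "\<Phi> (t, x) \<le> 2 * G"
      unfolding \<Phi>_def using G[OF sm[OF t, of "\<sigma> x"]] G[of "\<sigma> x"] by auto
  qed (rule hc \<Phi>c)+
  then show ?thesis by blast
qed

text \<open>A full turn fixes every point at its end and lowers the integral by
  \<open>\<eta>\<close> everywhere, so repeating it makes \<open>F = M\<close> movable. With
  \<open>\<gamma> = 0\<close> the bound of the iterates stays that of a single turn.\<close>

lemma ccat_cover_circle:
  assumes dim: "DIM('e) = 1"
  shows "\<exists>C>0. \<forall>N>0. ccat_cover M \<omega> N C 0"
proof -
  define \<eta> where "\<eta> = loop_prim b q m 0 - loop_prim b q m m"
  have \<eta>: "0 < \<eta>" unfolding \<eta>_def using bead_loop_period(3)[of 0] by simp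
  obtain C where C: "move_by M \<omega> (\<lambda>x. x) (\<lambda>x. - \<eta>) C"
    using full_turn[OF dim] unfolding \<eta>_def by auto
  obtain x0 where "x0 \<in> topspace M" using nonempty by blast
  then have "0 \<le> C" using move_by_le(2)[OF C] by blast
  have "ccat_cover M \<omega> N (C + 1) 0" for N
  proof -
    obtain k :: nat where k: "N < real k * \<eta>" using ex_less_of_nat_mult[OF \<eta>] by blast
    have "\<exists>E. move_by M \<omega> ((\<lambda>x. x) ^^ k) E (C + 2 * 0) \<and>
      (\<forall>x\<in>topspace M. E x \<le> 0 - 0 - k * \<eta> \<and> (x = x \<longrightarrow> E x = k * - \<eta>))"
      using \<eta> by (intro iterate_move[OF C, where \<gamma> = "\<lambda>_. 0"]) auto
    then obtain E where E: "move_by M \<omega> ((\<lambda>x. x) ^^ k) E C" "\<And>x. x \<in> topspace M \<Longrightarrow> E x = - (k * \<eta>)"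
      by auto
    have "movable M \<omega> N (C + 1) (topspace M)"
      using k E(2) by (intro move_by_movable[OF form move_by_mono[OF E(1)]]) auto
    then show ?thesis
      unfolding ccat_cover_def by (intro exI[of _ "topspace M"]) auto
  qed
  then show ?thesis using \<open>0 \<le> C\<close> by (intro exI[of _ "C + 1"]) simp
qed

end

end

section \<open>Singular cocycles of degree one\<close>

lemma cochain_eval_superset:
  assumes "finite S" "Poly_Mapping.keys z \<subseteq> S"
  shows "cochain_eval c z = (\<Sum>\<sigma>\<in>S. of_int (Poly_Mapping.lookup z \<sigma>) * c \<sigma>)"
  unfolding cochain_eval_def
  by (rule sum.mono_neutral_left) (use assms in \<open>auto simp: in_keys_iff\<close>)

lemma cochain_eval_add: "cochain_eval c (x + y) = cochain_eval c x + cochain_eval c y"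
proof -
  let ?S = "Poly_Mapping.keys x \<union> Poly_Mapping.keys y"
  have "Poly_Mapping.keys (x + y) \<subseteq> ?S" by (rule Poly_Mapping.keys_add)
  then show ?thesis
    using cochain_eval_superset[of ?S "x + y" c] cochain_eval_superset[of ?S x c] cochain_eval_superset[of ?S y c]
    by (simp add: lookup_add sum.distrib distrib_right)
qed

lemma cochain_eval_frag_of: "cochain_eval c (frag_of \<sigma>) = c \<sigma>"
  unfolding cochain_eval_def by simp

lemma cochain_eval_minus: "cochain_eval c (- x) = - cochain_eval c x"
  using cochain_eval_add[of c x "- x"] by (simp add: cochain_eval_def)

lemma cochain_eval_fun_add: "cochain_eval (\<lambda>\<sigma>. c \<sigma> + d \<sigma>) z = cochain_eval c z + cochain_eval d z"
  unfolding cochain_eval_def by (simp add: distrib_left sum.distrib)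

lemma cochain_eval_fun_minus: "cochain_eval (\<lambda>\<sigma>. - c \<sigma>) z = - cochain_eval c z"
  unfolding cochain_eval_def by (simp add: sum_negf)

lemma cochain_eval_boundary_1:
  "cochain_eval b (chain_boundary 1 (frag_of \<sigma>)) = b (singular_face 1 0 \<sigma>) - b (singular_face 1 1 \<sigma>)"
proof -
  have "chain_boundary 1 (frag_of \<sigma>) = frag_of (singular_face 1 0 \<sigma>) + - frag_of (singular_face 1 1 \<sigma>)"
    by (simp add: chain_boundary_of atMost_Suc)
  then show ?thesis by (simp only: cochain_eval_add cochain_eval_minus cochain_eval_frag_of)
qed

lemma cochain_eval_boundary_2:
  "cochain_eval b (chain_boundary 2 (frag_of \<sigma>)) =
    b (singular_face 2 0 \<sigma>) - b (singular_face 2 1 \<sigma>) + b (singular_face 2 2 \<sigma>)"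
proof -
  have "{..2::nat} = {0, 1, 2}" by auto
  then have "chain_boundary 2 (frag_of \<sigma>) =
      frag_of (singular_face 2 0 \<sigma>) + - frag_of (singular_face 2 1 \<sigma>) + frag_of (singular_face 2 2 \<sigma>)"
    by (simp add: chain_boundary_of)
  then show ?thesis by (simp only: cochain_eval_add cochain_eval_minus cochain_eval_frag_of)
qed

section \<open>Paths as singular 1-simplices\<close>

lemma standard_simplex_1D:
  assumes "x \<in> standard_simplex 1"
  shows "0 \<le> x 1" "x 1 \<le> 1" "x 0 = 1 - x 1" "\<And>i. 1 < i \<Longrightarrow> x i = 0"
  using assms unfolding standard_simplex_def by auto

lemma path_simplex_cong:
  assumes "\<And>t. 0 \<le> t \<Longrightarrow> t \<le> 1 \<Longrightarrow> \<gamma> t = \<gamma>' t"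
  shows "path_simplex \<gamma> = path_simplex \<gamma>'"
  unfolding path_simplex_def by (rule restrict_ext) (use assms standard_simplex_1D in blast)

lemma continuous_map_coordinate:
  fixes i :: 'i
  shows "continuous_map (subtopology (powertop_real UNIV) S) euclideanreal (\<lambda>x. x i)"
proof (rule continuous_map_from_subtopology)
  have "continuous_map (powertop_real UNIV) (powertop_real UNIV) (\<lambda>x :: 'i \<Rightarrow> real. x)" by simp
  then show "continuous_map (powertop_real UNIV) euclideanreal (\<lambda>x. x i)"
    unfolding continuous_map_componentwise_UNIV by blast
qed

lemma singular_simplex_path:
  assumes "pathin X \<gamma>"
  shows "singular_simplex 1 X (path_simplex \<gamma>)"
proof -
  let ?S = "subtopology (powertop_real UNIV) (standard_simplex 1)"
  have "continuous_map ?S (top_of_set {0..1}) (\<lambda>x. x 1)"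
    using continuous_map_coordinate standard_simplex_1D by (auto simp: continuous_map_in_subtopology topspace_standard_simplex)
  from continuous_map_compose[OF this assms[unfolded pathin_def]]
  have "continuous_map ?S X (path_simplex \<gamma>)"
    by (rule continuous_map_eq) (auto simp: path_simplex_def topspace_standard_simplex)
  then show ?thesis unfolding singular_simplex_def path_simplex_def by simp
qed

text \<open>Inverse to the second barycentric coordinate on the standard 1-simplex.\<close>

definition edge_path :: "real \<Rightarrow> nat \<Rightarrow> real"
  where "edge_path t i = (if i = 0 then 1 - t else if i = 1 then t else 0)"

lemma edge_path_in: "0 \<le> t \<Longrightarrow> t \<le> 1 \<Longrightarrow> edge_path t \<in> standard_simplex 1"
  unfolding standard_simplex_def edge_path_def by auto

lemma singular_simplex_1_path:
  assumes "singular_simplex 1 X \<sigma>"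
  shows "pathin X (\<lambda>t. \<sigma> (edge_path t))" "\<sigma> = path_simplex (\<lambda>t. \<sigma> (edge_path t))"
proof -
  have "continuous_on {0..1} (\<lambda>t. edge_path t i)" for i
    unfolding edge_path_def by (cases "i = 0"; cases "i = 1") (auto intro!: continuous_intros)
  then have "continuous_map (top_of_set {0..1}) (subtopology (powertop_real UNIV) (standard_simplex 1)) edge_path"
    using edge_path_in by (auto simp: continuous_map_in_subtopology continuous_map_componentwise_UNIV)
  from continuous_map_compose[OF this] assms
  show "pathin X (\<lambda>t. \<sigma> (edge_path t))"
    unfolding singular_simplex_def pathin_def o_def by blast
  have "edge_path (x 1) = x" if "x \<in> standard_simplex 1" for x
  proof
    fix i :: nat
    consider "i = 0" | "i = 1" | "1 < i" by linarith
    then show "edge_path (x 1) i = x i"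
      by cases (use standard_simplex_1D[OF that] in \<open>auto simp: edge_path_def\<close>)
  qed
  then have "\<sigma> x = path_simplex (\<lambda>t. \<sigma> (edge_path t)) x" if "x \<in> standard_simplex 1" for x
    unfolding path_simplex_def using that by simp
  moreover have "\<sigma> \<in> extensional (standard_simplex 1)" using assms unfolding singular_simplex_def by blast
  ultimately show "\<sigma> = path_simplex (\<lambda>t. \<sigma> (edge_path t))"
    by (intro extensionalityI[of \<sigma> "standard_simplex 1"]) (auto simp: path_simplex_def)
qed

lemma singular_face_path_simplex:
  "singular_face 1 0 (path_simplex \<gamma>) = restrict (\<lambda>_. \<gamma> 1) (standard_simplex 0)"
  "singular_face 1 1 (path_simplex \<gamma>) = restrict (\<lambda>_. \<gamma> 0) (standard_simplex 0)"
proof -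
  have "simplical_face k x \<in> standard_simplex 1" if "k \<le> 1" "x \<in> standard_simplex 0" for k x
    using simplical_face_in_standard_simplex[of 1 k x] that by simp
  moreover have "simplical_face 0 x 1 = 1" if "x \<in> standard_simplex 0" for x :: "nat \<Rightarrow> real"
    using that unfolding simplical_face_def standard_simplex_0 by simp
  moreover have "simplical_face 1 x 1 = 0" for x :: "nat \<Rightarrow> real"
    unfolding simplical_face_def by simp
  ultimately show "singular_face 1 0 (path_simplex \<gamma>) = restrict (\<lambda>_. \<gamma> 1) (standard_simplex 0)"
    "singular_face 1 1 (path_simplex \<gamma>) = restrict (\<lambda>_. \<gamma> 0) (standard_simplex 0)"
    unfolding singular_face_def path_simplex_def by (auto intro!: restrict_ext)
qed

lemma coboundary_path:
  assumes "pathin X \<gamma>"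
  shows "coboundary 1 X b (path_simplex \<gamma>) =
    b (restrict (\<lambda>_. \<gamma> 1) (standard_simplex 0)) - b (restrict (\<lambda>_. \<gamma> 0) (standard_simplex 0))"
  unfolding coboundary_def using singular_simplex_path[OF assms]
  by (simp only: if_True cochain_eval_boundary_1 singular_face_path_simplex)

text \<open>The affine triangle with vertices \<open>a\<close>, \<open>b\<close>, \<open>d\<close>
  in \<open>T\<close>, followed by \<open>h\<close>, is a singular 2-simplex whose faces are the
  three sides. Degenerate triangles are allowed, and the rules for constant, partial, reversed and
  joined paths all follow from this one.\<close>

lemma cocycle_triangle:
  fixes h :: "'v::real_normed_vector \<Rightarrow> 'a"
  assumes c: "c \<in> cocycle_set 1 X" and T: "convex T" "a \<in> T" "b \<in> T" "d \<in> T"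
    and h: "continuous_map (top_of_set T) X h"
  shows "c (path_simplex (\<lambda>t. h ((1 - t) *\<^sub>R a + t *\<^sub>R d))) =
    c (path_simplex (\<lambda>t. h ((1 - t) *\<^sub>R a + t *\<^sub>R b))) + c (path_simplex (\<lambda>t. h ((1 - t) *\<^sub>R b + t *\<^sub>R d)))"
proof -
  let ?S = "subtopology (powertop_real UNIV) (standard_simplex 2)"
  let ?l = "\<lambda>x :: nat \<Rightarrow> real. x 0 *\<^sub>R a + x 1 *\<^sub>R b + x 2 *\<^sub>R d"
  define \<sigma> where "\<sigma> = restrict (\<lambda>x. h (?l x)) (standard_simplex 2)"
  have atM: "{..2::nat} = {0, 1, 2}" by auto
  have lT: "?l x \<in> T" if "x \<in> standard_simplex 2" for x
  proof -
    have x: "0 \<le> x 0" "0 \<le> x 1" "0 \<le> x 2" "x 0 + x 1 + x 2 = 1"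
      using that unfolding standard_simplex_def atM by auto
    have "(\<Sum>i\<in>{0,1,2::nat}. x i *\<^sub>R (if i = 0 then a else if i = 1 then b else d)) \<in> T"
      by (rule convex_sum) (use T x in auto)
    then show ?thesis by (simp add: add.assoc)
  qed
  have sc: "continuous_map ?S euclidean (\<lambda>x. x i *\<^sub>R v)" for i and v :: 'v
  proof -
    have "continuous_map euclideanreal euclidean (\<lambda>r. r *\<^sub>R v)" by (simp add: continuous_intros)
    from continuous_map_compose[OF continuous_map_coordinate this] show ?thesis by (simp add: o_def)
  qed
  have "continuous_map ?S euclidean ?l"
    by (intro continuous_map_add sc)
  then have "continuous_map ?S (top_of_set T) ?l"
    using lT by (auto simp: continuous_map_in_subtopology topspace_standard_simplex)
  from continuous_map_compose[OF this h] have "continuous_map ?S X \<sigma>"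
    by (rule continuous_map_eq) (auto simp: \<sigma>_def topspace_standard_simplex)
  then have s: "singular_simplex 2 X \<sigma>" unfolding singular_simplex_def \<sigma>_def by simp
  have "coboundary 2 X c \<sigma> = 0"
    using c unfolding cocycle_set_def by (simp add: numeral_2_eq_2)
  then have "c (singular_face 2 0 \<sigma>) - c (singular_face 2 1 \<sigma>) + c (singular_face 2 2 \<sigma>) = 0"
    unfolding coboundary_def cochain_eval_boundary_2 using s by simp
  moreover have "singular_face 2 k \<sigma> = restrict (\<lambda>x. h (?l (simplical_face k x))) (standard_simplex 1)" if "k \<le> 2" for k
    unfolding singular_face_def \<sigma>_def
    using simplical_face_in_standard_simplex[of 2 k] that by (auto intro!: restrict_ext)
  moreover have "restrict (\<lambda>x. h (?l (simplical_face k x))) (standard_simplex 1) =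
      path_simplex (\<lambda>t. h (?l (simplical_face k (edge_path t))))" for k
    unfolding path_simplex_def
  proof (rule restrict_ext)
    fix x :: "nat \<Rightarrow> real" assume x: "x \<in> standard_simplex 1"
    have "edge_path (x 1) i = x i" for i
    proof -
      consider "i = 0" | "i = 1" | "1 < i" by linarith
      then show "edge_path (x 1) i = x i"
        by cases (use standard_simplex_1D[OF x] in \<open>auto simp: edge_path_def\<close>)
    qed
    then have "edge_path (x 1) = x" by (rule ext)
    then show "h (?l (simplical_face k x)) = h (?l (simplical_face k (edge_path (x 1))))" by simp
  qed
  ultimately have "c (path_simplex (\<lambda>t. h (?l (simplical_face 0 (edge_path t))))) -
      c (path_simplex (\<lambda>t. h (?l (simplical_face 1 (edge_path t))))) +
      c (path_simplex (\<lambda>t. h (?l (simplical_face 2 (edge_path t))))) = 0" by simp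
  then show ?thesis by (simp add: simplical_face_def edge_path_def)
qed

text \<open>For a degenerate triangle the triangle rule says that the value equals its own
  double.\<close>

lemma cocycle_const:
  assumes c: "c \<in> cocycle_set 1 X" and x: "x \<in> topspace X"
  shows "c (path_simplex (\<lambda>_. x)) = 0"
  using cocycle_triangle[OF c, of "UNIV :: real set" 0 0 0 "\<lambda>_. x"] x by simp

text \<open>The case \<open>b < a\<close> is included and yields reversed paths.\<close>

definition subpath_at :: "(real \<Rightarrow> 'a) \<Rightarrow> real \<Rightarrow> real \<Rightarrow> real \<Rightarrow> 'a"
  where "subpath_at \<gamma> a b = (\<lambda>t. \<gamma> ((1 - t) *\<^sub>R a + t *\<^sub>R b))"

lemma pathin_subpath_at:
  assumes "pathin X \<gamma>" "a \<in> {0..1}" "b \<in> {0..1}"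
  shows "pathin X (subpath_at \<gamma> a b)"
proof -
  have "(1 - t) *\<^sub>R a + t *\<^sub>R b \<in> {0..1}" if "t \<in> {0..1}" for t
    using convexD[OF convex_real_interval(5)[of 0 1] assms(2,3), of "1 - t" t] that by simp
  then have "continuous_map (top_of_set {0..1}) (top_of_set {0..1}) (\<lambda>t. (1 - t) *\<^sub>R a + t *\<^sub>R b)"
    by (auto simp: continuous_map_in_subtopology intro!: continuous_intros)
  from continuous_map_compose[OF this] assms(1) show ?thesis
    unfolding pathin_def subpath_at_def o_def by blast
qed

lemma cocycle_subpath:
  assumes "c \<in> cocycle_set 1 X" "pathin X \<gamma>" "a \<in> {0..1}" "b \<in> {0..1}" "d \<in> {0..1}"
  shows "c (path_simplex (subpath_at \<gamma> a d)) =
    c (path_simplex (subpath_at \<gamma> a b)) + c (path_simplex (subpath_at \<gamma> b d))"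
  unfolding subpath_at_def
  by (rule cocycle_triangle[OF assms(1) convex_real_interval(5) assms(3,4,5) assms(2)[unfolded pathin_def]])

lemma cocycle_reverse:
  assumes c: "c \<in> cocycle_set 1 X" and \<gamma>: "pathin X \<gamma>"
  obtains \<gamma>' where "pathin X \<gamma>'" "\<gamma>' 0 = \<gamma> 1" "\<gamma>' 1 = \<gamma> 0" "c (path_simplex \<gamma>') = - c (path_simplex \<gamma>)"
proof
  have \<gamma>0: "\<gamma> 0 \<in> topspace X" using \<gamma> unfolding pathin_def continuous_map_def by auto
  show "pathin X (subpath_at \<gamma> 1 0)" by (rule pathin_subpath_at[OF \<gamma>]) auto
  show "subpath_at \<gamma> 1 0 0 = \<gamma> 1" "subpath_at \<gamma> 1 0 1 = \<gamma> 0" unfolding subpath_at_def by simp_all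
  have "c (path_simplex (subpath_at \<gamma> 0 0)) =
      c (path_simplex (subpath_at \<gamma> 0 1)) + c (path_simplex (subpath_at \<gamma> 1 0))"
    by (rule cocycle_subpath[OF c \<gamma>]) auto
  then show "c (path_simplex (subpath_at \<gamma> 1 0)) = - c (path_simplex \<gamma>)"
    using cocycle_const[OF c \<gamma>0] by (simp add: subpath_at_def)
qed

lemma cocycle_concat:
  assumes c: "c \<in> cocycle_set 1 X" and \<gamma>: "pathin X \<gamma>" and \<delta>: "pathin X \<delta>" and eq: "\<gamma> 1 = \<delta> 0"
  obtains \<epsilon> where "pathin X \<epsilon>" "\<epsilon> 0 = \<gamma> 0" "\<epsilon> 1 = \<delta> 1"
    "c (path_simplex \<epsilon>) = c (path_simplex \<gamma>) + c (path_simplex \<delta>)"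
proof
  define \<epsilon> where "\<epsilon> = (\<lambda>t. if t \<le> 1/2 then \<gamma> (2 * t) else \<delta> (2 * t - 1))"
  let ?I = "top_of_set {0..1::real}"
  show e: "pathin X \<epsilon>"
    unfolding pathin_def \<epsilon>_def
  proof (rule continuous_map_cases_le)
    have "continuous_map (subtopology ?I {x \<in> topspace ?I. x \<le> 1/2}) ?I (\<lambda>t. 2 * t)"
      by (auto simp: continuous_map_in_subtopology subtopology_subtopology intro!: continuous_intros)
    from continuous_map_compose[OF this \<gamma>[unfolded pathin_def]]
    show "continuous_map (subtopology ?I {x \<in> topspace ?I. x \<le> 1/2}) X (\<lambda>t. \<gamma> (2 * t))" by (simp add: o_def)
    have "continuous_map (subtopology ?I {x \<in> topspace ?I. 1/2 \<le> x}) ?I (\<lambda>t. 2 * t - 1)"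
      by (auto simp: continuous_map_in_subtopology subtopology_subtopology intro!: continuous_intros)
    from continuous_map_compose[OF this \<delta>[unfolded pathin_def]]
    show "continuous_map (subtopology ?I {x \<in> topspace ?I. 1/2 \<le> x}) X (\<lambda>t. \<delta> (2 * t - 1))" by (simp add: o_def)
    show "continuous_map ?I euclideanreal (\<lambda>x. x)" by (simp add: continuous_map_subtopology_eu)
    show "\<gamma> (2 * t) = \<delta> (2 * t - 1)" if "t = 1/2" for t :: real unfolding that by (simp add: eq)
  qed auto
  show "\<epsilon> 0 = \<gamma> 0" "\<epsilon> 1 = \<delta> 1" unfolding \<epsilon>_def by simp_all
  have 1: "path_simplex (subpath_at \<epsilon> 0 1) = path_simplex \<epsilon>" unfolding subpath_at_def by simp
  have 2: "path_simplex (subpath_at \<epsilon> 0 (1/2)) = path_simplex \<gamma>"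
    by (rule path_simplex_cong) (simp add: subpath_at_def \<epsilon>_def)
  have 3: "path_simplex (subpath_at \<epsilon> (1/2) 1) = path_simplex \<delta>"
  proof (rule path_simplex_cong)
    fix t :: real assume t: "0 \<le> t" "t \<le> 1"
    have a: "(1 - t) *\<^sub>R (1/2) + t *\<^sub>R 1 = (1 + t) / 2" by (simp add: field_simps)
    show "subpath_at \<epsilon> (1/2) 1 t = \<delta> t"
    \<comment> \<open>The start of the second half is the midpoint, where the definition of
      \<open>\<epsilon>\<close> still uses \<open>\<gamma>\<close>.\<close>
    proof (cases "t = 0")
      case True
      then show ?thesis unfolding subpath_at_def a unfolding \<epsilon>_def using eq by simp
    next
      case False
      then have "2 * ((1 + t) / 2) - 1 = t" "\<not> (1 + t) / 2 \<le> 1/2" using t by (simp_all add: field_simps)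
      then show ?thesis unfolding subpath_at_def a unfolding \<epsilon>_def by (simp only: if_False)
    qed
  qed
  have "c (path_simplex (subpath_at \<epsilon> 0 1)) =
      c (path_simplex (subpath_at \<epsilon> 0 (1/2))) + c (path_simplex (subpath_at \<epsilon> (1/2) 1))"
    by (rule cocycle_subpath[OF c e]) auto
  then show "c (path_simplex \<epsilon>) = c (path_simplex \<gamma>) + c (path_simplex \<delta>)" unfolding 1 2 3 .
qed

text \<open>The cone from \<open>z\<close> over the path is a map of a square. One side is constant,
  the opposite one is \<open>\<gamma>\<close>, and the other two are the spokes to its ends; the
  triangle rule for the two halves cut out by a diagonal gives the formula. Thus the values on
  spokes are a local primitive of the cocycle, though perhaps a discontinuous one.\<close>

lemma cocycle_chart:
  fixes \<psi> :: "'e::euclidean_space \<Rightarrow> 'a"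
  assumes c: "c \<in> cocycle_set 1 M" and ch: "convex_chart M B \<phi> \<psi> D" and z: "z \<in> D"
    and \<gamma>: "pathin M \<gamma>" "\<And>t. t \<in> {0..1} \<Longrightarrow> \<gamma> t \<in> B"
  shows "c (path_simplex \<gamma>) =
    c (path_simplex (\<lambda>t. \<psi> ((1 - t) *\<^sub>R z + t *\<^sub>R \<phi> (\<gamma> 1)))) - c (path_simplex (\<lambda>t. \<psi> ((1 - t) *\<^sub>R z + t *\<^sub>R \<phi> (\<gamma> 0))))"
proof -
  note C = convex_chartD[OF ch]
  let ?T = "{0..1::real} \<times> {0..1::real}"
  let ?H = "\<lambda>p. (1 - fst p) *\<^sub>R z + fst p *\<^sub>R \<phi> (\<gamma> (snd p))"
  have "continuous_map (top_of_set {0..1}) (subtopology M B) \<gamma>"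
    using \<gamma> by (auto simp: pathin_def continuous_map_in_subtopology)
  from continuous_map_compose[OF this C(9)] have "continuous_on {0..1} (\<lambda>t. \<phi> (\<gamma> t))" by (simp add: o_def)
  then have cs: "continuous_on ?T (\<lambda>p. \<phi> (\<gamma> (snd p)))"
    by (rule continuous_on_compose2) (auto intro!: continuous_intros)
  have "?H p \<in> D" if "p \<in> ?T" for p
    using convexD[OF C(4) z, of "\<phi> (\<gamma> (snd p))" "1 - fst p" "fst p"] that C(5) \<gamma>(2) by auto
  moreover have "continuous_on ?T ?H" by (intro continuous_intros cs)
  ultimately have "continuous_map (top_of_set ?T) (top_of_set D) ?H"
    by (auto simp: continuous_map_in_subtopology)
  from continuous_map_compose[OF this C(10)]
  have h: "continuous_map (top_of_set ?T) M (\<lambda>p. \<psi> (?H p))" by (simp add: o_def)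
  have T: "convex ?T" by (intro convex_Times convex_real_interval)
  have pz: "\<psi> z \<in> topspace M" using C(2,6) z by blast
  have \<psi>\<gamma>: "\<psi> (\<phi> (\<gamma> t)) = \<gamma> t" if "t \<in> {0..1}" for t using C(7) \<gamma>(2) that by blast
  have "c (path_simplex (\<lambda>t. \<psi> (?H ((1 - t) *\<^sub>R (0, 0) + t *\<^sub>R (1, 1))))) =
      c (path_simplex (\<lambda>t. \<psi> (?H ((1 - t) *\<^sub>R (0, 0) + t *\<^sub>R (1, 0))))) +
      c (path_simplex (\<lambda>t. \<psi> (?H ((1 - t) *\<^sub>R (1, 0) + t *\<^sub>R (1, 1)))))"
    by (rule cocycle_triangle[OF c T _ _ _ h]) auto
  moreover have "c (path_simplex (\<lambda>t. \<psi> (?H ((1 - t) *\<^sub>R (0, 0) + t *\<^sub>R (1, 1))))) =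
      c (path_simplex (\<lambda>t. \<psi> (?H ((1 - t) *\<^sub>R (0, 0) + t *\<^sub>R (0, 1))))) +
      c (path_simplex (\<lambda>t. \<psi> (?H ((1 - t) *\<^sub>R (0, 1) + t *\<^sub>R (1, 1)))))"
    by (rule cocycle_triangle[OF c T _ _ _ h]) auto
  moreover have "path_simplex (\<lambda>t. \<psi> (?H ((1 - t) *\<^sub>R (1, 0) + t *\<^sub>R (1, 1)))) = path_simplex \<gamma>"
    by (rule path_simplex_cong) (simp add: \<psi>\<gamma>)
  moreover have "path_simplex (\<lambda>t. \<psi> (?H ((1 - t) *\<^sub>R (0, 0) + t *\<^sub>R (0, 1)))) = path_simplex (\<lambda>_. \<psi> z)"
    by simp
  ultimately show ?thesis using cocycle_const[OF c pz] by simp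
qed

section \<open>Representing a class by a closed form\<close>

lemma continuous_map_locally:
  fixes k :: "'a \<Rightarrow> 'b :: topological_space"
  assumes "V \<subseteq> topspace X"
    and loc: "\<And>x. x \<in> V \<Longrightarrow> \<exists>Q h. openin X Q \<and> x \<in> Q \<and> continuous_map X euclidean h \<and> (\<forall>y\<in>Q \<inter> V. k y = h y)"
  shows "continuous_map (subtopology X V) euclidean k"
  unfolding continuous_map
proof (intro conjI allI impI)
  fix A :: "'b set" assume A: "openin euclidean A"
  show "openin (subtopology X V) {x \<in> topspace (subtopology X V). k x \<in> A}"
  proof (subst openin_subopen, intro ballI)
    fix x assume "x \<in> {x \<in> topspace (subtopology X V). k x \<in> A}"
    then have x: "x \<in> V" "k x \<in> A" by auto
    obtain Q h where Q: "openin X Q" "x \<in> Q" "continuous_map X euclidean h" "\<forall>y\<in>Q \<inter> V. k y = h y"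
      using loc[OF x(1)] by blast
    have "openin X (Q \<inter> {y \<in> topspace X. h y \<in> A})"
      by (rule openin_Int[OF Q(1) openin_continuous_map_preimage[OF Q(3) A]])
    then have "openin (subtopology X V) (V \<inter> (Q \<inter> {y \<in> topspace X. h y \<in> A}))"
      by (rule openin_subtopology_Int2)
    moreover have "x \<in> V \<inter> (Q \<inter> {y \<in> topspace X. h y \<in> A})" using x Q(2,4) assms(1) by auto
    moreover have "V \<inter> (Q \<inter> {y \<in> topspace X. h y \<in> A}) \<subseteq> {x \<in> topspace (subtopology X V). k x \<in> A}"
      using Q(4) by auto
    ultimately show "\<exists>T. openin (subtopology X V) T \<and> x \<in> T \<and> T \<subseteq> {x \<in> topspace (subtopology X V). k x \<in> A}"
      by blast
  qed
qed auto

context closed_manifold begin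

text \<open>Shrinking twice makes each function vanish on a neighbourhood of every point outside
  \<open>V\<close>, not just at the point. They will be multiplied by functions that are
  uncontrolled outside \<open>V\<close>.\<close>

lemma bump_functions:
  assumes "\<And>V. V \<in> \<V> \<Longrightarrow> openin M V" "topspace M \<subseteq> \<Union>\<V>"
  obtains u :: "'a set \<Rightarrow> 'a \<Rightarrow> real" where "\<And>V. continuous_map M euclideanreal (u V)"
    "\<And>V x. x \<in> topspace M \<Longrightarrow> 0 \<le> u V x"
    "\<And>V x. x \<in> topspace M - V \<Longrightarrow> \<exists>Q. openin M Q \<and> x \<in> Q \<and> (\<forall>y\<in>Q. u V y = 0)"
    "\<And>x. x \<in> topspace M \<Longrightarrow> \<exists>V\<in>\<V>. 0 < u V x"
proof -
  obtain v where v: "\<And>V. openin M (v V)" "\<And>V. M closure_of (v V) \<subseteq> V" "topspace M \<subseteq> (\<Union>V\<in>\<V>. v V)"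
    using shrink_finite_cover[OF compact Hausdorff closedin_topspace assms] by blast
  have "openin M V" if "V \<in> v ` \<V>" for V using that v(1) by blast
  from shrink_finite_cover[OF compact Hausdorff closedin_topspace this v(3)]
  obtain w where w: "\<And>V. openin M (w V)" "\<And>V. M closure_of (w V) \<subseteq> V" "topspace M \<subseteq> (\<Union>V\<in>v ` \<V>. w V)"
    by blast
  have "\<exists>f. continuous_map M (top_of_set {0..1::real}) f \<and> f ` (topspace M - v V) \<subseteq> {0} \<and>
      f ` (M closure_of (w (v V))) \<subseteq> {1}" for V
  proof -
    have "closedin M (topspace M - v V)" using v(1) by blast
    moreover have "closedin M (M closure_of (w (v V)))" by simp
    moreover have "disjnt (topspace M - v V) (M closure_of (w (v V)))" using w(2)[of "v V"] unfolding disjnt_def by blast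
    ultimately show ?thesis
      using Urysohn_lemma[OF normal, of "topspace M - v V" "M closure_of (w (v V))" 0 1] by fastforce
  qed
  then obtain u where u: "\<And>V. continuous_map M (top_of_set {0..1::real}) (u V)"
    "\<And>V. u V ` (topspace M - v V) \<subseteq> {0}" "\<And>V. u V ` (M closure_of (w (v V))) \<subseteq> {1}" by metis
  show thesis
  proof (rule that)
    show "continuous_map M euclideanreal (u V)" for V using u(1)[of V] by (simp add: continuous_map_in_subtopology)
    show "0 \<le> u V x" if "x \<in> topspace M" for V x
      using u(1)[of V] that by (auto simp: continuous_map_in_subtopology)
    show "\<exists>Q. openin M Q \<and> x \<in> Q \<and> (\<forall>y\<in>Q. u V y = 0)" if x: "x \<in> topspace M - V" for V x
    proof (intro exI conjI ballI)
      show "openin M (topspace M - M closure_of (v V))" by (rule openin_diff) simp_all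
      show "x \<in> topspace M - M closure_of (v V)" using x v(2) by blast
      fix y assume y: "y \<in> topspace M - M closure_of (v V)"
      then have "y \<in> topspace M - v V" using closure_of_subset[OF openin_subset[OF v(1)]] by blast
      then show "u V y = 0" using u(2)[of V] by blast
    qed
    show "\<exists>V\<in>\<V>. 0 < u V x" if x: "x \<in> topspace M" for x
    proof -
      obtain V where V: "V \<in> \<V>" "x \<in> w (v V)" using w(3) x by blast
      then have "x \<in> M closure_of (w (v V))" using closure_of_subset[OF openin_subset[OF w(1)]] by blast
      then have "u V x = 1" using u(3)[of V] by blast
      then show ?thesis using V(1) by (intro bexI[of _ V]) simp
    qed
  qed
qed

text \<open>Such neighbourhoods turn statements about paths into local constancy.\<close>

lemma path_neighbourhood:
  assumes "openin M W" "x \<in> W"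
  obtains N where "openin M N" "x \<in> N" "N \<subseteq> W"
    "\<And>y z. y \<in> N \<Longrightarrow> z \<in> N \<Longrightarrow> \<exists>\<gamma>. pathin M \<gamma> \<and> \<gamma> 0 = y \<and> \<gamma> 1 = z \<and> \<gamma> ` {0..1} \<subseteq> N"
proof -
  obtain B \<phi> \<psi> and r :: real where B: "convex_chart M B \<phi> \<psi> (ball (\<phi> x) r :: 'e set)" "x \<in> B" "B \<subseteq> W"
    using chart_exists[OF assms] by blast
  note C = convex_chartD[OF B(1)]
  show thesis
  proof (rule that[OF C(1) B(2,3)])
    fix y z assume yz: "y \<in> B" "z \<in> B"
    let ?\<gamma> = "\<lambda>t. \<psi> ((1 - t) *\<^sub>R \<phi> y + t *\<^sub>R \<phi> z)"
    have D: "(1 - t) *\<^sub>R \<phi> y + t *\<^sub>R \<phi> z \<in> ball (\<phi> x) r" if "t \<in> {0..1}" for t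
      using convexD[OF C(4) C(5)[OF yz(1)] C(5)[OF yz(2)], of "1 - t" t] that by simp
    then have "continuous_map (top_of_set {0..1}) (top_of_set (ball (\<phi> x) r)) (\<lambda>t. (1 - t) *\<^sub>R \<phi> y + t *\<^sub>R \<phi> z)"
      by (auto simp: continuous_map_in_subtopology intro!: continuous_intros)
    from continuous_map_compose[OF this C(10)] have "pathin M ?\<gamma>" by (simp add: pathin_def o_def)
    moreover have "?\<gamma> 0 = y" "?\<gamma> 1 = z" using C(7) yz by simp_all
    moreover have "?\<gamma> ` {0..1} \<subseteq> B" using C(6) D by blast
    ultimately show "\<exists>\<gamma>. pathin M \<gamma> \<and> \<gamma> 0 = y \<and> \<gamma> 1 = z \<and> \<gamma> ` {0..1} \<subseteq> B" by blast
  qed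
qed

lemma path_connected:
  assumes x: "x \<in> topspace M" and y: "y \<in> topspace M"
  shows "\<exists>\<gamma>. pathin M \<gamma> \<and> \<gamma> 0 = x \<and> \<gamma> 1 = y"
proof -
  let ?R = "{y \<in> topspace M. path_component_of M x y}"
  have "?R = topspace M"
  proof (rule connected_spread)
    have "path_component_of M x x" using x by (simp add: path_component_of_refl)
    then show "?R \<noteq> {}" using x by blast
    fix z assume z: "z \<in> topspace M"
    obtain N where N: "openin M N" "z \<in> N" "N \<subseteq> topspace M"
      "\<And>y z. y \<in> N \<Longrightarrow> z \<in> N \<Longrightarrow> \<exists>\<gamma>. pathin M \<gamma> \<and> \<gamma> 0 = y \<and> \<gamma> 1 = z \<and> \<gamma> ` {0..1} \<subseteq> N"
      using path_neighbourhood[OF openin_topspace z] by blast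
    have "N \<subseteq> ?R" if ne: "N \<inter> ?R \<noteq> {}"
    proof
      fix v assume v: "v \<in> N"
      obtain y where y: "y \<in> N" "path_component_of M x y" using ne by blast
      have "path_component_of M y v" using N(4)[OF y(1) v] unfolding path_component_of_def by blast
      then have "path_component_of M x v" using y(2) path_component_of_trans by metis
      then show "v \<in> ?R" using v N(3) by blast
    qed
    then show "\<exists>N. openin M N \<and> z \<in> N \<and> (N \<inter> ?R \<noteq> {} \<longrightarrow> N \<subseteq> ?R)" using N(1,2) by blast
  qed blast
  then have "path_component_of M x y" using y by blast
  then show ?thesis unfolding path_component_of_def .
qed

text \<open>On a chart the values on the spokes from its centre serve, by
  \<open>cocycle_chart\<close>. Finitely many charts are kept so that averages can be
  formed.\<close>

lemma cocycle_local_primitives: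
  assumes c: "c \<in> cocycle_set 1 M"
  obtains \<V> s where "finite \<V>" "\<And>V. V \<in> \<V> \<Longrightarrow> openin M V" "topspace M \<subseteq> \<Union>\<V>"
    "\<And>V \<gamma>. V \<in> \<V> \<Longrightarrow> pathin M \<gamma> \<Longrightarrow> \<gamma> ` {0..1} \<subseteq> V \<Longrightarrow> c (path_simplex \<gamma>) = s V (\<gamma> 1) - s V (\<gamma> 0)"
proof -
  define nice where "nice = (\<lambda>V. openin M V \<and> (\<exists>s. \<forall>\<gamma>. pathin M \<gamma> \<longrightarrow> \<gamma> ` {0..1} \<subseteq> V \<longrightarrow>
      c (path_simplex \<gamma>) = s (\<gamma> 1) - s (\<gamma> 0)))"
  have "\<exists>V. nice V \<and> x \<in> V" if x: "x \<in> topspace M" for x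
  proof -
    obtain B \<phi> \<psi> and r :: real where B: "convex_chart M B \<phi> \<psi> (ball (\<phi> x) r :: 'e set)" "x \<in> B"
      using chart_exists[OF openin_topspace x] by blast
    let ?s = "\<lambda>y. c (path_simplex (\<lambda>t. \<psi> ((1 - t) *\<^sub>R \<phi> x + t *\<^sub>R \<phi> y)))"
    have "c (path_simplex \<gamma>) = ?s (\<gamma> 1) - ?s (\<gamma> 0)" if "pathin M \<gamma>" "\<gamma> ` {0..1} \<subseteq> B" for \<gamma>
      by (rule cocycle_chart[OF c B(1) convex_chartD(5)[OF B] that(1)]) (use that(2) in blast)
    then have "nice B"
      unfolding nice_def using convex_chartD(1)[OF B(1)] by (intro conjI exI[of _ ?s] allI impI)
    then show ?thesis using B(2) by blast
  qed
  then have "topspace M \<subseteq> \<Union>(Collect nice)" by blast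
  moreover have "compactin M (topspace M)" using compact by (simp add: compact_space_def)
  moreover have "\<forall>V\<in>Collect nice. openin M V" unfolding nice_def by blast
  ultimately obtain \<V> where V: "finite \<V>" "\<V> \<subseteq> Collect nice" "topspace M \<subseteq> \<Union>\<V>"
    unfolding compactin_def by metis
  have "\<exists>s. \<forall>\<gamma>. pathin M \<gamma> \<longrightarrow> \<gamma> ` {0..1} \<subseteq> V \<longrightarrow> c (path_simplex \<gamma>) = s (\<gamma> 1) - s (\<gamma> 0)" if "V \<in> \<V>" for V
    using V(2) that unfolding nice_def by blast
  then obtain s where s: "\<And>V. V \<in> \<V> \<Longrightarrow> \<forall>\<gamma>. pathin M \<gamma> \<longrightarrow> \<gamma> ` {0..1} \<subseteq> V \<longrightarrow>
      c (path_simplex \<gamma>) = s V (\<gamma> 1) - s V (\<gamma> 0)" by metis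
  show thesis
  proof (rule that[OF V(1) _ V(3)])
    show "openin M V" if "V \<in> \<V>" for V using V(2) that unfolding nice_def by blast
    show "c (path_simplex \<gamma>) = s V (\<gamma> 1) - s V (\<gamma> 0)" if "V \<in> \<V>" "pathin M \<gamma>" "\<gamma> ` {0..1} \<subseteq> V" for V \<gamma>
      using s[OF that(1)] that(2,3) by blast
  qed
qed

text \<open>The local primitives of a cocycle need not be continuous. Subtracting from all of them the
  same average makes them so, because their differences are locally constant.\<close>

lemma cocycle_form:
  assumes c: "c \<in> cocycle_set 1 M"
  obtains \<omega> where "closed_one_form M \<omega>"
    "\<And>\<gamma>. pathin M \<gamma> \<Longrightarrow> \<gamma> 0 = \<gamma> 1 \<Longrightarrow> form_integral \<omega> \<gamma> = c (path_simplex \<gamma>)"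
proof -
  obtain \<V> s where V: "finite \<V>" "\<And>V. V \<in> \<V> \<Longrightarrow> openin M V" "topspace M \<subseteq> \<Union>\<V>"
    and s: "\<And>V \<gamma>. V \<in> \<V> \<Longrightarrow> pathin M \<gamma> \<Longrightarrow> \<gamma> ` {0..1} \<subseteq> V \<Longrightarrow> c (path_simplex \<gamma>) = s V (\<gamma> 1) - s V (\<gamma> 0)"
    using cocycle_local_primitives[OF c] by blast
  obtain u where u: "\<And>V. continuous_map M euclideanreal (u V)" "\<And>V x. x \<in> topspace M \<Longrightarrow> 0 \<le> u V x"
    "\<And>V x. x \<in> topspace M - V \<Longrightarrow> \<exists>Q. openin M Q \<and> x \<in> Q \<and> (\<forall>y\<in>Q. u V y = 0)"
    "\<And>x. x \<in> topspace M \<Longrightarrow> \<exists>V\<in>\<V>. 0 < u V x"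
    using bump_functions[OF V(2,3)] by blast
  have Vsub: "V \<subseteq> topspace M" if "V \<in> \<V>" for V using openin_subset[OF V(2)[OF that]] .
  define U where "U = (\<lambda>x. \<Sum>W\<in>\<V>. u W x)"
  have U: "0 < U x" if x: "x \<in> topspace M" for x
  proof -
    obtain W where "W \<in> \<V>" "0 < u W x" using u(4)[OF x] by blast
    then show ?thesis unfolding U_def using V(1) u(2)[OF x] by (intro sum_pos2)
  qed
  \<comment> \<open>The average of the local primitives, weighted by the bump functions;
    \<open>s W\<close> has arbitrary values off \<open>W\<close>, where its weight is 0.\<close>
  define g where "g = (\<lambda>x. (\<Sum>W\<in>\<V>. u W x * s W x) / U x)"
  define f where "f = (\<lambda>V x. s V x - g x)"
  define \<omega> where "\<omega> = (\<lambda>V. (V, f V)) ` \<V>"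
  have near: "\<exists>N. openin M N \<and> x \<in> N \<and> N \<subseteq> V \<inter> W \<and> (\<forall>y\<in>N. s V y - s W y = s V x - s W x)"
    if VW: "V \<in> \<V>" "W \<in> \<V>" and x: "x \<in> V \<inter> W" for V W x
  proof -
    obtain N where N: "openin M N" "x \<in> N" "N \<subseteq> V \<inter> W"
      "\<And>y z. y \<in> N \<Longrightarrow> z \<in> N \<Longrightarrow> \<exists>\<gamma>. pathin M \<gamma> \<and> \<gamma> 0 = y \<and> \<gamma> 1 = z \<and> \<gamma> ` {0..1} \<subseteq> N"
      using path_neighbourhood[OF openin_Int[OF V(2)[OF VW(1)] V(2)[OF VW(2)]] x] by blast
    have "s V y - s W y = s V x - s W x" if y: "y \<in> N" for y
    proof -
      obtain \<gamma> where \<gamma>: "pathin M \<gamma>" "\<gamma> 0 = x" "\<gamma> 1 = y" "\<gamma> ` {0..1} \<subseteq> N" using N(4)[OF N(2) y] by blast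
      then have "\<gamma> ` {0..1} \<subseteq> V" "\<gamma> ` {0..1} \<subseteq> W" using N(3) by blast+
      then show ?thesis using s[OF VW(1) \<gamma>(1)] s[OF VW(2) \<gamma>(1)] \<gamma>(2,3) by simp
    qed
    then show ?thesis using N(1-3) by blast
  qed
  have cont: "continuous_map (subtopology M V) euclideanreal (f V)" if VV: "V \<in> \<V>" for V
  proof -
    \<comment> \<open>After subtraction of the average, \<open>f V\<close> is a weighted mean of the
      differences \<open>s V - s W\<close>. Near a point of \<open>W\<close> the difference is
      constant, near a point outside \<open>W\<close> the weight vanishes.\<close>
    have term_cont: "continuous_map (subtopology M V) euclideanreal (\<lambda>x. u W x * (s V x - s W x))" if W: "W \<in> \<V>" for W
    proof (rule continuous_map_locally[OF Vsub[OF VV]])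
      fix x assume x: "x \<in> V"
      show "\<exists>Q h. openin M Q \<and> x \<in> Q \<and> continuous_map M euclideanreal h \<and>
          (\<forall>y\<in>Q \<inter> V. u W y * (s V y - s W y) = h y)"
      proof (cases "x \<in> W")
        case True
        then obtain N where N: "openin M N" "x \<in> N" "\<forall>y\<in>N. s V y - s W y = s V x - s W x"
          using near[OF VV W, of x] x by blast
        have "continuous_map M euclideanreal (\<lambda>y. u W y * (s V x - s W x))"
          by (intro continuous_map_real_mult u(1)) simp
        then show ?thesis
          using N(1,2) by (intro exI[of _ N] exI[of _ "\<lambda>y. u W y * (s V x - s W x)"] conjI ballI)
            (assumption, assumption, assumption, rule arg_cong[of _ _ "(*) (u W _)"], rule bspec[OF N(3)], simp)
      next
        case False
        then obtain Q where "openin M Q" "x \<in> Q" "\<forall>y\<in>Q. u W y = 0"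
          using u(3)[of x W] x Vsub[OF VV] by blast
        then show ?thesis by (intro exI[of _ Q] exI[of _ "\<lambda>_. 0"]) simp
      qed
    qed
    have uc: "continuous_map (subtopology M V) euclideanreal (u W)" for W
      by (rule continuous_map_from_subtopology[OF u(1)])
    have "continuous_map (subtopology M V) euclideanreal (\<lambda>x. (\<Sum>W\<in>\<V>. u W x * (s V x - s W x)) / U x)"
      unfolding U_def
    proof (rule continuous_map_real_divide)
      show "continuous_map (subtopology M V) euclideanreal (\<lambda>x. \<Sum>W\<in>\<V>. u W x * (s V x - s W x))"
        by (rule continuous_map_sum[OF V(1) term_cont])
      show "continuous_map (subtopology M V) euclideanreal (\<lambda>x. \<Sum>W\<in>\<V>. u W x)"
        by (rule continuous_map_sum[OF V(1) uc])
      show "(\<Sum>W\<in>\<V>. u W x) \<noteq> 0" if "x \<in> topspace (subtopology M V)" for x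
        using U[of x] that unfolding U_def by simp
    qed
    then show ?thesis
    proof (rule continuous_map_eq)
      fix x assume "x \<in> topspace (subtopology M V)"
      then have "U x \<noteq> 0" using U[of x] by simp
      have "(\<Sum>W\<in>\<V>. u W x * (s V x - s W x)) = U x * s V x - (\<Sum>W\<in>\<V>. u W x * s W x)"
        unfolding U_def by (simp add: right_diff_distrib sum_subtractf sum_distrib_right)
      then show "(\<Sum>W\<in>\<V>. u W x * (s V x - s W x)) / U x = f V x"
        unfolding f_def g_def using \<open>U x \<noteq> 0\<close> by (simp add: diff_divide_distrib)
    qed
  qed
  have om: "closed_one_form M \<omega>"
    unfolding closed_one_form_def
  proof (intro conjI ballI)
    fix p assume "p \<in> \<omega>"
    then obtain V where V': "V \<in> \<V>" "p = (V, f V)" unfolding \<omega>_def by blast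
    show "case p of (U, f) \<Rightarrow> openin M U \<and> continuous_map (subtopology M U) euclideanreal f"
      unfolding V'(2) prod.case using V(2)[OF V'(1)] cont[OF V'(1)] by blast
    have "case p' of (W, g) \<Rightarrow> \<forall>x\<in>V \<inter> W.
        \<exists>Q. openin M Q \<and> x \<in> Q \<and> Q \<subseteq> V \<inter> W \<and> (\<forall>y\<in>Q. f V y - g y = f V x - g x)"
      if "p' \<in> \<omega>" for p'
    proof -
      obtain W where W: "W \<in> \<V>" "p' = (W, f W)" using \<open>p' \<in> \<omega>\<close> unfolding \<omega>_def by blast
      show ?thesis unfolding W(2) prod.case f_def using near[OF V'(1) W(1)] by simp
    qed
    then show "case p of (U, f) \<Rightarrow> \<forall>(V, g)\<in>\<omega>. \<forall>x\<in>U \<inter> V.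
        \<exists>W. openin M W \<and> x \<in> W \<and> W \<subseteq> U \<inter> V \<and> (\<forall>y\<in>W. f y - g y = f x - g x)"
      unfolding V'(2) prod.case by (rule ballI)
  next
    show "(\<Union>(U, f)\<in>\<omega>. U) = topspace M" unfolding \<omega>_def using V(3) Vsub by auto
  qed
  have "form_integral \<omega> \<gamma> = c (path_simplex \<gamma>)" if \<gamma>: "pathin M \<gamma>" "\<gamma> 0 = \<gamma> 1" for \<gamma>
  proof -
    \<comment> \<open>The cocycle on initial pieces of \<open>\<gamma>\<close>, corrected by the
      average. Along a loop the correction cancels, and the integral is the value of the
      cocycle.\<close>
    define F where "F = (\<lambda>t. c (path_simplex (subpath_at \<gamma> 0 t)) - g (\<gamma> t))"
    have \<gamma>M: "\<gamma> t \<in> topspace M" if "t \<in> {0..1}" for t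
      using \<gamma>(1) that unfolding pathin_def continuous_map_def by auto
    have "primitive_on \<omega> \<gamma> {0..1} F"
    proof (rule primitive_onI[OF om \<gamma>(1)[unfolded pathin_def]])
      fix t0 :: real assume t0: "t0 \<in> {0..1}"
      obtain V where V': "V \<in> \<V>" "\<gamma> t0 \<in> V" using V(3) \<gamma>M[OF t0] by blast
      from continuous_map_eventually_in[OF \<gamma>(1)[unfolded pathin_def] V(2)[OF V'(1)] t0 V'(2)]
      obtain \<delta> where \<delta>: "0 < \<delta>" "\<And>t. t \<in> {0..1} \<Longrightarrow> t \<noteq> t0 \<Longrightarrow> dist t t0 < \<delta> \<Longrightarrow> \<gamma> t \<in> V"
        unfolding eventually_at by blast
      have inV: "\<gamma> t \<in> V" if "t \<in> {0..1} \<inter> ball t0 \<delta>" for t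
        using \<delta>(2)[of t] V'(2) that by (cases "t = t0") (auto simp: dist_commute)
      have cv: "convex ({0..1} \<inter> ball t0 \<delta>)" by (intro convex_Int convex_real_interval convex_ball)
      have "F t - F t0 = f V (\<gamma> t) - f V (\<gamma> t0)" if t: "t \<in> {0..1}" "dist t t0 < \<delta>" for t
      proof -
        have ends: "t0 \<in> {0..1} \<inter> ball t0 \<delta>" "t \<in> {0..1} \<inter> ball t0 \<delta>"
          using t t0 \<delta>(1) by (auto simp: dist_commute)
        have "subpath_at \<gamma> t0 t ` {0..1} \<subseteq> V"
        proof
          fix y assume "y \<in> subpath_at \<gamma> t0 t ` {0..1}"
          then obtain r where r: "0 \<le> r" "r \<le> 1" "y = \<gamma> ((1 - r) *\<^sub>R t0 + r *\<^sub>R t)"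
            unfolding subpath_at_def by auto
          then have "(1 - r) *\<^sub>R t0 + r *\<^sub>R t \<in> {0..1} \<inter> ball t0 \<delta>"
            by (intro convexD[OF cv ends]) auto
          then show "y \<in> V" unfolding r(3) by (rule inV)
        qed
        from s[OF V'(1) pathin_subpath_at[OF \<gamma>(1) t0 t(1)] this]
        have "c (path_simplex (subpath_at \<gamma> t0 t)) = s V (\<gamma> t) - s V (\<gamma> t0)"
          unfolding subpath_at_def by simp
        moreover have "c (path_simplex (subpath_at \<gamma> 0 t)) =
            c (path_simplex (subpath_at \<gamma> 0 t0)) + c (path_simplex (subpath_at \<gamma> t0 t))"
          by (rule cocycle_subpath[OF c \<gamma>(1) _ t0 t(1)]) simp
        ultimately show ?thesis unfolding F_def f_def by simp
      qed
      then have "\<forall>\<^sub>F t in at t0 within {0..1}. F t - F t0 = f V (\<gamma> t) - f V (\<gamma> t0)"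
        unfolding eventually_at using \<delta>(1) by blast
      moreover have "(V, f V) \<in> \<omega>" unfolding \<omega>_def using V'(1) by blast
      ultimately show "\<exists>(U, f)\<in>\<omega>. \<gamma> t0 \<in> U \<and> (\<forall>\<^sub>F t in at t0 within {0..1}. F t - F t0 = f (\<gamma> t) - f (\<gamma> t0))"
        using V'(2) by (intro bexI[of _ "(V, f V)"]) simp_all
    qed
    from form_integral_primitive[OF om \<gamma>(1) this]
    have "form_integral \<omega> \<gamma> = c (path_simplex (subpath_at \<gamma> 0 1)) - c (path_simplex (subpath_at \<gamma> 0 0))"
      unfolding F_def using \<gamma>(2) by simp
    moreover have "subpath_at \<gamma> 0 1 = \<gamma>" "subpath_at \<gamma> 0 0 = (\<lambda>_. \<gamma> 0)" unfolding subpath_at_def by simp_all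
    ultimately show ?thesis using cocycle_const[OF c \<gamma>M[of 0]] by simp
  qed
  then show thesis using that om by blast
qed

text \<open>As the values on loops vanish, the value on a path depends on its ends only; integration
  from a base point gives a potential \<open>B\<close>, whose coboundary is the cocycle.\<close>

lemma exact_cocycle:
  assumes c: "c \<in> cocycle_set 1 M"
    and z: "\<And>\<gamma>. pathin M \<gamma> \<Longrightarrow> \<gamma> 0 = \<gamma> 1 \<Longrightarrow> c (path_simplex \<gamma>) = 0"
  shows "c \<in> coboundary_set 1 M"
proof -
  define x0 where "x0 = (SOME x. x \<in> topspace M)"
  have x0: "x0 \<in> topspace M" if "x \<in> topspace M" for x unfolding x0_def using that by (rule someI)
  define v where "v = (\<lambda>x r. \<exists>\<gamma>. pathin M \<gamma> \<and> \<gamma> 0 = x0 \<and> \<gamma> 1 = x \<and> c (path_simplex \<gamma>) = r)"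
  have uniq: "r = r'" if r: "v x r" "v x r'" for x r r'
  proof -
    obtain \<gamma> where \<gamma>: "pathin M \<gamma>" "\<gamma> 0 = x0" "\<gamma> 1 = x" "c (path_simplex \<gamma>) = r" using r(1) unfolding v_def by blast
    obtain \<gamma>' where \<gamma>': "pathin M \<gamma>'" "\<gamma>' 0 = x0" "\<gamma>' 1 = x" "c (path_simplex \<gamma>') = r'" using r(2) unfolding v_def by blast
    obtain \<delta> where \<delta>: "pathin M \<delta>" "\<delta> 0 = x" "\<delta> 1 = x0" "c (path_simplex \<delta>) = - r'"
      using cocycle_reverse[OF c \<gamma>'(1)] \<gamma>'(2-4) by metis
    obtain \<epsilon> where "pathin M \<epsilon>" "\<epsilon> 0 = x0" "\<epsilon> 1 = x0" "c (path_simplex \<epsilon>) = r + - r'"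
      using cocycle_concat[OF c \<gamma>(1) \<delta>(1)] \<gamma>(2-4) \<delta>(2-4) by metis
    then show ?thesis using z[of \<epsilon>] by simp
  qed
  define B where "B = (\<lambda>x. SOME r. v x r)"
  have vB: "v x (B x)" if x: "x \<in> topspace M" for x
  proof -
    obtain \<gamma> where "pathin M \<gamma>" "\<gamma> 0 = x0" "\<gamma> 1 = x" using path_connected[OF x0[OF x] x] by blast
    then have "v x (c (path_simplex \<gamma>))" unfolding v_def by blast
    then show ?thesis unfolding B_def by (rule someI)
  qed
  have path: "c (path_simplex \<gamma>) = B (\<gamma> 1) - B (\<gamma> 0)" if \<gamma>: "pathin M \<gamma>" for \<gamma>
  proof -
    have ends: "\<gamma> 0 \<in> topspace M" "\<gamma> 1 \<in> topspace M" using \<gamma> unfolding pathin_def continuous_map_def by auto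
    obtain \<delta> where \<delta>: "pathin M \<delta>" "\<delta> 0 = x0" "\<delta> 1 = \<gamma> 0" "c (path_simplex \<delta>) = B (\<gamma> 0)"
      using vB[OF ends(1)] unfolding v_def by blast
    obtain \<epsilon> where "pathin M \<epsilon>" "\<epsilon> 0 = x0" "\<epsilon> 1 = \<gamma> 1" "c (path_simplex \<epsilon>) = B (\<gamma> 0) + c (path_simplex \<gamma>)"
      using cocycle_concat[OF c \<delta>(1) \<gamma> \<delta>(3)] \<delta>(2,4) by metis
    then have "v (\<gamma> 1) (B (\<gamma> 0) + c (path_simplex \<gamma>))" unfolding v_def by blast
    then show ?thesis using uniq[OF vB[OF ends(2)]] by fastforce
  qed
  define e0 where "e0 = (\<lambda>j :: nat. if j = 0 then 1 else 0 :: real)"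
  \<comment> \<open>A singular 0-simplex is determined by its value at \<open>e0\<close>, the only
    point of the standard 0-simplex.\<close>
  define b where "b = (\<lambda>\<tau>. if singular_simplex 0 M \<tau> then B (\<tau> e0) else 0)"
  have e0: "standard_simplex 0 = {e0}" unfolding standard_simplex_0 e0_def by simp
  have vert: "b (restrict (\<lambda>_. x) (standard_simplex 0)) = B x" if "x \<in> topspace M" for x
  proof -
    have "singular_simplex 0 M (restrict (\<lambda>_. x) (standard_simplex 0))"
      unfolding singular_simplex_def
      by (auto intro!: continuous_map_eq[of _ _ "\<lambda>_. x"] simp: that topspace_standard_simplex)
    then show ?thesis unfolding b_def by (simp add: e0)
  qed
  have "coboundary 1 M b \<sigma> = c \<sigma>" for \<sigma>
  proof (cases "singular_simplex 1 M \<sigma>")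
    case True
    define \<gamma> where "\<gamma> = (\<lambda>t. \<sigma> (edge_path t))"
    have \<gamma>: "pathin M \<gamma>" "\<sigma> = path_simplex \<gamma>" unfolding \<gamma>_def by (rule singular_simplex_1_path[OF True])+
    have ends: "\<gamma> 0 \<in> topspace M" "\<gamma> 1 \<in> topspace M" using \<gamma>(1) unfolding pathin_def continuous_map_def by auto
    show ?thesis unfolding \<gamma>(2) coboundary_path[OF \<gamma>(1)] vert[OF ends(1)] vert[OF ends(2)] path[OF \<gamma>(1)] ..
  next
    case False
    then show ?thesis using c unfolding coboundary_def cocycle_set_def cochain_group_def by simp
  qed
  then have "c = coboundary 1 M b" by (intro ext) simp
  moreover have "b \<in> carrier (cochain_group (1 - 1) M)" unfolding cochain_group_def b_def by simp
  ultimately show ?thesis unfolding coboundary_set_def by blast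
qed

end

section \<open>Cohomology classes as cosets of cocycles\<close>

lemma group_cochain_group: "group (cochain_group p X)"
proof (rule groupI)
  fix c assume "c \<in> carrier (cochain_group p X)"
  then show "\<exists>d\<in>carrier (cochain_group p X). d \<otimes>\<^bsub>cochain_group p X\<^esub> c = \<one>\<^bsub>cochain_group p X\<^esub>"
    by (intro bexI[of _ "\<lambda>\<sigma>. - c \<sigma>"]) (auto simp: cochain_group_def)
qed (auto simp: cochain_group_def add.assoc)

lemma coboundary_add: "coboundary p X (\<lambda>\<sigma>. c \<sigma> + d \<sigma>) = (\<lambda>\<sigma>. coboundary p X c \<sigma> + coboundary p X d \<sigma>)"
  unfolding coboundary_def by (auto simp: cochain_eval_fun_add)

lemma coboundary_minus: "coboundary p X (\<lambda>\<sigma>. - c \<sigma>) = (\<lambda>\<sigma>. - coboundary p X c \<sigma>)"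
  unfolding coboundary_def by (auto simp: cochain_eval_fun_minus)

lemma coboundary_zero: "coboundary p X (\<lambda>\<sigma>. 0) = (\<lambda>\<sigma>. 0)"
  unfolding coboundary_def cochain_eval_def by auto

lemma cochain_inv:
  assumes "c \<in> carrier (cochain_group p X)"
  shows "inv\<^bsub>cochain_group p X\<^esub> c = (\<lambda>\<sigma>. - c \<sigma>)"
  by (rule group.inv_equality[OF group_cochain_group]) (use assms in \<open>auto simp: cochain_group_def\<close>)

lemma subgroup_cocycle_set: "subgroup (cocycle_set p X) (cochain_group p X)"
proof
  show "cocycle_set p X \<subseteq> carrier (cochain_group p X)" unfolding cocycle_set_def by blast
  fix c assume c: "c \<in> cocycle_set p X"
  then show "inv\<^bsub>cochain_group p X\<^esub> c \<in> cocycle_set p X"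
    by (simp add: cochain_inv cocycle_set_def coboundary_minus) (simp add: cochain_group_def)
  fix d assume "d \<in> cocycle_set p X"
  with c show "c \<otimes>\<^bsub>cochain_group p X\<^esub> d \<in> cocycle_set p X"
    by (simp add: cocycle_set_def cochain_group_def coboundary_add)
qed (simp add: cocycle_set_def cochain_group_def coboundary_zero)

text \<open>The coset in the factor group is made explicit, in the form in which a class is
  evaluated on loops.\<close>

lemma cohomology_class:
  assumes "\<xi> \<in> carrier (real_cohomology_group p X)"
  obtains c where "c \<in> cocycle_set p X" "\<xi> = (\<lambda>b \<sigma>. b \<sigma> + c \<sigma>) ` coboundary_set p X"
proof -
  let ?G = "subgroup_generated (cochain_group p X) (cocycle_set p X)"
  obtain c where "c \<in> carrier ?G" "\<xi> = coboundary_set p X #>\<^bsub>?G\<^esub> c"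
    using assms unfolding real_cohomology_group_def FactGroup_def RCOSETS_def by auto
  moreover have "carrier ?G = cocycle_set p X"
    by (rule subgroup.carrier_subgroup_generated_subgroup[OF subgroup_cocycle_set])
  moreover have "coboundary_set p X #>\<^bsub>?G\<^esub> c = (\<lambda>b \<sigma>. b \<sigma> + c \<sigma>) ` coboundary_set p X"
    unfolding r_coset_def by (auto simp: cochain_group_def subgroup_generated_def)
  ultimately show thesis using that by blast
qed

lemma cohomology_class_trivial:
  assumes "c \<in> coboundary_set p X"
  shows "(\<lambda>b \<sigma>. b \<sigma> + c \<sigma>) ` coboundary_set p X = \<one>\<^bsub>real_cohomology_group p X\<^esub>"
proof -
  obtain b0 where b0: "b0 \<in> carrier (cochain_group (p - 1) X)" "c = coboundary p X b0"
    using assms unfolding coboundary_set_def by blast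
  have "(\<lambda>b \<sigma>. b \<sigma> + c \<sigma>) ` coboundary_set p X = coboundary_set p X"
  proof (intro equalityI subsetI)
    fix d assume "d \<in> (\<lambda>b \<sigma>. b \<sigma> + c \<sigma>) ` coboundary_set p X"
    then obtain b where b: "b \<in> carrier (cochain_group (p - 1) X)" "d = (\<lambda>\<sigma>. coboundary p X b \<sigma> + c \<sigma>)"
      unfolding coboundary_set_def by blast
    then have "d = coboundary p X (\<lambda>\<sigma>. b \<sigma> + b0 \<sigma>)" by (simp add: coboundary_add b0(2))
    moreover have "(\<lambda>\<sigma>. b \<sigma> + b0 \<sigma>) \<in> carrier (cochain_group (p - 1) X)"
      using b(1) b0(1) unfolding cochain_group_def by simp
    ultimately show "d \<in> coboundary_set p X" unfolding coboundary_set_def by blast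
  next
    fix d assume "d \<in> coboundary_set p X"
    then obtain b where b: "b \<in> carrier (cochain_group (p - 1) X)" "d = coboundary p X b"
      unfolding coboundary_set_def by blast
    have "(\<lambda>\<sigma>. b \<sigma> + - b0 \<sigma>) \<in> carrier (cochain_group (p - 1) X)"
      using b(1) b0(1) unfolding cochain_group_def by simp
    then have "coboundary p X (\<lambda>\<sigma>. b \<sigma> + - b0 \<sigma>) \<in> coboundary_set p X" unfolding coboundary_set_def by blast
    moreover have "d = (\<lambda>\<sigma>. coboundary p X (\<lambda>\<sigma>. b \<sigma> + - b0 \<sigma>) \<sigma> + c \<sigma>)"
      unfolding b(2) b0(2) coboundary_add coboundary_minus by simp
    ultimately show "d \<in> (\<lambda>b \<sigma>. b \<sigma> + c \<sigma>) ` coboundary_set p X" by blast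
  qed
  then show ?thesis unfolding real_cohomology_group_def FactGroup_def by simp
qed

context closed_manifold begin

text \<open>A coboundary vanishes on loops, so all cocycles in the coset have the periods of the
  chosen one.\<close>

lemma form_represents_exists:
  assumes \<xi>: "\<xi> \<in> carrier (real_cohomology_group 1 M)"
  shows "\<exists>\<omega>. form_represents M \<omega> \<xi>"
proof -
  obtain c where c: "c \<in> cocycle_set 1 M" "\<xi> = (\<lambda>b \<sigma>. b \<sigma> + c \<sigma>) ` coboundary_set 1 M"
    using cohomology_class[OF \<xi>] by blast
  obtain \<omega> where om: "closed_one_form M \<omega>"
    "\<And>\<gamma>. pathin M \<gamma> \<Longrightarrow> \<gamma> 0 = \<gamma> 1 \<Longrightarrow> form_integral \<omega> \<gamma> = c (path_simplex \<gamma>)"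
    using cocycle_form[OF c(1)] by blast
  have "c' (path_simplex \<gamma>) = form_integral \<omega> \<gamma>" if \<gamma>: "pathin M \<gamma>" "\<gamma> 0 = \<gamma> 1" and c': "c' \<in> \<xi>" for \<gamma> c'
  proof -
    obtain b where "c' = (\<lambda>\<sigma>. coboundary 1 M b \<sigma> + c \<sigma>)" using c' unfolding c(2) coboundary_set_def by blast
    then show ?thesis using coboundary_path[OF \<gamma>(1), of b] \<gamma>(2) om(2)[OF \<gamma>] by simp
  qed
  then show ?thesis unfolding form_represents_def using om(1) \<xi> by blast
qed

text \<open>A cocycle in a non-zero class is not a coboundary, so by \<open>exact_cocycle\<close>
  some loop has non-zero integral; if it is positive, the reversed loop is taken.\<close>

lemma negative_loop:
  assumes \<xi>: "\<xi> \<in> carrier (real_cohomology_group 1 M)" "\<xi> \<noteq> \<one>\<^bsub>real_cohomology_group 1 M\<^esub>"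
    and rep: "form_represents M \<omega> \<xi>"
  obtains \<gamma> where "pathin M \<gamma>" "\<gamma> 0 = \<gamma> 1" "form_integral \<omega> \<gamma> < 0"
proof -
  obtain c where c: "c \<in> cocycle_set 1 M" "\<xi> = (\<lambda>b \<sigma>. b \<sigma> + c \<sigma>) ` coboundary_set 1 M"
    using cohomology_class[OF \<xi>(1)] by blast
  have "(\<lambda>\<sigma>. 0) \<in> coboundary_set 1 M"
    unfolding coboundary_set_def by (rule image_eqI[of _ _ "\<lambda>\<sigma>. 0"]) (simp_all add: coboundary_zero cochain_group_def)
  then have "c \<in> \<xi>" unfolding c(2) by force
  then have int: "form_integral \<omega> \<gamma> = c (path_simplex \<gamma>)" if "pathin M \<gamma>" "\<gamma> 0 = \<gamma> 1" for \<gamma>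
    using rep that unfolding form_represents_def by metis
  have "c \<notin> coboundary_set 1 M" using \<xi>(2) cohomology_class_trivial c(2) by blast
  then obtain \<gamma> where \<gamma>: "pathin M \<gamma>" "\<gamma> 0 = \<gamma> 1" "c (path_simplex \<gamma>) \<noteq> 0" using exact_cocycle[OF c(1)] by blast
  show thesis
  proof (cases "c (path_simplex \<gamma>) < 0")
    case True
    then show thesis using that \<gamma>(1,2) int by simp
  next
    case False
    obtain \<gamma>' where "pathin M \<gamma>'" "\<gamma>' 0 = \<gamma> 1" "\<gamma>' 1 = \<gamma> 0" "c (path_simplex \<gamma>') = - c (path_simplex \<gamma>)"
      by (rule cocycle_reverse[OF c(1) \<gamma>(1)])
    then show thesis using that[of \<gamma>'] \<gamma>(2,3) int[of \<gamma>'] False by simp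
  qed
qed

end

theorem theorem11:
  fixes M :: "'a topology"
    and \<A> :: "('a set \<times> ('a \<Rightarrow> 'e::euclidean_space)) set"
    and \<xi> :: "(((nat \<Rightarrow> real) \<Rightarrow> 'a) \<Rightarrow> real) set"
    and n :: nat
  assumes "closed_smooth_manifold M \<A>"
    and "connected_space M"
    and "DIM('e) = n"
    and "\<xi> \<in> carrier (real_cohomology_group 1 M)"
    and "\<xi> \<noteq> \<one>\<^bsub>real_cohomology_group 1 M\<^esub>"
  shows "ccat M \<xi> \<le> enat (n - 1)"
proof -
  define \<omega> where "\<omega> = (SOME \<omega>. form_represents M \<omega> \<xi>)"
  interpret closed_manifold M \<A> using assms(1,2) by unfold_locales
  \<comment> \<open>The form is the one selected in the definition of \<open>ccat\<close>; existence
    of some representing form makes the selected one represent \<open>\<xi>\<close>.\<close>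
  have rep: "form_represents M \<omega> \<xi>"
    unfolding \<omega>_def using form_represents_exists[OF assms(4)] by (rule someI_ex)
  obtain \<gamma> where \<gamma>: "pathin M \<gamma>" "\<gamma> 0 = \<gamma> 1" "form_integral \<omega> \<gamma> < 0"
    using negative_loop[OF assms(4,5) rep] by blast
  \<comment> \<open>The loop also shows that \<open>M\<close> is not empty.\<close>
  have "\<gamma> 0 \<in> topspace M" using \<gamma>(1) unfolding pathin_def continuous_map_def by auto
  then interpret manifold_form M \<A> \<omega>
    using rep unfolding form_represents_def by unfold_locales auto
  obtain m b q where N: "necklace m b q" by (rule necklace_exists[OF \<gamma>])
  have "\<exists>C>0. \<forall>N>0. ccat_cover M \<omega> N C (n - 1)"
  proof (cases "n = 1")
    case True
    then show ?thesis using ccat_cover_circle[OF N] assms(3) by simp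
  next
    case False
    \<comment> \<open>A Euclidean space in this sense has positive dimension, so \<open>n\<close> is
      at least 2 here.\<close>
    moreover have "0 < n" using assms(3) DIM_positive by blast
    ultimately show ?thesis using ccat_cover_ge2[OF N] assms(3) by simp
  qed
  then have "ccat_form M \<omega> \<le> enat (n - 1)"
    unfolding ccat_form_def by (intro Inf_lower) blast
  then show ?thesis unfolding ccat_def \<omega>_def .
qed

end
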